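(* Suppose $\bar\Lambda$ is the skew Brauer graph algebra associated with the Brauer graph algebra $\Lambda$. Then their Krull–Gabriel dimensions are equal: $\mathrm{KG}(\bar\Lambda)=\mathrm{KG}(\Lambda)$.
   Context: $K$ is an algebraically closed field with $\mathrm{char}\,K\neq 2$. Krull–Gabriel dimension. For a finite-dimensional algebra $\Lambda$, $\mathcal{F}(\Lambda)$ is the abelian category of finitely presented contravariant $K$-linear functors from $\mathrm{mod}\text{-}\Lambda$ (finitely generated right modules) to finite-dimensional $K$-vector spaces. Put $\mathcal{F}(\Lambda)_{-1}=0$; let $\mathcal{F}(\Lambda)_{\alpha+1}$ be the Serre subcategory of functors having finite length in $\mathcal{F}(\Lambda)/\mathcal{F}(\Lambda)_\alpha$; and $\mathcal{F}(\Lambda)_\beta=\bigcup_{\alpha<\beta}\mathcal{F}(\Lambda)_\alpha$ for limit ordinals $\beta$. $\mathrm{KG}(\Lambda)$ is the smallest ordinal $\alpha$ with $\mathcal{F}(\Lambda)_\alpha=\mathcal{F}(\Lambda)$, and $\infty$ if none exists. Skew Brauer graphs. A skew Brauer graph is $\Gamma=(H,\iota,\sigma,m)$ with $H$ a finite set of half-edges, $\iota$ a permutation of $H$ with $\iota^2=\mathrm{id}_H$ (possibly with fixed points), $\sigma$ a permutation of $H$, and $m:H\to\mathbb{Z}_{>0}$ constant on $\sigma$-orbits. $H_\times$ is the set of half-edges fixed by $\iota$ and $H_0=H\setminus H_\times$. It is a Brauer graph if $H_\times=\emptyset$. A $\mathbb{Z}_2$-grading $d:H\to\mathbb{Z}_2$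 is $0$-homogeneous if the sum of $d(h)$ over each $\sigma$-orbit is $0$. Brauer graph algebra. For a Brauer graph $(H,\iota,\sigma,m)$ the Brauer graph algebra is the quotient of the path algebra of the quiver with vertex set $H/\iota$ and one arrow $\alpha_h:[h]\to[\sigma h]$ for each $h\in H$, by the relations: $C_h^{m(h)}=C_{\iota h}^{m(\iota h)}$ for all $h$, where $C_h$ is the closed path traversing successively $\alpha_h,\alpha_{\sigma h},\dots,\alpha_{\sigma^{\ell-1}h}$ with $\ell$ the size of the $\sigma$-orbit of $h$; and the path $\alpha_h$ followed by $\alpha_{\iota\sigma h}$ is zero for all $h$. (This ideal need not be admissible.) Associated Brauer graph and action. Given a skew Brauer graph $\Gamma$ with a $0$-homogeneous grading $d$, define the Brauer graph $\Gamma_d=(H_d,\iota_d,\sigma_d,m_d)$ by $H_d=H\times\mathbb{Z}_2$ (elements written $h_i$), $\iota_d(h_i)=h_{i+1}$ if $h\in H_\times$ and $(\iota h)_i$ if $h\in H_0$, $\sigma_d(h_i)=(\sigma h)_{i+d(h)}$, $m_d(h_i)=m(h)$. Let $B_d$ be the Brauer graph algebra of $\Gamma_d$. The group $G=\langle g\rangle$ of order $2$ acts on $B_d$ by $g\cdot e_{[h_i]}=e_{[h_{i+1}]}$ and $g\cdot\alpha_{h_i}=\alpha_{h_{i+1}}$. The skew group algebra $B_dG$ is $B_d\otimes_K KG$ with product $(\lambda\otimes a)(\mu\otimes b)=\lambda\,a(\mu)\otimes ab$. Skew Brauer graph algebra. The skew Brauer graph algebra $B$ of $\Gamma$ is, up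 to isomorphism, $fB_dGf$, where $f=\sum_{[h]\in H/\iota}e_{[h_0]}\otimes 1_G$. In the claim, $\bar\Lambda=B$ for some skew Brauer graph $\Gamma$ and $\Lambda=B_d$ for a $0$-homogeneous grading $d$ of $\Gamma$. *)

theory Defs
  imports
    "Jordan_Normal_Form.VS_Connect"
    "Graph_Theory.Arc_Walk"
    "HOL-Algebra.QuotRing"
    "HOL-Combinatorics.Orbits"
    "HOL-Library.Z2"
    "HOL-Library.FuncSet"
begin

section \<open>Categories, Serre quotients and finite length\<close>

record ('o, 'm) category =
  Ob :: "'o set"
  Hom :: "'o \<Rightarrow> 'o \<Rightarrow> 'm set"
  Id :: "'o \<Rightarrow> 'm"
  Cmp :: "'o \<Rightarrow> 'o \<Rightarrow> 'o \<Rightarrow> 'm \<Rightarrow> 'm \<Rightarrow> 'm"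

text \<open>\<^term>\<open>Cmp C X Y Z g f\<close> is the composite \<open>X \<rightarrow> Y \<rightarrow> Z\<close> of first \<open>f\<close>, then \<open>g\<close>.  The same
  function may occur in several hom-sets, so the objects are passed explicitly.\<close>

definition zero_object :: "('o, 'm) category \<Rightarrow> 'o \<Rightarrow> bool" where
  "zero_object C Z \<longleftrightarrow> Z \<in> Ob C \<and>
     (\<forall>X\<in>Ob C. (\<exists>!f. f \<in> Hom C X Z) \<and> (\<exists>!f. f \<in> Hom C Z X))"

definition zero_morphism :: "('o, 'm) category \<Rightarrow> 'o \<Rightarrow> 'o \<Rightarrow> 'm \<Rightarrow> bool" where
  "zero_morphism C X Y f \<longleftrightarrow>
     (\<exists>Z u v. zero_object C Z \<and> u \<in> Hom C X Z \<and> v \<in> Hom C Z Y \<and> f = Cmp C X Z Y v u)"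

definition monomorphism :: "('o, 'm) category \<Rightarrow> 'o \<Rightarrow> 'o \<Rightarrow> 'm \<Rightarrow> bool" where
  "monomorphism C X Y f \<longleftrightarrow> f \<in> Hom C X Y \<and>
     (\<forall>W\<in>Ob C. \<forall>u\<in>Hom C W X. \<forall>v\<in>Hom C W X. Cmp C W X Y f u = Cmp C W X Y f v \<longrightarrow> u = v)"

definition isomorphism :: "('o, 'm) category \<Rightarrow> 'o \<Rightarrow> 'o \<Rightarrow> 'm \<Rightarrow> bool" where
  "isomorphism C X Y f \<longleftrightarrow> f \<in> Hom C X Y \<and>
     (\<exists>g\<in>Hom C Y X. Cmp C X Y X g f = Id C X \<and> Cmp C Y X Y f g = Id C Y)"

definition is_kernel :: "('o, 'm) category \<Rightarrow> 'o \<Rightarrow> 'o \<Rightarrow> 'm \<Rightarrow> 'o \<Rightarrow> 'm \<Rightarrow> bool" where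
  "is_kernel C X Y f A k \<longleftrightarrow> A \<in> Ob C \<and> k \<in> Hom C A X \<and> zero_morphism C A Y (Cmp C A X Y f k) \<and>
     (\<forall>W\<in>Ob C. \<forall>w\<in>Hom C W X. zero_morphism C W Y (Cmp C W X Y f w) \<longrightarrow>
        (\<exists>!u. u \<in> Hom C W A \<and> Cmp C W A X k u = w))"

definition is_cokernel :: "('o, 'm) category \<Rightarrow> 'o \<Rightarrow> 'o \<Rightarrow> 'm \<Rightarrow> 'o \<Rightarrow> 'm \<Rightarrow> bool" where
  "is_cokernel C X Y f B q \<longleftrightarrow> B \<in> Ob C \<and> q \<in> Hom C Y B \<and> zero_morphism C X B (Cmp C X Y B q f) \<and>
     (\<forall>W\<in>Ob C. \<forall>w\<in>Hom C Y W. zero_morphism C X W (Cmp C X Y W w f) \<longrightarrow>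
        (\<exists>!u. u \<in> Hom C B W \<and> Cmp C Y B W u q = w))"

definition simple_object :: "('o, 'm) category \<Rightarrow> 'o \<Rightarrow> bool" where
  "simple_object C S \<longleftrightarrow> S \<in> Ob C \<and> \<not> zero_object C S \<and>
     (\<forall>Y\<in>Ob C. \<forall>f. monomorphism C Y S f \<longrightarrow> zero_object C Y \<or> isomorphism C Y S f)"

text \<open>Existence of a composition series, built up by short exact sequences
  \<open>0 \<rightarrow> Y \<rightarrow> X \<rightarrow> S \<rightarrow> 0\<close> with \<open>S\<close> simple.\<close>

inductive finite_length :: "('o, 'm) category \<Rightarrow> 'o \<Rightarrow> bool" for C where
  zero: "zero_object C X \<Longrightarrow> finite_length C X"
| step: "finite_length C Y \<Longrightarrow> X \<in> Ob C \<Longrightarrow> simple_object C S \<Longrightarrow>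
         f \<in> Hom C Y X \<Longrightarrow> g \<in> Hom C X S \<Longrightarrow>
         is_kernel C X S g Y f \<Longrightarrow> is_cokernel C Y X f S g \<Longrightarrow> finite_length C X"

text \<open>The quotient \<open>C/S\<close> of an abelian category by a Serre subcategory \<open>S\<close> (given by its objects)
  is the localisation at the morphisms with kernel and cokernel in \<open>S\<close>.  These form a
  multiplicative system, so a morphism \<open>X \<rightarrow> Y\<close> of \<open>C/S\<close> is an equivalence class of roofs
  \<open>X \<leftarrow>s\<comment> U \<midarrow>f\<rightarrow> Y\<close> with \<open>s\<close> in the system, recorded as \<open>(U, s, f)\<close>.\<close>

definition serre_system :: "('o, 'm) category \<Rightarrow> 'o set \<Rightarrow> 'o \<Rightarrow> 'o \<Rightarrow> 'm set" where
  "serre_system C S X Y = {s \<in> Hom C X Y.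
     (\<exists>A\<in>S. \<exists>k. is_kernel C X Y s A k) \<and> (\<exists>B\<in>S. \<exists>q. is_cokernel C X Y s B q)}"

definition roofs :: "('o, 'm) category \<Rightarrow> 'o set \<Rightarrow> 'o \<Rightarrow> 'o \<Rightarrow> ('o \<times> 'm \<times> 'm) set" where
  "roofs C S X Y = {(U, s, f). U \<in> Ob C \<and> s \<in> serre_system C S U X \<and> f \<in> Hom C U Y}"

definition roof_rel ::
  "('o, 'm) category \<Rightarrow> 'o set \<Rightarrow> 'o \<Rightarrow> 'o \<Rightarrow> (('o \<times> 'm \<times> 'm) \<times> ('o \<times> 'm \<times> 'm)) set" where
  "roof_rel C S X Y = {((U, s, f), (V, t, g)).
     (U, s, f) \<in> roofs C S X Y \<and> (V, t, g) \<in> roofs C S X Y \<and>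
     (\<exists>W\<in>Ob C. \<exists>u\<in>Hom C W U. \<exists>v\<in>Hom C W V.
        Cmp C W U X s u = Cmp C W V X t v \<and> Cmp C W U X s u \<in> serre_system C S W X \<and>
        Cmp C W U Y f u = Cmp C W V Y g v)}"

text \<open>The composite of \<open>X \<leftarrow>s\<comment> U \<midarrow>f\<rightarrow> Y\<close> and \<open>Y \<leftarrow>t\<comment> V \<midarrow>g\<rightarrow> Z\<close> is \<open>X \<leftarrow>su\<comment> W \<midarrow>gv\<rightarrow> Z\<close>, where
  \<open>fu = tv\<close> with \<open>u\<close> in the system; all choices give the same class.\<close>

definition serre_quotient ::
  "('o, 'm) category \<Rightarrow> 'o set \<Rightarrow> ('o, ('o \<times> 'm \<times> 'm) set) category" where
  "serre_quotient C S = \<lparr>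
     Ob = Ob C,
     Hom = (\<lambda>X Y. roofs C S X Y // roof_rel C S X Y),
     Id = (\<lambda>X. roof_rel C S X X `` {(X, Id C X, Id C X)}),
     Cmp = (\<lambda>X Y Z d c. roof_rel C S X Z ``
        {(W, Cmp C W U X s u, Cmp C W V Z g v) | U s f V t g W u v.
           (U, s, f) \<in> c \<and> (V, t, g) \<in> d \<and> W \<in> Ob C \<and>
           u \<in> serre_system C S W U \<and> v \<in> Hom C W V \<and> Cmp C W U Y f u = Cmp C W V Y t v})\<rparr>"

definition finite_length_modulo :: "('o, 'm) category \<Rightarrow> 'o set \<Rightarrow> 'o set" where
  "finite_length_modulo C S = {X \<in> Ob C. finite_length (serre_quotient C S) X}"


section \<open>The Krull--Gabriel filtration\<close>

text \<open>Ordinals are elements of an arbitrary well-ordered type \<open>'i\<close>: an element stands for the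
  order type of the set of its predecessors.\<close>

definition successor_of :: "'i::wellorder \<Rightarrow> 'i \<Rightarrow> bool" where
  "successor_of \<beta> \<alpha> \<longleftrightarrow> \<beta> < \<alpha> \<and> (\<forall>\<gamma>. \<not> (\<beta> < \<gamma> \<and> \<gamma> < \<alpha>))"

lemma successor_of_The:
  assumes "\<exists>\<beta>. successor_of \<beta> \<alpha>"
  shows "successor_of (THE \<beta>. successor_of \<beta> \<alpha>) \<alpha>"
proof -
  obtain \<beta> where b: "successor_of \<beta> \<alpha>" using assms ..
  have "\<gamma> = \<beta>" if c: "successor_of \<gamma> \<alpha>" for \<gamma>
  proof (cases rule: linorder_cases[of \<gamma> \<beta>])
    case less
    then show ?thesis using b c by (simp add: successor_of_def)
  next
    case greater
    then show ?thesis using b c by (simp add: successor_of_def)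
  qed
  with b show ?thesis by (rule theI)
qed

text \<open>The three cases are \<open>\<alpha> = 0\<close> (where the previous stage is \<open>-1\<close>, the zero objects),
  \<open>\<alpha> = \<beta> + 1\<close> and \<open>\<alpha>\<close> a limit.\<close>

function kg_stage :: "('o, 'm) category \<Rightarrow> 'i::wellorder \<Rightarrow> 'o set" where
  "kg_stage C \<alpha> =
    (if \<forall>\<gamma>. \<alpha> \<le> \<gamma> then finite_length_modulo C {X. zero_object C X}
     else if \<exists>\<beta>. successor_of \<beta> \<alpha>
       then finite_length_modulo C (kg_stage C (THE \<beta>. successor_of \<beta> \<alpha>))
     else (\<Union>\<beta>\<in>{..<\<alpha>}. kg_stage C \<beta>))"
  by pat_completeness auto
termination
proof (relation "inv_image {(x, y :: 'i::wellorder). x < y} snd")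
  show "wf (inv_image {(x, y :: 'i::wellorder). x < y} snd)"
    by (rule wf_inv_image[OF wf])
next
  fix C :: "('o, 'm) category" and \<alpha> :: "'i::wellorder"
  assume "\<exists>\<beta>. successor_of \<beta> \<alpha>"
  then have "(THE \<beta>. successor_of \<beta> \<alpha>) < \<alpha>"
    using successor_of_The successor_of_def by blast
  then show "((C, THE \<beta>. successor_of \<beta> \<alpha>), C, \<alpha>) \<in> inv_image {(x, y). x < y} snd"
    by simp
qed simp

declare kg_stage.simps [simp del]

text \<open>\<^const>\<open>None\<close> means that no stage indexed by \<open>'i\<close> is everything.  A well-ordered type only has
  an initial segment of the ordinals, so equality of Krull--Gabriel dimensions, including the
  value \<open>\<infinity>\<close>, is equality of the values below for \<^emph>\<open>every\<close> type \<open>'i\<close> of sort \<open>wellorder\<close>.\<close>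

definition kg_dimension :: "('o, 'm) category \<Rightarrow> 'i::wellorder option" where
  "kg_dimension C =
     (if \<exists>\<alpha>::'i. kg_stage C \<alpha> = Ob C then Some (LEAST \<alpha>. kg_stage C \<alpha> = Ob C) else None)"


section \<open>Algebras and their modules\<close>

text \<open>Vector spaces over \<open>'k\<close> are records of type \<open>('k, 'v) module\<close>, whose ring multiplication is
  ignored; for algebras that multiplication is used as well.\<close>

definition K_algebra :: "('k::field, 'a) module \<Rightarrow> bool" where
  "K_algebra A \<longleftrightarrow> ring A \<and> vectorspace class_ring A \<and>
     (\<forall>c. \<forall>x\<in>carrier A. \<forall>y\<in>carrier A.
        (c \<odot>\<^bsub>A\<^esub> x) \<otimes>\<^bsub>A\<^esub> y = c \<odot>\<^bsub>A\<^esub> (x \<otimes>\<^bsub>A\<^esub> y) \<and> x \<otimes>\<^bsub>A\<^esub> (c \<odot>\<^bsub>A\<^esub> y) = c \<odot>\<^bsub>A\<^esub> (x \<otimes>\<^bsub>A\<^esub> y))"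

definition K_algebra_isomorphic :: "('k::field, 'a) module \<Rightarrow> ('k, 'b) module \<Rightarrow> bool" where
  "K_algebra_isomorphic A B \<longleftrightarrow>
     (\<exists>\<phi>\<in>ring_iso A B. \<forall>c. \<forall>x\<in>carrier A. \<phi> (c \<odot>\<^bsub>A\<^esub> x) = c \<odot>\<^bsub>B\<^esub> \<phi> x)"

record ('k, 'v, 'a) right_module = "('k, 'v) module" +
  act :: "'v \<Rightarrow> 'a \<Rightarrow> 'v"

definition is_right_module :: "('k::field, 'a) module \<Rightarrow> ('k, 'v, 'a) right_module \<Rightarrow> bool" where
  "is_right_module A M \<longleftrightarrow> vectorspace class_ring M \<and>
     (\<forall>v\<in>carrier M. \<forall>a\<in>carrier A. act M v a \<in> carrier M) \<and>
     (\<forall>v\<in>carrier M. \<forall>w\<in>carrier M. \<forall>a\<in>carrier A. act M (v \<oplus>\<^bsub>M\<^esub> w) a = act M v a \<oplus>\<^bsub>M\<^esub> act M w a) \<and>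
     (\<forall>v\<in>carrier M. \<forall>a\<in>carrier A. \<forall>b\<in>carrier A. act M v (a \<oplus>\<^bsub>A\<^esub> b) = act M v a \<oplus>\<^bsub>M\<^esub> act M v b) \<and>
     (\<forall>v\<in>carrier M. \<forall>a\<in>carrier A. \<forall>b\<in>carrier A. act M v (a \<otimes>\<^bsub>A\<^esub> b) = act M (act M v a) b) \<and>
     (\<forall>v\<in>carrier M. act M v \<one>\<^bsub>A\<^esub> = v) \<and>
     (\<forall>v\<in>carrier M. \<forall>a\<in>carrier A. \<forall>c.
        act M (c \<odot>\<^bsub>M\<^esub> v) a = c \<odot>\<^bsub>M\<^esub> act M v a \<and> act M v (c \<odot>\<^bsub>A\<^esub> a) = c \<odot>\<^bsub>M\<^esub> act M v a)"

definition finitely_generated :: "('k::field, 'a) module \<Rightarrow> ('k, 'v, 'a) right_module \<Rightarrow> bool" where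
  "finitely_generated A M \<longleftrightarrow> (\<exists>G. finite G \<and> G \<subseteq> carrier M \<and>
     (\<forall>v\<in>carrier M. \<exists>a. (\<forall>g\<in>G. a g \<in> carrier A) \<and> v = finsum M (\<lambda>g. act M g (a g)) G))"

text \<open>Morphisms are functions on carriers, made canonical by being \<^const>\<open>undefined\<close> elsewhere.\<close>

definition linear_maps :: "('k::field, 'v, 'x) module_scheme \<Rightarrow> ('k, 'w, 'y) module_scheme \<Rightarrow> ('v \<Rightarrow> 'w) set" where
  "linear_maps V W = LinearCombinations.module_hom class_ring V W \<inter> extensional (carrier V)"

definition module_maps ::
  "('k::field, 'a) module \<Rightarrow> ('k, 'v, 'a) right_module \<Rightarrow> ('k, 'v, 'a) right_module \<Rightarrow> ('v \<Rightarrow> 'v) set" where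
  "module_maps A M N =
     {f \<in> linear_maps M N. \<forall>v\<in>carrier M. \<forall>a\<in>carrier A. f (act M v a) = act N (f v) a}"

definition mod_category ::
  "('k::field, 'a) module \<Rightarrow> (('k, 'v, 'a) right_module, 'v \<Rightarrow> 'v) category" where
  "mod_category A = \<lparr>
     Ob = {M. is_right_module A M \<and> finitely_generated A M},
     Hom = module_maps A,
     Id = (\<lambda>M. \<lambda>v\<in>carrier M. v),
     Cmp = (\<lambda>L M N g f. compose (carrier L) g f)\<rparr>"

definition pointwise_space ::
  "('v \<Rightarrow> 'w) set \<Rightarrow> ('k::field, 'v, 'x) module_scheme \<Rightarrow> ('k, 'w, 'y) module_scheme \<Rightarrow> ('k, 'v \<Rightarrow> 'w) module" where
  "pointwise_space F V W = \<lparr>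
     carrier = F, monoid.mult = undefined, one = undefined,
     zero = (\<lambda>v\<in>carrier V. \<zero>\<^bsub>W\<^esub>),
     add = (\<lambda>f g. \<lambda>v\<in>carrier V. f v \<oplus>\<^bsub>W\<^esub> g v),
     smult = (\<lambda>c f. \<lambda>v\<in>carrier V. c \<odot>\<^bsub>W\<^esub> f v)\<rparr>"


section \<open>Finitely presented functors\<close>

record ('o, 'm, 'k, 'w) vect_functor =
  on_ob :: "'o \<Rightarrow> ('k, 'w) module"
  on_mor :: "'o \<Rightarrow> 'o \<Rightarrow> 'm \<Rightarrow> 'w \<Rightarrow> 'w"

type_synonym ('k, 'v, 'a, 'w) mod_functor =
  "(('k, 'v, 'a) right_module, 'v \<Rightarrow> 'v, 'k, 'w) vect_functor"

definition contravariant_functor ::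
  "('k::field, 'a) module \<Rightarrow> ('k, 'v, 'a, 'w) mod_functor \<Rightarrow> bool" where
  "contravariant_functor A F \<longleftrightarrow> (let C = mod_category A in
     (\<forall>X\<in>Ob C. vectorspace class_ring (on_ob F X) \<and> vectorspace.fin_dim class_ring (on_ob F X)) \<and>
     (\<forall>X\<in>Ob C. \<forall>Y\<in>Ob C. on_mor F X Y \<in> LinearCombinations.module_hom class_ring
        (pointwise_space (Hom C X Y) X Y)
        (pointwise_space (linear_maps (on_ob F Y) (on_ob F X)) (on_ob F Y) (on_ob F X))) \<and>
     (\<forall>X\<in>Ob C. on_mor F X X (Id C X) = (\<lambda>v\<in>carrier (on_ob F X). v)) \<and>
     (\<forall>X\<in>Ob C. \<forall>Y\<in>Ob C. \<forall>Z\<in>Ob C. \<forall>f\<in>Hom C X Y. \<forall>g\<in>Hom C Y Z.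
        on_mor F X Z (Cmp C X Y Z g f) =
        compose (carrier (on_ob F Z)) (on_mor F X Y f) (on_mor F Y Z g)))"

definition natural_transformation ::
  "('k::field, 'a) module \<Rightarrow> ('k, 'v, 'a, 'w) mod_functor \<Rightarrow> ('k, 'v, 'a, 'x) mod_functor \<Rightarrow>
   (('k, 'v, 'a) right_module \<Rightarrow> 'w \<Rightarrow> 'x) \<Rightarrow> bool" where
  "natural_transformation A F G \<eta> \<longleftrightarrow> (let C = mod_category A in
     \<eta> \<in> extensional (Ob C) \<and>
     (\<forall>X\<in>Ob C. \<eta> X \<in> linear_maps (on_ob F X) (on_ob G X)) \<and>
     (\<forall>X\<in>Ob C. \<forall>Y\<in>Ob C. \<forall>f\<in>Hom C X Y. \<forall>v\<in>carrier (on_ob F Y).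
        on_mor G X Y f (\<eta> Y v) = \<eta> X (on_mor F X Y f v)))"

definition hom_functor ::
  "('k::field, 'a) module \<Rightarrow> ('k, 'v, 'a) right_module \<Rightarrow> ('k, 'v, 'a, 'v \<Rightarrow> 'v) mod_functor" where
  "hom_functor A N = \<lparr>
     on_ob = (\<lambda>X. pointwise_space (module_maps A X N) X N),
     on_mor = (\<lambda>X Y f. \<lambda>h\<in>module_maps A Y N. compose (carrier X) h f)\<rparr>"

text \<open>\<open>Hom(-, M) \<rightarrow> Hom(-, N) \<rightarrow> F \<rightarrow> 0\<close> is exact for some \<open>M\<close> and \<open>N\<close>.\<close>

definition finitely_presented ::
  "('k::field, 'a) module \<Rightarrow> ('k, 'v, 'a, 'w) mod_functor \<Rightarrow> bool" where
  "finitely_presented A F \<longleftrightarrow> (\<exists>M\<in>Ob (mod_category A). \<exists>N\<in>Ob (mod_category A). \<exists>\<rho> \<pi>.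
     natural_transformation A (hom_functor A M) (hom_functor A N) \<rho> \<and>
     natural_transformation A (hom_functor A N) F \<pi> \<and>
     (\<forall>X\<in>Ob (mod_category A).
        \<rho> X ` module_maps A X M = {h \<in> module_maps A X N. \<pi> X h = \<zero>\<^bsub>on_ob F X\<^esub>} \<and>
        \<pi> X ` module_maps A X N = carrier (on_ob F X)))"

definition fp_functor_category ::
  "('k::field, 'a) module \<Rightarrow>
   (('k, 'v, 'a, 'w) mod_functor, ('k, 'v, 'a) right_module \<Rightarrow> 'w \<Rightarrow> 'w) category" where
  "fp_functor_category A = \<lparr>
     Ob = {F. contravariant_functor A F \<and> finitely_presented A F},
     Hom = (\<lambda>F G. {\<eta>. natural_transformation A F G \<eta>}),
     Id = (\<lambda>F. \<lambda>X\<in>Ob (mod_category A). \<lambda>v\<in>carrier (on_ob F X). v),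
     Cmp = (\<lambda>F G H \<theta> \<eta>. \<lambda>X\<in>Ob (mod_category A). compose (carrier (on_ob F X)) (\<theta> X) (\<eta> X))\<rparr>"

text \<open>For a finite-dimensional algebra, finitely generated modules and finite-dimensional vector
  spaces have cardinality at most that of \<open>nat \<Rightarrow> 'k\<close>, and every one has an isomorphic copy with
  carrier inside this type (on \<open>'k\<^sup>n\<close>, say).  Restricting carriers to it thus yields small
  categories equivalent to the full ones.\<close>

definition KG :: "('k::field, 'a) module \<Rightarrow> 'i::wellorder option" where
  "KG A = kg_dimension (fp_functor_category A ::
     (('k, nat \<Rightarrow> 'k, 'a, nat \<Rightarrow> 'k) mod_functor,
      ('k, nat \<Rightarrow> 'k, 'a) right_module \<Rightarrow> (nat \<Rightarrow> 'k) \<Rightarrow> (nat \<Rightarrow> 'k)) category)"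


section \<open>Path algebras, skew group algebras, corners\<close>

text \<open>A path is a pair of its start vertex and its list of arrows, in the order of traversal; the
  product \<open>p q\<close> in the path algebra is \<open>p\<close> followed by \<open>q\<close>.\<close>

definition quiver_paths :: "('v, 'e) pre_digraph \<Rightarrow> ('v \<times> 'e list) set" where
  "quiver_paths Q = {(u, p). \<exists>v. pre_digraph.awalk Q u p v}"

definition path_elem :: "'v \<times> 'e list \<Rightarrow> 'v \<times> 'e list \<Rightarrow> 'k::field" where
  "path_elem p = (\<lambda>q. if q = p then 1 else 0)"

definition path_algebra :: "('v, 'e) pre_digraph \<Rightarrow> ('k::field, 'v \<times> 'e list \<Rightarrow> 'k) module" where
  "path_algebra Q = \<lparr>
     carrier = {x. finite {p. x p \<noteq> 0} \<and> {p. x p \<noteq> 0} \<subseteq> quiver_paths Q},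
     monoid.mult = (\<lambda>x y (u, p). \<Sum>i\<le>length p.
        x (u, take i p) * y (pre_digraph.awlast Q u (take i p), drop i p)),
     one = (\<lambda>(u, p). if u \<in> verts Q \<and> p = [] then 1 else 0),
     zero = (\<lambda>p. 0),
     add = (\<lambda>x y p. x p + y p),
     smult = (\<lambda>c x p. c * x p)\<rparr>"

definition quotient_algebra :: "('k::field, 'a) module \<Rightarrow> 'a set \<Rightarrow> ('k, 'a set) module" where
  "quotient_algebra A I = \<lparr>
     carrier = carrier (A Quot I), monoid.mult = monoid.mult (A Quot I), one = one (A Quot I),
     zero = zero (A Quot I), add = add (A Quot I),
     smult = (\<lambda>c X. \<Union>x\<in>X. I +>\<^bsub>A\<^esub> (c \<odot>\<^bsub>A\<^esub> x))\<rparr>"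

text \<open>The underlying space \<open>A \<otimes> KG\<close> is the space of functions from the finite group \<open>G\<close> to \<open>A\<close>:
  \<open>\<lambda> \<otimes> a\<close> is the function with value \<open>\<lambda>\<close> at \<open>a\<close> and \<open>0\<close> elsewhere.\<close>

definition skew_tensor :: "('k::field, 'a) module \<Rightarrow> ('g, 'x) monoid_scheme \<Rightarrow> 'a \<Rightarrow> 'g \<Rightarrow> 'g \<Rightarrow> 'a" where
  "skew_tensor A G x a = (\<lambda>b\<in>carrier G. if b = a then x else \<zero>\<^bsub>A\<^esub>)"

definition skew_group_algebra ::
  "('k::field, 'a) module \<Rightarrow> ('g, 'x) monoid_scheme \<Rightarrow> ('g \<Rightarrow> 'a \<Rightarrow> 'a) \<Rightarrow> ('k, 'g \<Rightarrow> 'a) module" where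
  "skew_group_algebra A G \<phi> = \<lparr>
     carrier = carrier G \<rightarrow>\<^sub>E carrier A,
     monoid.mult = (\<lambda>x y. \<lambda>c\<in>carrier G. finsum A (\<lambda>a. x a \<otimes>\<^bsub>A\<^esub> \<phi> a (y (inv\<^bsub>G\<^esub> a \<otimes>\<^bsub>G\<^esub> c))) (carrier G)),
     one = skew_tensor A G \<one>\<^bsub>A\<^esub> \<one>\<^bsub>G\<^esub>,
     zero = (\<lambda>a\<in>carrier G. \<zero>\<^bsub>A\<^esub>),
     add = (\<lambda>x y. \<lambda>a\<in>carrier G. x a \<oplus>\<^bsub>A\<^esub> y a),
     smult = (\<lambda>c x. \<lambda>a\<in>carrier G. c \<odot>\<^bsub>A\<^esub> x a)\<rparr>"

definition corner_algebra :: "('k::field, 'a) module \<Rightarrow> 'a \<Rightarrow> ('k, 'a) module" where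
  "corner_algebra A f =
     A\<lparr>carrier := {f \<otimes>\<^bsub>A\<^esub> x \<otimes>\<^bsub>A\<^esub> f | x. x \<in> carrier A}, one := f\<rparr>"


section \<open>Skew Brauer graphs and their algebras\<close>

record 'h skew_brauer_graph =
  half_edges :: "'h set"
  iota :: "'h \<Rightarrow> 'h"
  sigma :: "'h \<Rightarrow> 'h"
  mlt :: "'h \<Rightarrow> nat"

definition is_skew_brauer_graph :: "'h skew_brauer_graph \<Rightarrow> bool" where
  "is_skew_brauer_graph \<Gamma> \<longleftrightarrow> finite (half_edges \<Gamma>) \<and>
     iota \<Gamma> permutes half_edges \<Gamma> \<and> (\<forall>h\<in>half_edges \<Gamma>. iota \<Gamma> (iota \<Gamma> h) = h) \<and>
     sigma \<Gamma> permutes half_edges \<Gamma> \<and>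
     (\<forall>h\<in>half_edges \<Gamma>. mlt \<Gamma> h > 0 \<and> (\<forall>h'\<in>Orbits.orbit (sigma \<Gamma>) h. mlt \<Gamma> h' = mlt \<Gamma> h))"

definition H_cross :: "'h skew_brauer_graph \<Rightarrow> 'h set" where
  "H_cross \<Gamma> = {h \<in> half_edges \<Gamma>. iota \<Gamma> h = h}"

definition is_brauer_graph :: "'h skew_brauer_graph \<Rightarrow> bool" where
  "is_brauer_graph \<Gamma> \<longleftrightarrow> is_skew_brauer_graph \<Gamma> \<and> H_cross \<Gamma> = {}"

definition zero_homogeneous :: "'h skew_brauer_graph \<Rightarrow> ('h \<Rightarrow> bit) \<Rightarrow> bool" where
  "zero_homogeneous \<Gamma> d \<longleftrightarrow> (\<forall>h\<in>half_edges \<Gamma>. (\<Sum>h'\<in>Orbits.orbit (sigma \<Gamma>) h. d h') = 0)"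

definition edge_of :: "'h skew_brauer_graph \<Rightarrow> 'h \<Rightarrow> 'h set" where
  "edge_of \<Gamma> h = {h, iota \<Gamma> h}"

definition brauer_quiver :: "'h skew_brauer_graph \<Rightarrow> ('h set, 'h) pre_digraph" where
  "brauer_quiver \<Gamma> = \<lparr>
     verts = edge_of \<Gamma> ` half_edges \<Gamma>,
     arcs = half_edges \<Gamma>,
     tail = edge_of \<Gamma>,
     head = (\<lambda>h. edge_of \<Gamma> (sigma \<Gamma> h))\<rparr>"

definition cycle_power :: "'h skew_brauer_graph \<Rightarrow> 'h \<Rightarrow> 'h set \<times> 'h list" where
  "cycle_power \<Gamma> h = (edge_of \<Gamma> h, concat (replicate (mlt \<Gamma> h)
     (map (\<lambda>i. (sigma \<Gamma> ^^ i) h) [0..<card (Orbits.orbit (sigma \<Gamma>) h)])))"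

definition brauer_relations :: "'h skew_brauer_graph \<Rightarrow> ('h set \<times> 'h list \<Rightarrow> 'k::field) set" where
  "brauer_relations \<Gamma> =
     {(\<lambda>p. path_elem (cycle_power \<Gamma> h) p - path_elem (cycle_power \<Gamma> (iota \<Gamma> h)) p) | h. h \<in> half_edges \<Gamma>} \<union>
     {path_elem (edge_of \<Gamma> h, [h, iota \<Gamma> (sigma \<Gamma> h)]) | h. h \<in> half_edges \<Gamma>}"

definition brauer_ideal :: "'h skew_brauer_graph \<Rightarrow> ('h set \<times> 'h list \<Rightarrow> 'k::field) set" where
  "brauer_ideal \<Gamma> = genideal (path_algebra (brauer_quiver \<Gamma>) :: ('k, _) module) (brauer_relations \<Gamma>)"

definition brauer_graph_algebra ::
  "'h skew_brauer_graph \<Rightarrow> ('k::field, ('h set \<times> 'h list \<Rightarrow> 'k) set) module" where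
  "brauer_graph_algebra \<Gamma> = quotient_algebra (path_algebra (brauer_quiver \<Gamma>)) (brauer_ideal \<Gamma>)"

definition vertex_idempotent ::
  "'h skew_brauer_graph \<Rightarrow> 'h set \<Rightarrow> ('h set \<times> 'h list \<Rightarrow> 'k::field) set" where
  "vertex_idempotent \<Gamma> e = brauer_ideal \<Gamma> +>\<^bsub>path_algebra (brauer_quiver \<Gamma>) :: ('k, _) module\<^esub> path_elem (e, [])"

text \<open>The half-edge \<open>h\<^sub>i\<close> is the pair \<open>(h, i)\<close>.  The second branch of each permutation is only the
  convention that it is the identity outside of the half-edges.\<close>

definition associated_brauer_graph ::
  "'h skew_brauer_graph \<Rightarrow> ('h \<Rightarrow> bit) \<Rightarrow> ('h \<times> bit) skew_brauer_graph" where
  "associated_brauer_graph \<Gamma> d = \<lparr>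
     half_edges = half_edges \<Gamma> \<times> UNIV,
     iota = (\<lambda>(h, i). if h \<in> half_edges \<Gamma>
        then (if h \<in> H_cross \<Gamma> then (h, i + 1) else (iota \<Gamma> h, i)) else (h, i)),
     sigma = (\<lambda>(h, i). if h \<in> half_edges \<Gamma> then (sigma \<Gamma> h, i + d h) else (h, i)),
     mlt = (\<lambda>(h, i). mlt \<Gamma> h)\<rparr>"

lemma is_brauer_graph_associated:
  assumes G: "is_skew_brauer_graph \<Gamma>"
  shows "is_brauer_graph (associated_brauer_graph \<Gamma> d)"
proof -
  define H where "H = half_edges \<Gamma>"
  define \<iota> where "\<iota> = iota (associated_brauer_graph \<Gamma> d)"
  define \<sigma> where "\<sigma> = sigma (associated_brauer_graph \<Gamma> d)"
  have p: "iota \<Gamma> permutes H" and pp: "\<And>h. h \<in> H \<Longrightarrow> iota \<Gamma> (iota \<Gamma> h) = h"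
    and q: "sigma \<Gamma> permutes H" and fin: "finite H"
    and m: "\<And>h. h \<in> H \<Longrightarrow> mlt \<Gamma> h > 0"
    and mo: "\<And>h h'. h \<in> H \<Longrightarrow> h' \<in> Orbits.orbit (sigma \<Gamma>) h \<Longrightarrow> mlt \<Gamma> h' = mlt \<Gamma> h"
    using G by (auto simp: is_skew_brauer_graph_def H_def)
  have pH: "iota \<Gamma> h \<in> H \<longleftrightarrow> h \<in> H" and qH: "sigma \<Gamma> h \<in> H \<longleftrightarrow> h \<in> H" for h
    using permutes_in_image[OF p] permutes_in_image[OF q] by auto
  have i1: "\<iota> (h, i) = (if h \<in> H then (if iota \<Gamma> h = h then (h, i + 1) else (iota \<Gamma> h, i)) else (h, i))" for h i
    by (simp add: \<iota>_def associated_brauer_graph_def H_cross_def H_def)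
  have s1: "\<sigma> (h, i) = (if h \<in> H then (sigma \<Gamma> h, i + d h) else (h, i))" for h i
    by (simp add: \<sigma>_def associated_brauer_graph_def H_def)
  have s2: "fst (\<sigma> x) = (if fst x \<in> H then sigma \<Gamma> (fst x) else fst x)" for x
    by (cases x) (simp add: s1)
  have b: "i + a + a = i" for i a :: bit
    by (cases a) (simp_all add: add.assoc)
  have ii: "\<iota> (\<iota> x) = x" for x
    by (cases x) (auto simp: i1 pH pp b)
  have ip: "\<iota> permutes (H \<times> UNIV)"
    unfolding permutes_def using ii by (metis (no_types, lifting) SigmaD1 SigmaI UNIV_I i1 surj_pair)
  have sinj: "inj \<sigma>"
  proof (rule injI)
    fix x y assume e: "\<sigma> x = \<sigma> y"
    obtain h i k j where [simp]: "x = (h, i)" "y = (k, j)" by (cases x, cases y)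
    have "h \<in> H \<longleftrightarrow> k \<in> H" using e qH by (auto simp: s1 split: if_splits)
    moreover have "h = k" using e calculation permutes_inj[OF q] by (auto simp: s1 inj_eq split: if_splits)
    ultimately show "x = y"
      using e by (cases i; cases j; cases "d k") (auto simp: s1 split: if_splits)
  qed
  have "(UNIV :: bit set) = {0, 1}" by (auto intro: bit.exhaust)
  then have "finite (UNIV :: bit set)" by (metis finite.emptyI finite.insertI)
  then have fin2: "finite (H \<times> (UNIV :: bit set))"
    using fin by blast
  have sp: "\<sigma> permutes (H \<times> UNIV)"
  proof (rule bij_imp_permutes)
    have "\<sigma> ` (H \<times> UNIV) \<subseteq> H \<times> UNIV" by (auto simp: s1 qH)
    moreover note fin2
    ultimately show "bij_betw \<sigma> (H \<times> UNIV) (H \<times> UNIV)"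
      using sinj by (metis bij_betw_def endo_inj_surj inj_on_subset top_greatest)
  qed (auto simp: s1 split: if_splits)
  have orb: "fst y \<in> Orbits.orbit (sigma \<Gamma>) (fst x)" if "y \<in> Orbits.orbit \<sigma> x" "fst x \<in> H" for x y
  proof -
    have "fst y \<in> H \<and> fst y \<in> Orbits.orbit (sigma \<Gamma>) (fst x)"
      using that(1)
    proof induction
      case base
      then show ?case using that(2) by (auto simp: s2 qH intro: Orbits.orbit.base)
    next
      case (step y)
      then show ?case by (auto simp: s2 qH intro: Orbits.orbit.step)
    qed
    then show ?thesis by simp
  qed
  have nf: "\<iota> x \<noteq> x" if "fst x \<in> H" for x
    using that by (cases x) (auto simp: i1)
  have f: "half_edges (associated_brauer_graph \<Gamma> d) = H \<times> UNIV"
    "mlt (associated_brauer_graph \<Gamma> d) x = mlt \<Gamma> (fst x)" for x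
    by (auto simp: associated_brauer_graph_def H_def split: prod.splits)
  show ?thesis
    unfolding is_brauer_graph_def is_skew_brauer_graph_def H_cross_def f \<iota>_def[symmetric] \<sigma>_def[symmetric]
    using ip sp ii nf m mo orb fin2 by fastforce
qed

definition Z2_group :: "bit monoid" where
  "Z2_group = \<lparr>carrier = UNIV, monoid.mult = (+), one = 0\<rparr>"

text \<open>The generator \<open>g = 1\<close> of \<^const>\<open>Z2_group\<close> renames \<open>h\<^sub>i\<close> to \<open>h\<^sub>i\<^sub>+\<^sub>1\<close> in all paths, hence in all
  elements of the path algebra; it preserves the ideal and maps cosets to cosets.\<close>

definition shift_half_edge :: "bit \<Rightarrow> 'h \<times> bit \<Rightarrow> 'h \<times> bit" where
  "shift_half_edge a = (\<lambda>(h, i). (h, i + a))"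

definition shift_path :: "bit \<Rightarrow> ('h \<times> bit) set \<times> ('h \<times> bit) list \<Rightarrow> ('h \<times> bit) set \<times> ('h \<times> bit) list" where
  "shift_path a = (\<lambda>(u, p). (shift_half_edge a ` u, map (shift_half_edge a) p))"

definition shift_elem ::
  "bit \<Rightarrow> (('h \<times> bit) set \<times> ('h \<times> bit) list \<Rightarrow> 'k::field) \<Rightarrow> ('h \<times> bit) set \<times> ('h \<times> bit) list \<Rightarrow> 'k" where
  "shift_elem a x = (\<lambda>q. x (shift_path (- a) q))"

definition shift_class ::
  "bit \<Rightarrow> (('h \<times> bit) set \<times> ('h \<times> bit) list \<Rightarrow> 'k::field) set \<Rightarrow> (('h \<times> bit) set \<times> ('h \<times> bit) list \<Rightarrow> 'k) set" where
  "shift_class a X = shift_elem a ` X"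

lemma shift_half_edge_involutive: "shift_half_edge a (shift_half_edge a x) = x"
  by (cases x; cases a) (simp_all add: shift_half_edge_def)

lemma shift_path_involutive: "shift_path a (shift_path a q) = q"
  by (cases q) (simp add: shift_path_def image_image shift_half_edge_involutive comp_def)

lemma shift_elem_path_elem: "shift_elem a (path_elem p) = path_elem (shift_path a p)"
proof
  fix q
  have "- a = a" by (cases a) simp_all
  then have "shift_path (- a) q = p \<longleftrightarrow> q = shift_path a p"
    using shift_path_involutive[of a p] shift_path_involutive[of a q] by auto
  then show "shift_elem a (path_elem p) q = path_elem (shift_path a p) q"
    by (simp add: shift_elem_def path_elem_def)
qed

definition skew_group_brauer_algebra ::
  "'h skew_brauer_graph \<Rightarrow> ('h \<Rightarrow> bit) \<Rightarrow>
   ('k::field, bit \<Rightarrow> (('h \<times> bit) set \<times> ('h \<times> bit) list \<Rightarrow> 'k) set) module" where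
  "skew_group_brauer_algebra \<Gamma> d =
     skew_group_algebra (brauer_graph_algebra (associated_brauer_graph \<Gamma> d)) Z2_group shift_class"

text \<open>Since \<open>[h] \<mapsto> [h\<^sub>0]\<close> is a well-defined injection, the sum over \<open>[h]\<close> in \<open>H/\<iota>\<close> is a sum over the
  set of all vertices \<open>[h\<^sub>0]\<close>.\<close>

definition corner_idempotent ::
  "'h skew_brauer_graph \<Rightarrow> ('h \<Rightarrow> bit) \<Rightarrow> bit \<Rightarrow> (('h \<times> bit) set \<times> ('h \<times> bit) list \<Rightarrow> 'k::field) set" where
  "corner_idempotent \<Gamma> d = (let \<Gamma>' = associated_brauer_graph \<Gamma> d in
     finsum (skew_group_brauer_algebra \<Gamma> d :: ('k, _) module)
       (\<lambda>e. skew_tensor (brauer_graph_algebra \<Gamma>' :: ('k, _) module) Z2_group (vertex_idempotent \<Gamma>' e) \<one>\<^bsub>Z2_group\<^esub>)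
       ((\<lambda>h. edge_of \<Gamma>' (h, 0)) ` half_edges \<Gamma>))"

definition is_skew_brauer_graph_algebra ::
  "'h skew_brauer_graph \<Rightarrow> ('h \<Rightarrow> bit) \<Rightarrow> ('k::field, 'b) module \<Rightarrow> bool" where
  "is_skew_brauer_graph_algebra \<Gamma> d B \<longleftrightarrow> K_algebra B \<and>
     K_algebra_isomorphic B (corner_algebra (skew_group_brauer_algebra \<Gamma> d) (corner_idempotent \<Gamma> d))"

end

theory Submission
 imports Defs
begin

text \<open>Let \<open>S = \<Lambda>G\<close> be the skew group algebra, \<open>f\<close> the corner idempotent and \<open>B = fSf\<close>.  Write \<open>1 = v\<^sub>0u\<^sub>0 + v\<^sub>1u\<^sub>1\<close>
 with \<open>u\<^sub>k \<in> fS\<close> and \<open>v\<^sub>k \<in> Sf\<close>.  The matrices \<open>(u\<^sub>k a v\<^sub>l)\<close> and \<open>(\<pi>(g\<^sup>i s g\<^sup>-\<^sup>j))\<close>, where \<open>\<pi> : S \<rightarrow> \<Lambda>\<close> is the coefficient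
 at \<open>1\<close>, define non-unital homomorphisms \<open>\<Lambda> \<rightarrow> M\<^sub>2(B)\<close> and \<open>B \<rightarrow> M\<^sub>2(\<Lambda>)\<close> and hence functors
 between the module categories.  These functors are adjoint on both sides, and, because \<open>2\<close> is
 invertible, every module is a direct summand of one in the image.  Precomposition with either of
 them is therefore an exact functor between the categories of finitely presented functors which
 reflects zero objects, and such a functor reflects every stage of the Krull--Gabriel filtration.\<close>

text \<open>Localisations are awkward to carry along a functor, and a functor need not send simple
  objects to simple ones. Every stage is therefore described inside the category: \<open>lev\<close>
  bounds the length modulo a Serre class by short exact sequences alone, so an exact functor that
  reflects one stage reflects the next. Reflection alone suffices because the two functors run in
  opposite directions and give the two inequalities.

  Tensor products are replaced by pairs of vectors fixed by an idempotent matrix, so all carriers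
  stay in the type of functions on the natural numbers.

  The elements u and v come from the vertices. The idempotent \<open>f\<close> is the sum of the
  e_[h_0]; each remaining vertex is some [h_1] with h not fixed by \<iota>, the translate under g of
  the vertex [h_0], so that its idempotent lies in SfS. The factor 1/2 enters on one side only: a
  \<Lambda>-module is a summand of its double transform without division, whereas for B-modules the
  natural composite is multiplication by 2.\<close>

abbreviation add_in ("(_ \<oplus>[_]/ _)" [65, 0, 66] 65) where "x \<oplus>[R] y \<equiv> x \<oplus>\<^bsub>R\<^esub> y"
abbreviation mult_in ("(_ \<otimes>[_]/ _)" [70, 0, 71] 70) where "x \<otimes>[R] y \<equiv> x \<otimes>\<^bsub>R\<^esub> y"
abbreviation smult_in ("(_ \<odot>[_]/ _)" [70, 0, 71] 70) where "c \<odot>[V] x \<equiv> c \<odot>\<^bsub>V\<^esub> x"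
abbreviation zero_in ("\<zero>[_]") where "\<zero>[R] \<equiv> \<zero>\<^bsub>R\<^esub>"
abbreviation one_in ("\<one>[_]") where "\<one>[R] \<equiv> \<one>\<^bsub>R\<^esub>"

section \<open>Serre quotients of concrete abelian categories\<close>

text \<open>An abelian category observed through evaluations at the indices in \<open>J\<close>,
  jointly faithful and exact. For finitely presented functors the indices are modules and
  \<open>G F X\<close> is the value F(X). Kernels, images and exactness can then be handled on
  elements; \<open>lift\<close> and \<open>desc\<close> give pointwise injections and surjections
  the factorisation properties of kernels and cokernels.\<close>

locale concrete_abelian =
 fixes C :: "('o, 'j => 'e => 'e) category"
  and J :: "'j set"
  and G :: "'o => 'j => ('e, 'x) ring_scheme"
 assumes grp: "X \<in> Ob C ==> j \<in> J ==> abelian_group (G X j)"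
  and hom_closed: "[| X \<in> Ob C; Y \<in> Ob C; f \<in> Hom C X Y; j \<in> J; x \<in> carrier (G X j) |] ==> f j x \<in> carrier (G Y j)"
  and hom_add: "[| X \<in> Ob C; Y \<in> Ob C; f \<in> Hom C X Y; j \<in> J; x \<in> carrier (G X j); y \<in> carrier (G X j) |] ==>
   f j (x \<oplus>[G X j] y) = f j x \<oplus>[G Y j] f j y"
  and hom_ext: "[| X \<in> Ob C; Y \<in> Ob C; f \<in> Hom C X Y; g \<in> Hom C X Y;
   \<And>j x. j \<in> J ==> x \<in> carrier (G X j) ==> f j x = g j x |] ==> f = g"
  and id_hom: "X \<in> Ob C ==> Id C X \<in> Hom C X X"
  and id_app: "[| X \<in> Ob C; j \<in> J; x \<in> carrier (G X j) |] ==> Id C X j x = x"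
  and cmp_hom: "[| X \<in> Ob C; Y \<in> Ob C; Z \<in> Ob C; f \<in> Hom C X Y; g \<in> Hom C Y Z |] ==> Cmp C X Y Z g f \<in> Hom C X Z"
  and cmp_app: "[| X \<in> Ob C; Y \<in> Ob C; Z \<in> Ob C; f \<in> Hom C X Y; g \<in> Hom C Y Z; j \<in> J; x \<in> carrier (G X j) |] ==>
   Cmp C X Y Z g f j x = g j (f j x)"
  and zero_hom: "[| X \<in> Ob C; Y \<in> Ob C |] ==> \<exists>z\<in>Hom C X Y. \<forall>j\<in>J. \<forall>x\<in>carrier (G X j). z j x = \<zero>[G Y j]"
  and diff_hom: "[| X \<in> Ob C; Y \<in> Ob C; f \<in> Hom C X Y; g \<in> Hom C X Y |] ==>
   \<exists>h\<in>Hom C X Y. \<forall>j\<in>J. \<forall>x\<in>carrier (G X j). h j x = f j x \<ominus>\<^bsub>G Y j\<^esub> g j x"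
  and lift: "[| A \<in> Ob C; X \<in> Ob C; U \<in> Ob C; i \<in> Hom C A X; f \<in> Hom C U X;
   \<And>j. j \<in> J ==> inj_on (i j) (carrier (G A j));
   \<And>j u. j \<in> J ==> u \<in> carrier (G U j) ==> f j u \<in> i j ` carrier (G A j) |] ==>
   \<exists>h\<in>Hom C U A. \<forall>j\<in>J. \<forall>u\<in>carrier (G U j). i j (h j u) = f j u"
  and desc: "[| X \<in> Ob C; Q \<in> Ob C; Y \<in> Ob C; q \<in> Hom C X Q; f \<in> Hom C X Y;
   \<And>j. j \<in> J ==> q j ` carrier (G X j) = carrier (G Q j);
   \<And>j x. j \<in> J ==> x \<in> carrier (G X j) ==> q j x = \<zero>[G Q j] ==> f j x = \<zero>[G Y j] |] ==>
   \<exists>h\<in>Hom C Q Y. \<forall>j\<in>J. \<forall>x\<in>carrier (G X j). h j (q j x) = f j x"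
  and ker_ex: "[| X \<in> Ob C; Y \<in> Ob C; f \<in> Hom C X Y |] ==> \<exists>A\<in>Ob C. \<exists>i\<in>Hom C A X. \<forall>j\<in>J.
   inj_on (i j) (carrier (G A j)) \<and> i j ` carrier (G A j) = {x \<in> carrier (G X j). f j x = \<zero>[G Y j]}"
  and coker_ex: "[| X \<in> Ob C; Y \<in> Ob C; f \<in> Hom C X Y |] ==> \<exists>Q\<in>Ob C. \<exists>q\<in>Hom C Y Q. \<forall>j\<in>J.
   q j ` carrier (G Y j) = carrier (G Q j) \<and> f j ` carrier (G X j) = {y \<in> carrier (G Y j). q j y = \<zero>[G Q j]}"
  and prod_ex: "[| U \<in> Ob C; V \<in> Ob C |] ==> \<exists>P\<in>Ob C. \<exists>p\<in>Hom C P U. \<exists>q\<in>Hom C P V.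
   (\<forall>j\<in>J. \<forall>u\<in>carrier (G U j). \<forall>v\<in>carrier (G V j). \<exists>w\<in>carrier (G P j). p j w = u \<and> q j w = v) \<and>
   (\<forall>j\<in>J. \<forall>w\<in>carrier (G P j). p j w = \<zero>[G U j] --> q j w = \<zero>[G V j] --> w = \<zero>[G P j]) \<and>
   (\<forall>W\<in>Ob C. \<forall>a\<in>Hom C W U. \<forall>b\<in>Hom C W V. \<exists>h\<in>Hom C W P.
    \<forall>j\<in>J. \<forall>w\<in>carrier (G W j). p j (h j w) = a j w \<and> q j (h j w) = b j w)"
begin

section \<open>Exactness and fibre products on elements\<close>

abbreviation E :: "'o => 'j => 'e set" where "E X j \<equiv> carrier (G X j)"
abbreviation zr :: "'o => 'j => 'e" where "zr X j \<equiv> \<zero>[G X j]"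
abbreviation df :: "'o => 'j => 'e => 'e => 'e" where "df X j x y \<equiv> x \<ominus>\<^bsub>G X j\<^esub> y"

lemma zr_E: "X \<in> Ob C ==> j \<in> J ==> zr X j \<in> E X j"
 using grp abelian_group.axioms(1) abelian_monoid.zero_closed by fastforce

lemma df_E: "X \<in> Ob C ==> j \<in> J ==> x \<in> E X j ==> y \<in> E X j ==> df X j x y \<in> E X j"
 using grp abelian_group.minus_closed by fastforce

lemma df_eq_zr: "X \<in> Ob C ==> j \<in> J ==> x \<in> E X j ==> y \<in> E X j ==> df X j x y = zr X j \<longleftrightarrow> x = y"
proof -
 assume a: "X \<in> Ob C" "j \<in> J" "x \<in> E X j" "y \<in> E X j"
 interpret abelian_group "G X j" using a grp by blast
 show ?thesis using a by (metis a_minus_def add.inv_closed add.inv_solve_right l_zero r_neg zero_closed)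
qed

lemma df_zr: "X \<in> Ob C ==> j \<in> J ==> x \<in> E X j ==> df X j x (zr X j) = x"
 by (metis abelian_group.l_neg abelian_group.minus_add abelian_group.minus_eq abelian_group.minus_minus
   abelian_group.r_neg1 abelian_groupE(5) abelian_group.a_inv_closed abelian_groupE(2) grp abelian_groupE(4))

lemma df_add: "X \<in> Ob C ==> j \<in> J ==> x \<in> E X j ==> y \<in> E X j ==> df X j x y \<oplus>[G X j] y = x"
proof -
 assume a: "X \<in> Ob C" "j \<in> J" "x \<in> E X j" "y \<in> E X j"
 interpret abelian_group "G X j" using a grp by blast
 show ?thesis using a by (simp add: minus_eq a_assoc l_neg)
qed

lemma df_tele:
 assumes "X \<in> Ob C" "j \<in> J" "x \<in> E X j" "y \<in> E X j" "z \<in> E X j"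
 shows "df X j x z = df X j x y \<oplus>[G X j] df X j y z"
proof -
 interpret abelian_group "G X j" using assms grp by blast
 show ?thesis using assms by (simp add: minus_eq a_assoc r_neg1 l_neg r_neg2)
qed

lemma df_swap: assumes "X \<in> Ob C" "j \<in> J" "x \<in> E X j" "y \<in> E X j"
 shows "df X j y x = df X j (zr X j) (df X j x y)"
proof -
 interpret abelian_group "G X j" using assms grp by blast
 show ?thesis using assms by (simp add: minus_eq minus_add a_comm)
qed

lemma hom_zr:
 assumes "X \<in> Ob C" "Y \<in> Ob C" "f \<in> Hom C X Y" "j \<in> J"
 shows "f j (zr X j) = zr Y j"
proof -
 interpret X: abelian_group "G X j" using assms grp by blast
 interpret Y: abelian_group "G Y j" using assms grp by blast
 have "f j (zr X j) = f j (zr X j) \<oplus>[G Y j] f j (zr X j)"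
  using hom_add[OF assms X.zero_closed X.zero_closed] by simp
 then show ?thesis
  by (metis X.zero_closed Y.add.r_cancel_one' assms hom_closed)
qed

lemma hom_df:
 assumes "X \<in> Ob C" "Y \<in> Ob C" "f \<in> Hom C X Y" "j \<in> J" "x \<in> E X j" "y \<in> E X j"
 shows "f j (df X j x y) = df Y j (f j x) (f j y)"
proof -
 interpret X: abelian_group "G X j" using assms grp by blast
 interpret Y: abelian_group "G Y j" using assms grp by blast
 have "f j (df X j x y) \<oplus>[G Y j] f j y = f j x"
  using hom_add[OF assms(1-4), of "df X j x y" y] df_add[of X j x y] assms by simp
 moreover have "f j (df X j x y) \<in> E Y j" "f j x \<in> E Y j" "f j y \<in> E Y j"
  using assms hom_closed by (meson X.minus_closed)+
 ultimately show ?thesis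
  by (metis Y.add.inv_solve_right Y.minus_eq)
qed

lemma hom_inj:
 assumes "X \<in> Ob C" "Y \<in> Ob C" "f \<in> Hom C X Y" "j \<in> J" "\<And>x. x \<in> E X j ==> f j x = zr Y j ==> x = zr X j"
 shows "inj_on (f j) (E X j)"
proof (rule inj_onI)
 fix x y assume xy: "x \<in> E X j" "y \<in> E X j" "f j x = f j y"
 then have "f j (df X j x y) = zr Y j" using assms hom_df hom_closed df_eq_zr by metis
 then show "x = y" using assms xy df_E df_eq_zr by metis
qed

definition mono :: "'o => 'o => ('j => 'e => 'e) => bool" where
 "mono X Y f \<longleftrightarrow> f \<in> Hom C X Y \<and> (\<forall>j\<in>J. inj_on (f j) (E X j))"

definition epi :: "'o => 'o => ('j => 'e => 'e) => bool" where
 "epi X Y f \<longleftrightarrow> f \<in> Hom C X Y \<and> (\<forall>j\<in>J. f j ` E X j = E Y j)"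

definition ker :: "'o => 'o => ('j => 'e => 'e) => 'j => 'e set" where
 "ker X Y f j = {x \<in> E X j. f j x = zr Y j}"

definition im :: "'o => ('j => 'e => 'e) => 'j => 'e set" where
 "im X f j = f j ` E X j"

definition ses :: "'o => 'o => 'o => ('j => 'e => 'e) => ('j => 'e => 'e) => bool" where
 "ses A X Q i q \<longleftrightarrow> A \<in> Ob C \<and> X \<in> Ob C \<and> Q \<in> Ob C \<and> mono A X i \<and> epi X Q q \<and> (\<forall>j\<in>J. im A i j = ker X Q q j)"

lemma ses_of_ker: assumes "X \<in> Ob C" "Y \<in> Ob C" "f \<in> Hom C X Y"
 shows "\<exists>A i. A \<in> Ob C \<and> mono A X i \<and> (\<forall>j\<in>J. im A i j = ker X Y f j)"
proof -
 obtain A i where "A \<in> Ob C" "i \<in> Hom C A X" "\<forall>j\<in>J. inj_on (i j) (E A j) \<and> i j ` E A j = {x \<in> E X j. f j x = zr Y j}"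
  using ker_ex[OF assms] by (elim bexE) (rule that)
 then show ?thesis unfolding mono_def im_def ker_def by (intro exI[of _ A] exI[of _ i]) simp
qed

lemma ses_of_coker: assumes "X \<in> Ob C" "Y \<in> Ob C" "f \<in> Hom C X Y"
 shows "\<exists>Q q. Q \<in> Ob C \<and> epi Y Q q \<and> (\<forall>j\<in>J. im X f j = ker Y Q q j)"
proof -
 obtain Q q where "Q \<in> Ob C" "q \<in> Hom C Y Q"
  "\<forall>j\<in>J. q j ` E Y j = E Q j \<and> f j ` E X j = {y \<in> E Y j. q j y = zr Q j}"
  using coker_ex[OF assms] by (elim bexE) (rule that)
 then show ?thesis unfolding epi_def im_def ker_def by (intro exI[of _ Q] exI[of _ q]) simp
qed

lemma ses_of_mono: assumes "X \<in> Ob C" "Y \<in> Ob C" "mono X Y f"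
 obtains Q q where "ses X Y Q f q"
proof -
 have "f \<in> Hom C X Y" using assms(3) mono_def by simp
 then obtain Q q where "Q \<in> Ob C \<and> epi Y Q q \<and> (\<forall>j\<in>J. im X f j = ker Y Q q j)"
  using ses_of_coker[OF assms(1,2)] by blast
 then show thesis using that[of Q q] assms unfolding ses_def by simp
qed

lemma ses_of_epi: assumes "X \<in> Ob C" "Y \<in> Ob C" "epi X Y f"
 obtains A i where "ses A X Y i f"
proof -
 have "f \<in> Hom C X Y" using assms(3) epi_def by simp
 then obtain A i where "A \<in> Ob C \<and> mono A X i \<and> (\<forall>j\<in>J. im A i j = ker X Y f j)"
  using ses_of_ker[OF assms(1,2)] by blast
 then show thesis using that[of A i] assms unfolding ses_def by simp
qed

lemma mono_lift:
 assumes "A \<in> Ob C" "X \<in> Ob C" "U \<in> Ob C" "mono A X i" "f \<in> Hom C U X"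
  and "\<And>j u. j \<in> J ==> u \<in> E U j ==> f j u \<in> im A i j"
 shows "\<exists>h\<in>Hom C U A. \<forall>j\<in>J. \<forall>u\<in>E U j. i j (h j u) = f j u"
 by (rule lift[OF assms(1-3) _ assms(5)]) (use assms(4,6) in \<open>auto simp: mono_def im_def\<close>)

lemma epi_desc:
 assumes "X \<in> Ob C" "Q \<in> Ob C" "Y \<in> Ob C" "epi X Q q" "f \<in> Hom C X Y"
  and "\<And>j x. j \<in> J ==> x \<in> E X j ==> q j x = zr Q j ==> f j x = zr Y j"
 shows "\<exists>h\<in>Hom C Q Y. \<forall>j\<in>J. \<forall>x\<in>E X j. h j (q j x) = f j x"
 by (rule desc[OF assms(1-3) _ assms(5)]) (use assms(4,6) in \<open>auto simp: epi_def\<close>)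

lemma monoD: "mono X Y f ==> f \<in> Hom C X Y"
 "mono X Y f ==> j \<in> J ==> x \<in> E X j ==> y \<in> E X j ==> f j x = f j y ==> x = y"
 unfolding mono_def inj_on_def by simp_all

lemma epiD: "epi X Y f ==> f \<in> Hom C X Y"
 "epi X Y f ==> j \<in> J ==> y \<in> E Y j ==> \<exists>x\<in>E X j. y = f j x"
 unfolding epi_def by auto

text \<open>The image is obtained as the kernel of a cokernel, the constructions at hand;
  \<open>e\<close> is onto because \<open>i\<close> is injective and hits exactly the values of
  \<open>f\<close>.\<close>

lemma image_factor: assumes X: "X \<in> Ob C" and Y: "Y \<in> Ob C" and f: "f \<in> Hom C X Y"
 obtains I i e where "I \<in> Ob C" "mono I Y i" "epi X I e"
  "\<And>j x. j \<in> J ==> x \<in> E X j ==> i j (e j x) = f j x" "\<And>j. j \<in> J ==> im I i j = im X f j"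
proof -
 obtain Q q where Q: "Q \<in> Ob C" "epi Y Q q" "\<forall>j\<in>J. im X f j = ker Y Q q j"
  using ses_of_coker[OF assms] by blast
 obtain I i where I: "I \<in> Ob C" "mono I Y i" "\<forall>j\<in>J. im I i j = ker Y Q q j"
  using ses_of_ker[of Y Q q] Q Y unfolding epi_def by blast
 obtain e where e: "e \<in> Hom C X I" "\<forall>j\<in>J. \<forall>u\<in>E X j. i j (e j u) = f j u"
  using lift[of I Y X i f] I Q X Y f unfolding mono_def im_def by blast
 have "e j ` E X j = E I j" if j: "j \<in> J" for j
 proof
  show "e j ` E X j \<subseteq> E I j" using hom_closed X I e j by blast
  show "E I j \<subseteq> e j ` E X j"
  proof
   fix y assume y: "y \<in> E I j"
   then have "i j y \<in> f j ` E X j" using I Q j unfolding im_def by blast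
   then obtain x where x: "x \<in> E X j" "i j (e j x) = i j y" using e j by auto
   then have "e j x = y" using y I e j hom_closed[OF X I(1) e(1) j x(1)] unfolding mono_def inj_on_def by blast
   then show "y \<in> e j ` E X j" using x by blast
  qed
 qed
 then have "epi X I e" using e unfolding epi_def by blast
 then show thesis using that I e Q by metis
qed

text \<open>The kernel of an identity morphism is zero, so any object yields a zero object.\<close>

lemma zero_ob: assumes "X \<in> Ob C"
 obtains Z where "Z \<in> Ob C" "\<And>j. j \<in> J ==> E Z j = {zr Z j}"
proof -
 obtain A i where A: "A \<in> Ob C" "mono A X i" "\<forall>j\<in>J. im A i j = ker X X (Id C X) j"
  using ses_of_ker[OF assms assms id_hom[OF assms]] by blast
 have "E A j = {zr A j}" if j: "j \<in> J" for j
 proof -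
  have "i j x = zr X j" if "x \<in> E A j" for x
   using A that j id_app[OF assms] unfolding im_def ker_def by force
  then have "x = zr A j" if "x \<in> E A j" for x
   using A(1) A(2) that j zr_E[of A j] unfolding mono_def inj_on_def by (metis (full_types))
  then show ?thesis using zr_E[of A j] A j by blast
 qed
 then show thesis using that A by blast
qed

text \<open>The fibre product is the kernel of \<open>D\<close>, the difference of the two
  composites on the product. Besides the universal property it keeps the description by elements:
  every pair with equal images in X is realised, and an element with both components zero is
  zero.\<close>

lemma pullback: assumes U: "U \<in> Ob C" and V: "V \<in> Ob C" and X: "X \<in> Ob C" and s: "s \<in> Hom C U X" and t: "t \<in> Hom C V X"
 obtains P p q where "P \<in> Ob C" "p \<in> Hom C P U" "q \<in> Hom C P V"
  "\<And>j w. j \<in> J ==> w \<in> E P j ==> s j (p j w) = t j (q j w)"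
  "\<And>j u v. j \<in> J ==> u \<in> E U j ==> v \<in> E V j ==> s j u = t j v ==> \<exists>w\<in>E P j. p j w = u \<and> q j w = v"
  "\<And>W a b. W \<in> Ob C ==> a \<in> Hom C W U ==> b \<in> Hom C W V ==>
   (\<And>j w. j \<in> J ==> w \<in> E W j ==> s j (a j w) = t j (b j w)) ==>
   \<exists>h\<in>Hom C W P. \<forall>j\<in>J. \<forall>w\<in>E W j. p j (h j w) = a j w \<and> q j (h j w) = b j w"
  "\<And>j w. j \<in> J ==> w \<in> E P j ==> p j w = zr U j ==> q j w = zr V j ==> w = zr P j"
proof -
 obtain T p q where T: "T \<in> Ob C" "p \<in> Hom C T U" "q \<in> Hom C T V"
  and T1: "\<forall>j\<in>J. \<forall>u\<in>E U j. \<forall>v\<in>E V j. \<exists>w\<in>E T j. p j w = u \<and> q j w = v"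
  and T2: "\<forall>j\<in>J. \<forall>w\<in>E T j. p j w = zr U j --> q j w = zr V j --> w = zr T j"
  and T3: "\<forall>W\<in>Ob C. \<forall>a\<in>Hom C W U. \<forall>b\<in>Hom C W V. \<exists>h\<in>Hom C W T.
   \<forall>j\<in>J. \<forall>w\<in>E W j. p j (h j w) = a j w \<and> q j (h j w) = b j w"
  using prod_ex[OF U V] by (elim bexE conjE) (rule that)
 have surj: "\<exists>w\<in>E T j. p j w = u \<and> q j w = v" if "j \<in> J" "u \<in> E U j" "v \<in> E V j" for j u v
  using T1 that by simp
 have inj: "w = zr T j" if "j \<in> J" "w \<in> E T j" "p j w = zr U j" "q j w = zr V j" for j w
  using T2 that by simp
 have univ: "\<exists>h\<in>Hom C W T. \<forall>j\<in>J. \<forall>w\<in>E W j. p j (h j w) = a j w \<and> q j (h j w) = b j w"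
  if "W \<in> Ob C" "a \<in> Hom C W U" "b \<in> Hom C W V" for W a b
  using T3 that by simp
 note sp = cmp_hom[OF T(1) U X T(2) s] cmp_app[OF T(1) U X T(2) s]
 note tq = cmp_hom[OF T(1) V X T(3) t] cmp_app[OF T(1) V X T(3) t]
 obtain D where D: "D \<in> Hom C T X"
  and D': "\<forall>j\<in>J. \<forall>w\<in>E T j. D j w = df X j (Cmp C T U X s p j w) (Cmp C T V X t q j w)"
  using diff_hom[OF T(1) X sp(1) tq(1)] by (elim bexE) (rule that)
 obtain P i where P: "P \<in> Ob C" "mono P T i" "\<forall>j\<in>J. im P i j = ker T X D j"
  using ses_of_ker[OF T(1) X D] by blast
 have i: "i \<in> Hom C P T" using P mono_def by blast
 have cl: "i j w \<in> E T j" if "j \<in> J" "w \<in> E P j" for j w using hom_closed[OF P(1) T(1) i] that by blast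
 have D0: "D j w = zr X j \<longleftrightarrow> s j (p j w) = t j (q j w)" if "j \<in> J" "w \<in> E T j" for j w
  using that D' sp(2)[OF that] tq(2)[OF that]
   df_eq_zr[OF X that(1) hom_closed[OF U X s that(1) hom_closed[OF T(1) U T(2) that]]
    hom_closed[OF V X t that(1) hom_closed[OF T(1) V T(3) that]]] by simp
 let ?p = "Cmp C P T U p i" and ?q = "Cmp C P T V q i"
 note pq = cmp_hom[OF P(1) T(1) U i T(2)] cmp_hom[OF P(1) T(1) V i T(3)]
  cmp_app[OF P(1) T(1) U i T(2)] cmp_app[OF P(1) T(1) V i T(3)]
 show thesis
 proof (rule that[OF P(1) pq(1,2)])
  fix j w assume j: "j \<in> J" and w: "w \<in> E P j"
  have "i j w \<in> ker T X D j" using P j w unfolding im_def by blast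
  then show "s j (?p j w) = t j (?q j w)" using D0 j w pq unfolding ker_def by auto
 next
  fix j u v assume j: "j \<in> J" and u: "u \<in> E U j" and v: "v \<in> E V j" and e: "s j u = t j v"
  obtain w where w: "w \<in> E T j" "p j w = u" "q j w = v" using surj[OF j u v] by blast
  have "w \<in> im P i j" using P(3) j w e D0 unfolding ker_def by auto
  then show "\<exists>w\<in>E P j. ?p j w = u \<and> ?q j w = v" using w pq j unfolding im_def by auto
 next
  fix W a b assume W: "W \<in> Ob C" and a: "a \<in> Hom C W U" and b: "b \<in> Hom C W V"
   and e: "\<And>j w. j \<in> J ==> w \<in> E W j ==> s j (a j w) = t j (b j w)"
  obtain h where h: "h \<in> Hom C W T" "\<forall>j\<in>J. \<forall>w\<in>E W j. p j (h j w) = a j w \<and> q j (h j w) = b j w"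
   using univ[OF W a b] by (elim bexE) (rule that)
  have "h j w \<in> i j ` E P j" if "j \<in> J" "w \<in> E W j" for j w
  proof -
   have "h j w \<in> ker T X D j"
    using D0[OF that(1) hom_closed[OF W T(1) h(1) that]] e[OF that] h(2) that hom_closed[OF W T(1) h(1) that] unfolding ker_def by simp
   then show ?thesis using P(3) that(1) unfolding im_def by simp
  qed
  then obtain k where k: "k \<in> Hom C W P" "\<forall>j\<in>J. \<forall>w\<in>E W j. i j (k j w) = h j w"
   using lift[OF P(1) T(1) W i h(1)] P(2) unfolding mono_def by auto
  then show "\<exists>h\<in>Hom C W P. \<forall>j\<in>J. \<forall>w\<in>E W j. ?p j (h j w) = a j w \<and> ?q j (h j w) = b j w"
   using h pq hom_closed[OF W P(1) k(1)] by (intro bexI[of _ k]) auto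
 next
  fix j w assume j: "j \<in> J" and w: "w \<in> E P j" "?p j w = zr U j" "?q j w = zr V j"
  have "i j w = zr T j" using inj[OF j cl[OF j w(1)]] w pq j by auto
  moreover have "i j (zr P j) = zr T j" using hom_zr[OF P(1) T(1) i j] .
  ultimately show "w = zr P j" using P(2) w(1) j zr_E[OF P(1) j] unfolding mono_def inj_on_def by metis
 qed
qed

text \<open>One condition comprises closure under subobjects, quotients and extensions: the sequence
  A, X, Q need only satisfy that the kernel of \<open>q\<close> lies in the image of
  \<open>i\<close>. A zero object in place of A or Q gives the first two.\<close>

definition serre :: "'o set => bool" where
 "serre S \<longleftrightarrow> S \<subseteq> Ob C \<and> (\<forall>X\<in>Ob C. (\<forall>j\<in>J. E X j = {zr X j}) --> X \<in> S) \<and>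
  (\<forall>A\<in>S. \<forall>Q\<in>S. \<forall>X\<in>Ob C. \<forall>i\<in>Hom C A X. \<forall>q\<in>Hom C X Q.
    (\<forall>j\<in>J. ker X Q q j \<subseteq> im A i j) --> X \<in> S)"

end

section \<open>Serre classes and small families of subsets\<close>

locale serre_class = concrete_abelian C J G
 for C :: "('o, 'j => 'e => 'e) category" and J :: "'j set" and G :: "'o => 'j => ('e, 'x) ring_scheme" +
 fixes S :: "'o set"
 assumes serre: "serre S"
begin

lemma S_Ob: "X \<in> S ==> X \<in> Ob C" using serre unfolding serre_def by blast

lemma S_zero: "X \<in> Ob C ==> (\<And>j. j \<in> J ==> E X j = {zr X j}) ==> X \<in> S"
 using serre unfolding serre_def by blast

lemma S_mid: "[| A \<in> S; Q \<in> S; X \<in> Ob C; i \<in> Hom C A X; q \<in> Hom C X Q;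
 \<And>j x. j \<in> J ==> x \<in> E X j ==> q j x = zr Q j ==> x \<in> i j ` E A j |] ==> X \<in> S"
 using serre unfolding serre_def ker_def im_def by blast

lemma S_sub: assumes "X \<in> Ob C" "Y \<in> S" "mono X Y f" shows "X \<in> S"
proof -
 obtain Z where Z: "Z \<in> Ob C" "\<And>j. j \<in> J ==> E Z j = {zr Z j}" using zero_ob assms by blast
 obtain z where z: "z \<in> Hom C Z X" using zero_hom Z assms by blast
 have f: "f \<in> Hom C X Y" using assms mono_def by blast
 show ?thesis
 proof (rule S_mid[OF S_zero[OF Z] assms(2,1) z f])
  fix j x assume j: "j \<in> J" "x \<in> E X j" "f j x = zr Y j"
  then have "x = zr X j" using assms hom_zr[OF assms(1) S_Ob f] zr_E unfolding mono_def inj_on_def by metis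
  moreover have "z j (zr Z j) = zr X j" using hom_zr[OF Z(1) assms(1) z j(1)] .
  ultimately show "x \<in> z j ` E Z j" using zr_E[OF Z(1) j(1)] by (metis imageI)
 qed
qed

lemma S_quot: assumes "X \<in> S" "Y \<in> Ob C" "epi X Y f" shows "Y \<in> S"
proof -
 obtain Z where Z: "Z \<in> Ob C" "\<And>j. j \<in> J ==> E Z j = {zr Z j}" using zero_ob assms by blast
 obtain z where z: "z \<in> Hom C Y Z" using zero_hom Z assms by blast
 have f: "f \<in> Hom C X Y" using assms epi_def by blast
 show ?thesis
  by (rule S_mid[OF assms(1) S_zero[OF Z] assms(2) f z]) (use assms epi_def in auto)
qed

text \<open>Smallness is a property of arbitrary families of subsets, not of subobjects. Sums,
  images, preimages and sets of differences can thus be estimated without being turned into objects.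
  The dual notion \<open>cosmall\<close> says that the family contains a subobject with quotient in
  \<open>S\<close>.\<close>

definition small :: "'o => ('j => 'e set) => bool" where
 "small X N \<longleftrightarrow> (\<exists>A\<in>S. \<exists>i\<in>Hom C A X. \<forall>j\<in>J. N j \<subseteq> im A i j)"

definition cosmall :: "'o => ('j => 'e set) => bool" where
 "cosmall X N \<longleftrightarrow> (\<exists>Q\<in>S. \<exists>q\<in>Hom C X Q. \<forall>j\<in>J. ker X Q q j \<subseteq> N j)"

lemma small_mono: "small X N ==> (\<And>j x. j \<in> J ==> x \<in> M j ==> x \<in> N j) ==> small X M"
 unfolding small_def by blast

lemma cosmall_mono: "cosmall X N ==> (\<And>j x. j \<in> J ==> x \<in> E X j ==> x \<in> N j ==> x \<in> M j) ==> cosmall X M"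
 unfolding cosmall_def ker_def by blast

lemma small_inj: assumes X: "X \<in> Ob C" and "small X N"
 obtains A i where "A \<in> S" "mono A X i" "\<And>j. j \<in> J ==> N j \<subseteq> im A i j"
proof -
 obtain A i where A: "A \<in> S" "i \<in> Hom C A X" "\<forall>j\<in>J. N j \<subseteq> im A i j" using assms unfolding small_def by blast
 obtain I k e where I: "I \<in> Ob C" "mono I X k" "epi A I e" "\<And>j. j \<in> J ==> im I k j = im A i j"
  using image_factor[OF S_Ob[OF A(1)] X A(2)] by metis
 show thesis using that[OF S_quot[OF A(1) I(1,3)] I(2)] I(4) A by blast
qed

lemma cosmall_surj: assumes X: "X \<in> Ob C" and "cosmall X N"
 obtains Q q where "Q \<in> S" "epi X Q q" "\<And>j. j \<in> J ==> ker X Q q j \<subseteq> N j"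
proof -
 obtain Q q where A: "Q \<in> S" "q \<in> Hom C X Q" "\<forall>j\<in>J. ker X Q q j \<subseteq> N j" using assms unfolding cosmall_def by blast
 obtain I k e where I: "I \<in> Ob C" "mono I Q k" "epi X I e" "\<And>j x. j \<in> J ==> x \<in> E X j ==> k j (e j x) = q j x"
  using image_factor[OF X S_Ob[OF A(1)] A(2)] by metis
 have "ker X I e j \<subseteq> ker X Q q j" if j: "j \<in> J" for j
  using I(4)[OF j] hom_zr[OF I(1) S_Ob[OF A(1)] _ j, of k] I(2) unfolding ker_def mono_def by force
 then show thesis using that[OF S_sub[OF I(1) A(1) I(2)] I(3)] A by blast
qed

lemma small_self: "X \<in> S ==> small X (E X)"
 unfolding small_def im_def by (rule bexI[of _ X], rule bexI[of _ "Id C X"]) (use id_hom id_app S_Ob in \<open>auto simp: image_iff\<close>)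

lemma small_ob: assumes "X \<in> Ob C" "small X (E X)" shows "X \<in> S"
proof -
 obtain A i where "A \<in> S" "mono A X i" "\<And>j. j \<in> J ==> E X j \<subseteq> im A i j" using small_inj[OF assms] by metis
 moreover then have "epi A X i" using hom_closed[OF S_Ob assms(1)] unfolding epi_def mono_def im_def by blast
 ultimately show ?thesis using S_quot assms by blast
qed

lemma small_zero: assumes "X \<in> Ob C" "\<And>j. j \<in> J ==> N j \<subseteq> {zr X j}" shows "small X N"
proof -
 obtain Z where Z: "Z \<in> Ob C" "\<And>j. j \<in> J ==> E Z j = {zr Z j}" using zero_ob assms by blast
 obtain z where z: "z \<in> Hom C Z X" using zero_hom Z assms by blast
 show ?thesis unfolding small_def im_def
  by (rule bexI[OF _ S_zero[OF Z]], simp, rule bexI[OF _ z]) (use assms Z hom_zr[OF Z(1) assms(1) z] in auto)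
qed

lemma cosmall_all: assumes "X \<in> Ob C" "\<And>j x. j \<in> J ==> x \<in> E X j ==> x \<in> N j" shows "cosmall X N"
proof -
 obtain Z where Z: "Z \<in> Ob C" "\<And>j. j \<in> J ==> E Z j = {zr Z j}" using zero_ob assms by blast
 obtain z where "z \<in> Hom C X Z" using zero_hom Z assms by blast
 moreover have "ker X Z z j \<subseteq> N j" if "j \<in> J" for j using assms that unfolding ker_def by blast
 ultimately show ?thesis unfolding cosmall_def using S_zero[OF Z] by blast
qed

lemma S_mid': assumes "X \<in> Ob C" "small X N" "cosmall X N" shows "X \<in> S"
proof -
 obtain A i where A: "A \<in> S" "i \<in> Hom C A X" "\<forall>j\<in>J. N j \<subseteq> im A i j" using assms unfolding small_def by blast
 obtain Q q where Q: "Q \<in> S" "q \<in> Hom C X Q" "\<forall>j\<in>J. ker X Q q j \<subseteq> N j" using assms unfolding cosmall_def by blast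
 show ?thesis using S_mid[OF A(1) Q(1) assms(1) A(2) Q(2)] A Q unfolding ker_def im_def by blast
qed

lemma small_image: assumes "X \<in> Ob C" "Y \<in> Ob C" "f \<in> Hom C X Y" "small X N"
 shows "small Y (\<lambda>j. f j ` N j)"
proof -
 obtain A i where A: "A \<in> S" "i \<in> Hom C A X" "\<forall>j\<in>J. N j \<subseteq> im A i j" using assms unfolding small_def by blast
 have "f j ` N j \<subseteq> im A (Cmp C A X Y f i) j" if j: "j \<in> J" for j
  using A j cmp_app[OF S_Ob[OF A(1)] assms(1,2) A(2) assms(3) j] unfolding im_def by (auto simp: image_iff subset_iff)
 then show ?thesis unfolding small_def
  using A(1) cmp_hom[OF S_Ob[OF A(1)] assms(1,2) A(2) assms(3)] by blast
qed

lemma cosmall_preimage: assumes "X \<in> Ob C" "Y \<in> Ob C" "f \<in> Hom C X Y" "cosmall Y N"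
 shows "cosmall X (\<lambda>j. {x. f j x \<in> N j})"
proof -
 obtain Q q where A: "Q \<in> S" "q \<in> Hom C Y Q" "\<forall>j\<in>J. ker Y Q q j \<subseteq> N j" using assms unfolding cosmall_def by blast
 have "ker X Q (Cmp C X Y Q q f) j \<subseteq> {x. f j x \<in> N j}" if j: "j \<in> J" for j
  using A(3) j cmp_app[OF assms(1,2) S_Ob[OF A(1)] assms(3) A(2) j] hom_closed[OF assms(1-3) j] unfolding ker_def by (auto simp: subset_iff)
 then show ?thesis unfolding cosmall_def
  using A(1) cmp_hom[OF assms(1,2) S_Ob[OF A(1)] assms(3) A(2)] by blast
qed

lemma small_sub_ob: assumes "X \<in> Ob C" "small X N" "K \<in> Ob C" "mono K X k" "\<And>j. j \<in> J ==> im K k j \<subseteq> N j"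
 shows "K \<in> S"
proof -
 obtain A i where A: "A \<in> S" "mono A X i" "\<And>j. j \<in> J ==> N j \<subseteq> im A i j" using small_inj[OF assms(1,2)] by metis
 have "k j u \<in> im A i j" if "j \<in> J" "u \<in> E K j" for j u using A(3) assms(5) that unfolding im_def by blast
 then have "\<exists>h\<in>Hom C K A. \<forall>j\<in>J. \<forall>u\<in>E K j. i j (h j u) = k j u"
  by (rule mono_lift[OF S_Ob[OF A(1)] assms(1,3) A(2) monoD(1)[OF assms(4)]])
 then obtain h where h: "h \<in> Hom C K A" "\<And>j u. j \<in> J ==> u \<in> E K j ==> i j (h j u) = k j u" by (elim bexE) simp
 then have "mono K A h" using assms(4) unfolding mono_def inj_on_def by metis
 then show ?thesis using S_sub A assms by blast
qed

end

context serre_class begin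

text \<open>Enlarge \<open>N\<close> to a subobject A in \<open>S\<close>. Its preimage K, the
  kernel of \<open>f\<close> followed by the cokernel of A, is an extension: the kernel L of
  \<open>f\<close> maps into K, K maps into A, and both ends lie in \<open>S\<close>.\<close>

lemma small_preimage: assumes X: "X \<in> Ob C" and Y: "Y \<in> Ob C" and f: "f \<in> Hom C X Y"
  and k: "small X (ker X Y f)" and N: "small Y N"
 shows "small X (\<lambda>j. {x \<in> E X j. f j x \<in> N j})"
proof -
 obtain A i where A: "A \<in> S" "mono A Y i" "\<And>j. j \<in> J ==> N j \<subseteq> im A i j" using small_inj[OF Y N] by metis
 have A': "A \<in> Ob C" "i \<in> Hom C A Y" using A S_Ob mono_def by auto
 obtain Q q where Q: "Q \<in> Ob C" "epi Y Q q" "\<forall>j\<in>J. im A i j = ker Y Q q j"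
  using ses_of_coker[OF A'(1) Y A'(2)] by blast
 have q: "q \<in> Hom C Y Q" using Q epi_def by blast
 obtain K k where K: "K \<in> Ob C" "mono K X k" "\<forall>j\<in>J. im K k j = ker X Q (Cmp C X Y Q q f) j"
  using ses_of_ker[OF X Q(1) cmp_hom[OF X Y Q(1) f q]] by blast
 have kk: "k \<in> Hom C K X" using K mono_def by blast
 have qf: "Cmp C X Y Q q f j x = q j (f j x)" if "j \<in> J" "x \<in> E X j" for j x using cmp_app[OF X Y Q(1) f q that] .
 have imk: "x \<in> im K k j \<longleftrightarrow> x \<in> E X j \<and> f j x \<in> im A i j" if "j \<in> J" for j x
 proof -
  have "im A i j = {y \<in> E Y j. q j y = zr Q j}" using Q(3) that unfolding ker_def by simp
  moreover have "im K k j = {x \<in> E X j. Cmp C X Y Q q f j x = zr Q j}" using K(3) that unfolding ker_def by simp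
  ultimately show ?thesis using qf[OF that, of x] hom_closed[OF X Y f that, of x] by (cases "x \<in> E X j") simp_all
 qed
 obtain L l where L: "L \<in> Ob C" "mono L X l" "\<forall>j\<in>J. im L l j = ker X Y f j" using ses_of_ker[OF X Y f] by blast
 have LS: "L \<in> S" by (rule small_sub_ob[OF X assms(4) L(1,2)]) (use L(3) in simp)
 have "l j u \<in> im K k j" if "j \<in> J" "u \<in> E L j" for j u
 proof -
  have "l j u \<in> ker X Y f j" using L(3) that unfolding im_def by blast
  moreover have "zr Y j \<in> im A i j"
   using hom_zr[OF A'(1) Y A'(2) that(1)] zr_E[OF A'(1) that(1)] unfolding im_def by (metis imageI)
  ultimately show ?thesis using imk[OF that(1), of "l j u"] unfolding ker_def by simp
 qed
 then have "\<exists>m\<in>Hom C L K. \<forall>j\<in>J. \<forall>u\<in>E L j. k j (m j u) = l j u"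
  by (rule mono_lift[OF K(1) X L(1) K(2) monoD(1)[OF L(2)]])
 then obtain m where m: "m \<in> Hom C L K" "\<And>j u. j \<in> J ==> u \<in> E L j ==> k j (m j u) = l j u" by (elim bexE) simp
 have "Cmp C K X Y f k j u \<in> im A i j" if "j \<in> J" "u \<in> E K j" for j u
  using imk[OF that(1), of "k j u"] that cmp_app[OF K(1) X Y kk f that] unfolding im_def by auto
 then have "\<exists>n\<in>Hom C K A. \<forall>j\<in>J. \<forall>u\<in>E K j. i j (n j u) = Cmp C K X Y f k j u"
  by (rule mono_lift[OF A'(1) Y K(1) A(2) cmp_hom[OF K(1) X Y kk f]])
 then obtain n where n: "n \<in> Hom C K A" "\<And>j u. j \<in> J ==> u \<in> E K j ==> i j (n j u) = Cmp C K X Y f k j u" by (elim bexE) simp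
 have "K \<in> S"
 proof (rule S_mid[OF LS A(1) K(1) m(1) n(1)])
  fix j x assume j: "j \<in> J" and x: "x \<in> E K j" "n j x = zr A j"
  have "f j (k j x) = zr Y j" using n(2)[OF j x(1)] x hom_zr[OF A'(1) Y A'(2) j] cmp_app[OF K(1) X Y kk f j x(1)] by simp
  then have "k j x \<in> im L l j" using L(3) j hom_closed[OF K(1) X kk j x(1)] unfolding ker_def by auto
  then obtain y where y: "y \<in> E L j" "k j x = k j (m j y)" using m j unfolding im_def by auto
  then have "x = m j y" using monoD(2)[OF K(2) j x(1) hom_closed[OF L(1) K(1) m(1) j y(1)]] by simp
  then show "x \<in> m j ` E L j" using y by blast
 qed
 moreover have "{x \<in> E X j. f j x \<in> N j} \<subseteq> im K k j" if "j \<in> J" for j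
  using imk[OF that] A(3)[OF that] by blast
 ultimately show ?thesis unfolding small_def using kk by blast
qed

text \<open>Dual to preimages: with K the kernel of \<open>q\<close>, the quotient R of Y by the
  image of K is an extension of the cokernel T of \<open>f\<close> by a quotient of Q, so it lies in
  \<open>S\<close>.\<close>

lemma cosmall_image: assumes X: "X \<in> Ob C" and Y: "Y \<in> Ob C" and f: "f \<in> Hom C X Y"
  and k: "cosmall Y (im X f)" and N: "cosmall X N"
 shows "cosmall Y (\<lambda>j. f j ` N j)"
proof -
 obtain Q q where Q: "Q \<in> S" "epi X Q q" "\<And>j. j \<in> J ==> ker X Q q j \<subseteq> N j" using cosmall_surj[OF X N] by metis
 have q: "Q \<in> Ob C" "q \<in> Hom C X Q" using Q S_Ob epi_def by auto
 obtain K k where K: "K \<in> Ob C" "mono K X k" "\<forall>j\<in>J. im K k j = ker X Q q j" using ses_of_ker[OF X q] by blast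
 have kk: "k \<in> Hom C K X" using K mono_def by blast
 obtain R r where R: "R \<in> Ob C" "epi Y R r" "\<forall>j\<in>J. im K (Cmp C K X Y f k) j = ker Y R r j"
  using ses_of_coker[OF K(1) Y cmp_hom[OF K(1) X Y kk f]] by blast
 have r: "r \<in> Hom C Y R" using R epi_def by blast
 have imfk: "im K (Cmp C K X Y f k) j = f j ` ker X Q q j" if "j \<in> J" for j
 proof -
  have "im K (Cmp C K X Y f k) j = f j ` im K k j"
   unfolding im_def image_image using cmp_app[OF K(1) X Y kk f that] by simp
  then show ?thesis using K(3) that by simp
 qed
 obtain T t where T: "T \<in> Ob C" "epi Y T t" "\<forall>j\<in>J. im X f j = ker Y T t j" using ses_of_coker[OF X Y f] by blast
 have t: "t \<in> Hom C Y T" using T epi_def by blast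
 obtain P p where P: "P \<in> S" "epi Y P p" "\<And>j. j \<in> J ==> ker Y P p j \<subseteq> im X f j" using cosmall_surj[OF Y k] by metis
 \<comment> \<open>The kernel of \<open>p\<close> lies in the image of \<open>f\<close>, hence
   \<open>t\<close> factors through \<open>p\<close> and T is a quotient of P.\<close>
 have TS: "T \<in> S"
 proof -
  have "t j x = zr T j" if "j \<in> J" "x \<in> E Y j" "p j x = zr P j" for j x
  proof -
   have "x \<in> ker Y T t j" using P(3)[OF that(1)] bspec[OF T(3) that(1)] that(2,3) unfolding ker_def[of Y P] by blast
   then show ?thesis unfolding ker_def by simp
  qed
  then have "\<exists>h\<in>Hom C P T. \<forall>j\<in>J. \<forall>x\<in>E Y j. h j (p j x) = t j x"
   by (rule epi_desc[OF Y S_Ob[OF P(1)] T(1) P(2) t])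
  then obtain h where h: "h \<in> Hom C P T" "\<And>j x. j \<in> J ==> x \<in> E Y j ==> h j (p j x) = t j x" by (elim bexE) simp
  have "h j ` E P j = E T j" if "j \<in> J" for j
  proof -
   have e: "E P j = p j ` E Y j" "E T j = t j ` E Y j" using P T that unfolding epi_def by auto
   show ?thesis unfolding e image_image using h(2)[OF that] by simp
  qed
  then show ?thesis using S_quot[OF P(1) T(1)] h unfolding epi_def by blast
 qed
 have rz: "r j (f j x) = zr R j" if "j \<in> J" "x \<in> E X j" "q j x = zr Q j" for j x
 proof -
  have "f j x \<in> ker Y R r j" using imfk[OF that(1)] bspec[OF R(3) that(1)] that(2,3) unfolding ker_def[of X Q] by blast
  then show ?thesis unfolding ker_def by simp
 qed
 have "Cmp C X Y R r f j x = zr R j" if "j \<in> J" "x \<in> E X j" "q j x = zr Q j" for j x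
  using rz[OF that] cmp_app[OF X Y R(1) f r that(1,2)] by simp
 then have "\<exists>g\<in>Hom C Q R. \<forall>j\<in>J. \<forall>x\<in>E X j. g j (q j x) = Cmp C X Y R r f j x"
  by (rule epi_desc[OF X q(1) R(1) Q(2) cmp_hom[OF X Y R(1) f r]])
 then obtain g where g: "g \<in> Hom C Q R" "\<And>j x. j \<in> J ==> x \<in> E X j ==> g j (q j x) = Cmp C X Y R r f j x" by (elim bexE) simp
 have tz: "t j y = zr T j" if "j \<in> J" "y \<in> E Y j" "r j y = zr R j" for j y
 proof -
  have "y \<in> f j ` ker X Q q j" using R(3) imfk that unfolding ker_def by auto
  then show ?thesis using T(3) that unfolding im_def ker_def by auto
 qed
 have "\<exists>h\<in>Hom C R T. \<forall>j\<in>J. \<forall>y\<in>E Y j. h j (r j y) = t j y"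
  using tz by (rule epi_desc[OF Y R(1) T(1) R(2) t])
 then obtain h where h: "h \<in> Hom C R T" "\<And>j y. j \<in> J ==> y \<in> E Y j ==> h j (r j y) = t j y" by (elim bexE) simp
 have "R \<in> S"
 proof (rule S_mid[OF Q(1) TS R(1) g(1) h(1)])
  fix j z assume j: "j \<in> J" and z: "z \<in> E R j" "h j z = zr T j"
  obtain y where y: "y \<in> E Y j" "z = r j y" using epiD(2)[OF R(2) j z(1)] by blast
  have "t j y = zr T j" using h j z y by auto
  then obtain x where x: "x \<in> E X j" "y = f j x" using T(3) j y unfolding ker_def im_def by auto
  then have "z = g j (q j x)" using g j y cmp_app[OF X Y R(1) f r j x(1)] by auto
  then show "z \<in> g j ` E Q j" using hom_closed[OF X q j x(1)] by blast
 qed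
 moreover have "ker Y R r j \<subseteq> f j ` N j" if "j \<in> J" for j using R(3) imfk Q(3) that by blast
 ultimately show ?thesis unfolding cosmall_def using r by blast
qed

text \<open>Modulo A, which contains \<open>N\<close>, every sum has the same image as its summand
  in \<open>M\<close>. Hence the sums lie in the preimage of a small family under the cokernel of A,
  whose kernel is small.\<close>

lemma small_add: assumes X: "X \<in> Ob C" and N: "small X N" and M: "small X M"
 shows "small X (\<lambda>j. {x \<in> E X j. \<exists>n\<in>N j. \<exists>m\<in>M j. n \<in> E X j \<and> m \<in> E X j \<and> x = n \<oplus>[G X j] m})"
proof -
 obtain A i where A: "A \<in> S" "mono A X i" "\<And>j. j \<in> J ==> N j \<subseteq> im A i j" using small_inj[OF X N] by metis
 have A': "A \<in> Ob C" "i \<in> Hom C A X" using A S_Ob mono_def by auto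
 obtain Q q where Q: "Q \<in> Ob C" "epi X Q q" "\<forall>j\<in>J. im A i j = ker X Q q j"
  using ses_of_coker[OF A'(1) X A'(2)] by blast
 have q: "q \<in> Hom C X Q" using Q epi_def by blast
 have "small X (im A i)" using A A' unfolding small_def by blast
 then have "small X (ker X Q q)" using Q(3) small_mono by blast
 from small_preimage[OF X Q(1) q this small_image[OF X Q(1) q M]]
 show ?thesis
 proof (rule small_mono)
  fix j x assume j: "j \<in> J" and "x \<in> {x \<in> E X j. \<exists>n\<in>N j. \<exists>m\<in>M j. n \<in> E X j \<and> m \<in> E X j \<and> x = n \<oplus>[G X j] m}"
  then obtain n m where *: "x \<in> E X j" "n \<in> N j" "m \<in> M j" "n \<in> E X j" "m \<in> E X j" "x = n \<oplus>[G X j] m" by blast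
  have "q j n = zr Q j" using A(3) Q(3) j * unfolding ker_def by blast
  then have "q j x = q j m" using hom_add[OF X Q(1) q j *(4,5)] * grp[OF Q(1) j] hom_closed[OF X Q(1) q j *(5)]
   by (metis abelian_groupE(5))
  then show "x \<in> {x \<in> E X j. q j x \<in> q j ` M j}" using * by blast
 qed
qed

text \<open>A morphism need only be controlled on a cosmall part: after dividing Y by the subobject
  A that contains the values on \<open>M\<close>, \<open>h\<close> factors through Q in
  \<open>S\<close>. Equalities in the quotient category are later verified on such a part.\<close>

lemma small_extend: assumes X: "X \<in> Ob C" and Y: "Y \<in> Ob C" and h: "h \<in> Hom C X Y"
  and M: "cosmall X M" and s: "small Y (\<lambda>j. h j ` M j)"
 shows "small Y (im X h)"
proof -
 obtain Q q where Q: "Q \<in> S" "epi X Q q" "\<And>j. j \<in> J ==> ker X Q q j \<subseteq> M j" using cosmall_surj[OF X M] by metis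
 have q: "Q \<in> Ob C" "q \<in> Hom C X Q" using Q S_Ob epi_def by auto
 obtain A i where A: "A \<in> S" "mono A Y i" "\<And>j. j \<in> J ==> h j ` M j \<subseteq> im A i j" using small_inj[OF Y s] by metis
 have A': "A \<in> Ob C" "i \<in> Hom C A Y" using A S_Ob mono_def by auto
 obtain P p where P: "P \<in> Ob C" "epi Y P p" "\<forall>j\<in>J. im A i j = ker Y P p j"
  using ses_of_coker[OF A'(1) Y A'(2)] by blast
 have p: "p \<in> Hom C Y P" using P epi_def by blast
 have pz: "p j (h j x) = zr P j" if "j \<in> J" "x \<in> E X j" "q j x = zr Q j" for j x
 proof -
  have "x \<in> M j" using Q(3)[OF that(1)] that(2,3) unfolding ker_def by blast
  then have "h j x \<in> ker Y P p j" using A(3)[OF that(1)] bspec[OF P(3) that(1)] by blast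
  then show ?thesis unfolding ker_def by simp
 qed
 have "Cmp C X Y P p h j x = zr P j" if "j \<in> J" "x \<in> E X j" "q j x = zr Q j" for j x
  using pz[OF that] cmp_app[OF X Y P(1) h p that(1,2)] by simp
 then have "\<exists>g\<in>Hom C Q P. \<forall>j\<in>J. \<forall>x\<in>E X j. g j (q j x) = Cmp C X Y P p h j x"
  by (rule epi_desc[OF X q(1) P(1) Q(2) cmp_hom[OF X Y P(1) h p]])
 then obtain g where g: "g \<in> Hom C Q P" "\<And>j x. j \<in> J ==> x \<in> E X j ==> g j (q j x) = Cmp C X Y P p h j x" by (elim bexE) simp
 have "small Y (im A i)" using A A' unfolding small_def by blast
 then have "small Y (ker Y P p)" using P(3) small_mono by blast
 from small_preimage[OF Y P(1) p this small_image[OF q(1) P(1) g(1) small_self[OF Q(1)]]]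
 show ?thesis
 proof (rule small_mono)
  fix j y assume j: "j \<in> J" and "y \<in> im X h j"
  then obtain x where x: "x \<in> E X j" "y = h j x" unfolding im_def by blast
  then have "p j y = g j (q j x)" using g j cmp_app[OF X Y P(1) h p j x(1)] by auto
  then show "y \<in> {y \<in> E Y j. p j y \<in> g j ` E Q j}" using x hom_closed[OF X Y h j x(1)] hom_closed[OF X q j x(1)] by blast
 qed
qed

text \<open>If the image is small, \<open>h\<close> factors through an object of \<open>S\<close>,
  and the kernel of the first factor is contained in that of \<open>h\<close>.\<close>

lemma cosmall_ker: assumes X: "X \<in> Ob C" and Y: "Y \<in> Ob C" and h: "h \<in> Hom C X Y" and s: "small Y (im X h)"
 shows "cosmall X (ker X Y h)"
proof -
 obtain A i where A: "A \<in> S" "mono A Y i" "\<And>j. j \<in> J ==> im X h j \<subseteq> im A i j" using small_inj[OF Y s] by metis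
 have A': "A \<in> Ob C" "i \<in> Hom C A Y" using A S_Ob mono_def by auto
 have "h j x \<in> im A i j" if "j \<in> J" "x \<in> E X j" for j x using A(3)[OF that(1)] that(2) unfolding im_def by blast
 then have "\<exists>g\<in>Hom C X A. \<forall>j\<in>J. \<forall>x\<in>E X j. i j (g j x) = h j x"
  by (rule mono_lift[OF A'(1) Y X A(2) h])
 then obtain g where g: "g \<in> Hom C X A" "\<And>j x. j \<in> J ==> x \<in> E X j ==> i j (g j x) = h j x" by (elim bexE) simp
 have "ker X A g j \<subseteq> ker X Y h j" if "j \<in> J" for j
  using g that hom_zr[OF A'(1) Y A'(2) that] unfolding ker_def by force
 then show ?thesis unfolding cosmall_def using A g by blast
qed

end

section \<open>Categorical notions read off on elements\<close>

context concrete_abelian begin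

lemma zero_object_iff:
 assumes Z: "Z \<in> Ob C"
 shows "zero_object C Z \<longleftrightarrow> (\<forall>j\<in>J. E Z j = {zr Z j})"
proof
 assume a: "zero_object C Z"
 obtain z where z: "z \<in> Hom C Z Z" "\<forall>j\<in>J. \<forall>x\<in>E Z j. z j x = zr Z j" using zero_hom[OF Z Z] by blast
 have "\<exists>!f. f \<in> Hom C Z Z" using a Z unfolding zero_object_def by simp
 then have "z = Id C Z" using z(1) id_hom[OF Z] by blast
 then show "\<forall>j\<in>J. E Z j = {zr Z j}" using z(2) id_app[OF Z] zr_E[OF Z] by fastforce
next
 assume a: "\<forall>j\<in>J. E Z j = {zr Z j}"
 have "(\<exists>!f. f \<in> Hom C X Z) \<and> (\<exists>!f. f \<in> Hom C Z X)" if X: "X \<in> Ob C" for X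
 proof
  obtain z where z: "z \<in> Hom C X Z" using zero_hom[OF X Z] by blast
  have "f = z" if f: "f \<in> Hom C X Z" for f
   by (rule hom_ext[OF X Z f z]) (use a hom_closed[OF X Z f] hom_closed[OF X Z z] in auto)
  then show "\<exists>!f. f \<in> Hom C X Z" using z by blast
  obtain z where z: "z \<in> Hom C Z X" using zero_hom[OF Z X] by blast
  have "f = z" if f: "f \<in> Hom C Z X" for f
   by (rule hom_ext[OF Z X f z]) (use a hom_zr[OF Z X f] hom_zr[OF Z X z] in auto)
  then show "\<exists>!f. f \<in> Hom C Z X" using z by blast
 qed
 then show "zero_object C Z" unfolding zero_object_def using Z by simp
qed

lemma zero_morphism_iff:
 assumes X: "X \<in> Ob C" and Y: "Y \<in> Ob C" and f: "f \<in> Hom C X Y"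
 shows "zero_morphism C X Y f \<longleftrightarrow> (\<forall>j\<in>J. \<forall>x\<in>E X j. f j x = zr Y j)"
proof
 assume "zero_morphism C X Y f"
 then obtain Z u v where Z: "zero_object C Z" "u \<in> Hom C X Z" "v \<in> Hom C Z Y" "f = Cmp C X Z Y v u"
  unfolding zero_morphism_def by (elim exE conjE) (rule that)
 have Z': "Z \<in> Ob C" using conjunct1[OF Z(1)[unfolded zero_object_def]] .
 have "f j x = zr Y j" if "j \<in> J" "x \<in> E X j" for j x
 proof -
  have "u j x = zr Z j" using zero_object_iff[OF Z'] Z(1) hom_closed[OF X Z' Z(2) that] that by blast
  then show ?thesis using cmp_app[OF X Z' Y Z(2,3) that] Z(4) hom_zr[OF Z' Y Z(3) that(1)] by simp
 qed
 then show "\<forall>j\<in>J. \<forall>x\<in>E X j. f j x = zr Y j" by blast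
next
 assume a: "\<forall>j\<in>J. \<forall>x\<in>E X j. f j x = zr Y j"
 obtain Z where Z: "Z \<in> Ob C" "\<And>j. j \<in> J ==> E Z j = {zr Z j}" using zero_ob X by blast
 obtain u where u: "u \<in> Hom C X Z" using zero_hom[OF X Z(1)] by blast
 obtain v where v: "v \<in> Hom C Z Y" using zero_hom[OF Z(1) Y] by blast
 have "f = Cmp C X Z Y v u"
 proof (rule hom_ext[OF X Y f cmp_hom[OF X Z(1) Y u v]])
  fix j x assume j: "j \<in> J" "x \<in> E X j"
  have "u j x = zr Z j" using Z(2)[OF j(1)] hom_closed[OF X Z(1) u j] by simp
  then show "f j x = Cmp C X Z Y v u j x" using cmp_app[OF X Z(1) Y u v j] hom_zr[OF Z(1) Y v j(1)] a j by simp
 qed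
 then show "zero_morphism C X Y f" unfolding zero_morphism_def using zero_object_iff[OF Z(1)] Z(2) u v by blast
qed

text \<open>Needed to pass from exactness on elements to the universal property by which the
  localising system is defined.\<close>

lemma is_kernel_canonical:
 assumes X: "X \<in> Ob C" and Y: "Y \<in> Ob C" and f: "f \<in> Hom C X Y"
  and A: "A \<in> Ob C" "mono A X i" "\<And>j. j \<in> J ==> im A i j = ker X Y f j"
 shows "is_kernel C X Y f A i"
proof -
 have i: "i \<in> Hom C A X" using A monoD by blast
 have 1: "zero_morphism C A Y (Cmp C A X Y f i)"
  unfolding zero_morphism_iff[OF A(1) Y cmp_hom[OF A(1) X Y i f]]
 proof (intro ballI)
  fix j x assume j: "j \<in> J" "x \<in> E A j"
  then have "i j x \<in> ker X Y f j" using A(3) unfolding im_def by blast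
  then show "Cmp C A X Y f i j x = zr Y j" using cmp_app[OF A(1) X Y i f j] unfolding ker_def by simp
 qed
 have 2: "\<exists>!u. u \<in> Hom C W A \<and> Cmp C W A X i u = w"
  if W: "W \<in> Ob C" and w: "w \<in> Hom C W X" and z: "zero_morphism C W Y (Cmp C W X Y f w)" for W w
 proof -
  have "w j x \<in> im A i j" if "j \<in> J" "x \<in> E W j" for j x
   using z[unfolded zero_morphism_iff[OF W Y cmp_hom[OF W X Y w f]]] cmp_app[OF W X Y w f that] that A(3)[OF that(1)]
    hom_closed[OF W X w that] unfolding ker_def by simp
  then have "\<exists>u\<in>Hom C W A. \<forall>j\<in>J. \<forall>x\<in>E W j. i j (u j x) = w j x" by (rule mono_lift[OF A(1) X W A(2) w])
  then obtain u where u: "u \<in> Hom C W A" "\<And>j x. j \<in> J ==> x \<in> E W j ==> i j (u j x) = w j x" by (elim bexE) simp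
  have "Cmp C W A X i u = w"
   by (rule hom_ext[OF W X cmp_hom[OF W A(1) X u(1) i] w]) (use cmp_app[OF W A(1) X u(1) i] u(2) in simp)
  moreover have "v = u" if v: "v \<in> Hom C W A" "Cmp C W A X i v = w" for v
  proof (rule hom_ext[OF W A(1) v(1) u(1)])
   fix j x assume j: "j \<in> J" "x \<in> E W j"
   show "v j x = u j x"
    by (rule monoD(2)[OF A(2) j(1) hom_closed[OF W A(1) v(1) j] hom_closed[OF W A(1) u(1) j]])
     (use cmp_app[OF W A(1) X v(1) i j] v(2) u(2)[OF j] in simp)
  qed
  ultimately show ?thesis using u(1) by blast
 qed
 show ?thesis unfolding is_kernel_def using A(1) i 1 2 by blast
qed

lemma is_cokernel_canonical:
 assumes X: "X \<in> Ob C" and Y: "Y \<in> Ob C" and f: "f \<in> Hom C X Y"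
  and Q: "Q \<in> Ob C" "epi Y Q q" "\<And>j. j \<in> J ==> im X f j = ker Y Q q j"
 shows "is_cokernel C X Y f Q q"
proof -
 have q: "q \<in> Hom C Y Q" using Q epiD by blast
 have 1: "zero_morphism C X Q (Cmp C X Y Q q f)"
  unfolding zero_morphism_iff[OF X Q(1) cmp_hom[OF X Y Q(1) f q]]
 proof (intro ballI)
  fix j x assume j: "j \<in> J" "x \<in> E X j"
  then have "f j x \<in> ker Y Q q j" using Q(3) unfolding im_def by blast
  then show "Cmp C X Y Q q f j x = zr Q j" using cmp_app[OF X Y Q(1) f q j] unfolding ker_def by simp
 qed
 have 2: "\<exists>!u. u \<in> Hom C Q W \<and> Cmp C Y Q W u q = w"
  if W: "W \<in> Ob C" and w: "w \<in> Hom C Y W" and z: "zero_morphism C X W (Cmp C X Y W w f)" for W w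
 proof -
  have "w j y = zr W j" if "j \<in> J" "y \<in> E Y j" "q j y = zr Q j" for j y
  proof -
   have "y \<in> im X f j" using Q(3)[OF that(1)] that(2,3) unfolding ker_def by simp
   then obtain x where "x \<in> E X j" "y = f j x" unfolding im_def by blast
   then show ?thesis using z[unfolded zero_morphism_iff[OF X W cmp_hom[OF X Y W f w]]] cmp_app[OF X Y W f w that(1)] that(1) by auto
  qed
  then have "\<exists>u\<in>Hom C Q W. \<forall>j\<in>J. \<forall>y\<in>E Y j. u j (q j y) = w j y" by (rule epi_desc[OF Y Q(1) W Q(2) w])
  then obtain u where u: "u \<in> Hom C Q W" "\<And>j x. j \<in> J ==> x \<in> E Y j ==> u j (q j x) = w j x" by (elim bexE) simp
  have "Cmp C Y Q W u q = w"
   by (rule hom_ext[OF Y W cmp_hom[OF Y Q(1) W q u(1)] w]) (use cmp_app[OF Y Q(1) W q u(1)] u(2) in simp)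
  moreover have "v = u" if v: "v \<in> Hom C Q W" "Cmp C Y Q W v q = w" for v
  proof (rule hom_ext[OF Q(1) W v(1) u(1)])
   fix j x assume j: "j \<in> J" "x \<in> E Q j"
   obtain y where y: "y \<in> E Y j" "x = q j y" using epiD(2)[OF Q(2) j] by blast
   show "v j x = u j x" using cmp_app[OF Y Q(1) W q v(1) j(1) y(1)] v(2) u(2)[OF j(1) y(1)] y by simp
  qed
  ultimately show ?thesis using u(1) by blast
 qed
 show ?thesis unfolding is_cokernel_def using Q(1) q 1 2 by blast
qed

lemma diff_map:
 assumes P: "P \<in> Ob C" and U: "U \<in> Ob C" and V: "V \<in> Ob C" and Y: "Y \<in> Ob C"
  and p: "p \<in> Hom C P U" and f: "f \<in> Hom C U Y" and q: "q \<in> Hom C P V" and g: "g \<in> Hom C V Y"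
 obtains D where "D \<in> Hom C P Y" "\<And>j w. j \<in> J ==> w \<in> E P j ==> D j w = df Y j (f j (p j w)) (g j (q j w))"
proof -
 obtain D where "D \<in> Hom C P Y" "\<forall>j\<in>J. \<forall>w\<in>E P j. D j w = df Y j (Cmp C P U Y f p j w) (Cmp C P V Y g q j w)"
  using diff_hom[OF P Y cmp_hom[OF P U Y p f] cmp_hom[OF P V Y q g]] by blast
 then show thesis using that[of D] cmp_app[OF P U Y p f] cmp_app[OF P V Y q g] by simp
qed

end

section \<open>The localising system and equality of roofs\<close>

context serre_class begin

definition sys :: "'o => 'o => ('j => 'e => 'e) => bool" where
 "sys X Y s \<longleftrightarrow> s \<in> Hom C X Y \<and> small X (ker X Y s) \<and> cosmall Y (im X s)"

lemma sysD: "sys X Y s ==> s \<in> Hom C X Y" "sys X Y s ==> small X (ker X Y s)" "sys X Y s ==> cosmall Y (im X s)"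
 unfolding sys_def by auto

text \<open>The definition allows any object with the universal property of a kernel. The kernel on
  elements factors through the given one in \<open>S\<close> and is therefore small, and dually for
  cokernels. Conversely the kernel and cokernel on elements belong to \<open>S\<close>.\<close>

lemma serre_system_iff:
 assumes X: "X \<in> Ob C" and Y: "Y \<in> Ob C"
 shows "s \<in> serre_system C S X Y \<longleftrightarrow> sys X Y s"
proof
 assume "s \<in> serre_system C S X Y"
 then obtain A k B q where s: "s \<in> Hom C X Y" and A: "A \<in> S" "is_kernel C X Y s A k" and B: "B \<in> S" "is_cokernel C X Y s B q"
  unfolding serre_system_def by blast
 have k: "k \<in> Hom C A X" using A(2) is_kernel_def by metis
 have q: "q \<in> Hom C Y B" using B(2) is_cokernel_def by metis
 obtain K i where K: "K \<in> Ob C" "mono K X i" "\<And>j. j \<in> J ==> im K i j = ker X Y s j" using ses_of_ker[OF X Y s] by blast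
 have i: "i \<in> Hom C K X" using K monoD by blast
 have "zero_morphism C K Y (Cmp C K X Y s i)" using is_kernel_canonical[OF X Y s K] is_kernel_def by metis
 then obtain u where u: "u \<in> Hom C K A" "Cmp C K A X k u = i"
  using A(2) K(1) i unfolding is_kernel_def by metis
 have "ker X Y s j \<subseteq> im A k j" if j: "j \<in> J" for j
 proof
  fix x assume "x \<in> ker X Y s j"
  then obtain y where y: "y \<in> E K j" "x = i j y" using K(3)[OF j] unfolding im_def by blast
  then have "x = k j (u j y)" using u cmp_app[OF K(1) S_Ob[OF A(1)] X u(1) k j y(1)] by simp
  then show "x \<in> im A k j" using hom_closed[OF K(1) S_Ob[OF A(1)] u(1) j y(1)] unfolding im_def by blast
 qed
 then have 1: "small X (ker X Y s)" unfolding small_def using A k by blast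
 obtain R r where R: "R \<in> Ob C" "epi Y R r" "\<And>j. j \<in> J ==> im X s j = ker Y R r j" using ses_of_coker[OF X Y s] by blast
 have r: "r \<in> Hom C Y R" using R epiD by blast
 have "zero_morphism C X R (Cmp C X Y R r s)" using is_cokernel_canonical[OF X Y s R] is_cokernel_def by metis
 then obtain u where u: "u \<in> Hom C B R" "Cmp C Y B R u q = r"
  using B(2) R(1) r unfolding is_cokernel_def by metis
 have "ker Y B q j \<subseteq> im X s j" if j: "j \<in> J" for j
 proof
  fix y assume "y \<in> ker Y B q j"
  then have y: "y \<in> E Y j" "q j y = zr B j" unfolding ker_def by auto
  then have "r j y = zr R j" using u cmp_app[OF Y S_Ob[OF B(1)] R(1) q u(1) j y(1)] hom_zr[OF S_Ob[OF B(1)] R(1) u(1) j] by simp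
  then show "y \<in> im X s j" using R(3)[OF j] y unfolding ker_def by simp
 qed
 then have 2: "cosmall Y (im X s)" unfolding cosmall_def using B q by blast
 show "sys X Y s" unfolding sys_def using s 1 2 by blast
next
 assume a: "sys X Y s"
 note s = sysD(1)[OF a]
 obtain K i where K: "K \<in> Ob C" "mono K X i" "\<And>j. j \<in> J ==> im K i j = ker X Y s j" using ses_of_ker[OF X Y s] by blast
 have KS: "K \<in> S" by (rule small_sub_ob[OF X sysD(2)[OF a] K(1,2)]) (use K(3) in simp)
 obtain R r where R: "R \<in> Ob C" "epi Y R r" "\<And>j. j \<in> J ==> im X s j = ker Y R r j" using ses_of_coker[OF X Y s] by blast
 have r: "r \<in> Hom C Y R" using R epiD by blast
 \<comment> \<open>\<open>r\<close> vanishes on the cosmall image of \<open>s\<close>, so its whole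
   image, which is R, is small.\<close>
 have "small R (im Y r)"
 proof (rule small_extend[OF Y R(1) r sysD(3)[OF a]], rule small_zero[OF R(1)])
  fix j assume j: "j \<in> J"
  show "r j ` im X s j \<subseteq> {zr R j}" unfolding R(3)[OF j] ker_def by auto
 qed
 then have "small R (E R)"
 proof (rule small_mono)
  fix j x assume "j \<in> J" "x \<in> E R j"
  then show "x \<in> im Y r j" using R(2) unfolding epi_def im_def by blast
 qed
 then have RS: "R \<in> S" using small_ob R by blast
 show "s \<in> serre_system C S X Y" unfolding serre_system_def
  using s KS RS is_kernel_canonical[OF X Y s K] is_cokernel_canonical[OF X Y s R] by blast
qed

lemma sys_comp:
 assumes X: "X \<in> Ob C" and Y: "Y \<in> Ob C" and Z: "Z \<in> Ob C" and f: "sys X Y f" and g: "sys Y Z g"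
 shows "sys X Z (Cmp C X Y Z g f)"
proof -
 note f' = sysD(1)[OF f] and g' = sysD(1)[OF g]
 note c = cmp_app[OF X Y Z f' g']
 have "small X (ker X Z (Cmp C X Y Z g f))"
 proof (rule small_mono[OF small_preimage[OF X Y f' sysD(2)[OF f] sysD(2)[OF g]]])
  fix j x assume j: "j \<in> J" and x: "x \<in> ker X Z (Cmp C X Y Z g f) j"
  then show "x \<in> {x \<in> E X j. f j x \<in> ker Y Z g j}" using c[OF j] hom_closed[OF X Y f' j] unfolding ker_def by auto
 qed
 moreover have "cosmall Z (im X (Cmp C X Y Z g f))"
 proof (rule cosmall_mono[OF cosmall_image[OF Y Z g' sysD(3)[OF g] sysD(3)[OF f]]])
  fix j z assume j: "j \<in> J" and z: "z \<in> g j ` im X f j"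
  then obtain x where "x \<in> E X j" "z = g j (f j x)" unfolding im_def by blast
  then show "z \<in> im X (Cmp C X Y Z g f) j" using c[OF j] unfolding im_def by (metis imageI)
 qed
 ultimately show ?thesis unfolding sys_def using cmp_hom[OF X Y Z f' g'] by blast
qed

lemma sys_id: assumes X: "X \<in> Ob C" shows "sys X X (Id C X)"
 unfolding sys_def
proof (intro conjI)
 show "Id C X \<in> Hom C X X" using id_hom X .
 show "small X (ker X X (Id C X))" by (rule small_zero[OF X]) (use id_app[OF X] in \<open>auto simp: ker_def\<close>)
 show "cosmall X (im X (Id C X))" by (rule cosmall_all[OF X]) (use id_app[OF X] in \<open>force simp: im_def image_iff\<close>)
qed

lemma sys_mono: assumes X: "X \<in> Ob C" and Y: "Y \<in> Ob C" and f: "mono X Y f" and c: "cosmall Y (im X f)"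
 shows "sys X Y f"
proof -
 have "ker X Y f j \<subseteq> {zr X j}" if "j \<in> J" for j
  using monoD(2)[OF f that _ zr_E[OF X that]] hom_zr[OF X Y monoD(1)[OF f] that] unfolding ker_def by auto
 then show ?thesis unfolding sys_def using small_zero[OF X] monoD(1)[OF f] c by blast
qed

text \<open>Two roofs are equal in the quotient iff these values over their fibre product are small.\<close>

definition devs :: "'o => 'o \<times> ('j => 'e => 'e) \<times> ('j => 'e => 'e) => 'o \<times> ('j => 'e => 'e) \<times> ('j => 'e => 'e) => 'j => 'e set" where
 "devs Y = (\<lambda>(U, s, f) (V, t, g) j. {df Y j (f j u) (g j v) | u v. u \<in> E U j \<and> v \<in> E V j \<and> s j u = t j v})"

lemma devs_mem: "d \<in> devs Y (U, s, f) (V, t, g) j \<longleftrightarrow>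
 (\<exists>u v. u \<in> E U j \<and> v \<in> E V j \<and> s j u = t j v \<and> d = df Y j (f j u) (g j v))"
 unfolding devs_def by auto

definition roof :: "'o => 'o => 'o \<times> ('j => 'e => 'e) \<times> ('j => 'e => 'e) => bool" where
 "roof X Y = (\<lambda>(U, s, f). U \<in> Ob C \<and> sys U X s \<and> f \<in> Hom C U Y)"

lemma roofs_iff: "X \<in> Ob C ==> r \<in> roofs C S X Y \<longleftrightarrow> roof X Y r"
 unfolding roofs_def roof_def using serre_system_iff by (cases r) auto

text \<open>Ore condition: the base change \<open>p\<close> of \<open>t\<close> is again in the
  system. Its kernel is a copy of the kernel of \<open>t\<close>, and its image is the preimage
  under \<open>s\<close> of the image of \<open>t\<close>.\<close>

lemma sys_pullback:
 assumes U: "U \<in> Ob C" and V: "V \<in> Ob C" and X: "X \<in> Ob C" and s: "s \<in> Hom C U X" and t: "sys V X t"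
 shows "\<exists>P p q. P \<in> Ob C \<and> sys P U p \<and> q \<in> Hom C P V \<and>
  (\<forall>j w. j \<in> J --> w \<in> E P j --> s j (p j w) = t j (q j w)) \<and>
  (\<forall>j u v. j \<in> J --> u \<in> E U j --> v \<in> E V j --> s j u = t j v --> (\<exists>w\<in>E P j. p j w = u \<and> q j w = v)) \<and>
  (\<forall>W a b. W \<in> Ob C --> a \<in> Hom C W U --> b \<in> Hom C W V -->
   (\<forall>j w. j \<in> J --> w \<in> E W j --> s j (a j w) = t j (b j w)) -->
   (\<exists>h\<in>Hom C W P. \<forall>j\<in>J. \<forall>w\<in>E W j. p j (h j w) = a j w \<and> q j (h j w) = b j w))"
proof -
 note t' = sysD(1)[OF t]
 show ?thesis
 proof (rule pullback[OF U V X s t'])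
 fix P p q assume P: "P \<in> Ob C" "p \<in> Hom C P U" "q \<in> Hom C P V"
  and P1: "\<And>j w. j \<in> J ==> w \<in> E P j ==> s j (p j w) = t j (q j w)"
  and P2: "\<And>j u v. j \<in> J ==> u \<in> E U j ==> v \<in> E V j ==> s j u = t j v ==> \<exists>w\<in>E P j. p j w = u \<and> q j w = v"
  and P3: "\<And>W a b. W \<in> Ob C ==> a \<in> Hom C W U ==> b \<in> Hom C W V ==>
   (\<And>j w. j \<in> J ==> w \<in> E W j ==> s j (a j w) = t j (b j w)) ==>
   \<exists>h\<in>Hom C W P. \<forall>j\<in>J. \<forall>w\<in>E W j. p j (h j w) = a j w \<and> q j (h j w) = b j w"
  and P4: "\<And>j w. j \<in> J ==> w \<in> E P j ==> p j w = zr U j ==> q j w = zr V j ==> w = zr P j"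
 obtain A k where A: "A \<in> Ob C" "mono A V k" "\<And>j. j \<in> J ==> im A k j = ker V X t j" using ses_of_ker[OF V X t'] by blast
 have AS: "A \<in> S" by (rule small_sub_ob[OF V sysD(2)[OF t] A(1,2)]) (use A(3) in simp)
 obtain z where z: "z \<in> Hom C A U" "\<And>j x. j \<in> J ==> x \<in> E A j ==> z j x = zr U j" using zero_hom[OF A(1) U] by blast
 have "s j (z j w) = t j (k j w)" if "j \<in> J" "w \<in> E A j" for j w
 proof -
  have "k j w \<in> ker V X t j" using A(3)[OF that(1)] that unfolding im_def by blast
  then show ?thesis using z(2)[OF that] hom_zr[OF U X s that(1)] unfolding ker_def by simp
 qed
 \<comment> \<open>\<open>c\<close> embeds the kernel of \<open>t\<close> into the fibre product as
   the pairs with first component zero.\<close>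
 then obtain c where c: "c \<in> Hom C A P" "\<And>j w. j \<in> J ==> w \<in> E A j ==> p j (c j w) = z j w \<and> q j (c j w) = k j w"
  using P3[OF A(1) z(1) monoD(1)[OF A(2)]] by blast
 have "ker P U p j \<subseteq> im A c j" if j: "j \<in> J" for j
 proof
  fix w assume "w \<in> ker P U p j"
  then have w: "w \<in> E P j" "p j w = zr U j" unfolding ker_def by auto
  then have "q j w \<in> ker V X t j" using P1[OF j w(1)] hom_zr[OF U X s j] hom_closed[OF P(1) V P(3) j w(1)] unfolding ker_def by simp
  then obtain x where x: "x \<in> E A j" "q j w = k j x" using A(3)[OF j] unfolding im_def by blast
  have cx: "c j x \<in> E P j" using hom_closed[OF A(1) P(1) c(1) j x(1)] .
  have "df P j w (c j x) = zr P j"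
  proof (rule P4[OF j df_E[OF P(1) j w(1) cx]])
   show "p j (df P j w (c j x)) = zr U j"
    using hom_df[OF P(1) U P(2) j w(1) cx] w(2) c(2)[OF j x(1)] z(2)[OF j x(1)] df_zr[OF U j zr_E[OF U j]] by simp
   show "q j (df P j w (c j x)) = zr V j"
    using hom_df[OF P(1) V P(3) j w(1) cx] x(2) c(2)[OF j x(1)] df_eq_zr[OF V j]
     hom_closed[OF A(1) V monoD(1)[OF A(2)] j x(1)] by simp
  qed
  then show "w \<in> im A c j" using df_eq_zr[OF P(1) j w(1) cx] x unfolding im_def by blast
 qed
 then have "small P (ker P U p)" unfolding small_def using AS c by blast
 moreover have "cosmall U (im P p)"
 proof (rule cosmall_mono[OF cosmall_preimage[OF U X s sysD(3)[OF t]]])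
  fix j u assume j: "j \<in> J" and u: "u \<in> E U j" "u \<in> {u. s j u \<in> im V t j}"
  then obtain v where "v \<in> E V j" "s j u = t j v" unfolding im_def by blast
  then show "u \<in> im P p j" using P2[OF j u(1)] unfolding im_def by blast
 qed
 ultimately have "sys P U p" unfolding sys_def using P(2) by blast
 then show ?thesis using P(1,3) P1 P2 P3
  by (intro exI[of _ P] exI[of _ p] exI[of _ q] conjI allI impI) (assumption | simp)+
 qed
qed

lemma small_neg: assumes Y: "Y \<in> Ob C" and N: "small Y N" shows "small Y (\<lambda>j. df Y j (zr Y j) ` N j)"
proof -
 obtain A i where A: "A \<in> S" "i \<in> Hom C A Y" "\<And>j. j \<in> J ==> N j \<subseteq> im A i j" using N unfolding small_def by blast
 note A' = S_Ob[OF A(1)]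
 obtain z where z: "z \<in> Hom C A Y" "\<And>j x. j \<in> J ==> x \<in> E A j ==> z j x = zr Y j" using zero_hom[OF A' Y] by blast
 obtain h where h: "h \<in> Hom C A Y" "\<And>j x. j \<in> J ==> x \<in> E A j ==> h j x = df Y j (z j x) (i j x)"
  using diff_hom[OF A' Y z(1) A(2)] by blast
 have "df Y j (zr Y j) ` N j \<subseteq> im A h j" if j: "j \<in> J" for j
 proof
  fix y assume "y \<in> df Y j (zr Y j) ` N j"
  then obtain n where n: "n \<in> N j" "y = df Y j (zr Y j) n" by blast
  then obtain x where "x \<in> E A j" "n = i j x" using A(3)[OF j] unfolding im_def by blast
  then show "y \<in> im A h j" using h(2)[OF j] z(2)[OF j] n unfolding im_def by auto
 qed
 then show ?thesis unfolding small_def using A(1) h(1) by blast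
qed

text \<open>All differences together form the image of one morphism \<open>D\<close> on the fibre
  product, so the calculus of small images applies to them.\<close>

lemma devs_image:
 assumes X: "X \<in> Ob C" and Y: "Y \<in> Ob C" and 1: "roof X Y (U, s, f)" and 2: "roof X Y (V, t, g)"
 shows "\<exists>P p q D. P \<in> Ob C \<and>
  sys P U p \<and>
  q \<in> Hom C P V \<and>
  D \<in> Hom C P Y \<and>
  sys P X (Cmp C P U X s p) \<and>
  (\<forall>j w. j \<in> J --> w \<in> E P j --> s j (p j w) = t j (q j w)) \<and>
  (\<forall>j w. j \<in> J --> w \<in> E P j --> D j w = df Y j (f j (p j w)) (g j (q j w))) \<and>
  (\<forall>j u v. j \<in> J --> u \<in> E U j --> v \<in> E V j --> s j u = t j v --> (\<exists>w\<in>E P j. p j w = u \<and> q j w = v)) \<and>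
  (\<forall>j. j \<in> J --> devs Y (U, s, f) (V, t, g) j = im P D j) \<and>
  (\<forall>W a b. W \<in> Ob C --> a \<in> Hom C W U --> b \<in> Hom C W V --> (\<forall>j w. j \<in> J --> w \<in> E W j --> s j (a j w) = t j (b j w)) --> (\<exists>h\<in>Hom C W P. \<forall>j\<in>J. \<forall>w\<in>E W j. p j (h j w) = a j w \<and> q j (h j w) = b j w))"
proof -
 have U: "U \<in> Ob C" "sys U X s" "f \<in> Hom C U Y" and V: "V \<in> Ob C" "sys V X t" "g \<in> Hom C V Y"
  using 1 2 unfolding roof_def by auto
 obtain P p q where P: "P \<in> Ob C" "sys P U p" "q \<in> Hom C P V"
  and P1o: "\<forall>j w. j \<in> J --> w \<in> E P j --> s j (p j w) = t j (q j w)"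
  and P2o: "\<forall>j u v. j \<in> J --> u \<in> E U j --> v \<in> E V j --> s j u = t j v --> (\<exists>w\<in>E P j. p j w = u \<and> q j w = v)"
  and P3o: "\<forall>W a b. W \<in> Ob C --> a \<in> Hom C W U --> b \<in> Hom C W V --> (\<forall>j w. j \<in> J --> w \<in> E W j --> s j (a j w) = t j (b j w)) --> (\<exists>h\<in>Hom C W P. \<forall>j\<in>J. \<forall>w\<in>E W j. p j (h j w) = a j w \<and> q j (h j w) = b j w)"
  using sys_pullback[OF U(1) V(1) X sysD(1)[OF U(2)] V(2)] by (elim exE conjE) (rule that)
 note P1 = P1o[rule_format]
 note P2 = P2o[rule_format]
 note P3 = P3o[rule_format]
 obtain D where D: "D \<in> Hom C P Y" "\<And>j w. j \<in> J ==> w \<in> E P j ==> D j w = df Y j (f j (p j w)) (g j (q j w))"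
  using diff_map[OF P(1) U(1) V(1) Y sysD(1)[OF P(2)] U(3) P(3) V(3)] by metis
 have "devs Y (U, s, f) (V, t, g) j = im P D j" if j: "j \<in> J" for j
 proof (rule Set.set_eqI)
  fix d
  show "d \<in> devs Y (U, s, f) (V, t, g) j \<longleftrightarrow> d \<in> im P D j"
  proof
   assume "d \<in> devs Y (U, s, f) (V, t, g) j"
   then obtain u v where uv: "u \<in> E U j" "v \<in> E V j" "s j u = t j v" "d = df Y j (f j u) (g j v)" unfolding devs_mem by blast
   then obtain w where "w \<in> E P j" "p j w = u" "q j w = v" using P2[OF j] by blast
   then show "d \<in> im P D j" using D(2)[OF j] uv unfolding im_def by (metis imageI)
  next
   assume "d \<in> im P D j"
   then obtain w where w: "w \<in> E P j" "d = D j w" unfolding im_def by blast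
   show "d \<in> devs Y (U, s, f) (V, t, g) j" unfolding devs_mem
    using P1[OF j w(1)] D(2)[OF j w(1)] w hom_closed[OF P(1) U(1) sysD(1)[OF P(2)] j w(1)] hom_closed[OF P(1) V(1) P(3) j w(1)]
    by blast
  qed
 qed
 then show ?thesis using P D(1) sys_comp[OF P(1) U(1) X P(2) U(2)] P1 D(2) P2 P3
  by (intro exI[of _ P] exI[of _ p] exI[of _ q] exI[of _ D] conjI allI impI) (assumption | simp)+
qed

text \<open>This trades the search for a third roof for one smallness condition. Given a third roof
  W, \<open>D\<close> vanishes on the elements of P coming from W; on a cosmall part, every element
  of P differs from one of these by the kernel of the map to X, which is small. Given smallness, the
  kernel of \<open>D\<close> is cosmall in P and serves as the third roof.\<close>

lemma roof_rel_iff: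
 assumes X: "X \<in> Ob C" and Y: "Y \<in> Ob C" and 1: "roof X Y (U, s, f)" and 2: "roof X Y (V, t, g)"
 shows "((U, s, f), (V, t, g)) \<in> roof_rel C S X Y \<longleftrightarrow> small Y (devs Y (U, s, f) (V, t, g))"
proof -
 have U: "U \<in> Ob C" "sys U X s" "f \<in> Hom C U Y" and V: "V \<in> Ob C" "sys V X t" "g \<in> Hom C V Y"
  using 1 2 unfolding roof_def by auto
 note s = sysD(1)[OF U(2)] and t = sysD(1)[OF V(2)]
 obtain P p q D where P: "P \<in> Ob C" "sys P U p" "q \<in> Hom C P V" and D: "D \<in> Hom C P Y" and sp: "sys P X (Cmp C P U X s p)"
  and P1o: "\<forall>j w. j \<in> J --> w \<in> E P j --> s j (p j w) = t j (q j w)"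
  and D1o: "\<forall>j w. j \<in> J --> w \<in> E P j --> D j w = df Y j (f j (p j w)) (g j (q j w))"
  and P2o: "\<forall>j u v. j \<in> J --> u \<in> E U j --> v \<in> E V j --> s j u = t j v --> (\<exists>w\<in>E P j. p j w = u \<and> q j w = v)"
  and DDo: "\<forall>j. j \<in> J --> devs Y (U, s, f) (V, t, g) j = im P D j"
  and P3o: "\<forall>W a b. W \<in> Ob C --> a \<in> Hom C W U --> b \<in> Hom C W V --> (\<forall>j w. j \<in> J --> w \<in> E W j --> s j (a j w) = t j (b j w)) --> (\<exists>h\<in>Hom C W P. \<forall>j\<in>J. \<forall>w\<in>E W j. p j (h j w) = a j w \<and> q j (h j w) = b j w)"
  using devs_image[OF X Y 1 2] by (elim exE conjE) (rule that)
 note P1 = P1o[rule_format]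
 note D1 = D1o[rule_format]
 note P2 = P2o[rule_format]
 note DD = DDo[rule_format]
 note P3 = P3o[rule_format]
 note p = sysD(1)[OF P(2)]
 note spa = cmp_app[OF P(1) U(1) X p s]
 show ?thesis
 proof
  assume "((U, s, f), (V, t, g)) \<in> roof_rel C S X Y"
  then obtain W a b where W: "W \<in> Ob C" and a: "a \<in> Hom C W U" and b: "b \<in> Hom C W V"
   and e1: "Cmp C W U X s a = Cmp C W V X t b" and e2: "Cmp C W U X s a \<in> serre_system C S W X"
   and e3: "Cmp C W U Y f a = Cmp C W V Y g b" unfolding roof_rel_def by blast
  have sa: "sys W X (Cmp C W U X s a)" using e2 serre_system_iff[OF W X] by blast
  have "s j (a j w) = t j (b j w)" if "j \<in> J" "w \<in> E W j" for j w
   using e1 cmp_app[OF W U(1) X a s that] cmp_app[OF W V(1) X b t that] by simp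
  from P3[OF W a b this] obtain c where c: "c \<in> Hom C W P" "\<And>j w. j \<in> J ==> w \<in> E W j ==> p j (c j w) = a j w \<and> q j (c j w) = b j w"
   by blast
  have cos: "cosmall P (\<lambda>j. {w. Cmp C P U X s p j w \<in> im W (Cmp C W U X s a) j})"
   by (rule cosmall_preimage[OF P(1) X sysD(1)[OF sp] sysD(3)[OF sa]])
  \<comment> \<open>Elements of P that have the same image in X as some element of W.\<close>
  define M where "M = (\<lambda>j. {w \<in> E P j. \<exists>x\<in>E W j. s j (p j w) = s j (a j x)})"
  have cM: "cosmall P M"
  proof (rule cosmall_mono[OF cos])
   fix j w assume j: "j \<in> J" and w: "w \<in> E P j" "w \<in> {w. Cmp C P U X s p j w \<in> im W (Cmp C W U X s a) j}"
   then obtain x where x: "x \<in> E W j" "Cmp C P U X s p j w = Cmp C W U X s a j x" unfolding im_def by blast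
   then show "w \<in> M j" unfolding M_def using spa[OF j w(1)] cmp_app[OF W U(1) X a s j x(1)] w(1) by auto
  qed
  have "small Y (\<lambda>j. D j ` M j)"
  proof (rule small_mono[OF small_image[OF P(1) Y D sysD(2)[OF sp]]])
   fix j d assume j: "j \<in> J" and "d \<in> D j ` M j"
   then obtain w x where w: "d = D j w" "w \<in> E P j" and x: "x \<in> E W j" "s j (p j w) = s j (a j x)" unfolding M_def by blast
   \<comment> \<open>Subtracting \<open>c j x\<close>, on which \<open>D\<close> is zero, moves
     \<open>w\<close> into the kernel of the map to X without changing its value under
     \<open>D\<close>.\<close>
   have cx: "c j x \<in> E P j" using hom_closed[OF W P(1) c(1) j x(1)] .
   have "f j (a j x) = g j (b j x)" using e3 cmp_app[OF W U(1) Y a U(3) j x(1)] cmp_app[OF W V(1) Y b V(3) j x(1)] by simp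
   then have "D j (c j x) = zr Y j" using D1[OF j cx] c(2)[OF j x(1)] df_eq_zr[OF Y j]
     hom_closed[OF V(1) Y V(3) j hom_closed[OF W V(1) b j x(1)]] by simp
   then have "D j (df P j w (c j x)) = D j w"
    using hom_df[OF P(1) Y D j w(2) cx] df_zr[OF Y j hom_closed[OF P(1) Y D j w(2)]] by simp
   moreover have "df P j w (c j x) \<in> ker P X (Cmp C P U X s p) j"
    unfolding ker_def using df_E[OF P(1) j w(2) cx] hom_df[OF P(1) X sysD(1)[OF sp] j w(2) cx]
     spa[OF j w(2)] spa[OF j cx] x(2) c(2)[OF j x(1)] df_eq_zr[OF X j]
     hom_closed[OF U(1) X s j hom_closed[OF W U(1) a j x(1)]] by simp
   ultimately show "d \<in> D j ` ker P X (Cmp C P U X s p) j" using w by (metis imageI)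
  qed
  then have "small Y (im P D)" by (rule small_extend[OF P(1) Y D cM])
  then show "small Y (devs Y (U, s, f) (V, t, g))" by (rule small_mono) (use DD in simp)
 next
  assume "small Y (devs Y (U, s, f) (V, t, g))"
  then have "small Y (im P D)" by (rule small_mono) (use DD in simp)
  then have cK: "cosmall P (ker P Y D)" by (rule cosmall_ker[OF P(1) Y D])
  obtain K k where K: "K \<in> Ob C" "mono K P k" "\<And>j. j \<in> J ==> im K k j = ker P Y D j" using ses_of_ker[OF P(1) Y D] by blast
  note k = monoD(1)[OF K(2)]
  have sk: "sys K P k" by (rule sys_mono[OF K(1) P(1) K(2) cosmall_mono[OF cK]]) (use K(3) in simp)
  have ka: "k j x \<in> E P j" "D j (k j x) = zr Y j" if "j \<in> J" "x \<in> E K j" for j x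
   using K(3)[OF that(1)] that unfolding im_def ker_def by auto
  let ?a = "Cmp C K P U p k" and ?b = "Cmp C K P V q k"
  note a = cmp_hom[OF K(1) P(1) U(1) k p] and b = cmp_hom[OF K(1) P(1) V(1) k P(3)]
  note aa = cmp_app[OF K(1) P(1) U(1) k p] and bb = cmp_app[OF K(1) P(1) V(1) k P(3)]
  have 1: "Cmp C K U X s ?a = Cmp C K V X t ?b"
   by (rule hom_ext[OF K(1) X cmp_hom[OF K(1) U(1) X a s] cmp_hom[OF K(1) V(1) X b t]])
    (use cmp_app[OF K(1) U(1) X a s] cmp_app[OF K(1) V(1) X b t] aa bb P1 ka in simp)
  have "f j (p j (k j x)) = g j (q j (k j x))" if "j \<in> J" "x \<in> E K j" for j x
   using D1[OF that(1) ka(1)[OF that]] ka(2)[OF that] df_eq_zr[OF Y that(1)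
    hom_closed[OF U(1) Y U(3) that(1) hom_closed[OF P(1) U(1) p that(1) ka(1)[OF that]]]
    hom_closed[OF V(1) Y V(3) that(1) hom_closed[OF P(1) V(1) P(3) that(1) ka(1)[OF that]]]] by simp
  then have 2: "Cmp C K U Y f ?a = Cmp C K V Y g ?b"
   by (intro hom_ext[OF K(1) Y cmp_hom[OF K(1) U(1) Y a U(3)] cmp_hom[OF K(1) V(1) Y b V(3)]])
    (use cmp_app[OF K(1) U(1) Y a U(3)] cmp_app[OF K(1) V(1) Y b V(3)] aa bb in simp)
  have "sys K X (Cmp C K U X s ?a)"
   by (rule sys_comp[OF K(1) U(1) X sys_comp[OF K(1) P(1) U(1) sk P(2)] U(2)])
  then have 3: "Cmp C K U X s ?a \<in> serre_system C S K X" using serre_system_iff[OF K(1) X] by blast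
  have r: "(U, s, f) \<in> roofs C S X Y" "(V, t, g) \<in> roofs C S X Y" using roofs_iff[OF X] assms(3,4) by blast+
  show "((U, s, f), (V, t, g)) \<in> roof_rel C S X Y"
   unfolding roof_rel_def using r K(1) a b 1 2 3 by blast
 qed
qed

text \<open>Reflexivity holds because the differences of a roof with itself are values of
  \<open>f\<close> on the kernel of \<open>s\<close>. For transitivity, the elements of the fibre
  product of the outer roofs whose image in X also comes from the middle roof form a cosmall part,
  and there the difference is a sum of two small differences.\<close>

lemma equiv_roof_rel:
 assumes X: "X \<in> Ob C" and Y: "Y \<in> Ob C"
 shows "equiv (roofs C S X Y) (roof_rel C S X Y)"
proof (rule equivI)
 show "roof_rel C S X Y \<subseteq> roofs C S X Y \<times> roofs C S X Y" unfolding roof_rel_def by blast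
 show "refl_on (roofs C S X Y) (roof_rel C S X Y)"
 proof (rule refl_onI)
  fix r assume r: "r \<in> roofs C S X Y"
  obtain U s f where [simp]: "r = (U, s, f)" by (cases r)
  have rf: "roof X Y (U, s, f)" using r roofs_iff[OF X] by simp
  then have U: "U \<in> Ob C" "sys U X s" "f \<in> Hom C U Y" unfolding roof_def by auto
  have "small Y (devs Y (U, s, f) (U, s, f))"
  proof (rule small_mono[OF small_image[OF U(1) Y U(3) sysD(2)[OF U(2)]]])
   fix j d assume j: "j \<in> J" and "d \<in> devs Y (U, s, f) (U, s, f) j"
   then obtain u v where uv: "u \<in> E U j" "v \<in> E U j" "s j u = s j v" "d = df Y j (f j u) (f j v)" unfolding devs_mem by blast
   have "df U j u v \<in> ker U X s j" unfolding ker_def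
    using df_E[OF U(1) j uv(1,2)] hom_df[OF U(1) X sysD(1)[OF U(2)] j uv(1,2)] uv(3) df_eq_zr[OF X j]
     hom_closed[OF U(1) X sysD(1)[OF U(2)] j uv(2)] by simp
   moreover have "d = f j (df U j u v)" using hom_df[OF U(1) Y U(3) j uv(1,2)] uv by simp
   ultimately show "d \<in> f j ` ker U X s j" by blast
  qed
  then show "(r, r) \<in> roof_rel C S X Y" using roof_rel_iff[OF X Y rf rf] by simp
 qed
 show "sym (roof_rel C S X Y)" by (rule symI) (unfold roof_rel_def, auto, metis)
 show "trans (roof_rel C S X Y)"
 proof (rule transI)
  fix r1 r2 r3 assume r12: "(r1, r2) \<in> roof_rel C S X Y" and r23: "(r2, r3) \<in> roof_rel C S X Y"
  obtain U s f where [simp]: "r1 = (U, s, f)" by (cases r1)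
  obtain V t g where [simp]: "r2 = (V, t, g)" by (cases r2)
  obtain W r h where [simp]: "r3 = (W, r, h)" by (cases r3)
  have rf: "roof X Y (U, s, f)" "roof X Y (V, t, g)" "roof X Y (W, r, h)"
   using r12 r23 roofs_iff[OF X] unfolding roof_rel_def by auto
  then have U: "U \<in> Ob C" "sys U X s" "f \<in> Hom C U Y" and V: "V \<in> Ob C" "sys V X t" "g \<in> Hom C V Y"
   and W: "W \<in> Ob C" "sys W X r" "h \<in> Hom C W Y" unfolding roof_def by auto
  have s1: "small Y (devs Y (U, s, f) (V, t, g))" using r12 roof_rel_iff[OF X Y rf(1,2)] by simp
  have s2: "small Y (devs Y (V, t, g) (W, r, h))" using r23 roof_rel_iff[OF X Y rf(2,3)] by simp
  obtain P p q D where P: "P \<in> Ob C" "sys P U p" "q \<in> Hom C P W" and D: "D \<in> Hom C P Y" and sp: "sys P X (Cmp C P U X s p)"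
   and P1o: "\<forall>j w. j \<in> J --> w \<in> E P j --> s j (p j w) = r j (q j w)"
   and D1o: "\<forall>j w. j \<in> J --> w \<in> E P j --> D j w = df Y j (f j (p j w)) (h j (q j w))"
   and DDo: "\<forall>j. j \<in> J --> devs Y (U, s, f) (W, r, h) j = im P D j"
   using devs_image[OF X Y rf(1,3)] by (elim exE conjE) (rule that)
 note P1 = P1o[rule_format]
 note D1 = D1o[rule_format]
 note DD = DDo[rule_format]
  note p = sysD(1)[OF P(2)]
  have cM: "cosmall P (\<lambda>j. {w. Cmp C P U X s p j w \<in> im V t j})"
   by (rule cosmall_preimage[OF P(1) X sysD(1)[OF sp] sysD(3)[OF V(2)]])
  then have cM: "cosmall P (\<lambda>j. {w \<in> E P j. Cmp C P U X s p j w \<in> im V t j})" by (rule cosmall_mono) simp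
  have "small Y (\<lambda>j. D j ` {w \<in> E P j. Cmp C P U X s p j w \<in> im V t j})"
  proof (rule small_mono[OF small_add[OF Y s1 s2]])
   fix j d assume j: "j \<in> J" and "d \<in> D j ` {w \<in> E P j. Cmp C P U X s p j w \<in> im V t j}"
   then obtain w v where w: "d = D j w" "w \<in> E P j" and v: "v \<in> E V j" "Cmp C P U X s p j w = t j v" unfolding im_def by blast
   have sv: "s j (p j w) = t j v" using v cmp_app[OF P(1) U(1) X p sysD(1)[OF U(2)] j w(2)] by simp
   have fu: "f j (p j w) \<in> E Y j" "g j v \<in> E Y j" "h j (q j w) \<in> E Y j" "p j w \<in> E U j" "q j w \<in> E W j"
    using hom_closed[OF U(1) Y U(3) j hom_closed[OF P(1) U(1) p j w(2)]] hom_closed[OF V(1) Y V(3) j v(1)]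
     hom_closed[OF W(1) Y W(3) j hom_closed[OF P(1) W(1) P(3) j w(2)]] hom_closed[OF P(1) U(1) p j w(2)]
     hom_closed[OF P(1) W(1) P(3) j w(2)] by auto
   have "df Y j (f j (p j w)) (g j v) \<in> devs Y (U, s, f) (V, t, g) j" unfolding devs_mem using fu v sv by blast
   moreover have "df Y j (g j v) (h j (q j w)) \<in> devs Y (V, t, g) (W, r, h) j" unfolding devs_mem using fu v sv P1[OF j w(2)] by metis
   moreover have "d = df Y j (f j (p j w)) (g j v) \<oplus>[G Y j] df Y j (g j v) (h j (q j w))"
    using df_tele[OF Y j fu(1-3)] w D1[OF j w(2)] by simp
   moreover have "d \<in> E Y j" "df Y j (f j (p j w)) (g j v) \<in> E Y j" "df Y j (g j v) (h j (q j w)) \<in> E Y j"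
    using df_E[OF Y j] fu w D1[OF j w(2)] by auto
   ultimately show "d \<in> {x \<in> E Y j. \<exists>n\<in>devs Y (U, s, f) (V, t, g) j. \<exists>m\<in>devs Y (V, t, g) (W, r, h) j.
     n \<in> E Y j \<and> m \<in> E Y j \<and> x = n \<oplus>[G Y j] m}" by blast
  qed
  then have "small Y (im P D)" by (rule small_extend[OF P(1) Y D cM])
  then have "small Y (devs Y (U, s, f) (W, r, h))" by (rule small_mono) (use DD in simp)
  then show "(r1, r3) \<in> roof_rel C S X Y" using roof_rel_iff[OF X Y rf(1,3)] by simp
 qed
qed

end

context concrete_abelian begin

lemma cmp_id_r: "X \<in> Ob C ==> Y \<in> Ob C ==> f \<in> Hom C X Y ==> Cmp C X X Y f (Id C X) = f"
 by (rule hom_ext[of X Y]) (auto simp: cmp_hom id_hom cmp_app id_app)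

lemma cmp_id_l: "X \<in> Ob C ==> Y \<in> Ob C ==> f \<in> Hom C X Y ==> Cmp C X Y Y (Id C Y) f = f"
 by (rule hom_ext[of X Y]) (auto simp: cmp_hom id_hom cmp_app id_app hom_closed)

end

section \<open>The quotient category: composition, zero objects and monomorphisms\<close>

context serre_class begin

abbreviation Q where "Q \<equiv> serre_quotient C S"
abbreviation cls where "cls X Y r \<equiv> roof_rel C S X Y `` {r}"

lemma Q_Ob: "Ob Q = Ob C" by (simp add: serre_quotient_def)
lemma Q_Hom: "Hom Q X Y = roofs C S X Y // roof_rel C S X Y" by (simp add: serre_quotient_def)
lemma Q_Id: "Id Q X = cls X X (X, Id C X, Id C X)" by (simp add: serre_quotient_def)

lemma roofI: "U \<in> Ob C ==> sys U X s ==> f \<in> Hom C U Y ==> roof X Y (U, s, f)"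
 by (simp add: roof_def)

lemma roofD: "roof X Y (U, s, f) ==> U \<in> Ob C" "roof X Y (U, s, f) ==> sys U X s" "roof X Y (U, s, f) ==> f \<in> Hom C U Y"
 by (simp_all add: roof_def)

lemma roof_id: "X \<in> Ob C ==> f \<in> Hom C X Y ==> roof X Y (X, Id C X, f)"
 by (simp add: roof_def sys_id)

lemma cls_hom: "X \<in> Ob C ==> roof X Y r ==> cls X Y r \<in> Hom Q X Y"
 unfolding Q_Hom by (rule quotientI) (simp add: roofs_iff)

lemma hom_rep: assumes "X \<in> Ob C" "c \<in> Hom Q X Y"
 obtains U s f where "roof X Y (U, s, f)" "c = cls X Y (U, s, f)"
 using assms unfolding Q_Hom by (elim quotientE) (metis roofs_iff surj_pair)

lemma cls_eq: assumes X: "X \<in> Ob C" and Y: "Y \<in> Ob C" and "roof X Y (U, s, f)" "roof X Y (V, t, g)"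
 shows "cls X Y (U, s, f) = cls X Y (V, t, g) \<longleftrightarrow> small Y (devs Y (U, s, f) (V, t, g))"
 using eq_equiv_class_iff[OF equiv_roof_rel[OF X Y]] roofs_iff[OF X] roof_rel_iff[OF X Y assms(3,4)] assms(3,4) by metis

text \<open>The two first roofs agree only up to a subobject A in \<open>S\<close>, so V and V' are
  compared over R, the quotient of Y by A, and not over Y. In their fibre product the pairs with
  equal image in Y form a cosmall part, and there \<open>D\<close> is controlled by the equivalence
  of the second roofs.\<close>

lemma comp_rel:
 assumes X: "X \<in> Ob C" and Y: "Y \<in> Ob C" and Z: "Z \<in> Ob C"
  and r1: "roof X Y (U, s, f)" and r1': "roof X Y (U', s', f')" and d1: "small Y (devs Y (U, s, f) (U', s', f'))"
  and r2: "roof Y Z (V, t, g)" and r2': "roof Y Z (V', t', g')" and d2: "small Z (devs Z (V, t, g) (V', t', g'))"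
  and W: "W \<in> Ob C" "sys W U u" "v \<in> Hom C W V" "Cmp C W U Y f u = Cmp C W V Y t v"
  and W': "W' \<in> Ob C" "sys W' U' u'" "v' \<in> Hom C W' V'" "Cmp C W' U' Y f' u' = Cmp C W' V' Y t' v'"
 shows "small Z (devs Z (W, Cmp C W U X s u, Cmp C W V Z g v) (W', Cmp C W' U' X s' u', Cmp C W' V' Z g' v'))"
proof -
 note U = roofD[OF r1] and U' = roofD[OF r1'] and V = roofD[OF r2] and V' = roofD[OF r2']
 note s = sysD(1)[OF U(2)] and s' = sysD(1)[OF U'(2)] and t = sysD(1)[OF V(2)] and t' = sysD(1)[OF V'(2)]
 note u = sysD(1)[OF W(2)] and u' = sysD(1)[OF W'(2)]
 obtain A i where A: "A \<in> S" "mono A Y i" "\<And>j. j \<in> J ==> devs Y (U, s, f) (U', s', f') j \<subseteq> im A i j"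
  using small_inj[OF Y d1] by metis
 note A' = S_Ob[OF A(1)]
 note i = monoD(1)[OF A(2)]
 obtain R r where R: "R \<in> Ob C" "epi Y R r" "\<forall>j\<in>J. im A i j = ker Y R r j" using ses_of_coker[OF A' Y i] by blast
 note r = epiD(1)[OF R(2)]
 note rt = cmp_hom[OF V(1) Y R(1) t r] and rta = cmp_app[OF V(1) Y R(1) t r]
 note rt' = cmp_hom[OF V'(1) Y R(1) t' r] and rta' = cmp_app[OF V'(1) Y R(1) t' r]
 show ?thesis
 proof (rule pullback[OF V(1) V'(1) R(1) rt rt'])
  fix P p q assume P: "P \<in> Ob C" "p \<in> Hom C P V" "q \<in> Hom C P V'"
   and P1: "\<And>j w. j \<in> J ==> w \<in> E P j ==> Cmp C V Y R r t j (p j w) = Cmp C V' Y R r t' j (q j w)"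
   and P2: "\<And>j u v. j \<in> J ==> u \<in> E V j ==> v \<in> E V' j ==> Cmp C V Y R r t j u = Cmp C V' Y R r t' j v ==>
    \<exists>w\<in>E P j. p j w = u \<and> q j w = v"
  obtain D where D: "D \<in> Hom C P Z" "\<And>j w. j \<in> J ==> w \<in> E P j ==> D j w = df Z j (g j (p j w)) (g' j (q j w))"
   using diff_map[OF P(1) V(1) V'(1) Z P(2) V(3) P(3) V'(3)] by metis
  obtain h where h: "h \<in> Hom C P Y" "\<And>j w. j \<in> J ==> w \<in> E P j ==> h j w = df Y j (t j (p j w)) (t' j (q j w))"
   using diff_map[OF P(1) V(1) V'(1) Y P(2) t P(3) t'] by metis
  have cl: "p j w \<in> E V j" "q j w \<in> E V' j" "t j (p j w) \<in> E Y j" "t' j (q j w) \<in> E Y j"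
   if "j \<in> J" "w \<in> E P j" for j w
   using hom_closed[OF P(1) V(1) P(2) that] hom_closed[OF P(1) V'(1) P(3) that]
    hom_closed[OF V(1) Y t that(1) hom_closed[OF P(1) V(1) P(2) that]]
    hom_closed[OF V'(1) Y t' that(1) hom_closed[OF P(1) V'(1) P(3) that]] by auto
  have "small Y (im P h)"
  proof (rule small_mono[of _ "im A i"])
   show "small Y (im A i)" unfolding small_def using A(1) i by blast
   fix j y assume j: "j \<in> J" and "y \<in> im P h j"
   then obtain w where w: "w \<in> E P j" "y = h j w" unfolding im_def by blast
   have "r j (h j w) = zr R j" using h(2)[OF j w(1)] cl[OF j w(1)] hom_df[OF Y R(1) r j cl(3,4)[OF j w(1)]]
     P1[OF j w(1)] rta[OF j cl(1)[OF j w(1)]] rta'[OF j cl(2)[OF j w(1)]]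
     df_eq_zr[OF R(1) j] hom_closed[OF Y R(1) r j cl(4)[OF j w(1)]] by simp
   then show "y \<in> im A i j" using R(3) j w hom_closed[OF P(1) Y h(1) j w(1)] unfolding ker_def by simp
  qed
  then have cM: "cosmall P (ker P Y h)" by (rule cosmall_ker[OF P(1) Y h(1)])
  have "small Z (\<lambda>j. D j ` ker P Y h j)"
  proof (rule small_mono[OF d2])
   fix j d assume j: "j \<in> J" and "d \<in> D j ` ker P Y h j"
   then obtain w where w: "w \<in> E P j" "d = D j w" "h j w = zr Y j" unfolding ker_def by blast
   then have "t j (p j w) = t' j (q j w)" using h(2)[OF j w(1)] df_eq_zr[OF Y j cl(3,4)[OF j w(1)]] by simp
   then show "d \<in> devs Z (V, t, g) (V', t', g') j" unfolding devs_mem using cl[OF j w(1)] D(2)[OF j w(1)] w by blast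
  qed
  then have "small Z (im P D)" by (rule small_extend[OF P(1) Z D(1) cM])
  then show ?thesis
  proof (rule small_mono)
   fix j d assume j: "j \<in> J"
    and "d \<in> devs Z (W, Cmp C W U X s u, Cmp C W V Z g v) (W', Cmp C W' U' X s' u', Cmp C W' V' Z g' v') j"
   then obtain x x' where x: "x \<in> E W j" "x' \<in> E W' j" "Cmp C W U X s u j x = Cmp C W' U' X s' u' j x'"
    "d = df Z j (Cmp C W V Z g v j x) (Cmp C W' V' Z g' v' j x')" unfolding devs_mem by blast
   have su: "s j (u j x) = s' j (u' j x')" using x(3) cmp_app[OF W(1) U(1) X u s j x(1)] cmp_app[OF W'(1) U'(1) X u' s' j x(2)] by simp
   have d: "d = df Z j (g j (v j x)) (g' j (v' j x'))"
    using x(4) cmp_app[OF W(1) V(1) Z W(3) V(3) j x(1)] cmp_app[OF W'(1) V'(1) Z W'(3) V'(3) j x(2)] by simp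
   note vx = hom_closed[OF W(1) V(1) W(3) j x(1)] and vx' = hom_closed[OF W'(1) V'(1) W'(3) j x(2)]
   note ux = hom_closed[OF W(1) U(1) u j x(1)] and ux' = hom_closed[OF W'(1) U'(1) u' j x(2)]
   have tv: "f j (u j x) = t j (v j x)" using W(4) cmp_app[OF W(1) U(1) Y u U(3) j x(1)] cmp_app[OF W(1) V(1) Y W(3) t j x(1)] by simp
   have tv': "f' j (u' j x') = t' j (v' j x')"
    using W'(4) cmp_app[OF W'(1) U'(1) Y u' U'(3) j x(2)] cmp_app[OF W'(1) V'(1) Y W'(3) t' j x(2)] by simp
   note ty = hom_closed[OF V(1) Y t j vx] and ty' = hom_closed[OF V'(1) Y t' j vx']
   have "df Y j (t j (v j x)) (t' j (v' j x')) \<in> devs Y (U, s, f) (U', s', f') j"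
    unfolding devs_mem using ux ux' su tv tv' by metis
   then have "df Y j (t j (v j x)) (t' j (v' j x')) \<in> ker Y R r j" using A(3)[OF j] R(3) j by blast
   then have "r j (t j (v j x)) = r j (t' j (v' j x'))" unfolding ker_def
    using hom_df[OF Y R(1) r j ty ty'] df_eq_zr[OF R(1) j hom_closed[OF Y R(1) r j ty] hom_closed[OF Y R(1) r j ty']] by simp
   then obtain w where "w \<in> E P j" "p j w = v j x" "q j w = v' j x'"
    using P2[OF j vx vx'] rta[OF j vx] rta'[OF j vx'] by auto
   then show "d \<in> im P D j" using D(2)[OF j] d unfolding im_def by (metis imageI)
  qed
 qed
qed

text \<open>The definition of composition collects all representatives and all completing squares.
  As any two results are equivalent, one square determines the class.\<close>

lemma Q_cmp:
 assumes X: "X \<in> Ob C" and Y: "Y \<in> Ob C" and Z: "Z \<in> Ob C"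
  and r1: "roof X Y (U, s, f)" and r2: "roof Y Z (V, t, g)"
  and W: "W \<in> Ob C" "sys W U u" "v \<in> Hom C W V" "Cmp C W U Y f u = Cmp C W V Y t v"
 shows "Cmp Q X Y Z (cls Y Z (V, t, g)) (cls X Y (U, s, f)) = cls X Z (W, Cmp C W U X s u, Cmp C W V Z g v)"
  and "roof X Z (W, Cmp C W U X s u, Cmp C W V Z g v)"
proof -
 note U = roofD[OF r1] and V = roofD[OF r2]
 let ?R = "roof_rel C S X Z" and ?x = "(W, Cmp C W U X s u, Cmp C W V Z g v)"
 show ro: "roof X Z ?x"
  by (rule roofI[OF W(1) sys_comp[OF W(1) U(1) X W(2) U(2)] cmp_hom[OF W(1) V(1) Z W(3) V(3)]])
 define c where "c = cls X Y (U, s, f)"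
 define d where "d = cls Y Z (V, t, g)"
 define TT where "TT = {(W, Cmp C W U X s u, Cmp C W V Z g v) | U s f V t g W u v.
     (U, s, f) \<in> c \<and> (V, t, g) \<in> d \<and> W \<in> Ob C \<and>
     u \<in> serre_system C S W U \<and> v \<in> Hom C W V \<and> Cmp C W U Y f u = Cmp C W V Y t v}"
 have eq: "Cmp Q X Y Z d c = ?R `` TT" unfolding TT_def serre_quotient_def by simp
 have e1: "equiv (roofs C S X Y) (roof_rel C S X Y)" and e2: "equiv (roofs C S Y Z) (roof_rel C S Y Z)"
  and e3: "equiv (roofs C S X Z) ?R" using equiv_roof_rel X Y Z by blast+
 have cself: "(U, s, f) \<in> c" unfolding c_def by (rule equiv_class_self[OF e1]) (simp add: roofs_iff[OF X] r1)
 have dself: "(V, t, g) \<in> d" unfolding d_def by (rule equiv_class_self[OF e2]) (simp add: roofs_iff[OF Y] r2)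
 have xT: "?x \<in> TT" unfolding TT_def using cself dself W serre_system_iff[OF W(1) U(1)] by blast
 have rel: "(?x, y) \<in> ?R" if "y \<in> TT" for y
 proof -
  from that obtain U' s' f' V' t' g' W' u' v' where y: "y = (W', Cmp C W' U' X s' u', Cmp C W' V' Z g' v')"
   and c': "(U', s', f') \<in> c" and d': "(V', t', g') \<in> d" and W': "W' \<in> Ob C" "u' \<in> serre_system C S W' U'" "v' \<in> Hom C W' V'"
    "Cmp C W' U' Y f' u' = Cmp C W' V' Y t' v'"
   unfolding TT_def by blast
  have c1: "((U, s, f), (U', s', f')) \<in> roof_rel C S X Y" using c' unfolding c_def by simp
  have d1: "((V, t, g), (V', t', g')) \<in> roof_rel C S Y Z" using d' unfolding d_def by simp
  have r1': "roof X Y (U', s', f')" using c1 roofs_iff[OF X] unfolding roof_rel_def by blast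
  have r2': "roof Y Z (V', t', g')" using d1 roofs_iff[OF Y] unfolding roof_rel_def by blast
  note U' = roofD[OF r1'] and V' = roofD[OF r2']
  have u': "sys W' U' u'" using W' serre_system_iff[OF W'(1) U'(1)] by blast
  have ro': "roof X Z (W', Cmp C W' U' X s' u', Cmp C W' V' Z g' v')"
   by (rule roofI[OF W'(1) sys_comp[OF W'(1) U'(1) X u' U'(2)] cmp_hom[OF W'(1) V'(1) Z W'(3) V'(3)]])
  have "small Z (devs Z ?x (W', Cmp C W' U' X s' u', Cmp C W' V' Z g' v'))"
   by (rule comp_rel[OF X Y Z r1 r1' _ r2 r2' _ W W'(1) u' W'(3,4)])
    (use c1 d1 roof_rel_iff[OF X Y r1 r1'] roof_rel_iff[OF Y Z r2 r2'] in auto)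
  then show ?thesis using roof_rel_iff[OF X Z ro ro'] y by simp
 qed
 have "?R `` TT = ?R `` {?x}"
 proof
  show "?R `` {?x} \<subseteq> ?R `` TT" using xT by blast
  show "?R `` TT \<subseteq> ?R `` {?x}" using rel e3 unfolding equiv_def trans_def by blast
 qed
 then show "Cmp Q X Y Z (cls Y Z (V, t, g)) (cls X Y (U, s, f)) = cls X Z ?x" using eq unfolding c_def d_def by simp
qed

lemma Q_cmp_ex:
 assumes X: "X \<in> Ob C" and Y: "Y \<in> Ob C" and Z: "Z \<in> Ob C"
  and r1: "roof X Y (U, s, f)" and r2: "roof Y Z (V, t, g)"
 obtains W u v where "W \<in> Ob C" "sys W U u" "v \<in> Hom C W V"
  "\<And>j x. j \<in> J ==> x \<in> E W j ==> f j (u j x) = t j (v j x)"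
  "\<And>j x y. j \<in> J ==> x \<in> E U j ==> y \<in> E V j ==> f j x = t j y ==> \<exists>w\<in>E W j. u j w = x \<and> v j w = y"
  "Cmp Q X Y Z (cls Y Z (V, t, g)) (cls X Y (U, s, f)) = cls X Z (W, Cmp C W U X s u, Cmp C W V Z g v)"
  "roof X Z (W, Cmp C W U X s u, Cmp C W V Z g v)"
proof -
 note U = roofD[OF r1] and V = roofD[OF r2]
 note t = sysD(1)[OF V(2)]
 obtain W u v where W: "W \<in> Ob C" "sys W U u" "v \<in> Hom C W V"
  and 1: "\<forall>j x. j \<in> J --> x \<in> E W j --> f j (u j x) = t j (v j x)"
  and 2: "\<forall>j x y. j \<in> J --> x \<in> E U j --> y \<in> E V j --> f j x = t j y --> (\<exists>w\<in>E W j. u j w = x \<and> v j w = y)"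
  using sys_pullback[OF U(1) V(1) Y U(3) V(2)] by (elim exE conjE) (rule that)
 note u = sysD(1)[OF W(2)]
 have e: "Cmp C W U Y f u = Cmp C W V Y t v"
  by (rule hom_ext[OF W(1) Y cmp_hom[OF W(1) U(1) Y u U(3)] cmp_hom[OF W(1) V(1) Y W(3) t]])
   (use cmp_app[OF W(1) U(1) Y u U(3)] cmp_app[OF W(1) V(1) Y W(3) t] 1 in simp)
 show thesis by (rule that[OF W 1[rule_format] 2[rule_format] Q_cmp[OF X Y Z r1 r2 W e]])
qed

lemma Q_cmp_post:
 assumes X: "X \<in> Ob C" and Y: "Y \<in> Ob C" and Z: "Z \<in> Ob C"
  and r1: "roof X Y (U, s, f)" and g: "g \<in> Hom C Y Z"
 shows "Cmp Q X Y Z (cls Y Z (Y, Id C Y, g)) (cls X Y (U, s, f)) = cls X Z (U, s, Cmp C U Y Z g f)"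
  and "roof X Z (U, s, Cmp C U Y Z g f)"
proof -
 note U = roofD[OF r1]
 have e: "Cmp C U U Y f (Id C U) = Cmp C U Y Y (Id C Y) f" using cmp_id_r[OF U(1) Y U(3)] cmp_id_l[OF U(1) Y U(3)] by simp
 show "Cmp Q X Y Z (cls Y Z (Y, Id C Y, g)) (cls X Y (U, s, f)) = cls X Z (U, s, Cmp C U Y Z g f)"
  using Q_cmp(1)[OF X Y Z r1 roof_id[OF Y g] U(1) sys_id[OF U(1)] U(3) e] cmp_id_r[OF U(1) X sysD(1)[OF U(2)]] by simp
 show "roof X Z (U, s, Cmp C U Y Z g f)" by (rule roofI[OF U(1,2) cmp_hom[OF U(1) Y Z U(3) g]])
qed

lemma small_df: assumes Y: "Y \<in> Ob C" and "small Y N" "small Y M"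
 shows "small Y (\<lambda>j. {df Y j n m | n m. n \<in> N j \<and> m \<in> M j \<and> n \<in> E Y j \<and> m \<in> E Y j})"
proof (rule small_mono[OF small_add[OF Y assms(2) small_neg[OF Y assms(3)]]])
 fix j x assume j: "j \<in> J" and "x \<in> {df Y j n m | n m. n \<in> N j \<and> m \<in> M j \<and> n \<in> E Y j \<and> m \<in> E Y j}"
 then obtain n m where *: "x = df Y j n m" "n \<in> N j" "m \<in> M j" "n \<in> E Y j" "m \<in> E Y j" by blast
 have z: "df Y j (zr Y j) m \<in> E Y j" "x \<in> E Y j" using df_E[OF Y j] zr_E[OF Y j] * by auto
 have "x = n \<oplus>[G Y j] df Y j (zr Y j) m"
  using df_tele[OF Y j *(4) zr_E[OF Y j] *(5)] df_zr[OF Y j *(4)] * by simp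
 then show "x \<in> {x \<in> E Y j. \<exists>n\<in>N j. \<exists>m\<in>df Y j (zr Y j) ` M j. n \<in> E Y j \<and> m \<in> E Y j \<and> x = n \<oplus>[G Y j] m}"
  using * z by blast
qed

lemma small_image_all: "U \<in> S ==> Y \<in> Ob C ==> f \<in> Hom C U Y ==> small Y (im U f)"
 unfolding small_def by blast

text \<open>U is the preimage of X under \<open>s\<close>, whose kernel is small.\<close>

lemma sys_source_S: assumes X: "X \<in> S" and U: "U \<in> Ob C" and s: "sys U X s" shows "U \<in> S"
proof -
 have "small U (\<lambda>j. {x \<in> E U j. s j x \<in> E X j})"
  by (rule small_preimage[OF U S_Ob[OF X] sysD(1)[OF s] sysD(2)[OF s] small_self[OF X]])
 then have "small U (E U)" by (rule small_mono) (use hom_closed[OF U S_Ob[OF X] sysD(1)[OF s]] in simp)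
 then show ?thesis using small_ob U by blast
qed

text \<open>If Z is zero in the quotient, the roofs of the identity and of the zero morphism
  coincide; their differences exhaust Z, so Z itself is small.\<close>

lemma Q_zero_object: assumes Z: "Z \<in> Ob C" shows "zero_object Q Z \<longleftrightarrow> Z \<in> S"
proof
 assume z: "zero_object Q Z"
 obtain o' where o: "o' \<in> Hom C Z Z" "\<forall>j\<in>J. \<forall>x\<in>E Z j. o' j x = zr Z j" using zero_hom[OF Z Z] by blast
 have r: "roof Z Z (Z, Id C Z, Id C Z)" "roof Z Z (Z, Id C Z, o')" using roof_id[OF Z] id_hom[OF Z] o(1) by auto
 have "\<exists>!f. f \<in> Hom Q Z Z" using z Z unfolding zero_object_def Q_Ob by simp
 then have "cls Z Z (Z, Id C Z, Id C Z) = cls Z Z (Z, Id C Z, o')" using cls_hom[OF Z r(1)] cls_hom[OF Z r(2)] by blast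
 then have "small Z (devs Z (Z, Id C Z, Id C Z) (Z, Id C Z, o'))" using cls_eq[OF Z Z r] by blast
 then have "small Z (E Z)"
 proof (rule small_mono)
  fix j x assume j: "j \<in> J" and x: "x \<in> E Z j"
  have "x = df Z j (Id C Z j x) (o' j x)" using o(2) j x id_app[OF Z j x] df_zr[OF Z j x] by simp
  then show "x \<in> devs Z (Z, Id C Z, Id C Z) (Z, Id C Z, o') j" unfolding devs_mem using x by blast
 qed
 then show "Z \<in> S" using small_ob[OF Z] by blast
next
 assume z: "Z \<in> S"
 have "(\<exists>!f. f \<in> Hom Q X Z) \<and> (\<exists>!f. f \<in> Hom Q Z X)" if X: "X \<in> Ob C" for X
 proof
  obtain o' where o: "o' \<in> Hom C X Z" using zero_hom[OF X Z] by blast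
  have "c = d" if c: "c \<in> Hom Q X Z" and d: "d \<in> Hom Q X Z" for c d
  proof -
   obtain U s f where c': "roof X Z (U, s, f)" "c = cls X Z (U, s, f)" by (rule hom_rep[OF X c])
   obtain V t g where d': "roof X Z (V, t, g)" "d = cls X Z (V, t, g)" by (rule hom_rep[OF X d])
   have "small Z (devs Z (U, s, f) (V, t, g))"
   proof (rule small_mono[OF small_self[OF z]])
    fix j x assume j: "j \<in> J" and "x \<in> devs Z (U, s, f) (V, t, g) j"
    then show "x \<in> E Z j" unfolding devs_mem
     using df_E[OF Z j] hom_closed[OF roofD(1)[OF c'(1)] Z roofD(3)[OF c'(1)] j]
      hom_closed[OF roofD(1)[OF d'(1)] Z roofD(3)[OF d'(1)] j] by blast
   qed
   then show "c = d" using cls_eq[OF X Z c'(1) d'(1)] c' d' by simp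
  qed
  then show "\<exists>!f. f \<in> Hom Q X Z" using cls_hom[OF X roof_id[OF X o]] by blast
  obtain o' where o: "o' \<in> Hom C Z X" using zero_hom[OF Z X] by blast
  have "c = d" if c: "c \<in> Hom Q Z X" and d: "d \<in> Hom Q Z X" for c d
  proof -
   obtain U s f where c': "roof Z X (U, s, f)" "c = cls Z X (U, s, f)" by (rule hom_rep[OF Z c])
   obtain V t g where d': "roof Z X (V, t, g)" "d = cls Z X (V, t, g)" by (rule hom_rep[OF Z d])
   note U = roofD[OF c'(1)] and V = roofD[OF d'(1)]
   have "small X (devs X (U, s, f) (V, t, g))"
   proof (rule small_mono[OF small_df[OF X small_image_all[OF sys_source_S[OF z U(1,2)] X U(3)]
       small_image_all[OF sys_source_S[OF z V(1,2)] X V(3)]]])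
    fix j x assume j: "j \<in> J" and "x \<in> devs X (U, s, f) (V, t, g) j"
    then obtain u v where uv: "u \<in> E U j" "v \<in> E V j" "x = df X j (f j u) (g j v)" unfolding devs_mem by blast
    then show "x \<in> {df X j n m | n m. n \<in> im U f j \<and> m \<in> im V g j \<and> n \<in> E X j \<and> m \<in> E X j}"
     using hom_closed[OF U(1) X U(3) j uv(1)] hom_closed[OF V(1) X V(3) j uv(2)] unfolding im_def by blast
   qed
   then show "c = d" using cls_eq[OF Z X c'(1) d'(1)] c' d' by simp
  qed
  then show "\<exists>!f. f \<in> Hom Q Z X" using cls_hom[OF Z roof_id[OF Z o]] by blast
 qed
 then show "zero_object Q Z" unfolding zero_object_def Q_Ob using Z by simp
qed

text \<open>A factorisation through an object of \<open>S\<close> gives an equivalent roof with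
  small image; on a cosmall part of U the values of \<open>f\<close> differ from it by small
  elements. Conversely a roof with small image is equivalent to one through a zero object.\<close>

lemma Q_zero_morphism:
 assumes X: "X \<in> Ob C" and Y: "Y \<in> Ob C" and r: "roof X Y (U, s, f)"
 shows "zero_morphism Q X Y (cls X Y (U, s, f)) \<longleftrightarrow> small Y (im U f)"
proof
 note U = roofD[OF r]
 assume "zero_morphism Q X Y (cls X Y (U, s, f))"
 then obtain Z a b where Z: "zero_object Q Z" and a: "a \<in> Hom Q X Z" and b: "b \<in> Hom Q Z Y"
  and e: "cls X Y (U, s, f) = Cmp Q X Z Y b a" unfolding zero_morphism_def by (elim exE conjE) (rule that)
 have Z': "Z \<in> Ob C" using conjunct1[OF Z[unfolded zero_object_def]] Q_Ob by simp
 have ZS: "Z \<in> S" using Q_zero_object[OF Z'] Z by simp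
 obtain A s1 a1 where a': "roof X Z (A, s1, a1)" "a = cls X Z (A, s1, a1)" by (rule hom_rep[OF X a])
 obtain B s2 b1 where b': "roof Z Y (B, s2, b1)" "b = cls Z Y (B, s2, b1)" by (rule hom_rep[OF Z' b])
 note B = roofD[OF b'(1)]
 have BS: "B \<in> S" by (rule sys_source_S[OF ZS B(1,2)])
 obtain W u v where W: "W \<in> Ob C" "v \<in> Hom C W B"
  and e': "Cmp Q X Z Y b a = cls X Y (W, Cmp C W A X s1 u, Cmp C W B Y b1 v)"
  and ro: "roof X Y (W, Cmp C W A X s1 u, Cmp C W B Y b1 v)"
  using Q_cmp_ex[OF X Z' Y a'(1) b'(1)] a'(2) b'(2) by metis
 let ?s = "Cmp C W A X s1 u" and ?g = "Cmp C W B Y b1 v"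
 note R = roofD[OF ro]
 have d: "small Y (devs Y (U, s, f) (W, ?s, ?g))" using cls_eq[OF X Y r ro] e e' by simp
 have g: "small Y (im W ?g)"
 proof (rule small_mono[OF small_image_all[OF BS Y B(3)]])
  fix j x assume j: "j \<in> J" and "x \<in> im W ?g j"
  then obtain w where "w \<in> E W j" "x = b1 j (v j w)" using cmp_app[OF W(1) B(1) Y W(2) B(3) j] unfolding im_def by auto
  then show "x \<in> im B b1 j" using hom_closed[OF W(1) B(1) W(2) j] unfolding im_def by blast
 qed
 have cM: "cosmall U (\<lambda>j. {x \<in> E U j. s j x \<in> im W ?s j})"
  by (rule cosmall_mono[OF cosmall_preimage[OF U(1) X sysD(1)[OF U(2)] sysD(3)[OF R(2)]]]) simp
 show "small Y (im U f)"
 proof (rule small_extend[OF U(1) Y U(3) cM], rule small_mono[OF small_add[OF Y d g]])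
  fix j y assume j: "j \<in> J" and "y \<in> f j ` {x \<in> E U j. s j x \<in> im W ?s j}"
  then obtain x w where x: "x \<in> E U j" "y = f j x" and w: "w \<in> E W j" "s j x = ?s j w" unfolding im_def by blast
  note fx = hom_closed[OF U(1) Y U(3) j x(1)] and gw = hom_closed[OF R(1) Y R(3) j w(1)]
  have "df Y j (f j x) (?g j w) \<in> devs Y (U, s, f) (W, ?s, ?g) j" unfolding devs_mem using x w by blast
  then show "y \<in> {z \<in> E Y j. \<exists>n\<in>devs Y (U, s, f) (W, ?s, ?g) j. \<exists>m\<in>im W ?g j. n \<in> E Y j \<and> m \<in> E Y j \<and> z = n \<oplus>[G Y j] m}"
   using df_add[OF Y j fx gw] df_E[OF Y j fx gw] fx gw x w unfolding im_def by force
 qed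
next
 assume sm: "small Y (im U f)"
 note U = roofD[OF r]
 obtain Z where Z: "Z \<in> Ob C" "\<And>j. j \<in> J ==> E Z j = {zr Z j}" using zero_ob X by blast
 obtain a where a: "a \<in> Hom C X Z" using zero_hom[OF X Z(1)] by blast
 obtain b where b: "b \<in> Hom C Z Y" using zero_hom[OF Z(1) Y] by blast
 have zQ: "zero_object Q Z" using Q_zero_object[OF Z(1)] S_zero[OF Z] by simp
 note ra = roof_id[OF X a] and rb = roof_id[OF Z(1) b]
 note cc = Q_cmp_post[OF X Z(1) Y ra b]
 have ba: "Cmp C X Z Y b a j x = zr Y j" if "j \<in> J" "x \<in> E X j" for j x
  using cmp_app[OF X Z(1) Y a b that] hom_closed[OF X Z(1) a that] Z(2)[OF that(1)] hom_zr[OF Z(1) Y b that(1)] by simp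
 have "small Y (devs Y (U, s, f) (X, Id C X, Cmp C X Z Y b a))"
 proof (rule small_mono[OF sm])
  fix j y assume j: "j \<in> J" and "y \<in> devs Y (U, s, f) (X, Id C X, Cmp C X Z Y b a) j"
  then obtain u v where uv: "u \<in> E U j" "v \<in> E X j" "y = df Y j (f j u) (Cmp C X Z Y b a j v)" unfolding devs_mem by blast
  then show "y \<in> im U f j" using ba[OF j uv(2)] df_zr[OF Y j hom_closed[OF U(1) Y U(3) j uv(1)]] unfolding im_def by simp
 qed
 then have "cls X Y (U, s, f) = Cmp Q X Z Y (cls Z Y (Z, Id C Z, b)) (cls X Z (X, Id C X, a))"
  using cls_eq[OF X Y r cc(2)] cc(1) by simp
 then show "zero_morphism Q X Y (cls X Y (U, s, f))" unfolding zero_morphism_def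
  using zQ cls_hom[OF X ra] cls_hom[OF Z(1) rb] by blast
qed

lemma Q_mono_post:
 assumes Y: "Y \<in> Ob C" and X: "X \<in> Ob C" and i: "mono Y X i"
 shows "monomorphism Q Y X (cls Y X (Y, Id C Y, i))"
 unfolding monomorphism_def Q_Ob
proof (intro conjI ballI impI)
 note i' = monoD(1)[OF i]
 show "cls Y X (Y, Id C Y, i) \<in> Hom Q Y X" by (rule cls_hom[OF Y roof_id[OF Y i']])
 fix W a b assume W: "W \<in> Ob C" and a: "a \<in> Hom Q W Y" and b: "b \<in> Hom Q W Y"
  and e: "Cmp Q W Y X (cls Y X (Y, Id C Y, i)) a = Cmp Q W Y X (cls Y X (Y, Id C Y, i)) b"
 obtain A s f where a': "roof W Y (A, s, f)" "a = cls W Y (A, s, f)" by (rule hom_rep[OF W a])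
 obtain B t g where b': "roof W Y (B, t, g)" "b = cls W Y (B, t, g)" by (rule hom_rep[OF W b])
 note A = roofD[OF a'(1)] and B = roofD[OF b'(1)]
 note ca = Q_cmp_post[OF W Y X a'(1) i'] and cb = Q_cmp_post[OF W Y X b'(1) i']
 have d: "small X (devs X (A, s, Cmp C A Y X i f) (B, t, Cmp C B Y X i g))"
  using cls_eq[OF W X ca(2) cb(2)] ca(1) cb(1) e a' b' by simp
 have ki: "small Y (ker Y X i)"
  by (rule small_zero[OF Y]) (use monoD(2)[OF i _ _ zr_E[OF Y]] hom_zr[OF Y X i'] in \<open>auto simp: ker_def\<close>)
 have "small Y (devs Y (A, s, f) (B, t, g))"
 proof (rule small_mono[OF small_preimage[OF Y X i' ki d]])
  fix j x assume j: "j \<in> J" and "x \<in> devs Y (A, s, f) (B, t, g) j"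
  then obtain u v where uv: "u \<in> E A j" "v \<in> E B j" "s j u = t j v" "x = df Y j (f j u) (g j v)" unfolding devs_mem by blast
  note fu = hom_closed[OF A(1) Y A(3) j uv(1)] and gv = hom_closed[OF B(1) Y B(3) j uv(2)]
  have "i j x = df X j (Cmp C A Y X i f j u) (Cmp C B Y X i g j v)"
   using uv hom_df[OF Y X i' j fu gv] cmp_app[OF A(1) Y X A(3) i' j uv(1)] cmp_app[OF B(1) Y X B(3) i' j uv(2)] by simp
  then show "x \<in> {x \<in> E Y j. i j x \<in> devs X (A, s, Cmp C A Y X i f) (B, t, Cmp C B Y X i g) j}"
   unfolding devs_mem using uv df_E[OF Y j fu gv] by blast
 qed
 then show "a = b" using cls_eq[OF W Y a'(1) b'(1)] a' b' by simp
qed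

end

section \<open>Finite length in the quotient\<close>

context concrete_abelian begin

text \<open>Length at most \<open>n\<close> modulo \<open>S\<close>, by recursion on \<open>n\<close>: in a chain of \<open>n + 2\<close> steps outside \<open>S\<close>, the
 last but one member \<open>Y\<close> has length more than \<open>n\<close>, and \<open>X/Y\<close> is not in \<open>S\<close>.\<close>

primrec lev :: "'o set => nat => 'o set" where
 "lev S 0 = S"
| "lev S (Suc n) = {X \<in> Ob C. \<forall>Y Q i q. ses Y X Q i q --> Q \<in> S \<or> Y \<in> lev S n}"

lemma sesD: assumes "ses Y X Q i q"
 shows "Y \<in> Ob C" "X \<in> Ob C" "Q \<in> Ob C" "mono Y X i" "epi X Q q" "\<And>j. j \<in> J ==> im Y i j = ker X Q q j"
  "i \<in> Hom C Y X" "q \<in> Hom C X Q"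
 using assms unfolding ses_def mono_def epi_def by auto

lemma ses_im: "ses Y X Q i q ==> j \<in> J ==> x \<in> E X j ==> q j x = zr Q j \<longleftrightarrow> (\<exists>y\<in>E Y j. x = i j y)"
 using sesD(6)[of Y X Q i q j] unfolding im_def ker_def by blast

lemma mono_cmp: assumes X: "X \<in> Ob C" and Y: "Y \<in> Ob C" and Z: "Z \<in> Ob C" and f: "mono X Y f" and g: "mono Y Z g"
 shows "mono X Z (Cmp C X Y Z g f)"
 unfolding mono_def
proof (intro conjI ballI)
 show "Cmp C X Y Z g f \<in> Hom C X Z" by (rule cmp_hom[OF X Y Z monoD(1)[OF f] monoD(1)[OF g]])
 fix j assume j: "j \<in> J"
 show "inj_on (Cmp C X Y Z g f j) (E X j)"
 proof (rule inj_onI)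
  fix x y assume x: "x \<in> E X j" "y \<in> E X j" "Cmp C X Y Z g f j x = Cmp C X Y Z g f j y"
  then have "g j (f j x) = g j (f j y)" using cmp_app[OF X Y Z monoD(1)[OF f] monoD(1)[OF g] j] by simp
  then have "f j x = f j y"
   by (rule monoD(2)[OF g j hom_closed[OF X Y monoD(1)[OF f] j x(1)] hom_closed[OF X Y monoD(1)[OF f] j x(2)]])
  then show "x = y" by (rule monoD(2)[OF f j x(1,2)])
 qed
qed

lemma epi_cmp: assumes X: "X \<in> Ob C" and Y: "Y \<in> Ob C" and Z: "Z \<in> Ob C" and f: "epi X Y f" and g: "epi Y Z g"
 shows "epi X Z (Cmp C X Y Z g f)"
 unfolding epi_def
proof (intro conjI ballI)
 show "Cmp C X Y Z g f \<in> Hom C X Z" by (rule cmp_hom[OF X Y Z epiD(1)[OF f] epiD(1)[OF g]])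
 fix j assume j: "j \<in> J"
 have "Cmp C X Y Z g f j ` E X j = g j ` f j ` E X j"
  unfolding image_image using cmp_app[OF X Y Z epiD(1)[OF f] epiD(1)[OF g] j] by simp
 then show "Cmp C X Y Z g f j ` E X j = E Z j" using f g j unfolding epi_def by simp
qed

lemma monoI0: assumes X: "X \<in> Ob C" and Y: "Y \<in> Ob C" and f: "f \<in> Hom C X Y"
  and "\<And>j x. j \<in> J ==> x \<in> E X j ==> f j x = zr Y j ==> x = zr X j"
 shows "mono X Y f"
 unfolding mono_def using f hom_inj[OF X Y f] assms(4) by blast

end

section \<open>Closure properties of bounded length, and exactness of the localisation\<close>

context serre_class begin

lemma lev_Ob: "lev S n \<subseteq> Ob C"
 by (cases n) (use S_Ob in auto)

text \<open>For a subobject Y of Z, the quotient of Z by Y embeds into that of X by Y.\<close>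

lemma lev_sub: "X \<in> lev S n ==> Z \<in> Ob C ==> mono Z X f ==> Z \<in> lev S n"
proof (induction n arbitrary: X Z f)
 case 0
 then show ?case using S_sub by auto
next
 case (Suc n)
 have X: "X \<in> Ob C" using Suc.prems lev_Ob by blast
 note Z = Suc.prems(2) and f = Suc.prems(3)
 note f' = monoD(1)[OF f]
 have "Q \<in> S \<or> Y \<in> lev S n" if s: "ses Y Z Q i q" for Y Q i q
 proof -
  note D = sesD[OF s]
  let ?i = "Cmp C Y Z X f i"
  have m: "mono Y X ?i" by (rule mono_cmp[OF D(1) Z X D(4) f])
  obtain Q' q' where s': "ses Y X Q' ?i q'" by (rule ses_of_mono[OF D(1) X m])
  note D' = sesD[OF s']
  have ia: "?i j y = f j (i j y)" if "j \<in> J" "y \<in> E Y j" for j y using cmp_app[OF D(1) Z X D(7) f' that] .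
  have qf: "Cmp C Z X Q' q' f j z = q' j (f j z)" if "j \<in> J" "z \<in> E Z j" for j z using cmp_app[OF Z X D'(3) f' D'(8) that] .
  have "\<exists>h\<in>Hom C Q Q'. \<forall>j\<in>J. \<forall>z\<in>E Z j. h j (q j z) = Cmp C Z X Q' q' f j z"
  proof (rule epi_desc[OF Z D(3) D'(3) D(5) cmp_hom[OF Z X D'(3) f' D'(8)]])
   fix j z assume j: "j \<in> J" and z: "z \<in> E Z j" "q j z = zr Q j"
   then obtain y where y: "y \<in> E Y j" "z = i j y" using ses_im[OF s j z(1)] by blast
   have "f j z = ?i j y" using ia[OF j y(1)] y by simp
   then have "q' j (f j z) = zr Q' j" using ses_im[OF s' j hom_closed[OF Z X f' j z(1)]] y by blast
   then show "Cmp C Z X Q' q' f j z = zr Q' j" using qf[OF j z(1)] by simp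
  qed
  then obtain h where h: "h \<in> Hom C Q Q'" "\<And>j z. j \<in> J ==> z \<in> E Z j ==> h j (q j z) = q' j (f j z)"
   using qf by auto
  have "mono Q Q' h"
  proof (rule monoI0[OF D(3) D'(3) h(1)])
   fix j x assume j: "j \<in> J" and x: "x \<in> E Q j" "h j x = zr Q' j"
   obtain z where z: "z \<in> E Z j" "x = q j z" using epiD(2)[OF D(5) j x(1)] by blast
   have "q' j (f j z) = zr Q' j" using h(2)[OF j z(1)] x z by simp
   then obtain y where y: "y \<in> E Y j" "f j z = ?i j y" using ses_im[OF s' j hom_closed[OF Z X f' j z(1)]] by blast
   then have "z = i j y" using monoD(2)[OF f j z(1) hom_closed[OF D(1) Z D(7) j y(1)]] ia[OF j y(1)] by simp
   then show "x = zr Q j" using ses_im[OF s j z(1)] y z by blast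
  qed
  moreover have "Q' \<in> S \<or> Y \<in> lev S n" using Suc.prems(1) s' by auto
  ultimately show ?thesis using S_sub[OF D(3)] by blast
 qed
 then show ?case unfolding lev.simps using Z by blast
qed

text \<open>A subobject Y of Z is replaced by its preimage Y' in X, which has the same quotient and
  maps onto Y.\<close>

lemma lev_quot: "X \<in> lev S n ==> Z \<in> Ob C ==> epi X Z f ==> Z \<in> lev S n"
proof (induction n arbitrary: X Z f)
 case 0
 then show ?case using S_quot by auto
next
 case (Suc n)
 have X: "X \<in> Ob C" using Suc.prems lev_Ob by blast
 note Z = Suc.prems(2) and f = Suc.prems(3)
 note f' = epiD(1)[OF f]
 have "Q \<in> S \<or> Y \<in> lev S n" if s: "ses Y Z Q i q" for Y Q i q
 proof -
  note D = sesD[OF s]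
  have e: "epi X Q (Cmp C X Z Q q f)" by (rule epi_cmp[OF X Z D(3) f D(5)])
  obtain Y' i' where s': "ses Y' X Q i' (Cmp C X Z Q q f)" by (rule ses_of_epi[OF X D(3) e])
  note D' = sesD[OF s']
  note fi = cmp_hom[OF D'(1) X Z D'(7) f'] and fia = cmp_app[OF D'(1) X Z D'(7) f']
  note qfa = cmp_app[OF X Z D(3) f' D(8)]
  have iY: "f j x \<in> im Y i j \<longleftrightarrow> x \<in> im Y' i' j" if "j \<in> J" "x \<in> E X j" for j x
   using ses_im[OF s that(1) hom_closed[OF X Z f' that]] ses_im[OF s' that] qfa[OF that] unfolding im_def by auto
  have "\<exists>h\<in>Hom C Y' Y. \<forall>j\<in>J. \<forall>y\<in>E Y' j. i j (h j y) = Cmp C Y' X Z f i' j y"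
  proof (rule mono_lift[OF D(1) Z D'(1) D(4) fi])
   fix j y assume j: "j \<in> J" and y: "y \<in> E Y' j"
   then have "i' j y \<in> im Y' i' j" unfolding im_def by blast
   then show "Cmp C Y' X Z f i' j y \<in> im Y i j" using iY[OF j hom_closed[OF D'(1) X D'(7) j y]] fia[OF j y] by simp
  qed
  then obtain h where h: "h \<in> Hom C Y' Y" "\<And>j y. j \<in> J ==> y \<in> E Y' j ==> i j (h j y) = f j (i' j y)" using fia by auto
  have "epi Y' Y h" unfolding epi_def
  proof (intro conjI ballI h(1) equalityI subsetI)
   fix j y assume j: "j \<in> J"
   { assume "y \<in> h j ` E Y' j"
    then show "y \<in> E Y j" using hom_closed[OF D'(1) D(1) h(1) j] by blast }
   assume y: "y \<in> E Y j"
   obtain x where x: "x \<in> E X j" "i j y = f j x" using epiD(2)[OF f j hom_closed[OF D(1) Z D(7) j y]] by blast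
   moreover have "i j y \<in> im Y i j" using y unfolding im_def by blast
   ultimately have "x \<in> im Y' i' j" using iY[OF j x(1)] by simp
   then obtain y' where y': "y' \<in> E Y' j" "x = i' j y'" unfolding im_def by blast
   then have "y = h j y'" using monoD(2)[OF D(4) j y hom_closed[OF D'(1) D(1) h(1) j y'(1)]] h(2)[OF j y'(1)] x by simp
   then show "y \<in> h j ` E Y' j" using y' by blast
  qed
  moreover have "Q \<in> S \<or> Y' \<in> lev S n" using Suc.prems(1) s' by auto
  ultimately show ?thesis using Suc.IH D(1) by blast
 qed
 then show ?case unfolding lev.simps using Z by blast
qed

text \<open>Bounds add up in extensions. A subobject Y of X is cut into its intersection Y0 with Z
  and its image I in T. If both Z/Y0 and T/I lie in \<open>S\<close>, so does X/Y; otherwise the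
  bound for Y0 or for I is smaller by one and induction applies to Y.\<close>

lemma lev_ext: "a + b = n ==> Z \<in> lev S a ==> T \<in> lev S b ==> ses Z X T z t ==> X \<in> lev S n"
proof (induction n arbitrary: a b X Z T z t)
 case 0
 note D = sesD[OF 0(4)]
 have "X \<in> S" using 0 S_mid[of Z T X z t] D ses_im[OF 0(4)] by (auto simp: image_iff)
 then show ?case by simp
next
 case (Suc n)
 note s = Suc.prems(4)
 note D = sesD[OF s]
 have "Q \<in> S \<or> Y \<in> lev S n" if s': "ses Y X Q i q" for Y Q i q
 proof -
  note D' = sesD[OF s']
  note ti = cmp_hom[OF D'(1) D(2,3) D'(7) D(8)] and tia = cmp_app[OF D'(1) D(2,3) D'(7) D(8)]
  obtain I k e where I: "I \<in> Ob C" "mono I T k" "epi Y I e"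
   and ke: "\<And>j x. j \<in> J ==> x \<in> E Y j ==> k j (e j x) = t j (i j x)"
   using image_factor[OF D'(1) D(3) ti] tia by metis
  note k = monoD(1)[OF I(2)] and e = epiD(1)[OF I(3)]
  obtain Y0 m where sY: "ses Y0 Y I m e" by (rule ses_of_epi[OF D'(1) I(1,3)])
  note DY = sesD[OF sY]
  note im' = cmp_hom[OF DY(1,2) D(2) DY(7) D'(7)] and ima = cmp_app[OF DY(1,2) D(2) DY(7) D'(7)]
  have "\<exists>h\<in>Hom C Y0 Z. \<forall>j\<in>J. \<forall>y\<in>E Y0 j. z j (h j y) = Cmp C Y0 Y X i m j y"
  proof (rule mono_lift[OF D(1,2) DY(1) D(4) im'])
   fix j y assume j: "j \<in> J" and y: "y \<in> E Y0 j"
   note my = hom_closed[OF DY(1,2,7) j y]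
   have "e j (m j y) = zr I j" using ses_im[OF sY j my] y by blast
   then have "t j (i j (m j y)) = zr T j" using ke[OF j my] hom_zr[OF I(1) D(3) k j] by simp
   then show "Cmp C Y0 Y X i m j y \<in> im Z z j"
    using ses_im[OF s j hom_closed[OF D'(1,2,7) j my]] ima[OF j y] unfolding im_def by auto
  qed
  then obtain h where h: "h \<in> Hom C Y0 Z" "\<And>j y. j \<in> J ==> y \<in> E Y0 j ==> z j (h j y) = i j (m j y)" using ima by auto
  have mh: "mono Y0 Z h" unfolding mono_def
  proof (intro conjI ballI h(1) inj_onI)
   fix j x y assume j: "j \<in> J" and xy: "x \<in> E Y0 j" "y \<in> E Y0 j" "h j x = h j y"
   then have "i j (m j x) = i j (m j y)" using h(2)[OF j] by metis
   then have "m j x = m j y" by (rule monoD(2)[OF D'(4) j hom_closed[OF DY(1,2,7) j xy(1)] hom_closed[OF DY(1,2,7) j xy(2)]])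
   then show "x = y" by (rule monoD(2)[OF DY(4) j xy(1,2)])
  qed
  obtain Z' p where sZ: "ses Y0 Z Z' h p" by (rule ses_of_mono[OF DY(1) D(1) mh])
  note DZ = sesD[OF sZ]
  obtain T' r where sT: "ses I T T' k r" by (rule ses_of_mono[OF I(1) D(3) I(2)])
  note DT = sesD[OF sT]
  have IH1: "Y \<in> lev S n" if "Suc (a' + b') = Suc n" "Y0 \<in> lev S a'" "I \<in> lev S b'" for a' b'
   using Suc.IH[OF _ that(2,3) sY] that(1) by simp
  \<comment> \<open>A bound of zero already puts Z or T, and with it the quotient, into
    \<open>S\<close>; so a bound is lowered only when it is positive.\<close>
  consider a' where "a = Suc a'" "Y0 \<in> lev S a'" | b' where "b = Suc b'" "I \<in> lev S b'" | "Z' \<in> S" "T' \<in> S"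
  proof -
   have 1: "Z' \<in> S \<or> (\<exists>a'. a = Suc a' \<and> Y0 \<in> lev S a')"
   proof (cases a)
    case 0
    then show ?thesis using Suc.prems(2) S_quot[OF _ DZ(3,5)] by simp
   next
    case (Suc a')
    then show ?thesis using Suc.prems(2) sZ by auto
   qed
   have 2: "T' \<in> S \<or> (\<exists>b'. b = Suc b' \<and> I \<in> lev S b')"
   proof (cases b)
    case 0
    then show ?thesis using Suc.prems(3) S_quot[OF _ DT(3,5)] by simp
   next
    case (Suc b')
    then show ?thesis using Suc.prems(3) sT by auto
   qed
   show thesis using 1 2 that by blast
  qed
  then show ?thesis
  proof cases
   case 1
   then show ?thesis using IH1[of a' b] Suc.prems(1) lev_sub[OF Suc.prems(3) I(1,2)] by simp
  next
   case 2
   then show ?thesis using IH1[of a b'] Suc.prems(1) lev_sub[OF Suc.prems(2) DY(1) mh] by simp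
  next
   case 3
   note qz = cmp_hom[OF D(1,2) D'(3) D(7) D'(8)] and qza = cmp_app[OF D(1,2) D'(3) D(7) D'(8)]
   have "\<exists>g\<in>Hom C Z' Q. \<forall>j\<in>J. \<forall>x\<in>E Z j. g j (p j x) = Cmp C Z X Q q z j x"
   proof (rule epi_desc[OF DZ(2,3) D'(3) DZ(5) qz])
    fix j x assume j: "j \<in> J" and x: "x \<in> E Z j" "p j x = zr Z' j"
    then obtain y where y: "y \<in> E Y0 j" "x = h j y" using ses_im[OF sZ j x(1)] by blast
    have "z j x = i j (m j y)" using h(2)[OF j y(1)] y by simp
    then have "q j (z j x) = zr Q j"
     using ses_im[OF s' j hom_closed[OF D(1,2,7) j x(1)]] hom_closed[OF DY(1,2,7) j y(1)] by blast
    then show "Cmp C Z X Q q z j x = zr Q j" using qza[OF j x(1)] by simp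
   qed
   then obtain g where g: "g \<in> Hom C Z' Q" "\<And>j x. j \<in> J ==> x \<in> E Z j ==> g j (p j x) = q j (z j x)" using qza by auto
   note rt = cmp_hom[OF D(2,3) DT(3) D(8) DT(8)] and rta = cmp_app[OF D(2,3) DT(3) D(8) DT(8)]
   have "\<exists>g\<in>Hom C Q T'. \<forall>j\<in>J. \<forall>x\<in>E X j. g j (q j x) = Cmp C X T T' r t j x"
   proof (rule epi_desc[OF D'(2,3) DT(3) D'(5) rt])
    fix j x assume j: "j \<in> J" and x: "x \<in> E X j" "q j x = zr Q j"
    then obtain y where y: "y \<in> E Y j" "x = i j y" using ses_im[OF s' j x(1)] by blast
    then have "t j x = k j (e j y)" using ke[OF j y(1)] by simp
    then have "r j (t j x) = zr T' j"
     using ses_im[OF sT j hom_closed[OF D(2,3,8) j x(1)]] hom_closed[OF D'(1) I(1) e j y(1)] by blast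
    then show "Cmp C X T T' r t j x = zr T' j" using rta[OF j x(1)] by simp
   qed
   then obtain g' where g': "g' \<in> Hom C Q T'" "\<And>j x. j \<in> J ==> x \<in> E X j ==> g' j (q j x) = r j (t j x)" using rta by auto
   \<comment> \<open>Exactness of Z/Y0, X/Y, T/I in the middle: a class going to zero in T/I has a
     representative that, after subtracting an element of Y, comes from Z.\<close>
   have "Q \<in> S"
   proof (rule S_mid[OF 3 D'(3) g(1) g'(1)])
    fix j x assume j: "j \<in> J" and x: "x \<in> E Q j" "g' j x = zr T' j"
    obtain w where w: "w \<in> E X j" "x = q j w" using epiD(2)[OF D'(5) j x(1)] by blast
    have "r j (t j w) = zr T' j" using g'(2)[OF j w(1)] w x by simp
    then obtain v where v: "v \<in> E I j" "t j w = k j v" using ses_im[OF sT j hom_closed[OF D(2,3,8) j w(1)]] by blast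
    obtain y where y: "y \<in> E Y j" "v = e j y" using epiD(2)[OF I(3) j v(1)] by blast
    note iy = hom_closed[OF D'(1,2,7) j y(1)]
    have tw: "t j w = t j (i j y)" using v y ke[OF j y(1)] by simp
    then have "t j (df X j w (i j y)) = zr T j"
     using hom_df[OF D(2,3,8) j w(1) iy] df_eq_zr[OF D(3) j] hom_closed[OF D(2,3,8) j iy] by simp
    then obtain u where u: "u \<in> E Z j" "df X j w (i j y) = z j u" using ses_im[OF s j df_E[OF D(2) j w(1) iy]] by blast
    have qi: "q j (i j y) = zr Q j" using ses_im[OF s' j iy] y by blast
    have "x = q j (z j u)" using u w hom_df[OF D'(2,3,8) j w(1) iy] qi df_zr[OF D'(3) j] x(1) by simp
    then have "x = g j (p j u)" using g(2)[OF j u(1)] by simp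
    then show "x \<in> g j ` E Z' j" using hom_closed[OF DZ(2,3,8) j u(1)] by blast
   qed
   then show ?thesis by simp
  qed
 qed
 then show ?case unfolding lev.simps using D(2) by blast
qed

lemma ses_self_zero: assumes X: "X \<in> Ob C"
 obtains Z i where "ses Z X X i (Id C X)" "Z \<in> S"
proof -
 have e: "epi X X (Id C X)" unfolding epi_def using id_hom[OF X] id_app[OF X] by (auto simp: image_iff)
 obtain Z i where s: "ses Z X X i (Id C X)" by (rule ses_of_epi[OF X X e])
 note D = sesD[OF s]
 have "Z \<in> S"
 proof (rule small_sub_ob[OF X _ D(1,4)])
  show "small X (\<lambda>j. {zr X j})" by (rule small_zero[OF X]) simp
  fix j assume j: "j \<in> J"
  show "im Z i j \<subseteq> {zr X j}" unfolding D(6)[OF j] ker_def using id_app[OF X j] by auto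
 qed
 then show thesis using that s by blast
qed

text \<open>The union over all bounds, to be identified with the objects of finite length in the
  quotient.\<close>

definition BD where "BD = (\<Union>n. lev S n)"

text \<open>The kernel K of X onto its image in Q embeds into the image of A in X. So X is an
  extension of a subobject of Q by a subobject of a quotient of A, and the two bounds add.\<close>

lemma serre_BD: "serre_class C J G BD"
proof (unfold_locales)
 show "serre BD" unfolding serre_def
 proof (intro conjI ballI impI)
  show "BD \<subseteq> Ob C" unfolding BD_def using lev_Ob by blast
  fix X assume "X \<in> Ob C" "\<forall>j\<in>J. E X j = {zr X j}"
  then have "X \<in> lev S 0" using S_zero by simp
  then show "X \<in> BD" unfolding BD_def by blast
 next
  fix A Q X i q assume A: "A \<in> BD" and Q: "Q \<in> BD" and X: "X \<in> Ob C" and i: "i \<in> Hom C A X" and q: "q \<in> Hom C X Q"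
   and ex: "\<forall>j\<in>J. ker X Q q j \<subseteq> im A i j"
  obtain a b where ab: "A \<in> lev S a" "Q \<in> lev S b" using A Q unfolding BD_def by blast
  have A': "A \<in> Ob C" and Q': "Q \<in> Ob C" using ab lev_Ob by blast+
  obtain I k e where I: "I \<in> Ob C" "mono I Q k" "epi X I e" "\<And>j x. j \<in> J ==> x \<in> E X j ==> k j (e j x) = q j x"
   using image_factor[OF X Q' q] by metis
  have Ib: "I \<in> lev S b" by (rule lev_sub[OF ab(2) I(1,2)])
  obtain K m where s: "ses K X I m e" by (rule ses_of_epi[OF X I(1,3)])
  note D = sesD[OF s]
  obtain L l d where L: "L \<in> Ob C" "mono L X l" "epi A L d" "\<And>j. j \<in> J ==> im L l j = im A i j"
   using image_factor[OF A' X i] by metis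
  have La: "L \<in> lev S a" by (rule lev_quot[OF ab(1) L(1,3)])
  have "\<exists>h\<in>Hom C K L. \<forall>j\<in>J. \<forall>u\<in>E K j. l j (h j u) = m j u"
  proof (rule mono_lift[OF L(1) X D(1) L(2) D(7)])
   fix j u assume j: "j \<in> J" and u: "u \<in> E K j"
   note mu = hom_closed[OF D(1,2,7) j u]
   have "e j (m j u) = zr I j" using ses_im[OF s j mu] u by blast
   then have "m j u \<in> ker X Q q j" unfolding ker_def using mu I(4)[OF j mu] hom_zr[OF I(1) Q' monoD(1)[OF I(2)] j] by simp
   then show "m j u \<in> im L l j" using ex L(4)[OF j] j by blast
  qed
  then obtain h where h: "h \<in> Hom C K L" "\<And>j u. j \<in> J ==> u \<in> E K j ==> l j (h j u) = m j u" by blast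
  have "mono K L h" unfolding mono_def
   using h D(4) unfolding mono_def inj_on_def by metis
  then have "K \<in> lev S a" by (rule lev_sub[OF La D(1)])
  then have "X \<in> lev S (a + b)" using lev_ext[OF refl _ Ib s] by blast
  then show "X \<in> BD" unfolding BD_def by blast
 qed
qed

text \<open>If a roof into X becomes zero in T, its apex may be shrunk to the kernel of
  \<open>q\<close> after \<open>f\<close>, which is cosmall, and there \<open>f\<close> lifts to Y.
  Uniqueness is the monomorphism property of \<open>i\<close>.\<close>

lemma ses_kernel_Q: assumes s: "ses Y X T i q"
 shows "is_kernel Q X T (cls X T (X, Id C X, q)) Y (cls Y X (Y, Id C Y, i))"
proof -
 note D = sesD[OF s]
 note ri = roof_id[OF D(1,7)] and rq = roof_id[OF D(2,8)]
 have 1: "zero_morphism Q Y T (Cmp Q Y X T (cls X T (X, Id C X, q)) (cls Y X (Y, Id C Y, i)))"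
 proof -
  have "small T (im Y (Cmp C Y X T q i))"
  proof (rule small_zero[OF D(3)])
   fix j assume j: "j \<in> J"
   have "q j (i j y) = zr T j" if "y \<in> E Y j" for y using ses_im[OF s j hom_closed[OF D(1,2,7) j that]] that by blast
   then show "im Y (Cmp C Y X T q i) j \<subseteq> {zr T j}" unfolding im_def using cmp_app[OF D(1-3,7,8) j] by auto
  qed
  then show ?thesis
   using Q_cmp_post[OF D(1-3) ri D(8)] Q_zero_morphism[OF D(1,3)] by simp
 qed
 have 2: "\<exists>!u. u \<in> Hom Q W Y \<and> Cmp Q W Y X (cls Y X (Y, Id C Y, i)) u = w"
  if W: "W \<in> Ob C" and w: "w \<in> Hom Q W X" and z: "zero_morphism Q W T (Cmp Q W X T (cls X T (X, Id C X, q)) w)" for W w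
 proof -
  obtain U s' f where w': "roof W X (U, s', f)" "w = cls W X (U, s', f)" by (rule hom_rep[OF W w])
  note U = roofD[OF w'(1)]
  note qf = cmp_hom[OF U(1) D(2,3) U(3) D(8)] and qfa = cmp_app[OF U(1) D(2,3) U(3) D(8)]
  have "small T (im U (Cmp C U X T q f))"
   using z w' Q_cmp_post[OF W D(2,3) w'(1) D(8)] Q_zero_morphism[OF W D(3)] by simp
  then have cK: "cosmall U (ker U T (Cmp C U X T q f))" by (rule cosmall_ker[OF U(1) D(3) qf])
  obtain K k where K: "K \<in> Ob C" "mono K U k" "\<And>j. j \<in> J ==> im K k j = ker U T (Cmp C U X T q f) j"
   using ses_of_ker[OF U(1) D(3) qf] by blast
  note k = monoD(1)[OF K(2)]
  have sk: "sys K U k" by (rule sys_mono[OF K(1) U(1) K(2) cosmall_mono[OF cK]]) (use K(3) in simp)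
  note fk = cmp_hom[OF K(1) U(1) D(2) k U(3)] and fka = cmp_app[OF K(1) U(1) D(2) k U(3)]
  have "\<exists>h\<in>Hom C K Y. \<forall>j\<in>J. \<forall>x\<in>E K j. i j (h j x) = Cmp C K U X f k j x"
  proof (rule mono_lift[OF D(1,2) K(1) D(4) fk])
   fix j x assume j: "j \<in> J" and x: "x \<in> E K j"
   note kx = hom_closed[OF K(1) U(1) k j x]
   have "k j x \<in> ker U T (Cmp C U X T q f) j" using K(3)[OF j] x unfolding im_def by blast
   then have "q j (f j (k j x)) = zr T j" unfolding ker_def using qfa[OF j kx] by simp
   then show "Cmp C K U X f k j x \<in> im Y i j"
    using ses_im[OF s j hom_closed[OF U(1) D(2) U(3) j kx]] fka[OF j x] unfolding im_def by auto
  qed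
  then obtain h where h: "h \<in> Hom C K Y" "\<And>j x. j \<in> J ==> x \<in> E K j ==> i j (h j x) = f j (k j x)" using fka by auto
  let ?s = "Cmp C K U W s' k"
  have ru: "roof W Y (K, ?s, h)" by (rule roofI[OF K(1) sys_comp[OF K(1) U(1) W sk U(2)] h(1)])
  note c = Q_cmp_post[OF W D(1,2) ru D(7)]
  have "small X (devs X (K, ?s, Cmp C K Y X i h) (U, s', f))"
  proof (rule small_mono[OF small_image[OF U(1) D(2) U(3) sysD(2)[OF U(2)]]])
   fix j x assume j: "j \<in> J" and "x \<in> devs X (K, ?s, Cmp C K Y X i h) (U, s', f) j"
   then obtain a b where ab: "a \<in> E K j" "b \<in> E U j" "?s j a = s' j b" "x = df X j (Cmp C K Y X i h j a) (f j b)"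
    unfolding devs_mem by blast
   note ka = hom_closed[OF K(1) U(1) k j ab(1)]
   have x: "x = f j (df U j (k j a) b)"
    using ab(4) cmp_app[OF K(1) D(1,2) h(1) D(7) j ab(1)] h(2)[OF j ab(1)] hom_df[OF U(1) D(2) U(3) j ka ab(2)] by simp
   have "s' j (k j a) = s' j b" using ab(3) cmp_app[OF K(1) U(1) W k sysD(1)[OF U(2)] j ab(1)] by simp
   then have "df U j (k j a) b \<in> ker U W s' j" unfolding ker_def
    using df_E[OF U(1) j ka ab(2)] hom_df[OF U(1) W sysD(1)[OF U(2)] j ka ab(2)] df_eq_zr[OF W j]
     hom_closed[OF U(1) W sysD(1)[OF U(2)] j ab(2)] by simp
   then show "x \<in> f j ` ker U W s' j" using x by blast
  qed
  then have "Cmp Q W Y X (cls Y X (Y, Id C Y, i)) (cls W Y (K, ?s, h)) = w"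
   using c cls_eq[OF W D(2) c(2) w'(1)] w'(2) by simp
  moreover have "u = v" if "u \<in> Hom Q W Y \<and> Cmp Q W Y X (cls Y X (Y, Id C Y, i)) u = w"
   "v \<in> Hom Q W Y \<and> Cmp Q W Y X (cls Y X (Y, Id C Y, i)) v = w" for u v
   using Q_mono_post[OF D(1,2,4), unfolded monomorphism_def Q_Ob] W that by metis
  ultimately show ?thesis using cls_hom[OF W ru] by blast
 qed
 show ?thesis unfolding is_kernel_def Q_Ob using D(1) cls_hom[OF D(1) ri] 1 2 by simp
qed

text \<open>The apex of a roof out of X that is zero on Y has to be divided rather than shrunk: V is
  the quotient of U by the part of the kernel of \<open>q\<close> after \<open>s'\<close> on which
  \<open>f\<close> vanishes. Both \<open>q\<close> after \<open>s'\<close> and \<open>f\<close>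
  descend to V, and the new left leg is in the system because \<open>f\<close> has small image on
  that kernel.\<close>

lemma ses_cokernel_Q: assumes s: "ses Y X T i q"
 shows "is_cokernel Q Y X (cls Y X (Y, Id C Y, i)) T (cls X T (X, Id C X, q))"
proof -
 note D = sesD[OF s]
 note ri = roof_id[OF D(1,7)] and rq = roof_id[OF D(2,8)]
 have 1: "zero_morphism Q Y T (Cmp Q Y X T (cls X T (X, Id C X, q)) (cls Y X (Y, Id C Y, i)))"
  using ses_kernel_Q[OF s] unfolding is_kernel_def by simp
 have 2: "\<exists>!u. u \<in> Hom Q T W \<and> Cmp Q X T W u (cls X T (X, Id C X, q)) = w"
  if W: "W \<in> Ob C" and w: "w \<in> Hom Q X W" and z: "zero_morphism Q Y W (Cmp Q Y X W w (cls Y X (Y, Id C Y, i)))" for W w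
 proof -
  obtain U s' f where w': "roof X W (U, s', f)" "w = cls X W (U, s', f)" by (rule hom_rep[OF D(2) w])
  note U = roofD[OF w'(1)]
  note s'h = sysD(1)[OF U(2)]
  obtain P p r where P: "P \<in> Ob C" "sys P Y p" "r \<in> Hom C P U"
   and Pe: "\<And>j x y. j \<in> J ==> x \<in> E Y j ==> y \<in> E U j ==> i j x = s' j y ==> \<exists>w\<in>E P j. p j w = x \<and> r j w = y"
   and Pc: "Cmp Q Y X W (cls X W (U, s', f)) (cls Y X (Y, Id C Y, i)) = cls Y W (P, Cmp C P Y Y (Id C Y) p, Cmp C P U W f r)"
    "roof Y W (P, Cmp C P Y Y (Id C Y) p, Cmp C P U W f r)"
   by (rule Q_cmp_ex[OF D(1,2) W ri w'(1)]) blast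
  have sm: "small W (im P (Cmp C P U W f r))" using z w' Pc Q_zero_morphism[OF D(1) W Pc(2)] by simp
  note qs = cmp_hom[OF U(1) D(2,3) s'h D(8)] and qsa = cmp_app[OF U(1) D(2,3) s'h D(8)]
  obtain K k where K: "K \<in> Ob C" "mono K U k" "\<And>j. j \<in> J ==> im K k j = ker U T (Cmp C U X T q s') j"
   using ses_of_ker[OF U(1) D(3) qs] by blast
  note k = monoD(1)[OF K(2)]
  note fk = cmp_hom[OF K(1) U(1) W k U(3)] and fka = cmp_app[OF K(1) U(1) W k U(3)]
  have kk: "q j (s' j (k j x)) = zr T j" if "j \<in> J" "x \<in> E K j" for j x
  proof -
   have "k j x \<in> ker U T (Cmp C U X T q s') j" using K(3)[OF that(1)] that(2) unfolding im_def by blast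
   then show ?thesis unfolding ker_def using qsa[OF that(1)] by auto
  qed
  have sfk: "small W (im K (Cmp C K U W f k))"
  proof (rule small_mono[OF sm])
   fix j y assume j: "j \<in> J" and "y \<in> im K (Cmp C K U W f k) j"
   then obtain x where x: "x \<in> E K j" "y = f j (k j x)" using fka[OF j] unfolding im_def by auto
   note kx = hom_closed[OF K(1) U(1) k j x(1)]
   obtain v where v: "v \<in> E Y j" "s' j (k j x) = i j v"
    using ses_im[OF s j hom_closed[OF U(1) D(2) s'h j kx]] kk[OF j x(1)] by blast
   obtain u where "u \<in> E P j" "r j u = k j x" using Pe[OF j v(1) kx] v(2) by auto
   then show "y \<in> im P (Cmp C P U W f r) j" using cmp_app[OF P(1) U(1) W P(3) U(3) j] x unfolding im_def by force
  qed
  then have cK: "cosmall K (ker K W (Cmp C K U W f k))" by (rule cosmall_ker[OF K(1) W fk])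
  obtain K' k' where K': "K' \<in> Ob C" "mono K' K k'" "\<And>j. j \<in> J ==> im K' k' j = ker K W (Cmp C K U W f k) j"
   using ses_of_ker[OF K(1) W fk] by blast
  note k' = monoD(1)[OF K'(2)]
  obtain V e where sV: "ses K' U V (Cmp C K' K U k k') e" by (rule ses_of_mono[OF K'(1) U(1) mono_cmp[OF K'(1) K(1) U(1) K'(2) K(2)]])
  note DV = sesD[OF sV]
  have ez: "e j x = zr V j \<longleftrightarrow> q j (s' j x) = zr T j \<and> f j x = zr W j" if j: "j \<in> J" and x: "x \<in> E U j" for j x
  proof -
   have "e j x = zr V j \<longleftrightarrow> (\<exists>y\<in>E K' j. x = k j (k' j y))"
    using ses_im[OF sV j x] cmp_app[OF K'(1) K(1) U(1) k' k j] by auto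
   also have "\<dots> \<longleftrightarrow> (\<exists>y\<in>im K' k' j. x = k j y)" unfolding im_def by blast
   also have "\<dots> \<longleftrightarrow> (\<exists>y\<in>E K j. f j (k j y) = zr W j \<and> x = k j y)"
    unfolding K'(3)[OF j] ker_def using fka[OF j] by auto
   also have "\<dots> \<longleftrightarrow> x \<in> im K k j \<and> f j x = zr W j" unfolding im_def by blast
   also have "\<dots> \<longleftrightarrow> q j (s' j x) = zr T j \<and> f j x = zr W j" unfolding K(3)[OF j] ker_def using qsa[OF j x] x by simp
   finally show ?thesis .
  qed
  have "\<exists>t\<in>Hom C V T. \<forall>j\<in>J. \<forall>x\<in>E U j. t j (e j x) = Cmp C U X T q s' j x"
   by (rule epi_desc[OF U(1) DV(3) D(3) DV(5) qs]) (use ez qsa in simp)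
  then obtain t where t: "t \<in> Hom C V T" "\<And>j x. j \<in> J ==> x \<in> E U j ==> t j (e j x) = q j (s' j x)" using qsa by auto
  have "\<exists>g\<in>Hom C V W. \<forall>j\<in>J. \<forall>x\<in>E U j. g j (e j x) = f j x"
   by (rule epi_desc[OF U(1) DV(3) W DV(5) U(3)]) (use ez in simp)
  then obtain g where g: "g \<in> Hom C V W" "\<And>j x. j \<in> J ==> x \<in> E U j ==> g j (e j x) = f j x" by blast
  have "sys V T t" unfolding sys_def
  proof (intro conjI t(1))
   note ek = cmp_hom[OF K(1) U(1) DV(3) k DV(8)] and eka = cmp_app[OF K(1) U(1) DV(3) k DV(8)]
   have "small V (im K (Cmp C K U V e k))"
   proof (rule small_extend[OF K(1) DV(3) ek cK], rule small_zero[OF DV(3)])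
    fix j assume j: "j \<in> J"
    have "e j (k j x) = zr V j" if "x \<in> E K j" "f j (k j x) = zr W j" for x
     using ez[OF j hom_closed[OF K(1) U(1) k j that(1)]] that kk[OF j that(1)] by simp
    then show "Cmp C K U V e k j ` ker K W (Cmp C K U W f k) j \<subseteq> {zr V j}"
     unfolding ker_def using eka[OF j] fka[OF j] by auto
   qed
   then show "small V (ker V T t)"
   proof (rule small_mono)
    fix j v assume j: "j \<in> J" and "v \<in> ker V T t j"
    then have v: "v \<in> E V j" "t j v = zr T j" unfolding ker_def by auto
    obtain x where x: "x \<in> E U j" "v = e j x" using epiD(2)[OF DV(5) j v(1)] by blast
    have "x \<in> im K k j" unfolding K(3)[OF j] ker_def using x v t(2)[OF j x(1)] qsa[OF j x(1)] by simp
    then obtain y where "y \<in> E K j" "x = k j y" unfolding im_def by blast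
    then show "v \<in> im K (Cmp C K U V e k) j" unfolding im_def using x eka[OF j] by (metis imageI)
   qed
   have "cosmall T (\<lambda>j. q j ` im U s' j)"
    by (rule cosmall_image[OF D(2,3,8) _ sysD(3)[OF U(2)]], rule cosmall_all[OF D(3)])
     (use epiD(2)[OF D(5)] in \<open>auto simp: im_def\<close>)
   then show "cosmall T (im V t)"
   proof (rule cosmall_mono)
    fix j y assume j: "j \<in> J" and "y \<in> q j ` im U s' j"
    then obtain x where x: "x \<in> E U j" "y = q j (s' j x)" unfolding im_def by blast
    then show "y \<in> im V t j" unfolding im_def using t(2)[OF j x(1)] hom_closed[OF DV(2,3,8) j x(1)] by (metis imageI)
   qed
  qed
  then have ru: "roof T W (V, t, g)" by (rule roofI[OF DV(3) _ g(1)])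
  have qe: "Cmp C U X T q s' = Cmp C U V T t e"
   by (rule hom_ext[OF U(1) D(3) qs cmp_hom[OF U(1) DV(3) D(3) DV(8) t(1)]])
    (use qsa cmp_app[OF U(1) DV(3) D(3) DV(8) t(1)] t(2) in simp)
  have ge: "Cmp C U V W g e = f"
   by (rule hom_ext[OF U(1) W cmp_hom[OF U(1) DV(3) W DV(8) g(1)] U(3)])
    (use cmp_app[OF U(1) DV(3) W DV(8) g(1)] g(2) in simp)
  have "Cmp Q X T W (cls T W (V, t, g)) (cls X T (X, Id C X, q)) = w"
   using Q_cmp(1)[OF D(2,3) W rq ru U(1,2) DV(8) qe] ge cmp_id_l[OF U(1) D(2) s'h] w'(2) by simp
  \<comment> \<open>Both roofs are pulled back along \<open>q\<close>. Since \<open>q\<close> is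
    onto, every difference of the two roofs already occurs for the pullbacks.\<close>
  moreover have "u = v" if uu: "u \<in> Hom Q T W \<and> Cmp Q X T W u (cls X T (X, Id C X, q)) = w"
   and vv: "v \<in> Hom Q T W \<and> Cmp Q X T W v (cls X T (X, Id C X, q)) = w" for u v
  proof -
   obtain V1 t1 g1 where u': "roof T W (V1, t1, g1)" "u = cls T W (V1, t1, g1)" using hom_rep[OF D(3)] uu by metis
   obtain V2 t2 g2 where v': "roof T W (V2, t2, g2)" "v = cls T W (V2, t2, g2)" using hom_rep[OF D(3)] vv by metis
   note V1 = roofD[OF u'(1)] and V2 = roofD[OF v'(1)]
   obtain P1 p1 r1 where P1: "P1 \<in> Ob C" "sys P1 X p1" "r1 \<in> Hom C P1 V1"
    and e1: "\<And>j x y. j \<in> J ==> x \<in> E X j ==> y \<in> E V1 j ==> q j x = t1 j y ==> \<exists>w\<in>E P1 j. p1 j w = x \<and> r1 j w = y"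
    and c1: "Cmp Q X T W (cls T W (V1, t1, g1)) (cls X T (X, Id C X, q)) = cls X W (P1, Cmp C P1 X X (Id C X) p1, Cmp C P1 V1 W g1 r1)"
     "roof X W (P1, Cmp C P1 X X (Id C X) p1, Cmp C P1 V1 W g1 r1)"
    by (rule Q_cmp_ex[OF D(2,3) W rq u'(1)]) blast
   obtain P2 p2 r2 where P2: "P2 \<in> Ob C" "sys P2 X p2" "r2 \<in> Hom C P2 V2"
    and e2: "\<And>j x y. j \<in> J ==> x \<in> E X j ==> y \<in> E V2 j ==> q j x = t2 j y ==> \<exists>w\<in>E P2 j. p2 j w = x \<and> r2 j w = y"
    and c2: "Cmp Q X T W (cls T W (V2, t2, g2)) (cls X T (X, Id C X, q)) = cls X W (P2, Cmp C P2 X X (Id C X) p2, Cmp C P2 V2 W g2 r2)"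
     "roof X W (P2, Cmp C P2 X X (Id C X) p2, Cmp C P2 V2 W g2 r2)"
    by (rule Q_cmp_ex[OF D(2,3) W rq v'(1)]) blast
   have i1: "Cmp C P1 X X (Id C X) p1 = p1" "Cmp C P2 X X (Id C X) p2 = p2"
    using cmp_id_l[OF P1(1) D(2) sysD(1)[OF P1(2)]] cmp_id_l[OF P2(1) D(2) sysD(1)[OF P2(2)]] by auto
   have d: "small W (devs W (P1, p1, Cmp C P1 V1 W g1 r1) (P2, p2, Cmp C P2 V2 W g2 r2))"
    using cls_eq[OF D(2) W c1(2) c2(2)] c1(1) c2(1) uu vv u' v' i1 by simp
   have "small W (devs W (V1, t1, g1) (V2, t2, g2))"
   proof (rule small_mono[OF d])
    fix j x assume j: "j \<in> J" and "x \<in> devs W (V1, t1, g1) (V2, t2, g2) j"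
    then obtain a b where ab: "a \<in> E V1 j" "b \<in> E V2 j" "t1 j a = t2 j b" "x = df W j (g1 j a) (g2 j b)" unfolding devs_mem by blast
    obtain y where y: "y \<in> E X j" "t1 j a = q j y" using epiD(2)[OF D(5) j hom_closed[OF V1(1) D(3) sysD(1)[OF V1(2)] j ab(1)]] by blast
    obtain w1 where w1: "w1 \<in> E P1 j" "p1 j w1 = y" "r1 j w1 = a" using e1[OF j y(1) ab(1)] y by auto
    obtain w2 where w2: "w2 \<in> E P2 j" "p2 j w2 = y" "r2 j w2 = b" using e2[OF j y(1) ab(2)] y ab by auto
    show "x \<in> devs W (P1, p1, Cmp C P1 V1 W g1 r1) (P2, p2, Cmp C P2 V2 W g2 r2) j" unfolding devs_mem
     by (rule exI[of _ w1], rule exI[of _ w2])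
      (use w1 w2 ab cmp_app[OF P1(1) V1(1) W P1(3) V1(3) j w1(1)] cmp_app[OF P2(1) V2(1) W P2(3) V2(3) j w2(1)] in simp)
   qed
   then show "u = v" using cls_eq[OF D(3) W u'(1) v'(1)] u' v' by simp
  qed
  ultimately show ?thesis using cls_hom[OF D(3) ru] by blast
 qed
 show ?thesis unfolding is_cokernel_def Q_Ob using D(3) cls_hom[OF D(2) rq] 1 2 by simp
qed

end

section \<open>Simple objects of the quotient and the characterisation of finite length\<close>

context serre_class begin

text \<open>The inclusion of Y is a monomorphism in the quotient category. If it has an inverse roof
  (V, t, g), then \<open>i\<close> after \<open>g\<close> agrees with \<open>t\<close> up to small
  elements; \<open>q\<close> kills the former, so \<open>q\<close> is small on the cosmall image of
  \<open>t\<close>, and R is small.\<close>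

lemma simple_QD:
 assumes si: "simple_object Q T" and s: "ses Y T R i q"
 shows "R \<in> S \<or> Y \<in> S"
proof -
 note D = sesD[OF s]
 note ri = roof_id[OF D(1,7)]
 have "zero_object Q Y \<or> isomorphism Q Y T (cls Y T (Y, Id C Y, i))"
  using si Q_mono_post[OF D(1,2,4)] D(1) unfolding simple_object_def Q_Ob by blast
 then show ?thesis
 proof
  assume "zero_object Q Y"
  then show ?thesis using Q_zero_object[OF D(1)] by simp
 next
  assume "isomorphism Q Y T (cls Y T (Y, Id C Y, i))"
  then obtain c where c: "c \<in> Hom Q T Y" "Cmp Q T Y T (cls Y T (Y, Id C Y, i)) c = Id Q T"
   unfolding isomorphism_def by blast
  obtain V t g where c': "roof T Y (V, t, g)" "c = cls T Y (V, t, g)" by (rule hom_rep[OF D(2) c(1)])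
  note V = roofD[OF c'(1)]
  note t = sysD(1)[OF V(2)]
  note cc = Q_cmp_post[OF D(2,1,2) c'(1) D(7)]
  have d: "small T (devs T (V, t, Cmp C V Y T i g) (T, Id C T, Id C T))"
   using cls_eq[OF D(2,2) cc(2) roof_id[OF D(2) id_hom[OF D(2)]]] cc(1) c(2) c'(2) Q_Id by simp
  have "small R (im T q)"
  proof (rule small_extend[OF D(2,3,8) sysD(3)[OF V(2)]], rule small_mono[OF small_neg[OF D(3) small_image[OF D(2,3,8) d]]])
   fix j y assume j: "j \<in> J" and "y \<in> q j ` im V t j"
   then obtain v where v: "v \<in> E V j" "y = q j (t j v)" unfolding im_def by blast
   note tv = hom_closed[OF V(1) D(2) t j v(1)] and gv = hom_closed[OF V(1) D(1) V(3) j v(1)]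
   note igv = hom_closed[OF D(1,2,7) j gv]
   let ?d = "df T j (i j (g j v)) (t j v)"
   have "?d \<in> devs T (V, t, Cmp C V Y T i g) (T, Id C T, Id C T) j" unfolding devs_mem
    by (rule exI[of _ v], rule exI[of _ "t j v"])
     (use v tv id_app[OF D(2) j tv] cmp_app[OF V(1) D(1,2) V(3) D(7) j v(1)] in simp)
   moreover have "y = df R j (zr R j) (q j ?d)"
   proof -
    have "q j (i j (g j v)) = zr R j" using ses_im[OF s j igv] gv by blast
    then have "q j ?d = df R j (zr R j) y" using hom_df[OF D(2,3,8) j igv tv] v by simp
    moreover have y: "y \<in> E R j" using v hom_closed[OF D(2,3,8) j tv] by simp
    ultimately show ?thesis using df_swap[OF D(3) j zr_E[OF D(3) j] y] df_zr[OF D(3) j y] by simp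
   qed
   ultimately show "y \<in> df R j (zr R j) ` q j ` devs T (V, t, Cmp C V Y T i g) (T, Id C T, Id C T) j" by blast
  qed
  then have "small R (E R)" by (rule small_mono) (use epiD(2)[OF D(5)] in \<open>auto simp: im_def\<close>)
  then show ?thesis using small_ob[OF D(3)] by blast
 qed
qed

lemma small_cosmall_ob:
 assumes X: "X \<in> Ob C" and c: "cosmall X N" and s: "small X N" shows "X \<in> S"
 using S_mid'[OF X s c] .

text \<open>For a monomorphism with roof (U, s, f), the kernel of \<open>f\<close> is small. If T
  modulo the image of \<open>f\<close> is in \<open>S\<close>, then \<open>f\<close> belongs to the
  system and the roof with legs exchanged is an inverse; if the image is in \<open>S\<close>, so are
  U and Y.\<close>

lemma simple_QI:
 assumes T: "T \<in> Ob C" "T \<notin> S" and dich: "\<And>Y R i q. ses Y T R i q ==> R \<in> S \<or> Y \<in> S"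
 shows "simple_object Q T"
 unfolding simple_object_def Q_Ob
proof (intro conjI ballI allI impI)
 show "T \<in> Ob C" by (rule T(1))
 show "\<not> zero_object Q T" using Q_zero_object[OF T(1)] T(2) by simp
 fix Y c assume Y: "Y \<in> Ob C" and m: "monomorphism Q Y T c"
 have c: "c \<in> Hom Q Y T" using m unfolding monomorphism_def by blast
 obtain U s f where c': "roof Y T (U, s, f)" "c = cls Y T (U, s, f)" by (rule hom_rep[OF Y c])
 note U = roofD[OF c'(1)]
 note s = sysD(1)[OF U(2)]
 obtain K k where K: "K \<in> Ob C" "mono K U k" "\<And>j. j \<in> J ==> im K k j = ker U T f j"
  using ses_of_ker[OF U(1) T(1) U(3)] by blast
 note k = monoD(1)[OF K(2)]
 note sk = cmp_hom[OF K(1) U(1) Y k s] and ska = cmp_app[OF K(1) U(1) Y k s]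
 \<comment> \<open>The kernel of \<open>f\<close>, mapped to Y by \<open>s\<close> or by zero, gives
   the same composite with \<open>c\<close>; cancelling \<open>c\<close> shows that its image in Y
   is small.\<close>
 obtain o1 where o1: "o1 \<in> Hom C K Y" "\<And>j x. j \<in> J ==> x \<in> E K j ==> o1 j x = zr Y j" using zero_hom[OF K(1) Y] by blast
 obtain o2 where o2: "o2 \<in> Hom C K U" "\<And>j x. j \<in> J ==> x \<in> E K j ==> o2 j x = zr U j" using zero_hom[OF K(1) U(1)] by blast
 note ra = roof_id[OF K(1) sk] and rb = roof_id[OF K(1) o1(1)]
 have e1: "Cmp C K K Y (Cmp C K U Y s k) (Id C K) = Cmp C K U Y s k" by (rule cmp_id_r[OF K(1) Y sk])
 have e2: "Cmp C K K Y o1 (Id C K) = Cmp C K U Y s o2"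
  unfolding cmp_id_r[OF K(1) Y o1(1)]
  by (rule hom_ext[OF K(1) Y o1(1) cmp_hom[OF K(1) U(1) Y o2(1) s]])
   (use o1(2) o2(2) cmp_app[OF K(1) U(1) Y o2(1) s] hom_zr[OF U(1) Y s] in simp)
 have e3: "Cmp C K U T f k = Cmp C K U T f o2"
 proof (rule hom_ext[OF K(1) T(1) cmp_hom[OF K(1) U(1) T(1) k U(3)] cmp_hom[OF K(1) U(1) T(1) o2(1) U(3)]])
  fix j x assume j: "j \<in> J" and x: "x \<in> E K j"
  have "k j x \<in> ker U T f j" using K(3)[OF j] x unfolding im_def by blast
  then show "Cmp C K U T f k j x = Cmp C K U T f o2 j x" unfolding ker_def
   using cmp_app[OF K(1) U(1) T(1) k U(3) j x] cmp_app[OF K(1) U(1) T(1) o2(1) U(3) j x] o2(2)[OF j x]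
    hom_zr[OF U(1) T(1) U(3) j] by simp
 qed
 have "Cmp Q K Y T c (cls K Y (K, Id C K, Cmp C K U Y s k)) = Cmp Q K Y T c (cls K Y (K, Id C K, o1))"
  unfolding c'(2) using Q_cmp(1)[OF K(1) Y T(1) ra c'(1) K(1) sys_id[OF K(1)] k e1]
   Q_cmp(1)[OF K(1) Y T(1) rb c'(1) K(1) sys_id[OF K(1)] o2(1) e2] e3 by simp
 then have "cls K Y (K, Id C K, Cmp C K U Y s k) = cls K Y (K, Id C K, o1)"
  using m K(1) cls_hom[OF K(1) ra] cls_hom[OF K(1) rb] unfolding monomorphism_def Q_Ob by blast
 then have "small Y (devs Y (K, Id C K, Cmp C K U Y s k) (K, Id C K, o1))" using cls_eq[OF K(1) Y ra rb] by simp
 then have smk: "small Y (im K (Cmp C K U Y s k))"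
 proof (rule small_mono)
  fix j y assume j: "j \<in> J" and "y \<in> im K (Cmp C K U Y s k) j"
  then obtain x where x: "x \<in> E K j" "y = Cmp C K U Y s k j x" unfolding im_def by blast
  then have "y = df Y j y (o1 j x)" using o1(2)[OF j x(1)] df_zr[OF Y j hom_closed[OF K(1) Y sk j x(1)]] by simp
  then show "y \<in> devs Y (K, Id C K, Cmp C K U Y s k) (K, Id C K, o1) j" unfolding devs_mem using x by metis
 qed
 have skU: "small U (ker U T f)"
 proof (rule small_mono[OF small_preimage[OF U(1) Y s sysD(2)[OF U(2)] smk]])
  fix j x assume j: "j \<in> J" and "x \<in> ker U T f j"
  then obtain y where "y \<in> E K j" "x = k j y" using K(3)[OF j] unfolding im_def by blast
  then show "x \<in> {x \<in> E U j. s j x \<in> im K (Cmp C K U Y s k) j}"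
   using ska[OF j] hom_closed[OF K(1) U(1) k j] unfolding im_def by (auto simp: image_iff)
 qed
 obtain I i e where I: "I \<in> Ob C" "mono I T i" "epi U I e" "\<And>j. j \<in> J ==> im I i j = im U f j"
  using image_factor[OF U(1) T(1) U(3)] by metis
 obtain R q where sI: "ses I T R i q" by (rule ses_of_mono[OF I(1) T(1) I(2)])
 note D = sesD[OF sI]
 have "R \<in> S \<or> I \<in> S" by (rule dich[OF sI])
 then show "zero_object Q Y \<or> isomorphism Q Y T c"
 proof
  assume IS: "I \<in> S"
  have "small T (im U f)" by (rule small_mono[OF small_image_all[OF IS T(1) D(7)]]) (use I(4) in simp)
  then have "small U (\<lambda>j. {x \<in> E U j. f j x \<in> im U f j})" by (rule small_preimage[OF U(1) T(1) U(3) skU])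
  then have "small U (E U)" by (rule small_mono) (auto simp: im_def)
  then have "U \<in> S" using small_ob[OF U(1)] by blast
  then have "Y \<in> S" using small_cosmall_ob[OF Y sysD(3)[OF U(2)]] small_image_all[OF _ Y s] by blast
  then show ?thesis using Q_zero_object[OF Y] by simp
 next
  assume RS: "R \<in> S"
  have "cosmall T (im U f)" unfolding cosmall_def
   by (rule bexI[OF _ RS], rule bexI[OF _ D(8)]) (use D(6) I(4) in simp)
  then have sf: "sys U T f" unfolding sys_def using U(3) skU by blast
  have ri: "roof T Y (U, f, s)" by (rule roofI[OF U(1) sf s])
  note i1 = cmp_id_r[OF U(1) Y s] and i2 = cmp_id_r[OF U(1) T(1) U(3)]
  have "Cmp Q Y T Y (cls T Y (U, f, s)) c = cls Y Y (U, s, s)"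
   using Q_cmp(1)[OF Y T(1) Y c'(1) ri U(1) sys_id[OF U(1)] id_hom[OF U(1)] refl] i1 c'(2) by simp
  moreover have "cls Y Y (U, s, s) = Id Q Y" unfolding Q_Id
  proof (subst cls_eq[OF Y Y roofI[OF U(1,2) s] roof_id[OF Y id_hom[OF Y]]], rule small_zero[OF Y])
   fix j assume j: "j \<in> J"
   show "devs Y (U, s, s) (Y, Id C Y, Id C Y) j \<subseteq> {zr Y j}"
    using df_eq_zr[OF Y j] hom_closed[OF U(1) Y s j] id_app[OF Y j] by (auto simp: devs_def)
  qed
  moreover have "Cmp Q T Y T c (cls T Y (U, f, s)) = cls T T (U, f, f)"
   using Q_cmp(1)[OF T(1) Y T(1) ri c'(1) U(1) sys_id[OF U(1)] id_hom[OF U(1)] refl] i2 c'(2) by simp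
  moreover have "cls T T (U, f, f) = Id Q T" unfolding Q_Id
  proof (subst cls_eq[OF T(1) T(1) roofI[OF U(1) sf U(3)] roof_id[OF T(1) id_hom[OF T(1)]]], rule small_zero[OF T(1)])
   fix j assume j: "j \<in> J"
   show "devs T (U, f, f) (T, Id C T, Id C T) j \<subseteq> {zr T j}"
    using df_eq_zr[OF T(1) j] hom_closed[OF U(1) T(1) U(3) j] id_app[OF T(1) j] by (auto simp: devs_def)
  qed
  ultimately have "isomorphism Q Y T c" unfolding isomorphism_def using c cls_hom[OF T(1) ri] by auto
  then show ?thesis ..
 qed
qed

lemma lev_S: "S \<subseteq> lev S n"
proof (cases n)
 case (Suc m)
 have "Qq \<in> S" if "X \<in> S" "ses Y X Qq i q" for X Y Qq i q
  using S_quot[OF that(1)] sesD[OF that(2)] by blast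
 then show ?thesis using Suc S_Ob by auto
qed simp

text \<open>Induction on the composition series, whose morphisms are roofs. All estimates are made
  relative to the larger Serre class \<open>BD\<close>, which contains both Y and T. It then
  contains the apex V of the roof onto T, and hence X, in which the image of V is cosmall.\<close>

lemma finite_length_BD:
 assumes "finite_length Q X"
 shows "X \<in> BD"
 using assms
proof induction
 case (zero X)
 then have "X \<in> Ob C" using conjunct1[OF zero[unfolded zero_object_def]] Q_Ob by simp
 then have "X \<in> lev S 0" using zero Q_zero_object by simp
 then show ?case unfolding BD_def by blast
next
 case (step Y X T f g)
 interpret B: serre_class C J G BD by (rule serre_BD)
 have S_BD: "S \<subseteq> BD" unfolding BD_def using lev_S by blast
 have sB: "B.small Z N" if "small Z N" for Z N using that S_BD unfolding small_def B.small_def by blast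
 have cB: "B.cosmall Z N" if "cosmall Z N" for Z N using that S_BD unfolding cosmall_def B.cosmall_def by blast
 have Y: "Y \<in> Ob C" using step.IH B.S_Ob by blast
 have X: "X \<in> Ob C" using step.hyps Q_Ob by simp
 have T: "T \<in> Ob C" using step.hyps(3) unfolding simple_object_def Q_Ob by blast
 obtain U s f0 where f: "roof Y X (U, s, f0)" "f = cls Y X (U, s, f0)" by (rule hom_rep[OF Y step.hyps(4)])
 obtain V t g0 where g: "roof X T (V, t, g0)" "g = cls X T (V, t, g0)" by (rule hom_rep[OF X step.hyps(5)])
 note U = roofD[OF f(1)] and V = roofD[OF g(1)]
 note s = sysD(1)[OF U(2)] and t = sysD(1)[OF V(2)]
 have TB: "T \<in> BD"
 proof -
  have "T \<in> lev S (Suc 0)" unfolding lev.simps using simple_QD[OF step.hyps(3)] T by blast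
  then show ?thesis unfolding BD_def by blast
 qed
 have UB: "U \<in> BD"
 proof -
  have "B.small U (\<lambda>j. {x \<in> E U j. s j x \<in> E Y j})"
   by (rule B.small_preimage[OF U(1) Y s sB[OF sysD(2)[OF U(2)]] B.small_self[OF step.IH]])
  then have "B.small U (E U)" by (rule B.small_mono) (use hom_closed[OF U(1) Y s] in simp)
  then show ?thesis using B.small_ob[OF U(1)] by blast
 qed
 obtain K k where K: "K \<in> Ob C" "mono K V k" "\<And>j. j \<in> J ==> im K k j = ker V T g0 j"
  using ses_of_ker[OF V(1) T V(3)] by blast
 note k = monoD(1)[OF K(2)]
 note tk = cmp_hom[OF K(1) V(1) X k t] and tka = cmp_app[OF K(1) V(1) X k t]
 note rw = roof_id[OF K(1) tk]
 \<comment> \<open>The kernel of \<open>g0\<close>, mapped to X by \<open>t\<close>, is killed by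
   \<open>g\<close>, so in the quotient category it factors through Y.\<close>
 have gw: "zero_morphism Q K T (Cmp Q K X T g (cls K X (K, Id C K, Cmp C K V X t k)))"
 proof -
  have e: "Cmp C K K X (Cmp C K V X t k) (Id C K) = Cmp C K V X t k" by (rule cmp_id_r[OF K(1) X tk])
  note c = Q_cmp[OF K(1) X T rw g(1) K(1) sys_id[OF K(1)] k e]
  have "small T (im K (Cmp C K V T g0 k))"
  proof (rule small_zero[OF T])
   fix j assume j: "j \<in> J"
   have "k j x \<in> ker V T g0 j" if "x \<in> E K j" for x using K(3)[OF j] that unfolding im_def by blast
   then show "im K (Cmp C K V T g0 k) j \<subseteq> {zr T j}" unfolding im_def ker_def
    using cmp_app[OF K(1) V(1) T k V(3) j] by auto
  qed
  then show ?thesis using c Q_zero_morphism[OF K(1) T c(2)] g(2) by simp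
 qed
 obtain u where u: "u \<in> Hom Q K Y" "Cmp Q K Y X f u = cls K X (K, Id C K, Cmp C K V X t k)"
 proof -
  have "\<exists>!u. u \<in> Hom Q K Y \<and> Cmp Q K Y X f u = cls K X (K, Id C K, Cmp C K V X t k)"
   using step.hyps(6) K(1) cls_hom[OF K(1) rw] gw unfolding is_kernel_def Q_Ob by simp
  then show thesis using that by blast
 qed
 obtain P p r where u': "roof K Y (P, p, r)" "u = cls K Y (P, p, r)" by (rule hom_rep[OF K(1) u(1)])
 note P = roofD[OF u'(1)]
 obtain W a b where W: "W \<in> Ob C" "b \<in> Hom C W U"
  and cc: "Cmp Q K Y X (cls Y X (U, s, f0)) (cls K Y (P, p, r)) = cls K X (W, Cmp C W P K p a, Cmp C W U X f0 b)"
   "roof K X (W, Cmp C W P K p a, Cmp C W U X f0 b)"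
  by (rule Q_cmp_ex[OF K(1) Y X u'(1) f(1)]) blast
 let ?a = "Cmp C W P K p a" and ?b = "Cmp C W U X f0 b"
 note W' = roofD[OF cc(2)]
 have d: "small X (devs X (W, ?a, ?b) (K, Id C K, Cmp C K V X t k))"
  using cls_eq[OF K(1) X cc(2) rw] cc(1) u u' f by simp
 have bU: "B.small X (im W ?b)"
 proof (rule B.small_mono[OF B.small_image_all[OF UB X U(3)]])
  fix j y assume j: "j \<in> J" and "y \<in> im W ?b j"
  then show "y \<in> im U f0 j" using cmp_app[OF W(1) U(1) X W(2) U(3) j] hom_closed[OF W(1) U(1) W(2) j] unfolding im_def by auto
 qed
 have stk: "B.small X (im K (Cmp C K V X t k))"
 proof (rule B.small_extend[OF K(1) X tk cB[OF sysD(3)[OF W'(2)]]], rule B.small_mono[OF B.small_df[OF X bU sB[OF d]]])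
  fix j y assume j: "j \<in> J" and "y \<in> Cmp C K V X t k j ` im W ?a j"
  then obtain w where w: "w \<in> E W j" "y = Cmp C K V X t k j (?a j w)" unfolding im_def by blast
  note aw = hom_closed[OF W(1) K(1) sysD(1)[OF W'(2)] j w(1)] and bw = hom_closed[OF W(1) X W'(3) j w(1)]
  have y: "y \<in> E X j" using hom_closed[OF K(1) X tk j aw] w by simp
  have dd: "df X j (?b j w) y \<in> devs X (W, ?a, ?b) (K, Id C K, Cmp C K V X t k) j" unfolding devs_mem
   by (rule exI[of _ w], rule exI[of _ "?a j w"]) (use w aw id_app[OF K(1) j aw] in simp)
  \<comment> \<open>\<open>?b j w\<close> comes from U, and the remainder is a difference of
    equivalent roofs.\<close>
  have "y = df X j (?b j w) (df X j (?b j w) y)"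
  proof -
   interpret abelian_group "G X j" by (rule grp[OF X j])
   show ?thesis using bw y by (simp add: minus_eq minus_add r_neg1 r_neg2 a_assoc[symmetric] r_neg)
  qed
  then show "y \<in> {df X j n m | n m. n \<in> im W ?b j \<and> m \<in> devs X (W, ?a, ?b) (K, Id C K, Cmp C K V X t k) j \<and> n \<in> E X j \<and> m \<in> E X j}"
   using dd bw df_E[OF X j bw y] w(1) unfolding im_def by blast
 qed
 have kg: "B.small V (ker V T g0)"
 proof (rule B.small_mono[OF B.small_preimage[OF V(1) X t sB[OF sysD(2)[OF V(2)]] stk]])
  fix j x assume j: "j \<in> J" and "x \<in> ker V T g0 j"
  then obtain y where "y \<in> E K j" "x = k j y" using K(3)[OF j] unfolding im_def by blast
  then show "x \<in> {x \<in> E V j. t j x \<in> im K (Cmp C K V X t k) j}"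
   using tka[OF j] hom_closed[OF K(1) V(1) k j] unfolding im_def by (auto simp: image_iff)
 qed
 have VB: "V \<in> BD"
 proof -
  have "B.small V (\<lambda>j. {x \<in> E V j. g0 j x \<in> E T j})"
   by (rule B.small_preimage[OF V(1) T V(3) kg B.small_self[OF TB]])
  then have "B.small V (E V)" by (rule B.small_mono) (use hom_closed[OF V(1) T V(3)] in simp)
  then show ?thesis using B.small_ob[OF V(1)] by blast
 qed
 show "X \<in> BD"
  by (rule B.small_cosmall_ob[OF X cB[OF sysD(3)[OF V(2)]] B.small_image_all[OF VB X t]])
qed

lemma finite_length_step_Q:
 assumes fl: "finite_length Q Y" and s: "ses Y X T i q" and si: "simple_object Q T"
 shows "finite_length Q X"
proof -
 note D = sesD[OF s]
 show ?thesis
  by (rule finite_length.step[OF fl _ si cls_hom[OF D(1) roof_id[OF D(1,7)]] cls_hom[OF D(2) roof_id[OF D(2,8)]]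
     ses_kernel_Q[OF s] ses_cokernel_Q[OF s]]) (use D(2) Q_Ob in simp)
qed

text \<open>If the bound for X cannot be lowered, there is a subobject Y with quotient T outside
  \<open>S\<close> whose own bound cannot be lowered either. Any Z between Y and X with X/Z outside
  \<open>S\<close> then has Z/Y in \<open>S\<close>, so T is simple in the quotient, while Y has
  finite length by induction.\<close>

lemma lev_finite_length: "X \<in> lev S n ==> finite_length Q X"
proof (induction n arbitrary: X)
 case 0
 then have "X \<in> S" by simp
 then have "zero_object Q X" using Q_zero_object[OF S_Ob] by simp
 then show ?case by (rule finite_length.zero)
next
 case (Suc n)
 have X: "X \<in> Ob C" using Suc.prems lev_Ob by blast
 show ?case
 proof (cases "X \<in> lev S n")
  case True
  then show ?thesis by (rule Suc.IH)
 next
  case False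
  \<comment> \<open>For n = 0 the subobject Y is a zero object and T is X itself; the last
    alternative then plays the part of the second.\<close>
  obtain Y T i q where s: "ses Y X T i q" and TS: "T \<notin> S"
   and dich: "\<And>Z R k r. ses Z X R k r ==> R \<in> S \<or> (\<forall>W l e. ses Y Z W l e --> W \<in> S) \<or> n = 0 \<and> Z \<in> S"
  proof (cases n)
   case 0
   obtain Z i where s: "ses Z X X i (Id C X)" "Z \<in> S" by (rule ses_self_zero[OF X])
   have d: "R \<in> S \<or> Z' \<in> S" if "ses Z' X R k r" for Z' R k r using Suc.prems that 0 by auto
   show thesis
   proof (rule that[OF s(1)])
    show "X \<notin> S" using False 0 by simp
    fix Z' R k r assume "ses Z' X R k r"
    then show "R \<in> S \<or> (\<forall>W l e. ses Z Z' W l e --> W \<in> S) \<or> n = 0 \<and> Z' \<in> S" using d 0 by blast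
   qed
  next
   case n: (Suc m)
   then obtain Y T i q where s: "ses Y X T i q" "T \<notin> S" "Y \<notin> lev S m" using False X by auto
   have "R \<in> S \<or> (\<forall>W l e. ses Y Z W l e --> W \<in> S)" if "ses Z X R k r" for Z R k r
   proof -
    have "R \<in> S \<or> Z \<in> lev S (Suc m)" using Suc.prems that n unfolding lev.simps(2)[of S n] by blast
    then show ?thesis using s(3) unfolding lev.simps(2)[of S m] by blast
   qed
   then show thesis using that[OF s(1,2)] by blast
  qed
  note D = sesD[OF s]
  have Yfl: "finite_length Q Y"
  proof (rule Suc.IH)
   show "Y \<in> lev S n" using Suc.prems s TS unfolding lev.simps(2)[of S n] by blast
  qed
  have "simple_object Q T"
  proof (rule simple_QI[OF D(3) TS])
   fix T' R k r assume s': "ses T' T R k r"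
   note D' = sesD[OF s']
   have e: "epi X R (Cmp C X T R r q)" by (rule epi_cmp[OF D(2,3) D'(3) D(5) D'(5)])
   \<comment> \<open>Z is the preimage in X of the subobject T' of T.\<close>
   obtain Z z where sZ: "ses Z X R z (Cmp C X T R r q)" by (rule ses_of_epi[OF D(2) D'(3) e])
   note DZ = sesD[OF sZ]
   note rqa = cmp_app[OF D(2,3) D'(3) D(8) D'(8)]
   have "\<exists>h\<in>Hom C Y Z. \<forall>j\<in>J. \<forall>y\<in>E Y j. z j (h j y) = i j y"
   proof (rule mono_lift[OF DZ(1,2) D(1) DZ(4) D(7)])
    fix j y assume j: "j \<in> J" and y: "y \<in> E Y j"
    note iy = hom_closed[OF D(1,2,7) j y]
    have "q j (i j y) = zr T j" using ses_im[OF s j iy] y by blast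
    then have "Cmp C X T R r q j (i j y) = zr R j" using rqa[OF j iy] hom_zr[OF D'(2,3,8) j] by simp
    then show "i j y \<in> im Z z j" using ses_im[OF sZ j iy] unfolding im_def by blast
   qed
   then obtain h where h: "h \<in> Hom C Y Z" "\<And>j y. j \<in> J ==> y \<in> E Y j ==> z j (h j y) = i j y" by blast
   have mh: "mono Y Z h" unfolding mono_def
    using h D(4) unfolding mono_def inj_on_def by metis
   obtain W e where sW: "ses Y Z W h e" by (rule ses_of_mono[OF D(1) DZ(1) mh])
   note DW = sesD[OF sW]
   note qz = cmp_hom[OF DZ(1,2) D(3) DZ(7) D(8)] and qza = cmp_app[OF DZ(1,2) D(3) DZ(7) D(8)]
   have "\<exists>g\<in>Hom C Z T'. \<forall>j\<in>J. \<forall>x\<in>E Z j. k j (g j x) = Cmp C Z X T q z j x"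
   proof (rule mono_lift[OF D'(1,2) DZ(1) D'(4) qz])
    fix j x assume j: "j \<in> J" and x: "x \<in> E Z j"
    note zx = hom_closed[OF DZ(1,2,7) j x]
    have "r j (q j (z j x)) = zr R j" using ses_im[OF sZ j zx] x rqa[OF j zx] by auto
    then show "Cmp C Z X T q z j x \<in> im T' k j"
     using ses_im[OF s' j hom_closed[OF D(2,3,8) j zx]] qza[OF j x] unfolding im_def by auto
   qed
   then obtain g where g: "g \<in> Hom C Z T'" "\<And>j x. j \<in> J ==> x \<in> E Z j ==> k j (g j x) = q j (z j x)" using qza by auto
   have ge: "epi Z T' g" unfolding epi_def
   proof (intro conjI ballI g(1) equalityI subsetI)
    fix j y assume j: "j \<in> J"
    { assume "y \<in> g j ` E Z j"
     then show "y \<in> E T' j" using hom_closed[OF DZ(1) D'(1) g(1) j] by blast }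
    assume y: "y \<in> E T' j"
    note ky = hom_closed[OF D'(1,2,7) j y]
    obtain x where x: "x \<in> E X j" "k j y = q j x" using epiD(2)[OF D(5) j ky] by blast
    have "r j (k j y) = zr R j" using ses_im[OF s' j ky] y by blast
    then obtain w where w: "w \<in> E Z j" "x = z j w" using ses_im[OF sZ j x(1)] rqa[OF j x(1)] x by auto
    then have "y = g j w" using monoD(2)[OF D'(4) j y hom_closed[OF DZ(1) D'(1) g(1) j w(1)]] g(2)[OF j w(1)] x by simp
    then show "y \<in> g j ` E Z j" using w by blast
   qed
   have "\<exists>l\<in>Hom C W T'. \<forall>j\<in>J. \<forall>x\<in>E Z j. l j (e j x) = g j x"
   proof (rule epi_desc[OF DW(2,3) D'(1) DW(5) g(1)])
    fix j x assume j: "j \<in> J" and x: "x \<in> E Z j" "e j x = zr W j"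
    then obtain y where y: "y \<in> E Y j" "x = h j y" using ses_im[OF sW j x(1)] by blast
    have "q j (z j x) = zr T j" using h(2)[OF j y(1)] y ses_im[OF s j hom_closed[OF DZ(1,2,7) j x(1)]] by auto
    then have "k j (g j x) = k j (zr T' j)" using g(2)[OF j x(1)] hom_zr[OF D'(1,2,7) j] by simp
    then show "g j x = zr T' j" by (rule monoD(2)[OF D'(4) j hom_closed[OF DZ(1) D'(1) g(1) j x(1)] zr_E[OF D'(1) j]])
   qed
   then obtain l where l: "l \<in> Hom C W T'" "\<And>j x. j \<in> J ==> x \<in> E Z j ==> l j (e j x) = g j x" by blast
   have "epi W T' l" unfolding epi_def
   proof (intro conjI ballI l(1) equalityI subsetI)
    fix j y assume j: "j \<in> J"
    { assume "y \<in> l j ` E W j"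
     then show "y \<in> E T' j" using hom_closed[OF DW(3) D'(1) l(1) j] by blast }
    assume y: "y \<in> E T' j"
    obtain x where x: "x \<in> E Z j" "y = g j x" using epiD(2)[OF ge j y] by blast
    then have "y = l j (e j x)" using l(2)[OF j x(1)] by simp
    then show "y \<in> l j ` E W j" using hom_closed[OF DW(2,3,8) j x(1)] by blast
   qed
   moreover have "R \<in> S \<or> (\<forall>W l e. ses Y Z W l e --> W \<in> S) \<or> n = 0 \<and> Z \<in> S" by (rule dich[OF sZ])
   ultimately show "R \<in> S \<or> T' \<in> S" using S_quot[OF _ D'(1)] sW ge by blast
  qed
  then show ?thesis by (rule finite_length_step_Q[OF Yfl s])
 qed
qed

theorem finite_length_modulo_eq: "finite_length_modulo C S = BD"
 unfolding finite_length_modulo_def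
 using finite_length_BD lev_finite_length lev_Ob unfolding BD_def by blast

end

section \<open>The filtration and its reflection along exact functors\<close>

context concrete_abelian begin

lemma zero_objectD: "zero_object C X ==> X \<in> Ob C"
 unfolding zero_object_def by simp

lemma serre_zero_objects: "serre {X. zero_object C X}"
proof -
 have z: "X \<in> {X. zero_object C X} \<longleftrightarrow> X \<in> Ob C \<and> (\<forall>j\<in>J. E X j = {zr X j})" for X
  using zero_object_iff[of X] zero_objectD[of X] by blast
 show ?thesis unfolding serre_def
 proof (intro conjI ballI impI)
  show "{X. zero_object C X} \<subseteq> Ob C" using zero_objectD by (intro subsetI) simp
  fix X assume X: "X \<in> Ob C" "\<forall>j\<in>J. E X j = {zr X j}"
  then show "X \<in> {X. zero_object C X}" unfolding z by simp
 next
  fix A Q X i q assume A: "A \<in> {X. zero_object C X}" and Q: "Q \<in> {X. zero_object C X}" and X: "X \<in> Ob C"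
   and i: "i \<in> Hom C A X" and q: "q \<in> Hom C X Q" and ex: "\<forall>j\<in>J. ker X Q q j \<subseteq> im A i j"
  have "E X j = {zr X j}" if j: "j \<in> J" for j
  proof -
   have "x = zr X j" if x: "x \<in> E X j" for x
   proof -
    have "x \<in> ker X Q q j" unfolding ker_def using x hom_closed[OF X _ q j x] Q[unfolded z] j by auto
    then have "x \<in> im A i j" using ex j by blast
    then show ?thesis unfolding im_def using A[unfolded z] hom_zr[OF _ X i j] j by auto
   qed
   then show ?thesis using zr_E[OF X j] by blast
  qed
  then show "X \<in> {X. zero_object C X}" unfolding z using X by simp
 qed
qed

text \<open>Both claims go through one induction: at a limit, two members of the union are brought
  into a common stage by monotonicity, and a stage is contained in the next because an object of
  \<open>S\<close> satisfies every bound.\<close>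

lemma kg_stage_serre: "serre (kg_stage C (\<alpha>::'i::wellorder)) \<and> (\<forall>\<beta><\<alpha>. kg_stage C \<beta> \<subseteq> kg_stage C \<alpha>)"
proof (induction \<alpha> rule: less_induct)
 case (less \<alpha>)
 have BD: "serre (finite_length_modulo C S) \<and> S \<subseteq> finite_length_modulo C S" if "serre S" for S
 proof -
  interpret s: serre_class C J G S by unfold_locales (rule that)
  interpret b: serre_class C J G s.BD by (rule s.serre_BD)
  show ?thesis using s.finite_length_modulo_eq b.serre s.lev_S unfolding s.BD_def by auto
 qed
 consider "\<forall>\<gamma>. \<alpha> \<le> \<gamma>" | "\<not> (\<forall>\<gamma>. \<alpha> \<le> \<gamma>)" "\<exists>\<beta>. successor_of \<beta> \<alpha>"
  | "\<not> (\<forall>\<gamma>. \<alpha> \<le> \<gamma>)" "\<not> (\<exists>\<beta>. successor_of \<beta> \<alpha>)" by blast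
 then show ?case
 proof cases
  case 1
  then have "\<not> \<beta> < \<alpha>" for \<beta> using not_less by blast
  then show ?thesis using kg_stage.simps[of C \<alpha>, unfolded if_P[OF 1]] BD[OF serre_zero_objects] by simp
 next
  case 2
  define b where "b = (THE \<beta>. successor_of \<beta> \<alpha>)"
  have b: "successor_of b \<alpha>" unfolding b_def using successor_of_The[OF 2(2)] .
  have e: "kg_stage C \<alpha> = finite_length_modulo C (kg_stage C b)"
   using kg_stage.simps[of C \<alpha>, unfolded if_not_P[OF 2(1)] if_P[OF 2(2)]] unfolding b_def .
  have "b < \<alpha>" using b successor_of_def by blast
  note IH = less.IH[OF this]
  have "kg_stage C \<beta> \<subseteq> kg_stage C \<alpha>" if "\<beta> < \<alpha>" for \<beta>
  proof -
   have "\<beta> \<le> b" using b that unfolding successor_of_def by (meson not_less)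
   then have "kg_stage C \<beta> \<subseteq> kg_stage C b" using IH by (cases "\<beta> = b") auto
   then show ?thesis using BD[OF conjunct1[OF IH]] e by blast
  qed
  then show ?thesis using BD[OF conjunct1[OF IH]] e by simp
 next
  case 3
  have e: "kg_stage C \<alpha> = (\<Union>\<beta>\<in>{..<\<alpha>}. kg_stage C \<beta>)" using kg_stage.simps[of C \<alpha>, unfolded if_not_P[OF 3(1)] if_not_P[OF 3(2)]] .
  obtain \<gamma> where \<gamma>: "\<gamma> < \<alpha>" using 3(1) not_less by blast
  have "serre (\<Union>\<beta>\<in>{..<\<alpha>}. kg_stage C \<beta>)" unfolding serre_def
  proof (intro conjI ballI impI)
   show "(\<Union>\<beta>\<in>{..<\<alpha>}. kg_stage C \<beta>) \<subseteq> Ob C" using less.IH unfolding serre_def by blast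
   fix X assume "X \<in> Ob C" "\<forall>j\<in>J. E X j = {zr X j}"
   then have "X \<in> kg_stage C \<gamma>" using less.IH[OF \<gamma>] unfolding serre_def by blast
   then show "X \<in> (\<Union>\<beta>\<in>{..<\<alpha>}. kg_stage C \<beta>)" using \<gamma> by blast
  next
   fix A Q X i q assume A: "A \<in> (\<Union>\<beta>\<in>{..<\<alpha>}. kg_stage C \<beta>)" and Q: "Q \<in> (\<Union>\<beta>\<in>{..<\<alpha>}. kg_stage C \<beta>)"
    and X: "X \<in> Ob C" "i \<in> Hom C A X" "q \<in> Hom C X Q" "\<forall>j\<in>J. ker X Q q j \<subseteq> im A i j"
   obtain a b where ab: "a < \<alpha>" "A \<in> kg_stage C a" "b < \<alpha>" "Q \<in> kg_stage C b" using A Q by blast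
   define c where "c = max a b"
   have c: "c < \<alpha>" using ab unfolding c_def by simp
   have "kg_stage C \<beta> \<subseteq> kg_stage C c" if "\<beta> \<le> c" for \<beta>
    using less.IH[OF c] that by (cases "\<beta> = c") auto
   then have m: "kg_stage C a \<subseteq> kg_stage C c" "kg_stage C b \<subseteq> kg_stage C c" unfolding c_def by simp_all
   then have "X \<in> kg_stage C c" using conjunct1[OF less.IH[OF c]] ab X unfolding serre_def by blast
   then show "X \<in> (\<Union>\<beta>\<in>{..<\<alpha>}. kg_stage C \<beta>)" using c by blast
  qed
  then show ?thesis using e by auto
 qed
qed

end

text \<open>Exactness is asked in the form that some short exact sequence connects the images. This
  is all that \<open>lev\<close> sees, so no action of \<open>\<Phi>\<close> on morphisms has to be
  carried along.\<close>

locale conservative_exact =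
 C: concrete_abelian C J G + D: concrete_abelian D I H
 for C :: "('o, 'j => 'e => 'e) category" and J :: "'j set" and G :: "'o => 'j => ('e, 'x) ring_scheme"
  and D :: "('p, 'i => 'f => 'f) category" and I :: "'i set" and H :: "'p => 'i => ('f, 'y) ring_scheme" +
 fixes \<Phi> :: "'o => 'p"
 assumes ob: "X \<in> Ob C ==> \<Phi> X \<in> Ob D"
  and reflects_zero: "X \<in> Ob C ==> zero_object D (\<Phi> X) ==> zero_object C X"
  and exact: "C.ses Y X Q i q ==> \<exists>i' q'. D.ses (\<Phi> Y) (\<Phi> X) (\<Phi> Q) i' q'"
begin

text \<open>\<open>lev\<close> quantifies over all short exact sequences of X, and each of them has
  an image in D; a bound for the image is therefore a bound for X.\<close>

lemma lev_reflect:
 assumes "\<And>X. X \<in> Ob C ==> \<Phi> X \<in> T ==> X \<in> S"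
 shows "X \<in> Ob C ==> \<Phi> X \<in> D.lev T n ==> X \<in> C.lev S n"
proof (induction n arbitrary: X)
 case 0
 then show ?case using assms by simp
next
 case (Suc n)
 have "Q \<in> S \<or> Y \<in> C.lev S n" if s: "C.ses Y X Q i q" for Y Q i q
 proof -
  have o: "Y \<in> Ob C" "Q \<in> Ob C" using C.sesD[OF s] by auto
  have "\<Phi> Q \<in> T \<or> \<Phi> Y \<in> D.lev T n" using exact[OF s] Suc.prems(2) by auto
  then show ?thesis using assms Suc.IH o by blast
 qed
 then show ?case unfolding C.lev.simps using Suc.prems(1) by blast
qed

lemma finite_length_modulo_reflect:
 assumes S: "C.serre S" and T: "D.serre T" and "\<And>X. X \<in> Ob C ==> \<Phi> X \<in> T ==> X \<in> S"
  and X: "X \<in> Ob C" "\<Phi> X \<in> finite_length_modulo D T"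
 shows "X \<in> finite_length_modulo C S"
proof -
 interpret s: serre_class C J G S by unfold_locales (rule S)
 interpret t: serre_class D I H T by unfold_locales (rule T)
 show ?thesis
  using X lev_reflect[OF assms(3)] unfolding s.finite_length_modulo_eq t.finite_length_modulo_eq s.BD_def t.BD_def by blast
qed

lemma kg_stage_reflect: "X \<in> Ob C ==> \<Phi> X \<in> kg_stage D (\<alpha>::'k::wellorder) ==> X \<in> kg_stage C \<alpha>"
proof (induction \<alpha> arbitrary: X rule: less_induct)
 case (less \<alpha>)
 consider "\<forall>\<gamma>. \<alpha> \<le> \<gamma>" | "\<not> (\<forall>\<gamma>. \<alpha> \<le> \<gamma>)" "\<exists>\<beta>. successor_of \<beta> \<alpha>"
  | "\<not> (\<forall>\<gamma>. \<alpha> \<le> \<gamma>)" "\<not> (\<exists>\<beta>. successor_of \<beta> \<alpha>)" by blast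
 then show ?case
 proof cases
  case 1
  have "X \<in> finite_length_modulo C {X. zero_object C X}"
   by (rule finite_length_modulo_reflect[OF C.serre_zero_objects D.serre_zero_objects _ less.prems(1)])
    (use reflects_zero less.prems(2) kg_stage.simps[of D \<alpha>, unfolded if_P[OF 1]] in auto)
  then show ?thesis using kg_stage.simps[of C \<alpha>, unfolded if_P[OF 1]] by simp
 next
  case 2
  define b where "b = (THE \<beta>. successor_of \<beta> \<alpha>)"
  have "successor_of b \<alpha>" unfolding b_def using successor_of_The[OF 2(2)] .
  then have b: "b < \<alpha>" using successor_of_def by blast
  have e: "kg_stage D \<alpha> = finite_length_modulo D (kg_stage D b)" "kg_stage C \<alpha> = finite_length_modulo C (kg_stage C b)"
   using kg_stage.simps[of D \<alpha>, unfolded if_not_P[OF 2(1)] if_P[OF 2(2)]]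
    kg_stage.simps[of C \<alpha>, unfolded if_not_P[OF 2(1)] if_P[OF 2(2)]] unfolding b_def by blast+
  show ?thesis unfolding e
   by (rule finite_length_modulo_reflect[OF conjunct1[OF C.kg_stage_serre] conjunct1[OF D.kg_stage_serre] less.IH[OF b] less.prems(1)])
    (use less.prems(2) e in auto)
 next
  case 3
  have e: "kg_stage D \<alpha> = (\<Union>\<beta>\<in>{..<\<alpha>}. kg_stage D \<beta>)" "kg_stage C \<alpha> = (\<Union>\<beta>\<in>{..<\<alpha>}. kg_stage C \<beta>)"
   using kg_stage.simps[of D \<alpha>, unfolded if_not_P[OF 3(1)] if_not_P[OF 3(2)]]
    kg_stage.simps[of C \<alpha>, unfolded if_not_P[OF 3(1)] if_not_P[OF 3(2)]] by blast+
  show ?thesis using less e by blast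
 qed
qed

lemma kg_stage_full_reflect:
 assumes "kg_stage D (\<alpha>::'k::wellorder) = Ob D"
 shows "kg_stage C \<alpha> = Ob C"
 using kg_stage_reflect[of _ \<alpha>] ob assms conjunct1[OF C.kg_stage_serre[of \<alpha>]] unfolding C.serre_def by auto

end

section \<open>Finite-dimensional vector spaces and modules\<close>

abbreviation vs :: "('k::field, 'v, 'x) module_scheme => bool" where
 "vs V \<equiv> vectorspace class_ring V"

abbreviation fd :: "('k::field, 'v, 'x) module_scheme => bool" where
 "fd V \<equiv> vectorspace.fin_dim class_ring V"

lemma vs_module: "vs V ==> Module.module class_ring V"
 by (rule vectorspace.axioms(1))

lemma vs_abelian_group: "vs V ==> abelian_group V"
 by (rule module.axioms(2)[OF vs_module])

lemma vs_abelian_monoid: "vs V ==> abelian_monoid V"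
 by (rule abelian_group.axioms(1)[OF vs_abelian_group])

lemma vs_zero: "vs V ==> \<zero>[V] \<in> carrier V"
 by (rule abelian_monoid.zero_closed[OF vs_abelian_monoid])

lemma vs_add: "vs V ==> x \<in> carrier V ==> y \<in> carrier V ==> x \<oplus>[V] y \<in> carrier V"
 by (rule abelian_monoid.a_closed[OF vs_abelian_monoid])

lemma vs_smult: "vs V ==> x \<in> carrier V ==> c \<odot>[V] x \<in> carrier V"
 using module.smult_closed[OF vs_module, of V c x] by simp

lemma vs_l_distr: "vs V ==> x \<in> carrier V ==> (c + d) \<odot>[V] x = c \<odot>[V] x \<oplus>[V] d \<odot>[V] x"
 using module.smult_l_distr[OF vs_module, of V c d x] by simp

lemma vs_r_distr: "vs V ==> x \<in> carrier V ==> y \<in> carrier V ==> c \<odot>[V] (x \<oplus>[V] y) = c \<odot>[V] x \<oplus>[V] c \<odot>[V] y"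
 using module.smult_r_distr[OF vs_module, of V c x y] by simp

lemma vs_smult_assoc: "vs V ==> x \<in> carrier V ==> (c * d) \<odot>[V] x = c \<odot>[V] (d \<odot>[V] x)"
 using module.smult_assoc1[OF vs_module, of V c d x] by simp

lemma vs_one: "vs V ==> x \<in> carrier V ==> 1 \<odot>[V] x = x"
 using module.smult_one[OF vs_module, of V x] by simp

lemma vs_assoc: "vs V ==> x \<in> carrier V ==> y \<in> carrier V ==> z \<in> carrier V ==>
 (x \<oplus>[V] y) \<oplus>[V] z = x \<oplus>[V] (y \<oplus>[V] z)"
 by (rule abelian_monoid.a_assoc[OF vs_abelian_monoid])

lemma vs_comm: "vs V ==> x \<in> carrier V ==> y \<in> carrier V ==> x \<oplus>[V] y = y \<oplus>[V] x"
 by (rule abelian_monoid.a_comm[OF vs_abelian_monoid])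

lemma vs_l_zero: "vs V ==> x \<in> carrier V ==> \<zero>[V] \<oplus>[V] x = x"
 by (rule abelian_monoid.l_zero[OF vs_abelian_monoid])

lemma vs_r_zero: "vs V ==> x \<in> carrier V ==> x \<oplus>[V] \<zero>[V] = x"
 using vs_l_zero vs_comm vs_zero by metis

lemma vs_cancel: "vs V ==> x \<in> carrier V ==> y \<in> carrier V ==> z \<in> carrier V ==> x \<oplus>[V] y = x \<oplus>[V] z ==> y = z"
proof -
 assume a: "vs V" "x \<in> carrier V" "y \<in> carrier V" "z \<in> carrier V" "x \<oplus>[V] y = x \<oplus>[V] z"
 interpret abelian_group V by (rule vs_abelian_group[OF a(1)])
 show ?thesis using a(2-5) by simp
qed

lemma vs_smult_zero: assumes V: "vs V" shows "c \<odot>[V] \<zero>[V] = \<zero>[V]"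
proof -
 have z: "\<zero>[V] \<in> carrier V" "c \<odot>[V] \<zero>[V] \<in> carrier V" using vs_zero[OF V] vs_smult[OF V] by auto
 have "c \<odot>[V] \<zero>[V] \<oplus>[V] c \<odot>[V] \<zero>[V] = c \<odot>[V] \<zero>[V] \<oplus>[V] \<zero>[V]"
  using vs_r_distr[OF V z(1) z(1), of c] vs_l_zero[OF V z(1)] vs_r_zero[OF V z(2)] by simp
 then show ?thesis using vs_cancel[OF V z(2,2,1)] by blast
qed

lemma vs_zero_smult: assumes V: "vs V" "x \<in> carrier V" shows "0 \<odot>[V] x = \<zero>[V]"
proof -
 have "0 \<odot>[V] x \<oplus>[V] 0 \<odot>[V] x = 0 \<odot>[V] x \<oplus>[V] \<zero>[V]"
  using vs_l_distr[OF V, of 0 0] vs_r_zero[OF V(1) vs_smult[OF V]] by simp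
 then show ?thesis using vs_cancel[OF V(1) vs_smult[OF V] vs_smult[OF V] vs_zero[OF V(1)]] by blast
qed

lemma vs_neg: assumes V: "vs V" "x \<in> carrier V" shows "x \<oplus>[V] (-1) \<odot>[V] x = \<zero>[V]"
 using vs_l_distr[OF V, of 1 "-1"] vs_one[OF V] vs_zero_smult[OF V] by simp

lemma vs_a_inv: assumes V: "vs V" "x \<in> carrier V" shows "\<ominus>\<^bsub>V\<^esub> x = (-1) \<odot>[V] x"
 using vs_neg[OF V] vs_cancel[OF V(1,2) _ vs_smult[OF V]]
 by (metis V abelian_group.a_inv_closed abelian_group.r_neg vs_abelian_group)

lemma vs_minus: "vs V ==> x \<in> carrier V ==> y \<in> carrier V ==> x \<ominus>\<^bsub>V\<^esub> y = x \<oplus>[V] (-1) \<odot>[V] y"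
 using vs_a_inv by (metis a_minus_def)

lemma vs_minus_closed: "vs V ==> x \<in> carrier V ==> y \<in> carrier V ==> x \<ominus>\<^bsub>V\<^esub> y \<in> carrier V"
 by (simp add: vs_minus vs_add vs_smult)

lemma vs_minus_eq_zero: "vs V ==> x \<in> carrier V ==> y \<in> carrier V ==> x \<ominus>\<^bsub>V\<^esub> y = \<zero>[V] \<longleftrightarrow> x = y"
 by (metis vs_minus vs_neg vs_smult vs_comm vs_cancel vs_add)

text \<open>Additive inverses are supplied by the scalar -1, so none has to be exhibited in
  applications.\<close>

lemma vsI:
 assumes "\<zero>[V] \<in> carrier V"
  and "\<And>x y. x \<in> carrier V ==> y \<in> carrier V ==> x \<oplus>[V] y \<in> carrier V"
  and "\<And>x (c::'k::field). x \<in> carrier V ==> c \<odot>[V] x \<in> carrier V"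
  and "\<And>x y z. x \<in> carrier V ==> y \<in> carrier V ==> z \<in> carrier V ==> (x \<oplus>[V] y) \<oplus>[V] z = x \<oplus>[V] (y \<oplus>[V] z)"
  and "\<And>x y. x \<in> carrier V ==> y \<in> carrier V ==> x \<oplus>[V] y = y \<oplus>[V] x"
  and "\<And>x. x \<in> carrier V ==> \<zero>[V] \<oplus>[V] x = x"
  and "\<And>x c d. x \<in> carrier V ==> (c + d) \<odot>[V] x = c \<odot>[V] x \<oplus>[V] d \<odot>[V] x"
  and "\<And>x y c. x \<in> carrier V ==> y \<in> carrier V ==> c \<odot>[V] (x \<oplus>[V] y) = c \<odot>[V] x \<oplus>[V] c \<odot>[V] y"
  and "\<And>x c d. x \<in> carrier V ==> (c * d) \<odot>[V] x = c \<odot>[V] (d \<odot>[V] x)"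
  and "\<And>x. x \<in> carrier V ==> 1 \<odot>[V] x = x"
  and "\<And>x. x \<in> carrier V ==> 0 \<odot>[V] x = \<zero>[V]"
 shows "vs V"
proof -
 have "abelian_group V"
 proof (rule abelian_groupI)
  fix x assume x: "x \<in> carrier V"
  have "(-1) \<odot>[V] x \<oplus>[V] x = \<zero>[V]" using assms(7)[OF x, of "-1" 1] assms(10,11)[OF x] by simp
  then show "\<exists>y\<in>carrier V. y \<oplus>[V] x = \<zero>[V]" using assms(3)[OF x] by blast
 qed (use assms in auto)
 then have "Module.module class_ring V"
  by (intro moduleI class_cring.cring_axioms[unfolded class_ring_simps] class_cring.is_cring) (use assms in auto)
 then show ?thesis unfolding vectorspace_def using class_field by blast
qed

text \<open>The span, generated by adding one scalar multiple of a generator at a time. It does not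
  mention the carrier, so it is the same set for a space and for its subspaces.\<close>

inductive_set sp :: "('k::field, 'v, 'x) module_scheme => 'v set => 'v set" for V G where
 zero: "\<zero>[V] \<in> sp V G"
| step: "g \<in> G ==> v \<in> sp V G ==> c \<odot>[V] g \<oplus>[V] v \<in> sp V G"

lemma sp_closed:
 assumes V: "vs V" "G \<subseteq> carrier V" and v: "v \<in> sp V G"
 shows "v \<in> carrier V"
 using v
proof induction
 case (step g v c)
 then show ?case using V(2) by (intro vs_add[OF V(1)] vs_smult[OF V(1)]) auto
qed (rule vs_zero[OF V(1)])

lemma sp_mono:
 assumes "G \<subseteq> H" and v: "v \<in> sp V G"
 shows "v \<in> sp V H"
 using v
proof induction
 case (step g v c)
 then show ?case using assms(1) by (intro sp.step) auto
qed (rule sp.zero)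

lemma sp_add:
 assumes V: "vs V" "G \<subseteq> carrier V" and v: "v \<in> sp V G" and w: "w \<in> sp V G"
 shows "v \<oplus>[V] w \<in> sp V G"
 using v
proof induction
 case zero
 then show ?case using vs_l_zero[OF V(1) sp_closed[OF V w]] w by simp
next
 case (step g v c)
 have "(c \<odot>[V] g \<oplus>[V] v) \<oplus>[V] w = c \<odot>[V] g \<oplus>[V] (v \<oplus>[V] w)"
  using step V sp_closed[OF V] w by (intro vs_assoc) (auto intro: vs_smult)
 then show ?case using step by (simp add: sp.step)
qed

lemma sp_smult:
 assumes V: "vs V" "G \<subseteq> carrier V" and v: "v \<in> sp V G"
 shows "c \<odot>[V] v \<in> sp V G"
 using v
proof induction
 case zero
 then show ?case using vs_smult_zero[OF V(1)] sp.zero by metis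
next
 case (step g v d)
 have g: "g \<in> carrier V" using step V by blast
 have "c \<odot>[V] (d \<odot>[V] g \<oplus>[V] v) = (c * d) \<odot>[V] g \<oplus>[V] c \<odot>[V] v"
  using vs_r_distr[OF V(1) vs_smult[OF V(1) g] sp_closed[OF V step.hyps(2)]] vs_smult_assoc[OF V(1) g] by simp
 then show ?case using step by (simp add: sp.step)
qed

lemma fd_iff:
 assumes V: "vs V"
 shows "fd V \<longleftrightarrow> (\<exists>G. finite G \<and> G \<subseteq> carrier V \<and> carrier V \<subseteq> sp V G)"
proof -
 interpret V: vectorspace class_ring V by (rule V)
 have 1: "V.span G \<subseteq> sp V G" if G: "G \<subseteq> carrier V" for G
 proof
  fix v assume "v \<in> V.span G"
  then obtain a A where A: "finite A" "A \<subseteq> G" "v = V.lincomb a A" unfolding V.span_def by blast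
  have "A \<subseteq> G ==> V.lincomb a A \<in> sp V G" using A(1)
  proof induction
   case empty
   then show ?case by (simp add: V.lincomb_def sp.zero)
  next
   case (insert x F)
   have "V.lincomb a (insert x F) = a x \<odot>[V] x \<oplus>[V] V.lincomb a F"
    unfolding V.lincomb_def using insert G by (subst V.finsum_insert) (auto intro: vs_smult[OF V])
   then show ?case using insert by (simp add: sp.step)
  qed
  then show "v \<in> sp V G" using A by blast
 qed
 have 2: "sp V G \<subseteq> V.span G" if G: "G \<subseteq> carrier V" for G
 proof
  interpret s: submodule class_ring "V.span G" V by (rule V.span_is_submodule[OF G])
  fix v assume "v \<in> sp V G"
  then show "v \<in> V.span G"
   by induction (use V.in_own_span[OF G] in \<open>auto intro!: s.m_closed s.smult_closed\<close>)
 qed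
 have 3: "sp V G = carrier V \<longleftrightarrow> carrier V \<subseteq> sp V G" if "G \<subseteq> carrier V" for G using sp_closed[OF V that] by blast
 have "V.span G = sp V G" if "G \<subseteq> carrier V" for G using 1[OF that] 2[OF that] by blast
 then show ?thesis unfolding V.fin_dim_def using 3 by metis
qed

lemma fdI: "vs V ==> finite G ==> G \<subseteq> carrier V ==> (\<And>v. v \<in> carrier V ==> v \<in> sp V G) ==> fd V"
 by (subst fd_iff) auto

lemma fdE: assumes "vs V" "fd V" obtains G where "finite G" "G \<subseteq> carrier V" "\<And>v. v \<in> carrier V ==> v \<in> sp V G"
proof -
 obtain G where "finite G \<and> G \<subseteq> carrier V \<and> carrier V \<subseteq> sp V G"
  using iffD1[OF fd_iff[OF assms(1)] assms(2)] by (elim exE) (rule that)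
 then show thesis by (intro that[of G]) auto
qed

lemma vs_sub:
 assumes V: "vs V" and N: "N \<subseteq> carrier V" "\<zero>[V] \<in> N"
  "\<And>x y. x \<in> N ==> y \<in> N ==> x \<oplus>[V] y \<in> N" "\<And>x c. x \<in> N ==> c \<odot>[V] x \<in> N"
 shows "vs (V\<lparr>carrier := N\<rparr>)"
proof -
 note in_V = subsetD[OF N(1)]
 show ?thesis
  by (rule vsI) (use N in \<open>auto intro!: vs_assoc[OF V] vs_comm[OF V] vs_l_zero[OF V] vs_l_distr[OF V] vs_r_distr[OF V]
   vs_smult_assoc[OF V] vs_one[OF V] vs_zero_smult[OF V] in_V\<close>)
qed

lemma sp_sub_iff: "v \<in> sp (V\<lparr>carrier := N\<rparr>) G \<longleftrightarrow> v \<in> sp V G"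
proof
 show "v \<in> sp (V\<lparr>carrier := N\<rparr>) G ==> v \<in> sp V G"
  by (induction rule: sp.induct) (auto intro: sp.intros)
 show "v \<in> sp V G ==> v \<in> sp (V\<lparr>carrier := N\<rparr>) G"
 proof (induction rule: sp.induct)
  case zero
  then show ?case using sp.zero[of "V\<lparr>carrier := N\<rparr>" G] by simp
 next
  case (step g v c)
  then show ?case using sp.step[of g G v "V\<lparr>carrier := N\<rparr>" c] by simp
 qed
qed

text \<open>Gaussian elimination by induction on the generators: if some \<open>u\<close> in N has a
  nonzero coefficient at \<open>g\<close>, all other elements of N are reduced by multiples of
  \<open>u\<close> into the span of the remaining generators.\<close>

lemma sub_fin_gen:
 assumes V: "vs V" and G: "finite G" "G \<subseteq> carrier V"
 shows "N \<subseteq> sp V G ==> \<zero>[V] \<in> N ==> (\<And>x y. x \<in> N ==> y \<in> N ==> x \<oplus>[V] y \<in> N) ==>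
  (\<And>x c. x \<in> N ==> c \<odot>[V] x \<in> N) ==> \<exists>H. finite H \<and> H \<subseteq> N \<and> N \<subseteq> sp V H"
 using G
proof (induction G arbitrary: N rule: finite_induct)
 case empty
 have "v = \<zero>[V]" if "v \<in> sp V {}" for v using that by (induction rule: sp.induct) auto
 then show ?case using empty.prems(1) by (intro exI[of _ "{}"]) (use sp.zero in blast)
next
 case (insert g G)
 note N = insert.prems(2-4)
 have gV: "g \<in> carrier V" "G \<subseteq> carrier V" using insert.prems by auto
 have dec: "\<exists>c w. v = c \<odot>[V] g \<oplus>[V] w \<and> w \<in> sp V G" if "v \<in> sp V (insert g G)" for v
  using that
 proof (induction rule: sp.induct)
  case zero
  have "\<zero>[V] = 0 \<odot>[V] g \<oplus>[V] \<zero>[V]" using vs_zero_smult[OF V gV(1)] vs_l_zero[OF V vs_zero[OF V]] by simp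
  then show ?case using sp.zero[of V G] by blast
 next
  case (step h v c)
  then obtain d w where dw: "v = d \<odot>[V] g \<oplus>[V] w" "w \<in> sp V G" by blast
  have wV: "w \<in> carrier V" using sp_closed[OF V gV(2) dw(2)] .
  show ?case
  proof (cases "h = g")
   case True
   then have "c \<odot>[V] h \<oplus>[V] v = (c + d) \<odot>[V] g \<oplus>[V] w"
    using dw vs_l_distr[OF V gV(1)] vs_assoc[OF V vs_smult[OF V gV(1)] vs_smult[OF V gV(1)] wV] by simp
   then show ?thesis using dw by blast
  next
   case False
   then have h: "h \<in> G" "h \<in> carrier V" using step gV by auto
   have "c \<odot>[V] h \<oplus>[V] v = d \<odot>[V] g \<oplus>[V] (c \<odot>[V] h \<oplus>[V] w)"
    using dw vs_assoc[OF V] vs_comm[OF V] vs_smult[OF V gV(1)] vs_smult[OF V h(2)] wV by metis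
   then show ?thesis using dw sp.step[OF h(1) dw(2)] by blast
  qed
 qed
 define N' where "N' = N \<inter> sp V G"
 have "\<exists>H. finite H \<and> H \<subseteq> N' \<and> N' \<subseteq> sp V H"
  by (rule insert.IH) (use N sp.zero sp_add[OF V gV(2)] sp_smult[OF V gV(2)] gV in \<open>auto simp: N'_def\<close>)
 then obtain H where H: "finite H" "H \<subseteq> N'" "N' \<subseteq> sp V H" by blast
 show ?case
 proof (cases "N \<subseteq> sp V G")
  case True
  then show ?thesis using H unfolding N'_def by blast
 next
  case False
  then obtain u where u: "u \<in> N" "u \<notin> sp V G" by blast
  obtain c w where cw: "u = c \<odot>[V] g \<oplus>[V] w" "w \<in> sp V G" using dec u insert.prems(1) by blast
  have wV: "w \<in> carrier V" using sp_closed[OF V gV(2) cw(2)] .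
  have c: "c \<noteq> 0" using u cw vs_zero_smult[OF V gV(1)] vs_l_zero[OF V wV] by auto
  have NV: "x \<in> carrier V" if "x \<in> N" for x using sp_closed[OF V _ subsetD[OF insert.prems(1) that]] gV by auto
  have "N \<subseteq> sp V (insert u H)"
  proof
   fix x assume x: "x \<in> N"
   obtain d z where dz: "x = d \<odot>[V] g \<oplus>[V] z" "z \<in> sp V G" using dec x insert.prems(1) by blast
   have zV: "z \<in> carrier V" using sp_closed[OF V gV(2) dz(2)] .
   \<comment> \<open>This multiple of \<open>u\<close> cancels the coefficient \<open>d\<close> of
     \<open>x\<close> at \<open>g\<close>.\<close>
   let ?e = "- d / c"
   let ?y = "?e \<odot>[V] u \<oplus>[V] x"
   have eu: "?e \<odot>[V] u = (- d) \<odot>[V] g \<oplus>[V] ?e \<odot>[V] w"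
    using cw(1) vs_r_distr[OF V vs_smult[OF V gV(1)] wV] vs_smult_assoc[OF V gV(1), of ?e c] c by simp
   have "?y = (((- d) \<odot>[V] g \<oplus>[V] ?e \<odot>[V] w)) \<oplus>[V] (d \<odot>[V] g \<oplus>[V] z)" using eu dz by simp
   also have "\<dots> = ((- d) \<odot>[V] g \<oplus>[V] d \<odot>[V] g) \<oplus>[V] (?e \<odot>[V] w \<oplus>[V] z)"
   proof -
    interpret a: abelian_group V by (rule vs_abelian_group[OF V])
    show ?thesis using vs_smult[OF V gV(1)] vs_smult[OF V wV] zV by (simp add: a.a_ac)
   qed
   also have "\<dots> = ?e \<odot>[V] w \<oplus>[V] z"
    using vs_l_distr[OF V gV(1), of "-d" d] vs_zero_smult[OF V gV(1)] vs_l_zero[OF V vs_add[OF V vs_smult[OF V wV] zV]] by simp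
   finally have "?y \<in> sp V G" using sp_add[OF V gV(2) sp_smult[OF V gV(2) cw(2)] dz(2)] by simp
   moreover have "?y \<in> N" using N u x by blast
   ultimately have "?y \<in> sp V (insert u H)" using H sp_mono[of H "insert u H"] unfolding N'_def by blast
   then have "(d / c) \<odot>[V] u \<oplus>[V] ?y \<in> sp V (insert u H)" by (rule sp.step[OF insertI1])
   moreover have "(d / c) \<odot>[V] u \<oplus>[V] ?y = x"
   proof -
    have "(d / c) \<odot>[V] u \<oplus>[V] ?y = ((d / c) \<odot>[V] u \<oplus>[V] ?e \<odot>[V] u) \<oplus>[V] x"
     using vs_assoc[OF V vs_smult[OF V NV[OF u(1)]] vs_smult[OF V NV[OF u(1)]] NV[OF x]] by simp
    also have "\<dots> = x" using vs_l_distr[OF V NV[OF u(1)], of "d/c" ?e] vs_zero_smult[OF V NV[OF u(1)]] vs_l_zero[OF V NV[OF x]] by simp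
    finally show ?thesis .
   qed
   ultimately show "x \<in> sp V (insert u H)" by simp
  qed
  then show ?thesis using H u unfolding N'_def by (intro exI[of _ "insert u H"]) auto
 qed
qed

lemma fd_sub:
 assumes V: "vs V" "fd V" and N: "N \<subseteq> carrier V" "\<zero>[V] \<in> N"
  "\<And>x y. x \<in> N ==> y \<in> N ==> x \<oplus>[V] y \<in> N" "\<And>x c. x \<in> N ==> c \<odot>[V] x \<in> N"
 shows "fd (V\<lparr>carrier := N\<rparr>)"
proof -
 obtain G where G: "finite G" "G \<subseteq> carrier V" "\<And>v. v \<in> carrier V ==> v \<in> sp V G" by (rule fdE[OF V]) blast
 have "\<exists>H. finite H \<and> H \<subseteq> N \<and> N \<subseteq> sp V H"
  by (rule sub_fin_gen[OF V(1) G(1,2) _ N(2-4)]) (use N(1) G(3) in auto)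
 then obtain H where H: "finite H" "H \<subseteq> N" "N \<subseteq> sp V H" by (elim exE conjE) (rule that)
 show ?thesis
  by (rule fdI[OF vs_sub[OF V(1) N] H(1)]) (use H in \<open>auto simp: sp_sub_iff\<close>)
qed

lemma fd_sum:
 assumes V: "vs V" "fd V" and W: "vs W"
  and f: "\<And>x. x \<in> carrier V ==> f x \<in> carrier W"
   "\<And>x y. x \<in> carrier V ==> y \<in> carrier V ==> f (x \<oplus>[V] y) = f x \<oplus>[W] f y"
   "\<And>x c. x \<in> carrier V ==> f (c \<odot>[V] x) = c \<odot>[W] f x"
  and g: "\<And>x. x \<in> carrier V ==> g x \<in> carrier W"
   "\<And>x y. x \<in> carrier V ==> y \<in> carrier V ==> g (x \<oplus>[V] y) = g x \<oplus>[W] g y"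
   "\<And>x c. x \<in> carrier V ==> g (c \<odot>[V] x) = c \<odot>[W] g x"
  and s: "\<And>y. y \<in> carrier W ==> \<exists>x\<in>carrier V. \<exists>x'\<in>carrier V. y = f x \<oplus>[W] g x'"
 shows "fd W"
proof -
 obtain G where G: "finite G" "G \<subseteq> carrier V" "\<And>v. v \<in> carrier V ==> v \<in> sp V G" by (rule fdE[OF V]) blast
 have im: "h v \<in> sp W H"
  if v: "v \<in> sp V G" and H: "h ` G \<subseteq> H" and h: "\<And>x. x \<in> carrier V ==> h x \<in> carrier W"
   "\<And>x y. x \<in> carrier V ==> y \<in> carrier V ==> h (x \<oplus>[V] y) = h x \<oplus>[W] h y"
   "\<And>x c. x \<in> carrier V ==> h (c \<odot>[V] x) = c \<odot>[W] h x" for h v H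
  using v
 proof induction
  case zero
  have "h \<zero>[V] = \<zero>[W]"
   using h(3)[OF vs_zero[OF V(1)], of 0] vs_zero_smult[OF V(1) vs_zero[OF V(1)]] vs_zero_smult[OF W h(1)[OF vs_zero[OF V(1)]]] by simp
  then show ?case using sp.zero[of W H] by simp
 next
  case (step x v c)
  note x = subsetD[OF G(2) step.hyps(1)]
  have "h (c \<odot>[V] x \<oplus>[V] v) = c \<odot>[W] h x \<oplus>[W] h v"
   using h(2)[OF vs_smult[OF V(1) x] sp_closed[OF V(1) G(2) step.hyps(2)]] h(3)[OF x] by simp
  then show ?case using sp.step[of "h x" H "h v" W c] step H by auto
 qed
 have sub: "f ` G \<union> g ` G \<subseteq> carrier W" using f(1) g(1) G(2) by blast
 show ?thesis
 proof (rule fdI[OF W _ sub])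
  fix y assume "y \<in> carrier W"
  then obtain x x' where x: "x \<in> carrier V" "x' \<in> carrier V" "y = f x \<oplus>[W] g x'" using s by blast
  show "y \<in> sp W (f ` G \<union> g ` G)" unfolding x(3)
   by (rule sp_add[OF W sub]; rule im) (use G(3) x f g in auto)
 qed (use G(1) in blast)
qed

lemma fd_image:
 assumes V: "vs V" "fd V" and W: "vs W"
  and f: "\<And>x. x \<in> carrier V ==> f x \<in> carrier W"
   "\<And>x y. x \<in> carrier V ==> y \<in> carrier V ==> f (x \<oplus>[V] y) = f x \<oplus>[W] f y"
   "\<And>x c. x \<in> carrier V ==> f (c \<odot>[V] x) = c \<odot>[W] f x"
   "\<And>y. y \<in> carrier W ==> \<exists>x\<in>carrier V. y = f x"
 shows "fd W"
 by (rule fd_sum[OF V W f(1-3), of "\<lambda>_. \<zero>[W]"])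
  (use f vs_zero[OF V(1)] in \<open>auto simp: vs_zero[OF W] vs_l_zero[OF W] vs_r_zero[OF W] vs_smult_zero[OF W]\<close>)

text \<open>Entries are interleaved, so that products of spaces in \<open>nat \<Rightarrow> 'k\<close> stay in that type.\<close>

definition pr :: "(nat => 'k) => (nat => 'k) => nat => 'k" where
 "pr u v = (\<lambda>n. if even n then u (n div 2) else v (n div 2))"

definition p1 :: "(nat => 'k) => nat => 'k" where "p1 w = (\<lambda>n. w (2 * n))"
definition p2 :: "(nat => 'k) => nat => 'k" where "p2 w = (\<lambda>n. w (2 * n + 1))"

lemma pr_simps [simp]: "p1 (pr u v) = u" "p2 (pr u v) = v" "pr (p1 w) (p2 w) = w"
 by (auto simp: pr_def p1_def p2_def fun_eq_iff elim!: evenE oddE)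

lemma pr_eq_iff: "pr u v = w \<longleftrightarrow> u = p1 w \<and> v = p2 w" by auto

lemma pr_inject: "pr u v = pr u' v' \<longleftrightarrow> u = u' \<and> v = v'" by (metis pr_simps(1,2))

text \<open>P is an arbitrary record with these operations, so that one statement serves products of
  spaces, products of modules and the module of pairs \<open>P0\<close>.\<close>

lemma vs_prod:
 fixes V :: "('k::field, nat => 'k, 'x) module_scheme" and W :: "('k, nat => 'k, 'y) module_scheme"
  and P :: "('k, nat => 'k, 'z) module_scheme"
 assumes V: "vs V" and W: "vs W"
  and P: "carrier P = {w. p1 w \<in> carrier V \<and> p2 w \<in> carrier W}" "\<zero>[P] = pr \<zero>[V] \<zero>[W]"
   "\<And>x y. x \<oplus>[P] y = pr (p1 x \<oplus>[V] p1 y) (p2 x \<oplus>[W] p2 y)"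
   "\<And>c x. c \<odot>[P] x = pr (c \<odot>[V] p1 x) (c \<odot>[W] p2 x)"
 shows "vs P"
 by (rule vsI) (auto simp: P pr_eq_iff pr_inject vs_zero[OF V] vs_zero[OF W] vs_add[OF V] vs_add[OF W] vs_smult[OF V] vs_smult[OF W]
  vs_assoc[OF V] vs_assoc[OF W] vs_l_zero[OF V] vs_l_zero[OF W] vs_l_distr[OF V] vs_l_distr[OF W] vs_r_distr[OF V] vs_r_distr[OF W]
  vs_smult_assoc[OF V] vs_smult_assoc[OF W] vs_one[OF V] vs_one[OF W] vs_zero_smult[OF V] vs_zero_smult[OF W]
  intro: vs_comm[OF V] vs_comm[OF W])

lemma fd_prod:
 fixes V :: "('k::field, nat => 'k, 'x) module_scheme" and W :: "('k, nat => 'k, 'y) module_scheme"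
  and P :: "('k, nat => 'k, 'z) module_scheme"
 assumes V: "vs V" "fd V" and W: "vs W" "fd W"
  and P: "carrier P = {w. p1 w \<in> carrier V \<and> p2 w \<in> carrier W}" "\<zero>[P] = pr \<zero>[V] \<zero>[W]"
   "\<And>x y. x \<oplus>[P] y = pr (p1 x \<oplus>[V] p1 y) (p2 x \<oplus>[W] p2 y)"
   "\<And>c x. c \<odot>[P] x = pr (c \<odot>[V] p1 x) (c \<odot>[W] p2 x)"
 shows "fd P"
proof -
 note vP = vs_prod[OF V(1) W(1) P]
 obtain G where G: "finite G" "G \<subseteq> carrier V" "\<And>v. v \<in> carrier V ==> v \<in> sp V G" by (rule fdE[OF V]) blast
 obtain H where H: "finite H" "H \<subseteq> carrier W" "\<And>v. v \<in> carrier W ==> v \<in> sp W H" by (rule fdE[OF W]) blast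
 define L where "L = (\<lambda>g. pr g \<zero>[W]) ` G \<union> (\<lambda>h. pr \<zero>[V] h) ` H"
 have L: "finite L" "L \<subseteq> carrier P" unfolding L_def P using G H vs_zero[OF V(1)] vs_zero[OF W(1)] by auto
 have 1: "pr v \<zero>[W] \<in> sp P L" if "v \<in> sp V G" for v using that
 proof induction
  case zero
  then show ?case using sp.zero[of P L] P(2) by simp
 next
  case (step g v c)
  have "pr (c \<odot>[V] g \<oplus>[V] v) \<zero>[W] = c \<odot>[P] (pr g \<zero>[W]) \<oplus>[P] pr v \<zero>[W]"
   by (simp add: P vs_smult_zero[OF W(1)] vs_l_zero[OF W(1) vs_zero[OF W(1)]])
  then show ?case using sp.step[of "pr g \<zero>[W]" L "pr v \<zero>[W]" P c] step unfolding L_def by auto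
 qed
 have 2: "pr \<zero>[V] v \<in> sp P L" if "v \<in> sp W H" for v using that
 proof induction
  case zero
  then show ?case using sp.zero[of P L] P(2) by simp
 next
  case (step g v c)
  have "pr \<zero>[V] (c \<odot>[W] g \<oplus>[W] v) = c \<odot>[P] (pr \<zero>[V] g) \<oplus>[P] pr \<zero>[V] v"
   by (simp add: P vs_smult_zero[OF V(1)] vs_l_zero[OF V(1) vs_zero[OF V(1)]])
  then show ?case using sp.step[of "pr \<zero>[V] g" L "pr \<zero>[V] v" P c] step unfolding L_def by auto
 qed
 show ?thesis
 proof (rule fdI[OF vP L])
  fix w assume "w \<in> carrier P"
  then have w: "p1 w \<in> carrier V" "p2 w \<in> carrier W" unfolding P by auto
  have "w = pr (p1 w) \<zero>[W] \<oplus>[P] pr \<zero>[V] (p2 w)"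
   using w by (simp add: P vs_r_zero[OF V(1)] vs_l_zero[OF W(1)])
  then show "w \<in> sp P L" using sp_add[OF vP L(2) 1[OF G(3)[OF w(1)]] 2[OF H(3)[OF w(2)]]] by simp
 qed
qed

section \<open>Linear maps and module homomorphisms\<close>

lemma linear_maps_iff:
 fixes V :: "('k::field, 'v, 'x) module_scheme" and W :: "('k, 'w, 'y) module_scheme"
 shows "f \<in> linear_maps V W \<longleftrightarrow> (\<forall>v\<in>carrier V. f v \<in> carrier W) \<and>
  (\<forall>v\<in>carrier V. \<forall>w\<in>carrier V. f (v \<oplus>[V] w) = f v \<oplus>[W] f w) \<and>
  (\<forall>c. \<forall>v\<in>carrier V. f (c \<odot>[V] v) = c \<odot>[W] f v) \<and> f \<in> extensional (carrier V)"
 unfolding linear_maps_def LinearCombinations.module_hom_def by auto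

lemma linear_mapsI:
 fixes V :: "('k::field, 'v, 'x) module_scheme" and W :: "('k, 'w, 'y) module_scheme"
 assumes "\<And>v. v \<in> carrier V ==> f v \<in> carrier W"
  "\<And>v w. v \<in> carrier V ==> w \<in> carrier V ==> f (v \<oplus>[V] w) = f v \<oplus>[W] f w"
  "\<And>c v. v \<in> carrier V ==> f (c \<odot>[V] v) = c \<odot>[W] f v" "f \<in> extensional (carrier V)"
 shows "f \<in> linear_maps V W"
 unfolding linear_maps_iff using assms by simp

lemma linear_mapsD:
 fixes V :: "('k::field, 'v, 'x) module_scheme" and W :: "('k, 'w, 'y) module_scheme"
 assumes "f \<in> linear_maps V W"
 shows "v \<in> carrier V ==> f v \<in> carrier W"
  "v \<in> carrier V ==> w \<in> carrier V ==> f (v \<oplus>[V] w) = f v \<oplus>[W] f w"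
  "v \<in> carrier V ==> f (c \<odot>[V] v) = c \<odot>[W] f v" "f \<in> extensional (carrier V)"
 using assms unfolding linear_maps_iff by auto

lemma linear_maps_zero:
 assumes V: "vs V" and W: "vs W" and f: "f \<in> linear_maps V W" shows "f \<zero>[V] = \<zero>[W]"
 using linear_mapsD(3)[OF f vs_zero[OF V], of 0] vs_zero_smult[OF V vs_zero[OF V]]
  vs_zero_smult[OF W linear_mapsD(1)[OF f vs_zero[OF V]]] by simp

lemma rm_vs: "is_right_module A M ==> vs M"
 unfolding is_right_module_def by simp

lemma rm_act:
 assumes "is_right_module A M"
 shows "v \<in> carrier M ==> a \<in> carrier A ==> act M v a \<in> carrier M"
  and "v \<in> carrier M ==> w \<in> carrier M ==> a \<in> carrier A ==> act M (v \<oplus>[M] w) a = act M v a \<oplus>[M] act M w a"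
  and "v \<in> carrier M ==> a \<in> carrier A ==> b \<in> carrier A ==> act M v (a \<oplus>[A] b) = act M v a \<oplus>[M] act M v b"
  and "v \<in> carrier M ==> a \<in> carrier A ==> b \<in> carrier A ==> act M v (a \<otimes>[A] b) = act M (act M v a) b"
  and "v \<in> carrier M ==> act M v \<one>[A] = v"
  and "v \<in> carrier M ==> a \<in> carrier A ==> act M (c \<odot>[M] v) a = c \<odot>[M] act M v a"
  and "v \<in> carrier M ==> a \<in> carrier A ==> act M v (c \<odot>[A] a) = c \<odot>[M] act M v a"
 using assms unfolding is_right_module_def by simp_all

lemma rmI:
 assumes "vs M"
  and "\<And>v a. v \<in> carrier M ==> a \<in> carrier A ==> act M v a \<in> carrier M"
  and "\<And>v w a. v \<in> carrier M ==> w \<in> carrier M ==> a \<in> carrier A ==> act M (v \<oplus>[M] w) a = act M v a \<oplus>[M] act M w a"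
  and "\<And>v a b. v \<in> carrier M ==> a \<in> carrier A ==> b \<in> carrier A ==> act M v (a \<oplus>[A] b) = act M v a \<oplus>[M] act M v b"
  and "\<And>v a b. v \<in> carrier M ==> a \<in> carrier A ==> b \<in> carrier A ==> act M v (a \<otimes>[A] b) = act M (act M v a) b"
  and "\<And>v. v \<in> carrier M ==> act M v \<one>[A] = v"
  and "\<And>v a c. v \<in> carrier M ==> a \<in> carrier A ==> act M (c \<odot>[M] v) a = c \<odot>[M] act M v a"
  and "\<And>v a c. v \<in> carrier M ==> a \<in> carrier A ==> act M v (c \<odot>[A] a) = c \<odot>[M] act M v a"
 shows "is_right_module A M"
 unfolding is_right_module_def using assms by simp

lemma module_maps_iff: "f \<in> module_maps A M N \<longleftrightarrow> f \<in> linear_maps M N \<and> (\<forall>v\<in>carrier M. \<forall>a\<in>carrier A. f (act M v a) = act N (f v) a)"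
 unfolding module_maps_def by simp

lemma mmD:
 assumes "f \<in> module_maps A M N"
 shows "v \<in> carrier M ==> f v \<in> carrier N"
  "v \<in> carrier M ==> w \<in> carrier M ==> f (v \<oplus>[M] w) = f v \<oplus>[N] f w"
  "v \<in> carrier M ==> f (c \<odot>[M] v) = c \<odot>[N] f v" "f \<in> extensional (carrier M)"
  "v \<in> carrier M ==> a \<in> carrier A ==> f (act M v a) = act N (f v) a"
 using assms unfolding module_maps_iff linear_maps_iff by simp_all

lemma mmI:
 assumes "\<And>v. v \<in> carrier M ==> f v \<in> carrier N"
  "\<And>v w. v \<in> carrier M ==> w \<in> carrier M ==> f (v \<oplus>[M] w) = f v \<oplus>[N] f w"
  "\<And>c v. v \<in> carrier M ==> f (c \<odot>[M] v) = c \<odot>[N] f v" "f \<in> extensional (carrier M)"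
  "\<And>v a. v \<in> carrier M ==> a \<in> carrier A ==> f (act M v a) = act N (f v) a"
 shows "f \<in> module_maps A M N"
 unfolding module_maps_iff linear_maps_iff using assms by simp

lemma mm_restrictI:
 assumes M: "is_right_module A M"
  and "\<And>v. v \<in> carrier M ==> f v \<in> carrier N"
  "\<And>v w. v \<in> carrier M ==> w \<in> carrier M ==> f (v \<oplus>[M] w) = f v \<oplus>[N] f w"
  "\<And>c v. v \<in> carrier M ==> f (c \<odot>[M] v) = c \<odot>[N] f v"
  "\<And>v a. v \<in> carrier M ==> a \<in> carrier A ==> f (act M v a) = act N (f v) a"
 shows "restrict f (carrier M) \<in> module_maps A M N"
 by (rule mmI) (use assms vs_add[OF rm_vs[OF M]] vs_smult[OF rm_vs[OF M]] rm_act(1)[OF M] in auto)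

lemma mm_ext: "f \<in> module_maps A M N ==> g \<in> module_maps A M N' ==> (\<And>v. v \<in> carrier M ==> f v = g v) ==> f = g"
 by (rule extensionalityI[OF mmD(4) mmD(4)])

lemma mm_comp:
 assumes L: "is_right_module A L" and f: "f \<in> module_maps A L M" and g: "g \<in> module_maps A M N"
 shows "compose (carrier L) g f \<in> module_maps A L N"
 unfolding compose_def
 by (rule mm_restrictI[OF L]) (simp_all add: mmD[OF f] mmD[OF g])

lemma mm_zero:
 assumes "is_right_module A M" "is_right_module A N" "f \<in> module_maps A M N"
 shows "f \<zero>[M] = \<zero>[N]"
 using assms linear_maps_zero rm_vs unfolding module_maps_iff by blast

lemma mm_id: "is_right_module A M ==> (\<lambda>v\<in>carrier M. v) \<in> module_maps A M M"
 by (rule mm_restrictI) auto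

lemma mm_plus:
 assumes M: "is_right_module A M" and N: "is_right_module A N" and f: "f \<in> module_maps A M N" and g: "g \<in> module_maps A M N"
 shows "(\<lambda>v\<in>carrier M. f v \<oplus>[N] g v) \<in> module_maps A M N"
proof (rule mm_restrictI[OF M])
 interpret abelian_group N by (rule vs_abelian_group[OF rm_vs[OF N]])
 fix v w assume v: "v \<in> carrier M" and w: "w \<in> carrier M"
 then show "f (v \<oplus>[M] w) \<oplus>[N] g (v \<oplus>[M] w) = f v \<oplus>[N] g v \<oplus>[N] (f w \<oplus>[N] g w)"
  using mmD(1,2)[OF f] mmD(1,2)[OF g] by (simp add: a_ac)
qed (simp_all add: mmD[OF f] mmD[OF g] vs_add[OF rm_vs[OF N]] vs_r_distr[OF rm_vs[OF N]] rm_act[OF N])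

lemma mm_smult:
 assumes M: "is_right_module A M" and N: "is_right_module A N" and f: "f \<in> module_maps A M N"
 shows "(\<lambda>v\<in>carrier M. c \<odot>[N] f v) \<in> module_maps A M N"
 by (rule mm_restrictI[OF M])
  (simp_all add: mmD[OF f] vs_smult[OF rm_vs[OF N]] vs_r_distr[OF rm_vs[OF N]] rm_act[OF N]
   vs_smult_assoc[OF rm_vs[OF N], symmetric] mult.commute)

lemma Hom_mod [simp]: "Hom (mod_category A) = module_maps A"
 and Id_mod [simp]: "Id (mod_category A) M = (\<lambda>v\<in>carrier M. v)"
 and Cmp_mod [simp]: "Cmp (mod_category A) L M N g f = compose (carrier L) g f"
 by (simp_all add: mod_category_def)

section \<open>Finitely generated modules over a finite-dimensional algebra\<close>

locale fd_algebra =
 fixes A :: "('k::field, 'a) module"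
 assumes alg: "K_algebra A" and fin: "fd A"
begin

lemma ring_A: "ring A" and vs_A: "vs A"
 using alg unfolding K_algebra_def by auto

lemma one_A: "\<one>[A] \<in> carrier A"
 using ring.ring_simprules(6)[OF ring_A] .

lemma zero_A: "\<zero>[A] \<in> carrier A"
 by (rule vs_zero[OF vs_A])

lemma act_zero: assumes M: "is_right_module A M" and v: "v \<in> carrier M" shows "act M v \<zero>[A] = \<zero>[M]"
 using rm_act(7)[OF M v zero_A, of 0] vs_zero_smult[OF vs_A zero_A] vs_zero_smult[OF rm_vs[OF M] rm_act(1)[OF M v zero_A]] by simp

text \<open>The products of module generators with a finite spanning set of A span M.\<close>

lemma fg_fd:
 fixes M :: "('k, 'v, 'a) right_module"
 assumes M: "is_right_module A M" and fg: "finitely_generated A M"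
 shows "fd M"
proof -
 note V = rm_vs[OF M]
 obtain G where G: "finite G" "G \<subseteq> carrier M"
  "\<forall>v\<in>carrier M. \<exists>a. (\<forall>g\<in>G. a g \<in> carrier A) \<and> v = finsum M (\<lambda>g. act M g (a g)) G"
  using fg unfolding finitely_generated_def by (elim exE conjE) (rule that)
 obtain B where B: "finite B" "B \<subseteq> carrier A" "\<And>a. a \<in> carrier A ==> a \<in> sp A B" by (rule fdE[OF vs_A fin]) blast
 define L where "L = (\<lambda>(g, b). act M g b) ` (G \<times> B)"
 have L: "finite L" "L \<subseteq> carrier M" unfolding L_def using G(1,2) B(1,2) by (auto intro!: rm_act(1)[OF M])
 have 1: "act M g a \<in> sp M L" if g: "g \<in> G" and a: "a \<in> sp A B" for g a
  using a
 proof induction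
  case zero
  have "act M g \<zero>[A] = \<zero>[M]" using act_zero[OF M] g G by blast
  then show ?case using sp.zero[of M L] by simp
 next
  case (step b a c)
  have gM: "g \<in> carrier M" and b: "b \<in> carrier A" and a: "a \<in> carrier A" using g G step.hyps B sp_closed[OF vs_A B(2)] by auto
  have "act M g (c \<odot>[A] b \<oplus>[A] a) = c \<odot>[M] act M g b \<oplus>[M] act M g a"
   using rm_act(3)[OF M gM vs_smult[OF vs_A b] a] rm_act(7)[OF M gM b] by simp
  moreover have "act M g b \<in> L" unfolding L_def using g step.hyps by auto
  ultimately show ?case using sp.step[OF _ step.IH] by simp
 qed
 interpret ab: abelian_group M by (rule vs_abelian_group[OF V])
 show ?thesis
 proof (rule fdI[OF V L])
  fix v assume "v \<in> carrier M"
  then obtain a where a: "\<forall>g\<in>G. a g \<in> carrier A" "v = finsum M (\<lambda>g. act M g (a g)) G" using G(3) by blast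
  have "H \<subseteq> G ==> finsum M (\<lambda>g. act M g (a g)) H \<in> sp M L" if "finite H" for H
   using that
  proof induction
   case empty
   then show ?case using sp.zero[of M L] by simp
  next
   case (insert x F)
   have "finsum M (\<lambda>g. act M g (a g)) (insert x F) = act M x (a x) \<oplus>[M] finsum M (\<lambda>g. act M g (a g)) F"
    using insert G(2) a(1) by (subst ab.finsum_insert) (auto intro!: rm_act(1)[OF M])
   moreover have "act M x (a x) \<in> sp M L" using 1 insert.prems a B by auto
   ultimately show ?case using sp_add[OF V L(2)] insert by auto
  qed
  then show "v \<in> sp M L" using a G(1) by blast
 qed
qed

text \<open>A scalar acts as a multiple of the unit of A, so a linear spanning set generates the
  module.\<close>

lemma fd_fg:
 fixes M :: "('k, 'v, 'a) right_module"
 assumes M: "is_right_module A M" and f: "fd M"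
 shows "finitely_generated A M"
proof -
 note V = rm_vs[OF M]
 interpret ab: abelian_group M by (rule vs_abelian_group[OF V])
 obtain G where G: "finite G" "G \<subseteq> carrier M" "\<And>v. v \<in> carrier M ==> v \<in> sp M G" by (rule fdE[OF V f]) blast
 have "\<exists>a. (\<forall>g\<in>G. a g \<in> carrier A) \<and> v = finsum M (\<lambda>g. act M g (a g)) G" if "v \<in> sp M G" for v
  using that
 proof induction
  case zero
  have "finsum M (\<lambda>g. act M g \<zero>[A]) G = \<zero>[M]"
   using G(2) act_zero[OF M] by (intro ab.finsum_all0) auto
  then show ?case using zero_A by (intro exI[of _ "\<lambda>_. \<zero>[A]"]) simp
 next
  case (step g v c)
  then obtain a where a: "\<forall>g\<in>G. a g \<in> carrier A" "v = finsum M (\<lambda>g. act M g (a g)) G" by blast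
  have g: "g \<in> carrier M" using step G by blast
  \<comment> \<open>The coefficient at \<open>g\<close> may already be nonzero, so the new scalar is
    added to it.\<close>
  define b where "b = a(g := c \<odot>[A] \<one>[A] \<oplus>[A] a g)"
  have bA: "\<forall>g\<in>G. b g \<in> carrier A" unfolding b_def using a(1) vs_add[OF vs_A vs_smult[OF vs_A one_A]] by auto
  have Gg: "G = insert g (G - {g})" using step by blast
  have cl: "act M h (a h) \<in> carrier M" "act M h (b h) \<in> carrier M" if "h \<in> G" for h
   using rm_act(1)[OF M] G(2) a(1) bA that by blast+
  have "finsum M (\<lambda>g. act M g (b g)) G = act M g (b g) \<oplus>[M] finsum M (\<lambda>g. act M g (b g)) (G - {g})"
   by (subst Gg, subst ab.finsum_insert) (use G(1) cl step in auto)
  also have "finsum M (\<lambda>g. act M g (b g)) (G - {g}) = finsum M (\<lambda>g. act M g (a g)) (G - {g})"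
   by (rule ab.finsum_cong') (use cl in \<open>auto simp: b_def\<close>)
  also have "act M g (b g) = c \<odot>[M] g \<oplus>[M] act M g (a g)"
   unfolding b_def using rm_act(3)[OF M g vs_smult[OF vs_A one_A]] rm_act(7)[OF M g one_A] rm_act(5)[OF M g] a(1) step by simp
  also have "c \<odot>[M] g \<oplus>[M] act M g (a g) \<oplus>[M] finsum M (\<lambda>g. act M g (a g)) (G - {g}) =
    c \<odot>[M] g \<oplus>[M] (act M g (a g) \<oplus>[M] finsum M (\<lambda>g. act M g (a g)) (G - {g}))"
   using cl step vs_smult[OF V g] by (intro ab.a_assoc) (auto intro!: ab.finsum_closed)
  also have "act M g (a g) \<oplus>[M] finsum M (\<lambda>g. act M g (a g)) (G - {g}) = finsum M (\<lambda>g. act M g (a g)) G"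
   by (subst (2) Gg, subst ab.finsum_insert) (use G(1) cl step in auto)
  finally show ?case using bA a(2) by (intro exI[of _ b]) simp
 qed
 then have "\<forall>v\<in>carrier M. \<exists>a. (\<forall>g\<in>G. a g \<in> carrier A) \<and> v = finsum M (\<lambda>g. act M g (a g)) G"
  using G(3) by blast
 then show ?thesis unfolding finitely_generated_def using G(1,2) by (intro exI[of _ G] conjI)
qed

text \<open>Over a finite-dimensional algebra finite generation is a condition on the vector space
  alone; closure under submodules and products becomes linear algebra.\<close>

lemma MO_iff:
 fixes M :: "('k, 'v, 'a) right_module"
 shows "M \<in> Ob (mod_category A) \<longleftrightarrow> is_right_module A M \<and> fd M"
 using fg_fd fd_fg by (auto simp: mod_category_def)

abbreviation MO :: "('k, nat => 'k, 'a) right_module set" where "MO \<equiv> Ob (mod_category A)"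
abbreviation MH :: "('k, nat => 'k, 'a) right_module => ('k, nat => 'k, 'a) right_module => _" where
 "MH \<equiv> module_maps A"

lemma MO_rm: "M \<in> MO ==> is_right_module A M" and MO_fd: "M \<in> MO ==> fd M" and MO_vs: "M \<in> MO ==> vs M"
 using MO_iff rm_vs by auto

lemma sub_rm:
 assumes M: "is_right_module A M" and N: "N \<subseteq> carrier M" "\<zero>[M] \<in> N"
  "\<And>x y. x \<in> N ==> y \<in> N ==> x \<oplus>[M] y \<in> N" "\<And>x c. x \<in> N ==> c \<odot>[M] x \<in> N"
  "\<And>x a. x \<in> N ==> a \<in> carrier A ==> act M x a \<in> N"
 shows "is_right_module A (M\<lparr>carrier := N\<rparr>)"
proof -
 note i = subsetD[OF N(1)]
 show ?thesis
  by (rule rmI[OF vs_sub[OF rm_vs[OF M] N(1-4)]]) (use N rm_act[OF M i] i in \<open>simp_all add: rm_act(2)[OF M]\<close>)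
qed

lemma sub_MO:
 assumes M: "M \<in> MO" and N: "N \<subseteq> carrier M" "\<zero>[M] \<in> N"
  "\<And>x y. x \<in> N ==> y \<in> N ==> x \<oplus>[M] y \<in> N" "\<And>x c. x \<in> N ==> c \<odot>[M] x \<in> N"
  "\<And>x a. x \<in> N ==> a \<in> carrier A ==> act M x a \<in> N"
 shows "M\<lparr>carrier := N\<rparr> \<in> MO"
 unfolding MO_iff
proof
 show "is_right_module A (M\<lparr>carrier := N\<rparr>)" by (rule sub_rm[OF MO_rm[OF M] N])
 show "fd (M\<lparr>carrier := N\<rparr>)" by (rule fd_sub[OF MO_vs[OF M] MO_fd[OF M] N(1-4)])
qed

end

definition prodM :: "('k, nat => 'k, 'a) right_module => ('k, nat => 'k, 'a) right_module => ('k, nat => 'k, 'a) right_module" where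
 "prodM M N = \<lparr>carrier = {w. p1 w \<in> carrier M \<and> p2 w \<in> carrier N}, monoid.mult = undefined, one = undefined,
  zero = pr \<zero>[M] \<zero>[N], add = (\<lambda>x y. pr (p1 x \<oplus>[M] p1 y) (p2 x \<oplus>[N] p2 y)),
  smult = (\<lambda>c x. pr (c \<odot>[M] p1 x) (c \<odot>[N] p2 x)), act = (\<lambda>x a. pr (act M (p1 x) a) (act N (p2 x) a))\<rparr>"

lemma prodM_simps [simp]:
 "carrier (prodM M N) = {w. p1 w \<in> carrier M \<and> p2 w \<in> carrier N}"
 "\<zero>[prodM M N] = pr \<zero>[M] \<zero>[N]"
 "x \<oplus>[prodM M N] y = pr (p1 x \<oplus>[M] p1 y) (p2 x \<oplus>[N] p2 y)"
 "c \<odot>[prodM M N] x = pr (c \<odot>[M] p1 x) (c \<odot>[N] p2 x)"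
 "act (prodM M N) x a = pr (act M (p1 x) a) (act N (p2 x) a)"
 by (simp_all add: prodM_def)

context fd_algebra begin

lemma prod_rm: assumes M: "is_right_module A M" and N: "is_right_module A N" shows "is_right_module A (prodM M N)"
 by (rule rmI[OF vs_prod[OF rm_vs[OF M] rm_vs[OF N]]]) (simp_all add: rm_act[OF M] rm_act[OF N])

lemma prod_MO: assumes M: "M \<in> MO" and N: "N \<in> MO" shows "prodM M N \<in> MO"
 unfolding MO_iff using prod_rm[OF MO_rm[OF M] MO_rm[OF N]]
  fd_prod[OF MO_vs[OF M] MO_fd[OF M] MO_vs[OF N] MO_fd[OF N], of "prodM M N"] by simp

lemma mm_p1: assumes M: "M \<in> MO" and N: "N \<in> MO" shows "restrict p1 (carrier (prodM M N)) \<in> MH (prodM M N) M"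
 by (rule mm_restrictI[OF prod_rm[OF MO_rm[OF M] MO_rm[OF N]]]) simp_all

lemma mm_p2: assumes M: "M \<in> MO" and N: "N \<in> MO" shows "restrict p2 (carrier (prodM M N)) \<in> MH (prodM M N) N"
 by (rule mm_restrictI[OF prod_rm[OF MO_rm[OF M] MO_rm[OF N]]]) simp_all

lemma mm_pair: assumes X: "X \<in> MO" and f: "f \<in> MH X M" and g: "g \<in> MH X N"
 shows "(\<lambda>v\<in>carrier X. pr (f v) (g v)) \<in> MH X (prodM M N)"
 by (rule mm_restrictI[OF MO_rm[OF X]]) (simp_all add: mmD[OF f] mmD[OF g])

lemma mm_copair: assumes M: "M \<in> MO" and N: "N \<in> MO" and Y: "Y \<in> MO" and f: "f \<in> MH M Y" and g: "g \<in> MH N Y"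
 shows "(\<lambda>w\<in>carrier (prodM M N). f (p1 w) \<oplus>[Y] g (p2 w)) \<in> MH (prodM M N) Y"
proof -
 interpret abelian_group Y by (rule vs_abelian_group[OF MO_vs[OF Y]])
 show ?thesis
  by (rule mm_restrictI[OF prod_rm[OF MO_rm[OF M] MO_rm[OF N]]])
   (simp_all add: mmD[OF f] mmD[OF g] a_ac vs_r_distr[OF MO_vs[OF Y]] rm_act[OF MO_rm[OF Y]])
qed

text \<open>Fibre products of modules are what makes kernels of finitely presented functors finitely
  presented. Existence of the induced map is the part that enters there.\<close>

lemma module_pullback:
 assumes N: "N \<in> MO" and M: "M \<in> MO" and Y: "Y \<in> MO" and a: "a \<in> MH N Y" and r: "r \<in> MH M Y"
 shows "\<exists>Q\<in>MO. \<exists>q\<in>MH Q N. \<exists>q'\<in>MH Q M. (\<forall>w\<in>carrier Q. a (q w) = r (q' w)) \<and>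
  (\<forall>X\<in>MO. \<forall>h\<in>MH X N. \<forall>k\<in>MH X M. (\<forall>v\<in>carrier X. a (h v) = r (k v)) -->
   (\<exists>l\<in>MH X Q. \<forall>v\<in>carrier X. q (l v) = h v \<and> q' (l v) = k v))"
proof -
 let ?P = "prodM N M"
 define K where "K = {w \<in> carrier ?P. a (p1 w) = r (p2 w)}"
 let ?Q = "?P\<lparr>carrier := K\<rparr>"
 have Q: "?Q \<in> MO"
  by (rule sub_MO[OF prod_MO[OF N M]])
   (auto simp: K_def mmD[OF a] mmD[OF r] mm_zero[OF MO_rm[OF N] MO_rm[OF Y] a] mm_zero[OF MO_rm[OF M] MO_rm[OF Y] r]
    vs_zero[OF MO_vs[OF N]] vs_zero[OF MO_vs[OF M]] vs_add[OF MO_vs[OF N]] vs_add[OF MO_vs[OF M]]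
    vs_smult[OF MO_vs[OF N]] vs_smult[OF MO_vs[OF M]] rm_act[OF MO_rm[OF N]] rm_act[OF MO_rm[OF M]])
 have q: "restrict p1 K \<in> MH ?Q N" "restrict p2 K \<in> MH ?Q M"
  using mm_restrictI[OF MO_rm[OF Q], of p1 N] mm_restrictI[OF MO_rm[OF Q], of p2 M] by (auto simp: K_def)
 show ?thesis
 proof (rule bexI[OF _ Q], rule bexI[OF _ q(1)], rule bexI[OF _ q(2)], intro conjI ballI impI)
  fix w assume "w \<in> carrier ?Q"
  then show "a (restrict p1 K w) = r (restrict p2 K w)" by (simp add: K_def)
 next
  fix X h k assume X: "X \<in> MO" and h: "h \<in> MH X N" and k: "k \<in> MH X M" and e: "\<forall>v\<in>carrier X. a (h v) = r (k v)"
  have "(\<lambda>v\<in>carrier X. pr (h v) (k v)) \<in> MH X ?Q"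
   by (rule mm_restrictI[OF MO_rm[OF X]]) (use e in \<open>simp_all add: K_def mmD[OF h] mmD[OF k]\<close>)
  then show "\<exists>l\<in>MH X ?Q. \<forall>v\<in>carrier X. restrict p1 K (l v) = h v \<and> restrict p2 K (l v) = k v"
   using e by (intro bexI[of _ "\<lambda>v\<in>carrier X. pr (h v) (k v)"]) (auto simp: K_def mmD[OF h] mmD[OF k])
 qed
qed

end

section \<open>Finitely presented functors\<close>

text \<open>The quotient of \<open>V\<close> by \<open>N\<close> lives on a set of coset representatives, so that its carrier
 stays in the type of \<open>V\<close>.\<close>

definition qp :: "('k::field, 'v, 'x) module_scheme => 'v set => 'v => 'v" where
 "qp V N v = (SOME w. w \<in> {w \<in> carrier V. w \<ominus>\<^bsub>V\<^esub> v \<in> N})"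

definition quoV :: "('k::field, 'v, 'x) module_scheme => 'v set => ('k, 'v) module" where
 "quoV V N = \<lparr>carrier = qp V N ` carrier V, monoid.mult = undefined, one = undefined, zero = qp V N \<zero>[V],
  add = (\<lambda>x y. qp V N (x \<oplus>[V] y)), smult = (\<lambda>c x. qp V N (c \<odot>[V] x))\<rparr>"

definition subspace_of :: "('k::field, 'v, 'x) module_scheme => 'v set => bool" where
 "subspace_of V N \<longleftrightarrow> N \<subseteq> carrier V \<and> \<zero>[V] \<in> N \<and> (\<forall>x\<in>N. \<forall>y\<in>N. x \<oplus>[V] y \<in> N) \<and> (\<forall>c. \<forall>x\<in>N. c \<odot>[V] x \<in> N)"

lemma subspace_ofD: assumes "subspace_of V N"
 shows "N \<subseteq> carrier V" "\<zero>[V] \<in> N" "\<And>x y. x \<in> N ==> y \<in> N ==> x \<oplus>[V] y \<in> N" "\<And>x c. x \<in> N ==> c \<odot>[V] x \<in> N"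
 using assms unfolding subspace_of_def by auto

lemma subspace_ofI: "N \<subseteq> carrier V ==> \<zero>[V] \<in> N ==> (\<And>x y. x \<in> N ==> y \<in> N ==> x \<oplus>[V] y \<in> N) ==>
 (\<And>x c. x \<in> N ==> c \<odot>[V] x \<in> N) ==> subspace_of V N"
 unfolding subspace_of_def by auto

context
 fixes V :: "('k::field, 'v, 'x) module_scheme" and N
 assumes V: "vs V" and N: "subspace_of V N"
begin

interpretation ab: abelian_group V by (rule vs_abelian_group[OF V])

lemma sub_minus: "x \<in> N ==> y \<in> N ==> x \<ominus>\<^bsub>V\<^esub> y \<in> N"
proof -
 assume "x \<in> N" "y \<in> N"
 then show ?thesis using vs_minus[OF V, of x y] subspace_ofD(1,3,4)[OF N] by (metis subsetD)
qed

lemma diff_sym: assumes "x \<in> carrier V" "y \<in> carrier V" "x \<ominus>\<^bsub>V\<^esub> y \<in> N" shows "y \<ominus>\<^bsub>V\<^esub> x \<in> N"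
proof -
 have "y \<ominus>\<^bsub>V\<^esub> x = \<zero>[V] \<ominus>\<^bsub>V\<^esub> (x \<ominus>\<^bsub>V\<^esub> y)" using assms by (simp add: ab.minus_eq ab.minus_add ab.a_comm)
 then show ?thesis using sub_minus subspace_ofD(2)[OF N] assms by simp
qed

lemma diff_trans: assumes "x \<in> carrier V" "y \<in> carrier V" "z \<in> carrier V" "x \<ominus>\<^bsub>V\<^esub> y \<in> N" "y \<ominus>\<^bsub>V\<^esub> z \<in> N"
 shows "x \<ominus>\<^bsub>V\<^esub> z \<in> N"
proof -
 have "x \<ominus>\<^bsub>V\<^esub> z = (x \<ominus>\<^bsub>V\<^esub> y) \<oplus>[V] (y \<ominus>\<^bsub>V\<^esub> z)" using assms(1-3) by (simp add: ab.minus_eq ab.a_assoc ab.r_neg1)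
 then show ?thesis using subspace_ofD(3)[OF N] assms by simp
qed

lemma qp_props: assumes v: "v \<in> carrier V" shows "qp V N v \<in> carrier V" "qp V N v \<ominus>\<^bsub>V\<^esub> v \<in> N"
proof -
 have "v \<ominus>\<^bsub>V\<^esub> v = \<zero>[V]" using vs_minus_eq_zero[OF V v v] by blast
 then have "v \<ominus>\<^bsub>V\<^esub> v \<in> N" using subspace_ofD(2)[OF N] by metis
 then have "v \<in> {w \<in> carrier V. w \<ominus>\<^bsub>V\<^esub> v \<in> N}" using v by simp
 then have "qp V N v \<in> {w \<in> carrier V. w \<ominus>\<^bsub>V\<^esub> v \<in> N}" unfolding qp_def by (rule someI)
 then show "qp V N v \<in> carrier V" "qp V N v \<ominus>\<^bsub>V\<^esub> v \<in> N" by auto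
qed

lemma qp_eq: assumes v: "v \<in> carrier V" and w: "w \<in> carrier V"
 shows "qp V N v = qp V N w \<longleftrightarrow> v \<ominus>\<^bsub>V\<^esub> w \<in> N"
proof
 assume "qp V N v = qp V N w"
 then show "v \<ominus>\<^bsub>V\<^esub> w \<in> N" using qp_props[OF v] qp_props[OF w] diff_sym diff_trans v w by metis
next
 assume d: "v \<ominus>\<^bsub>V\<^esub> w \<in> N"
 \<comment> \<open>The choice is made from the whole coset, so equal cosets have equal
   representatives.\<close>
 have "{x \<in> carrier V. x \<ominus>\<^bsub>V\<^esub> v \<in> N} = {x \<in> carrier V. x \<ominus>\<^bsub>V\<^esub> w \<in> N}"
  using d diff_sym diff_trans v w by blast
 then show "qp V N v = qp V N w" unfolding qp_def by simp
qed

lemma qp_qp: "v \<in> carrier V ==> qp V N (qp V N v) = qp V N v"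
 using qp_eq qp_props by blast

lemma qp_add: assumes "v \<in> carrier V" "w \<in> carrier V" shows "qp V N (qp V N v \<oplus>[V] qp V N w) = qp V N (v \<oplus>[V] w)"
proof -
 have "(qp V N v \<oplus>[V] qp V N w) \<ominus>\<^bsub>V\<^esub> (v \<oplus>[V] w) = (qp V N v \<ominus>\<^bsub>V\<^esub> v) \<oplus>[V] (qp V N w \<ominus>\<^bsub>V\<^esub> w)"
  using assms qp_props by (simp add: ab.minus_eq ab.minus_add ab.a_ac)
 then show ?thesis using qp_eq assms qp_props subspace_ofD(3)[OF N] by simp
qed

lemma qp_smult: assumes "v \<in> carrier V" shows "qp V N (c \<odot>[V] qp V N v) = qp V N (c \<odot>[V] v)"
proof -
 have "c \<odot>[V] qp V N v \<ominus>\<^bsub>V\<^esub> c \<odot>[V] v = c \<odot>[V] (qp V N v \<ominus>\<^bsub>V\<^esub> v)"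
  using assms qp_props by (simp add: vs_minus[OF V] vs_smult[OF V] vs_r_distr[OF V] vs_smult_assoc[OF V, symmetric] mult.commute)
 then show ?thesis using qp_eq assms qp_props subspace_ofD(4)[OF N] vs_smult[OF V] by simp
qed

lemma quoV_simps:
 "carrier (quoV V N) = qp V N ` carrier V" "\<zero>[quoV V N] = qp V N \<zero>[V]"
 "x \<oplus>[quoV V N] y = qp V N (x \<oplus>[V] y)" "c \<odot>[quoV V N] x = qp V N (c \<odot>[V] x)"
 by (simp_all add: quoV_def)

lemma quoV_sub: "x \<in> carrier (quoV V N) ==> x \<in> carrier V" "x \<in> carrier (quoV V N) ==> qp V N x = x"
 using qp_props qp_qp unfolding quoV_simps by auto

lemma qp_add2: assumes "v \<in> carrier V" "w \<in> carrier V"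
 shows "qp V N (qp V N v \<oplus>[V] w) = qp V N (v \<oplus>[V] w)" "qp V N (w \<oplus>[V] qp V N v) = qp V N (w \<oplus>[V] v)"
 using qp_add[of "qp V N v" w] qp_add[of v w] qp_add[of w "qp V N v"] qp_add[of w v] qp_qp qp_props assms by simp_all

lemma vs_quoV: "vs (quoV V N)"
proof (rule vsI)
 fix x y z :: 'v and c d :: 'k
 note q = qp_add2 qp_smult vs_add[OF V] vs_smult[OF V] vs_zero[OF V] quoV_sub
 { show "\<zero>[quoV V N] \<in> carrier (quoV V N)" unfolding quoV_simps using vs_zero[OF V] by blast }
 assume x: "x \<in> carrier (quoV V N)"
 { show "c \<odot>[quoV V N] x \<in> carrier (quoV V N)" using quoV_sub[OF x] vs_smult[OF V] unfolding quoV_simps by blast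
  show "\<zero>[quoV V N] \<oplus>[quoV V N] x = x" using q x vs_l_zero[OF V] by (simp add: quoV_simps(2,3))
  show "(c + d) \<odot>[quoV V N] x = c \<odot>[quoV V N] x \<oplus>[quoV V N] d \<odot>[quoV V N] x"
   using q(3-) x vs_l_distr[OF V] qp_add by (simp add: quoV_simps(3,4))
  show "(c * d) \<odot>[quoV V N] x = c \<odot>[quoV V N] (d \<odot>[quoV V N] x)" using q x vs_smult_assoc[OF V] by (simp add: quoV_simps(4))
  show "1 \<odot>[quoV V N] x = x" using q x vs_one[OF V] by (simp add: quoV_simps(4))
  show "0 \<odot>[quoV V N] x = \<zero>[quoV V N]" using q x vs_zero_smult[OF V] by (simp add: quoV_simps(2,4)) }
 assume y: "y \<in> carrier (quoV V N)"
 { show "x \<oplus>[quoV V N] y \<in> carrier (quoV V N)" using quoV_sub[OF x] quoV_sub[OF y] vs_add[OF V] unfolding quoV_simps by blast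
  show "x \<oplus>[quoV V N] y = y \<oplus>[quoV V N] x" using q x y vs_comm[OF V, of x y] by (simp add: quoV_simps(3))
  show "c \<odot>[quoV V N] (x \<oplus>[quoV V N] y) = c \<odot>[quoV V N] x \<oplus>[quoV V N] c \<odot>[quoV V N] y"
   using q(3-) x y vs_r_distr[OF V, of x y c] qp_add by (simp add: quoV_simps(3,4)) }
 assume z: "z \<in> carrier (quoV V N)"
 show "x \<oplus>[quoV V N] y \<oplus>[quoV V N] z = x \<oplus>[quoV V N] (y \<oplus>[quoV V N] z)"
  using q x y z vs_assoc[OF V, of x y z] by (simp add: quoV_simps(3))
qed

lemma fd_quoV: assumes "fd V" shows "fd (quoV V N)"
 by (rule fd_image[OF V assms vs_quoV, of "qp V N"]) (auto simp: quoV_simps qp_add qp_smult)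

lemma qp_zero_iff: "v \<in> carrier V ==> qp V N v = \<zero>[quoV V N] \<longleftrightarrow> v \<in> N"
 unfolding quoV_simps using qp_eq[of v "\<zero>[V]"] vs_zero[OF V] vs_minus[OF V, of v "\<zero>[V]"] vs_smult_zero[OF V] vs_r_zero[OF V] by simp

end

definition prodV :: "('k, nat => 'k) module => ('k, nat => 'k) module => ('k, nat => 'k) module" where
 "prodV M N = \<lparr>carrier = {w. p1 w \<in> carrier M \<and> p2 w \<in> carrier N}, monoid.mult = undefined, one = undefined,
  zero = pr \<zero>[M] \<zero>[N], add = (\<lambda>x y. pr (p1 x \<oplus>[M] p1 y) (p2 x \<oplus>[N] p2 y)),
  smult = (\<lambda>c x. pr (c \<odot>[M] p1 x) (c \<odot>[N] p2 x))\<rparr>"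

lemma prodV_simps [simp]:
 "carrier (prodV M N) = {w. p1 w \<in> carrier M \<and> p2 w \<in> carrier N}"
 "\<zero>[prodV M N] = pr \<zero>[M] \<zero>[N]"
 "x \<oplus>[prodV M N] y = pr (p1 x \<oplus>[M] p1 y) (p2 x \<oplus>[N] p2 y)"
 "c \<odot>[prodV M N] x = pr (c \<odot>[M] p1 x) (c \<odot>[N] p2 x)"
 by (simp_all add: prodV_def)

section \<open>Contravariant functors, natural transformations and presentations\<close>

context fd_algebra begin

abbreviation cf :: "('k, nat => 'k, 'a, nat => 'k) mod_functor => bool" where "cf \<equiv> contravariant_functor A"

lemma cfD:
 assumes F: "cf F"
 shows "X \<in> MO ==> vs (on_ob F X)" "X \<in> MO ==> fd (on_ob F X)"
  "X \<in> MO ==> Y \<in> MO ==> f \<in> MH X Y ==> on_mor F X Y f \<in> linear_maps (on_ob F Y) (on_ob F X)"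
  "X \<in> MO ==> Y \<in> MO ==> f \<in> MH X Y ==> g \<in> MH X Y ==> v \<in> carrier (on_ob F Y) ==>
   on_mor F X Y (\<lambda>v\<in>carrier X. f v \<oplus>[Y] g v) v = on_mor F X Y f v \<oplus>[on_ob F X] on_mor F X Y g v"
  "X \<in> MO ==> Y \<in> MO ==> f \<in> MH X Y ==> v \<in> carrier (on_ob F Y) ==>
   on_mor F X Y (\<lambda>v\<in>carrier X. c \<odot>[Y] f v) v = c \<odot>[on_ob F X] on_mor F X Y f v"
  "X \<in> MO ==> v \<in> carrier (on_ob F X) ==> on_mor F X X (\<lambda>v\<in>carrier X. v) v = v"
  "X \<in> MO ==> Y \<in> MO ==> Z \<in> MO ==> f \<in> MH X Y ==> g \<in> MH Y Z ==> v \<in> carrier (on_ob F Z) ==>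
   on_mor F X Z (compose (carrier X) g f) v = on_mor F X Y f (on_mor F Y Z g v)"
proof -
 note F' = F[unfolded contravariant_functor_def Let_def Hom_mod Id_mod Cmp_mod]
 show "X \<in> MO ==> vs (on_ob F X)" "X \<in> MO ==> fd (on_ob F X)" using F' by simp_all
 { assume X: "X \<in> MO" "Y \<in> MO"
  then have h: "on_mor F X Y \<in> LinearCombinations.module_hom class_ring (pointwise_space (MH X Y) X Y)
    (pointwise_space (linear_maps (on_ob F Y) (on_ob F X)) (on_ob F Y) (on_ob F X))" using F' by simp
  show "f \<in> MH X Y ==> on_mor F X Y f \<in> linear_maps (on_ob F Y) (on_ob F X)"
   using LinearCombinations.module_hom_closed[OF h] by (auto simp: pointwise_space_def)
  show "f \<in> MH X Y ==> g \<in> MH X Y ==> v \<in> carrier (on_ob F Y) ==>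
   on_mor F X Y (\<lambda>v\<in>carrier X. f v \<oplus>[Y] g v) v = on_mor F X Y f v \<oplus>[on_ob F X] on_mor F X Y g v"
   using LinearCombinations.module_hom_add[OF h, of f g] by (simp add: pointwise_space_def)
  show "f \<in> MH X Y ==> v \<in> carrier (on_ob F Y) ==>
   on_mor F X Y (\<lambda>v\<in>carrier X. c \<odot>[Y] f v) v = c \<odot>[on_ob F X] on_mor F X Y f v"
   using LinearCombinations.module_hom_smult[OF h, of c f] by (simp add: pointwise_space_def) }
 show "X \<in> MO ==> v \<in> carrier (on_ob F X) ==> on_mor F X X (\<lambda>v\<in>carrier X. v) v = v" using F' by simp
 show "X \<in> MO ==> Y \<in> MO ==> Z \<in> MO ==> f \<in> MH X Y ==> g \<in> MH Y Z ==> v \<in> carrier (on_ob F Z) ==>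
   on_mor F X Z (compose (carrier X) g f) v = on_mor F X Y f (on_mor F Y Z g v)"
  using F' by (simp add: compose_def)
qed

lemma cfI:
 assumes "\<And>X. X \<in> MO ==> vs (on_ob F X)" "\<And>X. X \<in> MO ==> fd (on_ob F X)"
  "\<And>X Y f. X \<in> MO ==> Y \<in> MO ==> f \<in> MH X Y ==> on_mor F X Y f \<in> linear_maps (on_ob F Y) (on_ob F X)"
  "\<And>X Y f g v. X \<in> MO ==> Y \<in> MO ==> f \<in> MH X Y ==> g \<in> MH X Y ==> v \<in> carrier (on_ob F Y) ==>
   on_mor F X Y (\<lambda>v\<in>carrier X. f v \<oplus>[Y] g v) v = on_mor F X Y f v \<oplus>[on_ob F X] on_mor F X Y g v"
  "\<And>X Y f c v. X \<in> MO ==> Y \<in> MO ==> f \<in> MH X Y ==> v \<in> carrier (on_ob F Y) ==>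
   on_mor F X Y (\<lambda>v\<in>carrier X. c \<odot>[Y] f v) v = c \<odot>[on_ob F X] on_mor F X Y f v"
  "\<And>X v. X \<in> MO ==> v \<in> carrier (on_ob F X) ==> on_mor F X X (\<lambda>v\<in>carrier X. v) v = v"
  "\<And>X Y Z f g v. X \<in> MO ==> Y \<in> MO ==> Z \<in> MO ==> f \<in> MH X Y ==> g \<in> MH Y Z ==> v \<in> carrier (on_ob F Z) ==>
   on_mor F X Z (compose (carrier X) g f) v = on_mor F X Y f (on_mor F Y Z g v)"
 shows "cf F"
proof -
 note ext = linear_mapsD(4)[OF assms(3)]
 have 1: "on_mor F X Y \<in> LinearCombinations.module_hom class_ring (pointwise_space (MH X Y) X Y)
    (pointwise_space (linear_maps (on_ob F Y) (on_ob F X)) (on_ob F Y) (on_ob F X))"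
  if X: "X \<in> MO" "Y \<in> MO" for X Y
  unfolding LinearCombinations.module_hom_def
 proof (simp add: pointwise_space_def assms(3)[OF X], intro conjI allI impI)
  fix f g assume f: "f \<in> MH X Y \<and> g \<in> MH X Y"
  show "on_mor F X Y (\<lambda>v\<in>carrier X. f v \<oplus>[Y] g v) = (\<lambda>v\<in>carrier (on_ob F Y). on_mor F X Y f v \<oplus>[on_ob F X] on_mor F X Y g v)"
   by (rule extensionalityI[OF ext[OF X] restrict_extensional])
    (use f assms(4)[OF X] mm_plus[OF MO_rm[OF X(1)] MO_rm[OF X(2)]] in auto)
 next
  fix c f assume f: "f \<in> MH X Y"
  show "on_mor F X Y (\<lambda>v\<in>carrier X. c \<odot>[Y] f v) = (\<lambda>v\<in>carrier (on_ob F Y). c \<odot>[on_ob F X] on_mor F X Y f v)"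
   by (rule extensionalityI[OF ext[OF X] restrict_extensional])
    (use f assms(5)[OF X] mm_smult[OF MO_rm[OF X(1)] MO_rm[OF X(2)]] in auto)
 qed
 have 2: "on_mor F X X (\<lambda>v\<in>carrier X. v) = (\<lambda>v\<in>carrier (on_ob F X). v)" if X: "X \<in> MO" for X
  by (rule extensionalityI[OF ext[OF X X mm_id[OF MO_rm[OF X]]] restrict_extensional]) (use assms(6)[OF X] in auto)
 have 3: "on_mor F X Z (compose (carrier X) g f) = compose (carrier (on_ob F Z)) (on_mor F X Y f) (on_mor F Y Z g)"
  if X: "X \<in> MO" "Y \<in> MO" "Z \<in> MO" and f: "f \<in> MH X Y" "g \<in> MH Y Z" for X Y Z f g
  by (rule extensionalityI[OF ext[OF X(1,3) mm_comp[OF MO_rm[OF X(1)] f]] compose_extensional])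
   (use assms(7)[OF X f] in \<open>auto simp: compose_def\<close>)
 show ?thesis unfolding contravariant_functor_def Let_def Hom_mod Id_mod Cmp_mod
  using assms(1,2) 1 2 3 by blast
qed

lemma cf_lin:
 assumes F: "cf F" and X: "X \<in> MO" and Y: "Y \<in> MO" and f: "f \<in> MH X Y"
 shows "v \<in> carrier (on_ob F Y) ==> on_mor F X Y f v \<in> carrier (on_ob F X)"
  "v \<in> carrier (on_ob F Y) ==> w \<in> carrier (on_ob F Y) ==>
   on_mor F X Y f (v \<oplus>[on_ob F Y] w) = on_mor F X Y f v \<oplus>[on_ob F X] on_mor F X Y f w"
  "v \<in> carrier (on_ob F Y) ==> on_mor F X Y f (c \<odot>[on_ob F Y] v) = c \<odot>[on_ob F X] on_mor F X Y f v"
  "on_mor F X Y f \<zero>[on_ob F Y] = \<zero>[on_ob F X]"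
 using linear_mapsD[OF cfD(3)[OF F X Y f]] linear_maps_zero[OF cfD(1)[OF F Y] cfD(1)[OF F X] cfD(3)[OF F X Y f]] by auto

lemma cf_comp:
 assumes F: "cf F" and X: "X \<in> MO" and Y: "Y \<in> MO" and Z: "Z \<in> MO"
  and f: "f \<in> MH X Y" and g: "g \<in> MH Y Z" and h: "h \<in> MH X Z" and e: "\<And>v. v \<in> carrier X ==> h v = g (f v)"
  and y: "y \<in> carrier (on_ob F Z)"
 shows "on_mor F X Z h y = on_mor F X Y f (on_mor F Y Z g y)"
proof -
 have "h = compose (carrier X) g f"
  by (rule mm_ext[OF h mm_comp[OF MO_rm[OF X] f g]]) (simp add: e compose_def)
 then show ?thesis using cfD(7)[OF F X Y Z f g y] by simp
qed

abbreviation nt where "nt \<equiv> natural_transformation A"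

lemma ntD:
 assumes "nt F G \<eta>"
 shows "\<eta> \<in> extensional MO" "X \<in> MO ==> \<eta> X \<in> linear_maps (on_ob F X) (on_ob G X)"
  "X \<in> MO ==> v \<in> carrier (on_ob F X) ==> \<eta> X v \<in> carrier (on_ob G X)"
  "X \<in> MO ==> v \<in> carrier (on_ob F X) ==> w \<in> carrier (on_ob F X) ==> \<eta> X (v \<oplus>[on_ob F X] w) = \<eta> X v \<oplus>[on_ob G X] \<eta> X w"
  "X \<in> MO ==> v \<in> carrier (on_ob F X) ==> \<eta> X (c \<odot>[on_ob F X] v) = c \<odot>[on_ob G X] \<eta> X v"
  "X \<in> MO ==> Y \<in> MO ==> f \<in> MH X Y ==> v \<in> carrier (on_ob F Y) ==> on_mor G X Y f (\<eta> Y v) = \<eta> X (on_mor F X Y f v)"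
proof -
 note a = assms[unfolded natural_transformation_def Let_def Hom_mod]
 show "\<eta> \<in> extensional MO" using a by simp
 show l: "X \<in> MO ==> \<eta> X \<in> linear_maps (on_ob F X) (on_ob G X)" using a by simp
 show "X \<in> MO ==> v \<in> carrier (on_ob F X) ==> \<eta> X v \<in> carrier (on_ob G X)"
  "X \<in> MO ==> v \<in> carrier (on_ob F X) ==> w \<in> carrier (on_ob F X) ==> \<eta> X (v \<oplus>[on_ob F X] w) = \<eta> X v \<oplus>[on_ob G X] \<eta> X w"
  "X \<in> MO ==> v \<in> carrier (on_ob F X) ==> \<eta> X (c \<odot>[on_ob F X] v) = c \<odot>[on_ob G X] \<eta> X v"
  using linear_mapsD[OF l] by auto
 show "X \<in> MO ==> Y \<in> MO ==> f \<in> MH X Y ==> v \<in> carrier (on_ob F Y) ==> on_mor G X Y f (\<eta> Y v) = \<eta> X (on_mor F X Y f v)"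
  using a by simp
qed

lemma ntI:
 assumes F: "\<And>X. X \<in> MO ==> vs (on_ob F X)"
  "\<And>X Y f v. X \<in> MO ==> Y \<in> MO ==> f \<in> MH X Y ==> v \<in> carrier (on_ob F Y) ==> on_mor F X Y f v \<in> carrier (on_ob F X)"
  and "\<And>X v. X \<in> MO ==> v \<in> carrier (on_ob F X) ==> \<eta> X v \<in> carrier (on_ob G X)"
  "\<And>X v w. X \<in> MO ==> v \<in> carrier (on_ob F X) ==> w \<in> carrier (on_ob F X) ==> \<eta> X (v \<oplus>[on_ob F X] w) = \<eta> X v \<oplus>[on_ob G X] \<eta> X w"
  "\<And>X v c. X \<in> MO ==> v \<in> carrier (on_ob F X) ==> \<eta> X (c \<odot>[on_ob F X] v) = c \<odot>[on_ob G X] \<eta> X v"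
  "\<And>X Y f v. X \<in> MO ==> Y \<in> MO ==> f \<in> MH X Y ==> v \<in> carrier (on_ob F Y) ==> on_mor G X Y f (\<eta> Y v) = \<eta> X (on_mor F X Y f v)"
 shows "nt F G (\<lambda>X\<in>MO. \<lambda>v\<in>carrier (on_ob F X). \<eta> X v)"
 unfolding natural_transformation_def Let_def Hom_mod
proof (intro conjI ballI)
 fix X assume X: "X \<in> MO"
 show "(\<lambda>X\<in>MO. \<lambda>v\<in>carrier (on_ob F X). \<eta> X v) X \<in> linear_maps (on_ob F X) (on_ob G X)"
  by (rule linear_mapsI) (use X assms(3-5)[OF X] vs_add[OF F(1)[OF X]] vs_smult[OF F(1)[OF X]] in auto)
qed (use assms(2,6) in auto)

text \<open>Yoneda form of a presentation \<open>Hom(-, M) \<rightarrow> Hom(-, N) \<rightarrow> F \<rightarrow> 0\<close>: it is given by \<open>r : M \<rightarrow> N\<close> and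
 a generator \<open>x \<in> F(N)\<close>.\<close>

definition pres where
 "pres F N x M r \<longleftrightarrow> N \<in> MO \<and> M \<in> MO \<and> x \<in> carrier (on_ob F N) \<and> r \<in> MH M N \<and>
  (\<forall>X\<in>MO. \<forall>y\<in>carrier (on_ob F X). \<exists>h\<in>MH X N. y = on_mor F X N h x) \<and>
  (\<forall>X\<in>MO. \<forall>h\<in>MH X N. on_mor F X N h x = \<zero>[on_ob F X] \<longleftrightarrow> (\<exists>k\<in>MH X M. \<forall>v\<in>carrier X. h v = r (k v)))"

lemma presD:
 assumes "pres F N x M r"
 shows "N \<in> MO" "M \<in> MO" "x \<in> carrier (on_ob F N)" "r \<in> MH M N"
  "X \<in> MO ==> y \<in> carrier (on_ob F X) ==> \<exists>h\<in>MH X N. y = on_mor F X N h x"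
  "X \<in> MO ==> h \<in> MH X N ==> on_mor F X N h x = \<zero>[on_ob F X] \<longleftrightarrow> (\<exists>k\<in>MH X M. \<forall>v\<in>carrier X. h v = r (k v))"
 using assms unfolding pres_def by simp_all

lemma presI:
 assumes "N \<in> MO" "M \<in> MO" "x \<in> carrier (on_ob F N)" "r \<in> MH M N"
  "\<And>X y. X \<in> MO ==> y \<in> carrier (on_ob F X) ==> \<exists>h\<in>MH X N. y = on_mor F X N h x"
  "\<And>X h. X \<in> MO ==> h \<in> MH X N ==> on_mor F X N h x = \<zero>[on_ob F X] \<longleftrightarrow> (\<exists>k\<in>MH X M. \<forall>v\<in>carrier X. h v = r (k v))"
 shows "pres F N x M r"
 unfolding pres_def using assms by simp

lemma fp_iff:
 assumes F: "cf F"
 shows "finitely_presented A F \<longleftrightarrow> (\<exists>N x M r. pres F N x M r)"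
proof
 assume "finitely_presented A F"
 then obtain M N \<rho> \<pi> where M: "M \<in> MO" and N: "N \<in> MO" and \<rho>: "nt (hom_functor A M) (hom_functor A N) \<rho>"
  and \<pi>: "nt (hom_functor A N) F \<pi>"
  and ex: "\<forall>X\<in>MO. \<rho> X ` MH X M = {h \<in> MH X N. \<pi> X h = \<zero>[on_ob F X]} \<and> \<pi> X ` MH X N = carrier (on_ob F X)"
  unfolding finitely_presented_def by (elim bexE exE conjE) (rule that)
 \<comment> \<open>By Yoneda, \<open>x\<close> and \<open>r\<close> are the values at the identities
   of N and M, and they determine \<open>\<pi>\<close> and \<open>\<rho>\<close>.\<close>
 define x where "x = \<pi> N (\<lambda>v\<in>carrier N. v)"
 define r where "r = \<rho> M (\<lambda>v\<in>carrier M. v)"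
 have hc: "carrier (on_ob (hom_functor A N') X) = MH X N'" for N' X
  by (simp add: hom_functor_def pointwise_space_def)
 have hm: "on_mor (hom_functor A N') X Y f h = compose (carrier X) h f" if "h \<in> MH Y N'" for N' X Y f h
  using that by (simp add: hom_functor_def)
 have x: "x \<in> carrier (on_ob F N)" unfolding x_def using ntD(3)[OF \<pi> N] mm_id[OF MO_rm[OF N]] by (simp add: hc)
 have r: "r \<in> MH M N" unfolding r_def using ntD(3)[OF \<rho> M] mm_id[OF MO_rm[OF M]] by (simp add: hc)
 have idc: "compose (carrier X) (\<lambda>v\<in>carrier Y. v) h = h" if "h \<in> MH X Y" for X Y h
  by (rule extensionalityI[OF compose_extensional mmD(4)[OF that]]) (use mmD(1)[OF that] in \<open>simp add: compose_def\<close>)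
 have pi: "\<pi> X h = on_mor F X N h x" if "X \<in> MO" "h \<in> MH X N" for X h
  using ntD(6)[OF \<pi> that(1) N that(2), of "\<lambda>v\<in>carrier N. v"] mm_id[OF MO_rm[OF N]] hm idc[OF that(2)] by (simp add: hc x_def)
 have rho: "\<rho> X k = compose (carrier X) r k" if "X \<in> MO" "k \<in> MH X M" for X k
  using ntD(6)[OF \<rho> that(1) M that(2), of "\<lambda>v\<in>carrier M. v"] mm_id[OF MO_rm[OF M]] hm idc[OF that(2)] hm[OF r]
  by (simp add: hc r_def)
 have "pres F N x M r"
 proof (rule presI[OF N M x r])
  fix X y assume X: "X \<in> MO" "y \<in> carrier (on_ob F X)"
  then obtain h where "h \<in> MH X N" "y = \<pi> X h" using ex by blast
  then show "\<exists>h\<in>MH X N. y = on_mor F X N h x" using pi X by blast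
 next
  fix X h assume X: "X \<in> MO" and h: "h \<in> MH X N"
  have "on_mor F X N h x = \<zero>[on_ob F X] \<longleftrightarrow> h \<in> \<rho> X ` MH X M" using ex X h pi by auto
  also have "\<dots> \<longleftrightarrow> (\<exists>k\<in>MH X M. \<forall>v\<in>carrier X. h v = r (k v))"
  proof
   assume "h \<in> \<rho> X ` MH X M"
   then obtain k where "k \<in> MH X M" "h = compose (carrier X) r k" using rho X by auto
   then show "\<exists>k\<in>MH X M. \<forall>v\<in>carrier X. h v = r (k v)" by (auto simp: compose_def)
  next
   assume "\<exists>k\<in>MH X M. \<forall>v\<in>carrier X. h v = r (k v)"
   then obtain k where k: "k \<in> MH X M" "\<forall>v\<in>carrier X. h v = r (k v)" by blast
   have "h = \<rho> X k" unfolding rho[OF X k(1)]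
    by (rule extensionalityI[OF mmD(4)[OF h] compose_extensional]) (use k in \<open>simp add: compose_def\<close>)
   then show "h \<in> \<rho> X ` MH X M" using k by blast
  qed
  finally show "on_mor F X N h x = \<zero>[on_ob F X] \<longleftrightarrow> (\<exists>k\<in>MH X M. \<forall>v\<in>carrier X. h v = r (k v))" .
 qed
 then show "\<exists>N x M r. pres F N x M r" by blast
next
 assume "\<exists>N x M r. pres F N x M r"
 then obtain N x M r where p: "pres F N x M r" by (elim exE) (rule that)
 note D = presD[OF p]
 define \<pi> where "\<pi> = (\<lambda>X\<in>MO. \<lambda>h\<in>MH X N. on_mor F X N h x)"
 define \<rho> where "\<rho> = (\<lambda>X\<in>MO. \<lambda>k\<in>MH X M. compose (carrier X) r k)"
 have 1: "nt (hom_functor A N) F \<pi>"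
  unfolding natural_transformation_def Let_def Hom_mod
 proof (intro conjI ballI)
  show "\<pi> \<in> extensional MO" unfolding \<pi>_def by simp
  fix X assume X: "X \<in> MO"
  show "\<pi> X \<in> linear_maps (on_ob (hom_functor A N) X) (on_ob F X)"
   by (rule linear_mapsI)
    (use X D(1,3) cf_lin(1)[OF F X D(1)] cfD(4,5)[OF F X D(1)] mm_plus[OF MO_rm[OF X] MO_rm[OF D(1)]]
     mm_smult[OF MO_rm[OF X] MO_rm[OF D(1)]]
     in \<open>simp_all add: \<pi>_def hom_functor_def pointwise_space_def\<close>)
  fix Y f h assume Y: "Y \<in> MO" and f: "f \<in> MH X Y" and "h \<in> carrier (on_ob (hom_functor A N) Y)"
  then have h: "h \<in> MH Y N" by (simp add: hom_functor_def pointwise_space_def)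
  show "on_mor F X Y f (\<pi> Y h) = \<pi> X (on_mor (hom_functor A N) X Y f h)"
   using X Y h mm_comp[OF MO_rm[OF X] f h] cfD(7)[OF F X Y D(1) f h D(3)] by (simp add: \<pi>_def hom_functor_def)
 qed
 have 2: "nt (hom_functor A M) (hom_functor A N) \<rho>"
  unfolding natural_transformation_def Let_def Hom_mod
 proof (intro conjI ballI)
  show "\<rho> \<in> extensional MO" unfolding \<rho>_def by simp
  fix X assume X: "X \<in> MO"
  show "\<rho> X \<in> linear_maps (on_ob (hom_functor A M) X) (on_ob (hom_functor A N) X)"
   by (rule linear_mapsI)
    (use X mm_comp[OF MO_rm[OF X] _ D(4)] mm_plus[OF MO_rm[OF X] MO_rm[OF D(2)]] mm_smult[OF MO_rm[OF X] MO_rm[OF D(2)]]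
     in \<open>auto simp: \<rho>_def hom_functor_def pointwise_space_def compose_def mmD[OF D(4)] mmD(1) intro!: restrict_ext\<close>)
  fix Y f h assume Y: "Y \<in> MO" and f: "f \<in> MH X Y" and "h \<in> carrier (on_ob (hom_functor A M) Y)"
  then have h: "h \<in> MH Y M" by (simp add: hom_functor_def pointwise_space_def)
  show "on_mor (hom_functor A N) X Y f (\<rho> Y h) = \<rho> X (on_mor (hom_functor A M) X Y f h)"
   using X Y h mm_comp[OF MO_rm[OF X] f h] mm_comp[OF MO_rm[OF Y] h D(4)] mmD(1)[OF f]
   by (auto simp: \<rho>_def hom_functor_def compose_def intro!: restrict_ext)
 qed
 have 3: "\<rho> X ` MH X M = {h \<in> MH X N. \<pi> X h = \<zero>[on_ob F X]}" if X: "X \<in> MO" for X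
 proof (intro equalityI subsetI)
  fix h assume "h \<in> \<rho> X ` MH X M"
  then obtain k where k: "k \<in> MH X M" "h = compose (carrier X) r k" unfolding \<rho>_def using X by auto
  have h: "h \<in> MH X N" using mm_comp[OF MO_rm[OF X] k(1) D(4)] k by simp
  have "\<forall>v\<in>carrier X. h v = r (k v)" using k by (simp add: compose_def)
  then show "h \<in> {h \<in> MH X N. \<pi> X h = \<zero>[on_ob F X]}" using h D(6)[OF X h] k(1) X unfolding \<pi>_def by auto
 next
  fix h assume "h \<in> {h \<in> MH X N. \<pi> X h = \<zero>[on_ob F X]}"
  then have h: "h \<in> MH X N" "on_mor F X N h x = \<zero>[on_ob F X]" using X unfolding \<pi>_def by auto
  then obtain k where k: "k \<in> MH X M" "\<forall>v\<in>carrier X. h v = r (k v)" using D(6)[OF X] by blast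
  have "h = \<rho> X k" using mm_ext[OF h(1) mm_comp[OF MO_rm[OF X] k(1) D(4)]] k X unfolding \<rho>_def by (simp add: compose_def)
  then show "h \<in> \<rho> X ` MH X M" using k by blast
 qed
 have 4: "\<pi> X ` MH X N = carrier (on_ob F X)" if X: "X \<in> MO" for X
  using D(5)[OF X] cf_lin(1)[OF F X D(1) _ D(3)] X unfolding \<pi>_def by (auto simp: image_iff)
 show "finitely_presented A F"
  unfolding finitely_presented_def
  by (rule bexI[OF _ D(2)], rule bexI[OF _ D(1)], rule exI[of _ \<rho>], rule exI[of _ \<pi>]) (use 1 2 3 4 in simp)
qed

end

definition subF :: "('o, 'm, 'k, 'w) vect_functor => ('o => 'w set) => ('o, 'm, 'k, 'w) vect_functor" where
 "subF F N = \<lparr>on_ob = (\<lambda>X. (on_ob F X)\<lparr>carrier := N X\<rparr>), on_mor = (\<lambda>X Y f. restrict (on_mor F X Y f) (N Y))\<rparr>"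

definition quoF :: "('o, 'm, 'k::field, 'w) vect_functor => ('o => 'w set) => ('o, 'm, 'k, 'w) vect_functor" where
 "quoF F N = \<lparr>on_ob = (\<lambda>X. quoV (on_ob F X) (N X)),
  on_mor = (\<lambda>X Y f. \<lambda>v\<in>carrier (quoV (on_ob F Y) (N Y)). qp (on_ob F X) (N X) (on_mor F X Y f v))\<rparr>"

definition prodF :: "('o, 'm, 'k, nat => 'k) vect_functor => ('o, 'm, 'k, nat => 'k) vect_functor => ('o, 'm, 'k, nat => 'k) vect_functor" where
 "prodF F G = \<lparr>on_ob = (\<lambda>X. prodV (on_ob F X) (on_ob G X)),
  on_mor = (\<lambda>X Y f. \<lambda>w\<in>carrier (prodV (on_ob F Y) (on_ob G Y)). pr (on_mor F X Y f (p1 w)) (on_mor G X Y f (p2 w)))\<rparr>"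

lemma diff_eq_iff:
 assumes "abelian_group R" "x \<in> carrier R" "y \<in> carrier R" "z \<in> carrier R"
 shows "x \<ominus>\<^bsub>R\<^esub> y = z \<longleftrightarrow> x = y \<oplus>[R] z"
proof -
 interpret abelian_group R by (rule assms(1))
 have 1: "y \<oplus>[R] (x \<ominus>\<^bsub>R\<^esub> y) = x" using assms(2-4) by (simp add: minus_eq a_lcomm[of y x] r_neg)
 have 2: "(y \<oplus>[R] z) \<ominus>\<^bsub>R\<^esub> y = z"
  using assms(2-4) by (simp add: minus_eq a_comm[of y z] a_assoc r_neg)
 show ?thesis using 1 2 by metis
qed

section \<open>Subfunctors, quotients and products, with their presentations\<close>

context fd_algebra begin

abbreviation FC :: "(('k, nat => 'k, 'a, nat => 'k) mod_functor, ('k, nat => 'k, 'a) right_module => (nat => 'k) => nat => 'k) category"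
 where "FC \<equiv> fp_functor_category A"

lemma FC_Ob: "F \<in> Ob FC \<longleftrightarrow> cf F \<and> (\<exists>N x M r. pres F N x M r)"
proof -
 have "F \<in> Ob FC \<longleftrightarrow> cf F \<and> finitely_presented A F" by (simp add: fp_functor_category_def)
 then show ?thesis using fp_iff[of F] by blast
qed

lemma FC_Hom: "\<eta> \<in> Hom FC F G \<longleftrightarrow> nt F G \<eta>"
 unfolding fp_functor_category_def by simp

lemma FC_cf: "F \<in> Ob FC ==> cf F" using FC_Ob by blast

definition subfunctor where
 "subfunctor F N \<longleftrightarrow> (\<forall>X\<in>MO. subspace_of (on_ob F X) (N X)) \<and>
  (\<forall>X\<in>MO. \<forall>Y\<in>MO. \<forall>f\<in>MH X Y. \<forall>v\<in>N Y. on_mor F X Y f v \<in> N X)"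

lemma subfunctorD:
 assumes "subfunctor F N"
 shows "X \<in> MO ==> subspace_of (on_ob F X) (N X)"
  "X \<in> MO ==> Y \<in> MO ==> f \<in> MH X Y ==> v \<in> N Y ==> on_mor F X Y f v \<in> N X"
 using assms unfolding subfunctor_def by auto

lemma subF_simps [simp]:
 "on_ob (subF F N) X = (on_ob F X)\<lparr>carrier := N X\<rparr>" "v \<in> N Y ==> on_mor (subF F N) X Y f v = on_mor F X Y f v"
 by (simp_all add: subF_def)

lemma subF_cf: assumes F: "cf F" and N: "subfunctor F N" shows "cf (subF F N)"
proof (rule cfI)
 note s = subfunctorD[OF N]
 note i = subsetD[OF subspace_ofD(1)[OF s(1)]]
 fix X assume X: "X \<in> MO"
 note sX = subspace_ofD[OF s(1)[OF X]]
 show "vs (on_ob (subF F N) X)" using vs_sub[OF cfD(1)[OF F X] sX] by simp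
 show "fd (on_ob (subF F N) X)" using fd_sub[OF cfD(1,2)[OF F X] sX] by simp
 { fix v assume "v \<in> carrier (on_ob (subF F N) X)"
  then show "on_mor (subF F N) X X (\<lambda>v\<in>carrier X. v) v = v" using cfD(6)[OF F X] i[OF X] by simp }
 fix Y f assume Y: "Y \<in> MO" and f: "f \<in> MH X Y"
 note sY = subspace_ofD[OF s(1)[OF Y]]
 show "on_mor (subF F N) X Y f \<in> linear_maps (on_ob (subF F N) Y) (on_ob (subF F N) X)"
  by (rule linear_mapsI) (use s(2)[OF X Y f] sY(3,4) cf_lin(2,3)[OF F X Y f] i[OF Y] in \<open>simp_all\<close>, simp add: subF_def)
 fix v
 { assume v: "v \<in> carrier (on_ob (subF F N) Y)"
  show "on_mor (subF F N) X Y (\<lambda>v\<in>carrier X. c \<odot>[Y] f v) v = c \<odot>[on_ob (subF F N) X] on_mor (subF F N) X Y f v" for c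
   using v cfD(5)[OF F X Y f] i[OF Y] by simp
  fix g assume g: "g \<in> MH X Y"
  show "on_mor (subF F N) X Y (\<lambda>v\<in>carrier X. f v \<oplus>[Y] g v) v =
    on_mor (subF F N) X Y f v \<oplus>[on_ob (subF F N) X] on_mor (subF F N) X Y g v"
   using v cfD(4)[OF F X Y f g] i[OF Y] by simp }
 fix Z g assume Z: "Z \<in> MO" and g: "g \<in> MH Y Z" and "v \<in> carrier (on_ob (subF F N) Z)"
 then show "on_mor (subF F N) X Z (compose (carrier X) g f) v = on_mor (subF F N) X Y f (on_mor (subF F N) Y Z g v)"
  using cfD(7)[OF F X Y Z f g] i[OF Z] s(2)[OF Y Z g] by simp
qed

lemma quoF_simps [simp]:
 "on_ob (quoF F N) X = quoV (on_ob F X) (N X)"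
 "v \<in> carrier (quoV (on_ob F Y) (N Y)) ==> on_mor (quoF F N) X Y f v = qp (on_ob F X) (N X) (on_mor F X Y f v)"
 by (simp_all add: quoF_def)

lemma quoF_mor:
 assumes F: "cf F" and N: "subfunctor F N" and X: "X \<in> MO" and Y: "Y \<in> MO" and f: "f \<in> MH X Y" and v: "v \<in> carrier (on_ob F Y)"
 shows "on_mor (quoF F N) X Y f (qp (on_ob F Y) (N Y) v) = qp (on_ob F X) (N X) (on_mor F X Y f v)"
proof -
 let ?V = "on_ob F Y" and ?q = "qp (on_ob F Y) (N Y) v"
 note VY = cfD(1)[OF F Y] and VX = cfD(1)[OF F X]
 note s = subfunctorD[OF N]
 note q = qp_props[OF VY s(1)[OF Y] v]
 have "?q \<in> carrier (quoV ?V (N Y))" using v by (simp add: quoV_simps[OF VY s(1)[OF Y]])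
 then have "on_mor (quoF F N) X Y f ?q = qp (on_ob F X) (N X) (on_mor F X Y f ?q)" by simp
 also have "\<dots> = qp (on_ob F X) (N X) (on_mor F X Y f v)"
 proof (subst qp_eq[OF VX s(1)[OF X] cf_lin(1)[OF F X Y f q(1)] cf_lin(1)[OF F X Y f v]])
  have "on_mor F X Y f ?q \<ominus>\<^bsub>on_ob F X\<^esub> on_mor F X Y f v = on_mor F X Y f (?q \<ominus>\<^bsub>?V\<^esub> v)"
   using cf_lin[OF F X Y f] q(1) v vs_smult[OF VY v] by (simp add: vs_minus[OF VX] vs_minus[OF VY])
  then show "on_mor F X Y f ?q \<ominus>\<^bsub>on_ob F X\<^esub> on_mor F X Y f v \<in> N X" using s(2)[OF X Y f q(2)] by simp
 qed
 finally show ?thesis .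
qed

lemma quoF_cf: assumes F: "cf F" and N: "subfunctor F N" shows "cf (quoF F N)"
proof (rule cfI)
 note s = subfunctorD[OF N]
 fix X assume X: "X \<in> MO"
 note VX = cfD(1)[OF F X] and sX = s(1)[OF X]
 have lift: "\<exists>w\<in>carrier (on_ob F Y). v = qp (on_ob F Y) (N Y) w" if "Y \<in> MO" "v \<in> carrier (on_ob (quoF F N) Y)" for Y v
  using that quoV_simps(1)[OF cfD(1)[OF F that(1)] s(1)[OF that(1)]] by auto
 show "vs (on_ob (quoF F N) X)" using vs_quoV[OF VX sX] by simp
 show "fd (on_ob (quoF F N) X)" using fd_quoV[OF VX sX cfD(2)[OF F X]] by simp
 { fix v assume "v \<in> carrier (on_ob (quoF F N) X)"
  then obtain w where w: "w \<in> carrier (on_ob F X)" "v = qp (on_ob F X) (N X) w" using lift[OF X] by blast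
  then show "on_mor (quoF F N) X X (\<lambda>v\<in>carrier X. v) v = v"
   using quoF_mor[OF F N X X mm_id[OF MO_rm[OF X]] w(1)] cfD(6)[OF F X w(1)] by simp }
 fix Y f assume Y: "Y \<in> MO" and f: "f \<in> MH X Y"
 note VY = cfD(1)[OF F Y] and sY = s(1)[OF Y]
 note qX = quoV_simps[OF VX sX] and qY = quoV_simps[OF VY sY]
 note lin = cf_lin[OF F X Y f]
 show "on_mor (quoF F N) X Y f \<in> linear_maps (on_ob (quoF F N) Y) (on_ob (quoF F N) X)"
 proof (rule linear_mapsI)
  fix v assume "v \<in> carrier (on_ob (quoF F N) Y)"
  then obtain w where w: "w \<in> carrier (on_ob F Y)" "v = qp (on_ob F Y) (N Y) w" using lift[OF Y] by blast
  note m = quoF_mor[OF F N X Y f]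
  show "on_mor (quoF F N) X Y f v \<in> carrier (on_ob (quoF F N) X)" using m[OF w(1)] w lin(1) by (simp add: qX)
  show "on_mor (quoF F N) X Y f (c \<odot>[on_ob (quoF F N) Y] v) = c \<odot>[on_ob (quoF F N) X] on_mor (quoF F N) X Y f v" for c
   using m[OF w(1)] m[OF vs_smult[OF VY w(1)]] w lin qp_smult[OF VY sY w(1)] qp_smult[OF VX sX lin(1)[OF w(1)]]
   by (simp add: qX qY del: quoF_simps(2))
  fix v' assume "v' \<in> carrier (on_ob (quoF F N) Y)"
  then obtain w' where w': "w' \<in> carrier (on_ob F Y)" "v' = qp (on_ob F Y) (N Y) w'" using lift[OF Y] by blast
  show "on_mor (quoF F N) X Y f (v \<oplus>[on_ob (quoF F N) Y] v') =
    on_mor (quoF F N) X Y f v \<oplus>[on_ob (quoF F N) X] on_mor (quoF F N) X Y f v'"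
   using m[OF w(1)] m[OF w'(1)] m[OF vs_add[OF VY w(1) w'(1)]] w w' lin qp_add[OF VY sY w(1) w'(1)]
    qp_add[OF VX sX lin(1)[OF w(1)] lin(1)[OF w'(1)]]
   by (simp add: qX qY del: quoF_simps(2))
 qed (simp add: quoF_def)
 fix v
 { assume "v \<in> carrier (on_ob (quoF F N) Y)"
  then obtain w where w: "w \<in> carrier (on_ob F Y)" "v = qp (on_ob F Y) (N Y) w" using lift[OF Y] by blast
  show "on_mor (quoF F N) X Y (\<lambda>v\<in>carrier X. c \<odot>[Y] f v) v = c \<odot>[on_ob (quoF F N) X] on_mor (quoF F N) X Y f v" for c
   using quoF_mor[OF F N X Y mm_smult[OF MO_rm[OF X] MO_rm[OF Y] f] w(1)] quoF_mor[OF F N X Y f w(1)] w(2)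
    cfD(5)[OF F X Y f w(1)] qp_smult[OF VX sX lin(1)[OF w(1)]] by (simp add: qX del: quoF_simps(2))
  fix g assume g: "g \<in> MH X Y"
  show "on_mor (quoF F N) X Y (\<lambda>v\<in>carrier X. f v \<oplus>[Y] g v) v =
    on_mor (quoF F N) X Y f v \<oplus>[on_ob (quoF F N) X] on_mor (quoF F N) X Y g v"
   using quoF_mor[OF F N X Y mm_plus[OF MO_rm[OF X] MO_rm[OF Y] f g] w(1)] quoF_mor[OF F N X Y f w(1)]
    quoF_mor[OF F N X Y g w(1)] w(2) cfD(4)[OF F X Y f g w(1)]
    qp_add[OF VX sX lin(1)[OF w(1)] cf_lin(1)[OF F X Y g w(1)]] by (simp add: qX del: quoF_simps(2)) }
 fix Z g assume Z: "Z \<in> MO" and g: "g \<in> MH Y Z" and "v \<in> carrier (on_ob (quoF F N) Z)"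
 then obtain w where w: "w \<in> carrier (on_ob F Z)" "v = qp (on_ob F Z) (N Z) w" using lift[OF Z] by blast
 show "on_mor (quoF F N) X Z (compose (carrier X) g f) v = on_mor (quoF F N) X Y f (on_mor (quoF F N) Y Z g v)"
  using quoF_mor[OF F N X Z mm_comp[OF MO_rm[OF X] f g] w(1)] quoF_mor[OF F N Y Z g w(1)]
   quoF_mor[OF F N X Y f cf_lin(1)[OF F Y Z g w(1)]] cfD(7)[OF F X Y Z f g w(1)] w(2) by (simp del: quoF_simps)
qed

lemma prodF_simps [simp]:
 "on_ob (prodF F G) X = prodV (on_ob F X) (on_ob G X)"
 "p1 w \<in> carrier (on_ob F Y) ==> p2 w \<in> carrier (on_ob G Y) ==>
  on_mor (prodF F G) X Y f w = pr (on_mor F X Y f (p1 w)) (on_mor G X Y f (p2 w))"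
 by (simp_all add: prodF_def)

lemma prodF_cf: assumes F: "cf F" and G: "cf G" shows "cf (prodF F G)"
proof (rule cfI)
 fix X assume X: "X \<in> MO"
 show "vs (on_ob (prodF F G) X)" using vs_prod[OF cfD(1)[OF F X] cfD(1)[OF G X], of "prodV (on_ob F X) (on_ob G X)"] by simp
 show "fd (on_ob (prodF F G) X)"
  using fd_prod[OF cfD(1,2)[OF F X] cfD(1,2)[OF G X], of "prodV (on_ob F X) (on_ob G X)"] by simp
 { fix v assume "v \<in> carrier (on_ob (prodF F G) X)"
  then show "on_mor (prodF F G) X X (\<lambda>v\<in>carrier X. v) v = v" using cfD(6)[OF F X] cfD(6)[OF G X] by simp }
 fix Y f assume Y: "Y \<in> MO" and f: "f \<in> MH X Y"
 show "on_mor (prodF F G) X Y f \<in> linear_maps (on_ob (prodF F G) Y) (on_ob (prodF F G) X)"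
 proof (rule linear_mapsI)
  show "on_mor (prodF F G) X Y f \<in> extensional (carrier (on_ob (prodF F G) Y))" by (simp add: prodF_def)
 qed (simp_all add: cf_lin[OF F X Y f] cf_lin[OF G X Y f] vs_add[OF cfD(1)[OF F Y]] vs_add[OF cfD(1)[OF G Y]]
    vs_smult[OF cfD(1)[OF F Y]] vs_smult[OF cfD(1)[OF G Y]])
 fix v
 { assume v: "v \<in> carrier (on_ob (prodF F G) Y)"
  show "on_mor (prodF F G) X Y (\<lambda>v\<in>carrier X. c \<odot>[Y] f v) v = c \<odot>[on_ob (prodF F G) X] on_mor (prodF F G) X Y f v" for c
   using v cfD(5)[OF F X Y f] cfD(5)[OF G X Y f] by simp
  fix g assume g: "g \<in> MH X Y"
  show "on_mor (prodF F G) X Y (\<lambda>v\<in>carrier X. f v \<oplus>[Y] g v) v =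
    on_mor (prodF F G) X Y f v \<oplus>[on_ob (prodF F G) X] on_mor (prodF F G) X Y g v"
   using v cfD(4)[OF F X Y f g] cfD(4)[OF G X Y f g] by simp }
 fix Z g assume Z: "Z \<in> MO" and g: "g \<in> MH Y Z" and "v \<in> carrier (on_ob (prodF F G) Z)"
 then show "on_mor (prodF F G) X Z (compose (carrier X) g f) v = on_mor (prodF F G) X Y f (on_mor (prodF F G) Y Z g v)"
  using cfD(7)[OF F X Y Z f g] cfD(7)[OF G X Y Z f g] cf_lin(1)[OF F Y Z g] cf_lin(1)[OF G Y Z g] by simp
qed

text \<open>Since \<open>x'\<close> generates G, the image of \<open>x\<close> in G(N) is obtained
  from \<open>x'\<close> along some \<open>a\<close> from N to N'; this lifts \<open>\<eta>\<close>
  to the presentations.\<close>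

lemma pres_map:
 assumes F: "cf F" and G: "cf G" and \<eta>: "nt F G \<eta>" and pF: "pres F N x M r" and pG: "pres G N' x' M' r'"
 obtains a where "a \<in> MH N N'"
  "\<And>X h h'. X \<in> MO ==> h \<in> MH X N ==> h' \<in> MH X N' ==> (\<And>v. v \<in> carrier X ==> h' v = a (h v)) ==>
   \<eta> X (on_mor F X N h x) = on_mor G X N' h' x'"
proof -
 note D = presD[OF pF] and D' = presD[OF pG]
 obtain a where a: "a \<in> MH N N'" "\<eta> N x = on_mor G N N' a x'" using D'(5)[OF D(1) ntD(3)[OF \<eta> D(1,3)]] by blast
 have "\<eta> X (on_mor F X N h x) = on_mor G X N' h' x'"
  if X: "X \<in> MO" and h: "h \<in> MH X N" and h': "h' \<in> MH X N'" "\<And>v. v \<in> carrier X ==> h' v = a (h v)" for X h h'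
  using ntD(6)[OF \<eta> X D(1) h D(3)] a(2) cf_comp[OF G X D(1) D'(1) h a(1) h' D'(3)] by simp
 then show thesis using that a(1) by blast
qed

definition kerN where "kerN F G \<eta> X = {v \<in> carrier (on_ob F X). \<eta> X v = \<zero>[on_ob G X]}"
definition imN where "imN F \<eta> X = \<eta> X ` carrier (on_ob F X)"

lemma nt_zero: assumes F: "cf F" and G: "cf G" and \<eta>: "nt F G \<eta>" and X: "X \<in> MO"
 shows "\<eta> X \<zero>[on_ob F X] = \<zero>[on_ob G X]"
 by (rule linear_maps_zero[OF cfD(1)[OF F X] cfD(1)[OF G X] ntD(2)[OF \<eta> X]])

lemma kerN_sub: assumes F: "cf F" and G: "cf G" and \<eta>: "nt F G \<eta>" shows "subfunctor F (kerN F G \<eta>)"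
 unfolding subfunctor_def
proof (intro conjI ballI)
 fix X assume X: "X \<in> MO"
 note VF = cfD(1)[OF F X] and VG = cfD(1)[OF G X]
 show "subspace_of (on_ob F X) (kerN F G \<eta> X)"
  by (rule subspace_ofI) (auto simp: kerN_def vs_zero[OF VF] vs_add[OF VF] vs_smult[OF VF] nt_zero[OF F G \<eta> X]
   ntD(4,5)[OF \<eta> X] vs_l_zero[OF VG vs_zero[OF VG]] vs_smult_zero[OF VG])
 fix Y f v assume Y: "Y \<in> MO" and f: "f \<in> MH X Y" and v: "v \<in> kerN F G \<eta> Y"
 then show "on_mor F X Y f v \<in> kerN F G \<eta> X"
  using ntD(6)[OF \<eta> X Y f, of v] cf_lin(4)[OF G X Y f] cf_lin(1)[OF F X Y f] unfolding kerN_def by auto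
qed

lemma imN_sub: assumes F: "cf F" and G: "cf G" and \<eta>: "nt F G \<eta>" shows "subfunctor G (imN F \<eta>)"
 unfolding subfunctor_def
proof (intro conjI ballI)
 fix X assume X: "X \<in> MO"
 note VF = cfD(1)[OF F X] and VG = cfD(1)[OF G X]
 show "subspace_of (on_ob G X) (imN F \<eta> X)"
 proof (rule subspace_ofI)
  show "imN F \<eta> X \<subseteq> carrier (on_ob G X)" unfolding imN_def using ntD(3)[OF \<eta> X] by blast
  show "\<zero>[on_ob G X] \<in> imN F \<eta> X" unfolding imN_def using nt_zero[OF F G \<eta> X] vs_zero[OF VF] by (metis imageI)
  fix x assume "x \<in> imN F \<eta> X"
  then obtain v where v: "v \<in> carrier (on_ob F X)" "x = \<eta> X v" unfolding imN_def by blast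
  show "c \<odot>[on_ob G X] x \<in> imN F \<eta> X" for c unfolding imN_def using v ntD(5)[OF \<eta> X v(1)] vs_smult[OF VF v(1)] by (metis imageI)
  fix y assume "y \<in> imN F \<eta> X"
  then obtain w where w: "w \<in> carrier (on_ob F X)" "y = \<eta> X w" unfolding imN_def by blast
  show "x \<oplus>[on_ob G X] y \<in> imN F \<eta> X" unfolding imN_def using v w ntD(4)[OF \<eta> X v(1) w(1)] vs_add[OF VF v(1) w(1)] by (metis imageI)
 qed
 fix Y f v assume Y: "Y \<in> MO" and f: "f \<in> MH X Y" and "v \<in> imN F \<eta> Y"
 then obtain w where w: "w \<in> carrier (on_ob F Y)" "v = \<eta> Y w" unfolding imN_def by blast
 then show "on_mor G X Y f v \<in> imN F \<eta> X"
  using ntD(6)[OF \<eta> X Y f w(1)] cf_lin(1)[OF F X Y f w(1)] unfolding imN_def by simp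
qed

text \<open>An element F(h)x is killed by \<open>\<eta>\<close> iff \<open>a\<close> after
  \<open>h\<close> factors through \<open>r'\<close>, that is, iff \<open>h\<close> factors through
  the fibre product Q of \<open>a\<close> and \<open>r'\<close>. It is zero iff \<open>h\<close>
  factors through \<open>r\<close>, which gives the relations as a second fibre product L, of Q and
  M over N.\<close>

lemma ker_pres:
 assumes F: "cf F" and G: "cf G" and \<eta>: "nt F G \<eta>" and pF: "pres F N x M r" and pG: "pres G N' x' M' r'"
 shows "\<exists>Q y L s. pres (subF F (kerN F G \<eta>)) Q y L s"
proof -
 note D = presD[OF pF] and D' = presD[OF pG]
 let ?K = "subF F (kerN F G \<eta>)"
 obtain a where a: "a \<in> MH N N'"
  and ax: "\<And>X h h'. X \<in> MO ==> h \<in> MH X N ==> h' \<in> MH X N' ==> (\<And>v. v \<in> carrier X ==> h' v = a (h v)) ==>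
   \<eta> X (on_mor F X N h x) = on_mor G X N' h' x'"
  by (rule pres_map[OF F G \<eta> pF pG]) blast
 obtain Q q q' where Q: "Q \<in> MO" and q: "q \<in> MH Q N" and q': "q' \<in> MH Q M'"
  and Q1: "\<forall>w\<in>carrier Q. a (q w) = r' (q' w)"
  and Q2: "\<forall>X\<in>MO. \<forall>h\<in>MH X N. \<forall>k\<in>MH X M'. (\<forall>v\<in>carrier X. a (h v) = r' (k v)) -->
   (\<exists>l\<in>MH X Q. \<forall>v\<in>carrier X. q (l v) = h v \<and> q' (l v) = k v)"
  using module_pullback[OF D(1) D'(2) D'(1) a D'(4)] by (elim bexE conjE) (rule that)
 obtain L s s' where L: "L \<in> MO" and s: "s \<in> MH L Q" and s': "s' \<in> MH L M"
  and L1: "\<forall>w\<in>carrier L. q (s w) = r (s' w)"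
  and L2: "\<forall>X\<in>MO. \<forall>h\<in>MH X Q. \<forall>k\<in>MH X M. (\<forall>v\<in>carrier X. q (h v) = r (k v)) -->
   (\<exists>l\<in>MH X L. \<forall>v\<in>carrier X. s (l v) = h v \<and> s' (l v) = k v)"
  using module_pullback[OF Q D(2,1) q D(4)] by (elim bexE conjE) (rule that)
 have et: "\<eta> X (on_mor F X N h x) = \<zero>[on_ob G X] \<longleftrightarrow> (\<exists>k\<in>MH X M'. \<forall>v\<in>carrier X. a (h v) = r' (k v))"
  if X: "X \<in> MO" and h: "h \<in> MH X N" for X h
  using ax[OF X h mm_comp[OF MO_rm[OF X] h a]] D'(6)[OF X mm_comp[OF MO_rm[OF X] h a]] by (simp add: compose_def)
 let ?y = "on_mor F Q N q x"
 have y: "?y \<in> kerN F G \<eta> Q" unfolding kerN_def using et[OF Q q] Q1 q' cf_lin(1)[OF F Q D(1) q D(3)] by blast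
 have Ky: "on_mor ?K X Q l ?y = on_mor F X N h x" if X: "X \<in> MO" and l: "l \<in> MH X Q" and h: "h \<in> MH X N"
  and e: "\<And>v. v \<in> carrier X ==> h v = q (l v)" for X l h
  using cf_comp[OF F X Q D(1) l q h e D(3)] y by simp
 have "pres ?K Q ?y L s"
 proof (rule presI[OF Q L _ s])
  show "?y \<in> carrier (on_ob ?K Q)" using y by simp
  fix X assume X: "X \<in> MO"
  { fix z assume "z \<in> carrier (on_ob ?K X)"
   then have z: "z \<in> carrier (on_ob F X)" "\<eta> X z = \<zero>[on_ob G X]" unfolding kerN_def by auto
   obtain h where h: "h \<in> MH X N" "z = on_mor F X N h x" using D(5)[OF X z(1)] by blast
   obtain k where k: "k \<in> MH X M'" "\<forall>v\<in>carrier X. a (h v) = r' (k v)" using et[OF X h(1)] z h by blast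
   obtain l where l: "l \<in> MH X Q" "\<forall>v\<in>carrier X. q (l v) = h v \<and> q' (l v) = k v" using Q2 X h(1) k by blast
   have "z = on_mor ?K X Q l ?y" using Ky[OF X l(1) h(1)] l(2) h(2) by simp
   then show "\<exists>h\<in>MH X Q. z = on_mor ?K X Q h ?y" by (rule bexI[OF _ l(1)]) }
  fix h assume h: "h \<in> MH X Q"
  note qh = mm_comp[OF MO_rm[OF X] h q]
  have "on_mor ?K X Q h ?y = \<zero>[on_ob ?K X] \<longleftrightarrow> (\<exists>k\<in>MH X M. \<forall>v\<in>carrier X. q (h v) = r (k v))"
   using Ky[OF X h qh] D(6)[OF X qh] by (simp add: compose_def)
  also have "\<dots> \<longleftrightarrow> (\<exists>k\<in>MH X L. \<forall>v\<in>carrier X. h v = s (k v))"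
  proof
   assume "\<exists>k\<in>MH X M. \<forall>v\<in>carrier X. q (h v) = r (k v)"
   then obtain l where "l \<in> MH X L" "\<forall>v\<in>carrier X. s (l v) = h v \<and> s' (l v) = s' (l v)" using L2 X h by blast
   then show "\<exists>k\<in>MH X L. \<forall>v\<in>carrier X. h v = s (k v)" by (intro bexI[of _ l]) simp_all
  next
   assume "\<exists>k\<in>MH X L. \<forall>v\<in>carrier X. h v = s (k v)"
   then obtain k where k: "k \<in> MH X L" "\<forall>v\<in>carrier X. h v = s (k v)" by blast
   then have "\<forall>v\<in>carrier X. q (h v) = r (compose (carrier X) s' k v)" using L1 mmD(1)[OF k(1)] by (simp add: compose_def)
   then show "\<exists>k\<in>MH X M. \<forall>v\<in>carrier X. q (h v) = r (k v)" using mm_comp[OF MO_rm[OF X] k(1) s'] by blast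
  qed
  finally show "on_mor ?K X Q h ?y = \<zero>[on_ob ?K X] \<longleftrightarrow> (\<exists>k\<in>MH X L. \<forall>v\<in>carrier X. h v = s (k v))" .
 qed
 then show ?thesis by blast
qed

text \<open>The generator of F is added to the relations of G: the cokernel is presented by the map
  from the direct sum of N and M' to N' with components \<open>a\<close> and
  \<open>r'\<close>.\<close>

lemma coker_pres:
 assumes F: "cf F" and G: "cf G" and \<eta>: "nt F G \<eta>" and pF: "pres F N x M r" and pG: "pres G N' x' M' r'"
 shows "\<exists>Q y L s. pres (quoF G (imN F \<eta>)) Q y L s"
proof -
 note D = presD[OF pF] and D' = presD[OF pG]
 note iN = imN_sub[OF F G \<eta>]
 let ?Q = "quoF G (imN F \<eta>)"
 obtain a where a: "a \<in> MH N N'"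
  and ax: "\<And>X h h'. X \<in> MO ==> h \<in> MH X N ==> h' \<in> MH X N' ==> (\<And>v. v \<in> carrier X ==> h' v = a (h v)) ==>
   \<eta> X (on_mor F X N h x) = on_mor G X N' h' x'"
  by (rule pres_map[OF F G \<eta> pF pG]) blast
 let ?y = "qp (on_ob G N') (imN F \<eta> N') x'" and ?L = "prodM N M'"
 let ?s = "\<lambda>w\<in>carrier ?L. a (p1 w) \<oplus>[N'] r' (p2 w)"
 note L = prod_MO[OF D(1) D'(2)]
 have s: "?s \<in> MH ?L N'" by (rule mm_copair[OF D(1) D'(2,1) a D'(4)])
 note qm = quoF_mor[OF G iN _ D'(1) _ D'(3)]
 have "pres ?Q N' ?y ?L ?s"
 proof (rule presI[OF D'(1) L _ s])
  show "?y \<in> carrier (on_ob ?Q N')" using quoV_simps(1)[OF cfD(1)[OF G D'(1)] subfunctorD(1)[OF iN D'(1)]] D'(3) by simp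
  fix X assume X: "X \<in> MO"
  note VX = cfD(1)[OF G X] and sX = subfunctorD(1)[OF iN X]
  { fix z assume "z \<in> carrier (on_ob ?Q X)"
   then obtain w where w: "w \<in> carrier (on_ob G X)" "z = qp (on_ob G X) (imN F \<eta> X) w"
    using quoV_simps(1)[OF VX sX] by auto
   obtain h where h: "h \<in> MH X N'" "w = on_mor G X N' h x'" using D'(5)[OF X w(1)] by blast
   have "z = on_mor ?Q X N' h ?y" using qm[OF X h(1)] h w by simp
   then show "\<exists>h\<in>MH X N'. z = on_mor ?Q X N' h ?y" by (rule bexI[OF _ h(1)]) }
  fix h assume h: "h \<in> MH X N'"
  let ?g = "on_mor G X N' h x'"
  note g = cf_lin(1)[OF G X D'(1) h D'(3)]
  have "on_mor ?Q X N' h ?y = \<zero>[on_ob ?Q X] \<longleftrightarrow> ?g \<in> imN F \<eta> X"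
   using qm[OF X h] qp_zero_iff[OF VX sX g] by simp
  also have "\<dots> \<longleftrightarrow> (\<exists>k\<in>MH X N. ?g = on_mor G X N' (compose (carrier X) a k) x')"
  proof -
   have "imN F \<eta> X = (\<lambda>k. on_mor G X N' (compose (carrier X) a k) x') ` MH X N"
   proof (intro equalityI subsetI)
    fix z assume "z \<in> imN F \<eta> X"
    then obtain w where w: "w \<in> carrier (on_ob F X)" "z = \<eta> X w" unfolding imN_def by blast
    obtain k where k: "k \<in> MH X N" "w = on_mor F X N k x" using D(5)[OF X w(1)] by blast
    show "z \<in> (\<lambda>k. on_mor G X N' (compose (carrier X) a k) x') ` MH X N"
     using ax[OF X k(1) mm_comp[OF MO_rm[OF X] k(1) a]] k w by (auto simp: compose_def)
   next
    fix z assume "z \<in> (\<lambda>k. on_mor G X N' (compose (carrier X) a k) x') ` MH X N"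
    then obtain k where k: "k \<in> MH X N" "z = on_mor G X N' (compose (carrier X) a k) x'" by blast
    have "z = \<eta> X (on_mor F X N k x)" using ax[OF X k(1) mm_comp[OF MO_rm[OF X] k(1) a]] k by (auto simp: compose_def)
    then show "z \<in> imN F \<eta> X" unfolding imN_def using cf_lin(1)[OF F X D(1) k(1) D(3)] by blast
   qed
   then show ?thesis by (simp add: image_iff)
  qed
  also have "\<dots> \<longleftrightarrow> (\<exists>k\<in>MH X N. \<exists>l\<in>MH X M'. \<forall>v\<in>carrier X. h v = a (k v) \<oplus>[N'] r' (l v))"
  proof (rule bex_cong[OF refl])
   fix k assume k: "k \<in> MH X N"
   note ak = mm_comp[OF MO_rm[OF X] k a]
   note nak = mm_smult[OF MO_rm[OF X] MO_rm[OF D'(1)] ak, of "-1"]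
   \<comment> \<open>\<open>?d\<close> is the difference of \<open>h\<close> and \<open>a\<close>
     after \<open>k\<close>; it factors through \<open>r'\<close> iff the two elements of G(X)
     agree.\<close>
   let ?d = "\<lambda>v\<in>carrier X. h v \<oplus>[N'] (\<lambda>v\<in>carrier X. (-1) \<odot>[N'] compose (carrier X) a k v) v"
   note d = mm_plus[OF MO_rm[OF X] MO_rm[OF D'(1)] h nak]
   note gk = cf_lin(1)[OF G X D'(1) ak D'(3)]
   have "on_mor G X N' ?d x' = ?g \<ominus>\<^bsub>on_ob G X\<^esub> on_mor G X N' (compose (carrier X) a k) x'"
    using cfD(4)[OF G X D'(1) h nak D'(3)] cfD(5)[OF G X D'(1) ak D'(3), of "-1"] vs_minus[OF VX g gk] by simp
   from arg_cong[OF this, of "\<lambda>z. z = \<zero>[on_ob G X]"]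
   have "?g = on_mor G X N' (compose (carrier X) a k) x' \<longleftrightarrow> on_mor G X N' ?d x' = \<zero>[on_ob G X]"
    unfolding vs_minus_eq_zero[OF VX g gk] by (rule sym)
   also have "\<dots> \<longleftrightarrow> (\<exists>l\<in>MH X M'. \<forall>v\<in>carrier X. ?d v = r' (l v))" by (rule D'(6)[OF X d])
   also have "\<dots> \<longleftrightarrow> (\<exists>l\<in>MH X M'. \<forall>v\<in>carrier X. h v = a (k v) \<oplus>[N'] r' (l v))"
   proof (rule bex_cong[OF refl], rule ball_cong[OF refl])
    fix l v assume l: "l \<in> MH X M'" and v: "v \<in> carrier X"
    have c: "h v \<in> carrier N'" "a (k v) \<in> carrier N'" "r' (l v) \<in> carrier N'"
     using mmD(1)[OF h v] mmD(1)[OF a mmD(1)[OF k v]] mmD(1)[OF D'(4) mmD(1)[OF l v]] by auto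
    interpret n: abelian_group N' by (rule vs_abelian_group[OF MO_vs[OF D'(1)]])
    have "?d v = h v \<ominus>\<^bsub>N'\<^esub> a (k v)" using v c vs_minus[OF MO_vs[OF D'(1)] c(1,2)] by (simp add: compose_def)
    then show "?d v = r' (l v) \<longleftrightarrow> h v = a (k v) \<oplus>[N'] r' (l v)"
     using diff_eq_iff[OF n.abelian_group_axioms c] by simp
   qed
   finally show "?g = on_mor G X N' (compose (carrier X) a k) x' \<longleftrightarrow> (\<exists>l\<in>MH X M'. \<forall>v\<in>carrier X. h v = a (k v) \<oplus>[N'] r' (l v))" .
  qed
  also have "\<dots> \<longleftrightarrow> (\<exists>m\<in>MH X ?L. \<forall>v\<in>carrier X. h v = ?s (m v))"
  proof
   assume "\<exists>k\<in>MH X N. \<exists>l\<in>MH X M'. \<forall>v\<in>carrier X. h v = a (k v) \<oplus>[N'] r' (l v)"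
   then obtain k l where k: "k \<in> MH X N" and l: "l \<in> MH X M'" and e: "\<forall>v\<in>carrier X. h v = a (k v) \<oplus>[N'] r' (l v)" by blast
   show "\<exists>m\<in>MH X ?L. \<forall>v\<in>carrier X. h v = ?s (m v)"
    by (rule bexI[OF _ mm_pair[OF X k l]]) (use e mmD(1)[OF k] mmD(1)[OF l] in simp)
  next
   assume "\<exists>m\<in>MH X ?L. \<forall>v\<in>carrier X. h v = ?s (m v)"
   then obtain m where m: "m \<in> MH X ?L" "\<forall>v\<in>carrier X. h v = ?s (m v)" by blast
   have mv: "p1 (m v) \<in> carrier N" "p2 (m v) \<in> carrier M'" if "v \<in> carrier X" for v using mmD(1)[OF m(1) that] by auto
   show "\<exists>k\<in>MH X N. \<exists>l\<in>MH X M'. \<forall>v\<in>carrier X. h v = a (k v) \<oplus>[N'] r' (l v)"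
    by (rule bexI[OF _ mm_comp[OF MO_rm[OF X] m(1) mm_p1[OF D(1) D'(2)]]],
      rule bexI[OF _ mm_comp[OF MO_rm[OF X] m(1) mm_p2[OF D(1) D'(2)]]])
     (use m(2) mv in \<open>simp add: compose_def\<close>)
  qed
  finally show "on_mor ?Q X N' h ?y = \<zero>[on_ob ?Q X] \<longleftrightarrow> (\<exists>m\<in>MH X ?L. \<forall>v\<in>carrier X. h v = ?s (m v))" .
 qed
 then show ?thesis by blast
qed

text \<open>The direct sum of the two presentations; the generator is the pair of \<open>x\<close>
  and \<open>x'\<close>, pulled back along the projections.\<close>

lemma prod_pres:
 assumes F: "cf F" and G: "cf G" and pF: "pres F N x M r" and pG: "pres G N' x' M' r'"
 shows "\<exists>Q y L s. pres (prodF F G) Q y L s"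
proof -
 note D = presD[OF pF] and D' = presD[OF pG]
 let ?N = "prodM N N'" and ?M = "prodM M M'"
 note N = prod_MO[OF D(1) D'(1)] and M = prod_MO[OF D(2) D'(2)]
 let ?q1 = "restrict p1 (carrier ?N)" and ?q2 = "restrict p2 (carrier ?N)"
 note q1 = mm_p1[OF D(1) D'(1)] and q2 = mm_p2[OF D(1) D'(1)]
 let ?y = "pr (on_mor F ?N N ?q1 x) (on_mor G ?N N' ?q2 x')"
 let ?r1 = "compose (carrier ?M) r (restrict p1 (carrier ?M))" and ?r2 = "compose (carrier ?M) r' (restrict p2 (carrier ?M))"
 note r1 = mm_comp[OF MO_rm[OF M] mm_p1[OF D(2) D'(2)] D(4)] and r2 = mm_comp[OF MO_rm[OF M] mm_p2[OF D(2) D'(2)] D'(4)]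
 let ?r = "\<lambda>v\<in>carrier ?M. pr (?r1 v) (?r2 v)"
 note r = mm_pair[OF M r1 r2]
 have y: "on_mor F ?N N ?q1 x \<in> carrier (on_ob F ?N)" "on_mor G ?N N' ?q2 x' \<in> carrier (on_ob G ?N)"
  using cf_lin(1)[OF F N D(1) q1 D(3)] cf_lin(1)[OF G N D'(1) q2 D'(3)] by auto
 have Py: "on_mor (prodF F G) X ?N h ?y = pr (on_mor F X N h1 x) (on_mor G X N' h2 x')"
  if X: "X \<in> MO" and h: "h \<in> MH X ?N" and h1: "h1 \<in> MH X N" and h2: "h2 \<in> MH X N'"
   and e: "\<And>v. v \<in> carrier X ==> h1 v = p1 (h v)" "\<And>v. v \<in> carrier X ==> h2 v = p2 (h v)" for X h h1 h2
 proof -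
  have i: "p1 (h v) \<in> carrier N" "p2 (h v) \<in> carrier N'" if "v \<in> carrier X" for v using mmD(1)[OF h that] by auto
  show ?thesis
   using y cf_comp[OF F X N D(1) h q1 h1 _ D(3)] cf_comp[OF G X N D'(1) h q2 h2 _ D'(3)] e i by simp
 qed
 have "pres (prodF F G) ?N ?y ?M ?r"
 proof (rule presI[OF N M _ r])
  show "?y \<in> carrier (on_ob (prodF F G) ?N)" using y by simp
  fix X assume X: "X \<in> MO"
  { fix z assume "z \<in> carrier (on_ob (prodF F G) X)"
   then have z: "p1 z \<in> carrier (on_ob F X)" "p2 z \<in> carrier (on_ob G X)" by auto
   obtain h1 where h1: "h1 \<in> MH X N" "p1 z = on_mor F X N h1 x" using D(5)[OF X z(1)] by blast
   obtain h2 where h2: "h2 \<in> MH X N'" "p2 z = on_mor G X N' h2 x'" using D'(5)[OF X z(2)] by blast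
   have "on_mor (prodF F G) X ?N (\<lambda>v\<in>carrier X. pr (h1 v) (h2 v)) ?y = pr (p1 z) (p2 z)"
    unfolding h1(2) h2(2) by (rule Py[OF X mm_pair[OF X h1(1) h2(1)] h1(1) h2(1)]) simp_all
   then have "z = on_mor (prodF F G) X ?N (\<lambda>v\<in>carrier X. pr (h1 v) (h2 v)) ?y" by (simp only: pr_simps)
   then show "\<exists>h\<in>MH X ?N. z = on_mor (prodF F G) X ?N h ?y" by (rule bexI[OF _ mm_pair[OF X h1(1) h2(1)]]) }
  fix h assume h: "h \<in> MH X ?N"
  have i: "p1 (h v) \<in> carrier N" "p2 (h v) \<in> carrier N'" if "v \<in> carrier X" for v using mmD(1)[OF h that] by auto
  note h1 = mm_comp[OF MO_rm[OF X] h q1] and h2 = mm_comp[OF MO_rm[OF X] h q2]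
  have "on_mor (prodF F G) X ?N h ?y = \<zero>[on_ob (prodF F G) X] \<longleftrightarrow>
    (\<exists>k\<in>MH X M. \<forall>v\<in>carrier X. p1 (h v) = r (k v)) \<and> (\<exists>k\<in>MH X M'. \<forall>v\<in>carrier X. p2 (h v) = r' (k v))"
   using Py[OF X h h1 h2] D(6)[OF X h1] D'(6)[OF X h2] i by (simp add: compose_def pr_inject)
  also have "\<dots> \<longleftrightarrow> (\<exists>k\<in>MH X ?M. \<forall>v\<in>carrier X. h v = ?r (k v))"
  proof
   assume "(\<exists>k\<in>MH X M. \<forall>v\<in>carrier X. p1 (h v) = r (k v)) \<and> (\<exists>k\<in>MH X M'. \<forall>v\<in>carrier X. p2 (h v) = r' (k v))"
   then obtain k k' where k: "k \<in> MH X M" "\<forall>v\<in>carrier X. p1 (h v) = r (k v)" and k': "k' \<in> MH X M'" "\<forall>v\<in>carrier X. p2 (h v) = r' (k' v)"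
    by blast
   show "\<exists>k\<in>MH X ?M. \<forall>v\<in>carrier X. h v = ?r (k v)"
    by (rule bexI[OF _ mm_pair[OF X k(1) k'(1)]])
     (use k(2) k'(2) mmD(1)[OF k(1)] mmD(1)[OF k'(1)] in \<open>simp add: compose_def, metis pr_simps(3)\<close>)
  next
   assume "\<exists>k\<in>MH X ?M. \<forall>v\<in>carrier X. h v = ?r (k v)"
   then obtain m where m: "m \<in> MH X ?M" "\<forall>v\<in>carrier X. h v = ?r (m v)" by blast
   have mv: "p1 (m v) \<in> carrier M" "p2 (m v) \<in> carrier M'" if "v \<in> carrier X" for v using mmD(1)[OF m(1) that] by auto
   have e: "p1 (h v) = r (p1 (m v))" "p2 (h v) = r' (p2 (m v))" if "v \<in> carrier X" for v
    using m(2) mv that by (simp_all add: compose_def)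
   show "(\<exists>k\<in>MH X M. \<forall>v\<in>carrier X. p1 (h v) = r (k v)) \<and> (\<exists>k\<in>MH X M'. \<forall>v\<in>carrier X. p2 (h v) = r' (k v))"
    by (intro conjI, rule bexI[OF _ mm_comp[OF MO_rm[OF X] m(1) mm_p1[OF D(2) D'(2)]]], use e mv in \<open>simp add: compose_def\<close>,
      rule bexI[OF _ mm_comp[OF MO_rm[OF X] m(1) mm_p2[OF D(2) D'(2)]]], use e mv in \<open>simp add: compose_def\<close>)
  qed
  finally show "on_mor (prodF F G) X ?N h ?y = \<zero>[on_ob (prodF F G) X] \<longleftrightarrow> (\<exists>k\<in>MH X ?M. \<forall>v\<in>carrier X. h v = ?r (k v))" .
 qed
 then show ?thesis by blast
qed

end

section \<open>Finitely presented functors as a concrete abelian category\<close>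

context fd_algebra begin

lemma nt_ext:
 assumes "nt F G \<eta>" "nt F G \<theta>" "\<And>X v. X \<in> MO ==> v \<in> carrier (on_ob F X) ==> \<eta> X v = \<theta> X v"
 shows "\<eta> = \<theta>"
proof (rule extensionalityI[OF ntD(1)[OF assms(1)] ntD(1)[OF assms(2)]])
 fix X assume X: "X \<in> MO"
 show "\<eta> X = \<theta> X"
  by (rule extensionalityI[OF linear_mapsD(4)[OF ntD(2)[OF assms(1) X]] linear_mapsD(4)[OF ntD(2)[OF assms(2) X]] assms(3)[OF X]])
qed

lemma Id_FC: "X \<in> MO ==> v \<in> carrier (on_ob F X) ==> Id FC F X v = v"
 by (simp add: fp_functor_category_def)

lemma Cmp_FC: "X \<in> MO ==> v \<in> carrier (on_ob F X) ==> Cmp FC F G H \<theta> \<eta> X v = \<theta> X (\<eta> X v)"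
 by (simp add: fp_functor_category_def compose_def)

lemma FC_ker:
 assumes F: "F \<in> Ob FC" and G: "G \<in> Ob FC" and \<eta>: "\<eta> \<in> Hom FC F G"
 shows "\<exists>A'\<in>Ob FC. \<exists>i\<in>Hom FC A' F. \<forall>X\<in>MO. inj_on (i X) (carrier (on_ob A' X)) \<and>
  i X ` carrier (on_ob A' X) = {v \<in> carrier (on_ob F X). \<eta> X v = \<zero>[on_ob G X]}"
proof -
 note cF = FC_cf[OF F] and cG = FC_cf[OF G] and e = \<eta>[unfolded FC_Hom]
 note sub = kerN_sub[OF cF cG e]
 note K = subF_cf[OF cF sub]
 obtain N x M r N' x' M' r' where p: "pres F N x M r" "pres G N' x' M' r'"
  using F G unfolding FC_Ob by (elim conjE exE) (rule that)
 have KO: "subF F (kerN F G \<eta>) \<in> Ob FC" unfolding FC_Ob using K ker_pres[OF cF cG e p] by simp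
 let ?i = "\<lambda>X\<in>MO. \<lambda>v\<in>carrier (on_ob (subF F (kerN F G \<eta>)) X). v"
 have i: "nt (subF F (kerN F G \<eta>)) F ?i"
  by (rule ntI[OF cfD(1)[OF K] cf_lin(1)[OF K]]) (auto simp: kerN_def)
 show ?thesis
  by (rule bexI[OF _ KO], rule bexI[of _ ?i]) (use i in \<open>auto simp: FC_Hom kerN_def inj_on_def image_iff\<close>)
qed

lemma FC_coker:
 assumes F: "F \<in> Ob FC" and G: "G \<in> Ob FC" and \<eta>: "\<eta> \<in> Hom FC F G"
 shows "\<exists>Q\<in>Ob FC. \<exists>q\<in>Hom FC G Q. \<forall>X\<in>MO. q X ` carrier (on_ob G X) = carrier (on_ob Q X) \<and>
  \<eta> X ` carrier (on_ob F X) = {v \<in> carrier (on_ob G X). q X v = \<zero>[on_ob Q X]}"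
proof -
 note cF = FC_cf[OF F] and cG = FC_cf[OF G] and e = \<eta>[unfolded FC_Hom]
 note sub = imN_sub[OF cF cG e]
 let ?Q = "quoF G (imN F \<eta>)"
 note K = quoF_cf[OF cG sub]
 obtain N x M r N' x' M' r' where p: "pres F N x M r" "pres G N' x' M' r'"
  using F G unfolding FC_Ob by (elim conjE exE) (rule that)
 have QO: "?Q \<in> Ob FC" unfolding FC_Ob using K coker_pres[OF cF cG e p] by simp
 let ?q = "\<lambda>X\<in>MO. \<lambda>v\<in>carrier (on_ob G X). qp (on_ob G X) (imN F \<eta> X) v"
 have q: "nt G ?Q ?q"
 proof (rule ntI[OF cfD(1)[OF cG] cf_lin(1)[OF cG]])
  fix X v assume X: "X \<in> MO" and v: "v \<in> carrier (on_ob G X)"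
  note V = cfD(1)[OF cG X] and S = subfunctorD(1)[OF sub X]
  show "qp (on_ob G X) (imN F \<eta> X) v \<in> carrier (on_ob ?Q X)" using v by (simp add: quoV_simps[OF V S])
  show "qp (on_ob G X) (imN F \<eta> X) (c \<odot>[on_ob G X] v) = c \<odot>[on_ob ?Q X] qp (on_ob G X) (imN F \<eta> X) v" for c
   using qp_smult[OF V S v] by (simp add: quoV_simps[OF V S])
  fix w assume w: "w \<in> carrier (on_ob G X)"
  show "qp (on_ob G X) (imN F \<eta> X) (v \<oplus>[on_ob G X] w) =
    qp (on_ob G X) (imN F \<eta> X) v \<oplus>[on_ob ?Q X] qp (on_ob G X) (imN F \<eta> X) w"
   using qp_add[OF V S v w] by (simp add: quoV_simps[OF V S])
 qed (simp_all add: quoF_mor[OF cG sub] del: quoF_simps)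
 have "?q X ` carrier (on_ob G X) = carrier (on_ob ?Q X) \<and>
   \<eta> X ` carrier (on_ob F X) = {v \<in> carrier (on_ob G X). ?q X v = \<zero>[on_ob ?Q X]}" if X: "X \<in> MO" for X
 proof -
  note V = cfD(1)[OF cG X] and S = subfunctorD(1)[OF sub X]
  have "{v \<in> carrier (on_ob G X). ?q X v = \<zero>[on_ob ?Q X]} = imN F \<eta> X"
   using qp_zero_iff[OF V S] subspace_ofD(1)[OF S] X by auto
  then show ?thesis using X quoV_simps(1)[OF V S] by (simp add: imN_def[of F \<eta> X, symmetric])
 qed
 then show ?thesis by (intro bexI[OF _ QO] bexI[of _ ?q]) (use q in \<open>simp_all add: FC_Hom\<close>)
qed

lemma FC_prod:
 assumes F: "F \<in> Ob FC" and G: "G \<in> Ob FC"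
 shows "\<exists>P\<in>Ob FC. \<exists>p\<in>Hom FC P F. \<exists>q\<in>Hom FC P G.
   (\<forall>X\<in>MO. \<forall>u\<in>carrier (on_ob F X). \<forall>v\<in>carrier (on_ob G X). \<exists>w\<in>carrier (on_ob P X). p X w = u \<and> q X w = v) \<and>
   (\<forall>X\<in>MO. \<forall>w\<in>carrier (on_ob P X). p X w = \<zero>[on_ob F X] --> q X w = \<zero>[on_ob G X] --> w = \<zero>[on_ob P X]) \<and>
   (\<forall>W\<in>Ob FC. \<forall>a\<in>Hom FC W F. \<forall>b\<in>Hom FC W G. \<exists>h\<in>Hom FC W P.
    \<forall>X\<in>MO. \<forall>w\<in>carrier (on_ob W X). p X (h X w) = a X w \<and> q X (h X w) = b X w)"
proof -
 note cF = FC_cf[OF F] and cG = FC_cf[OF G]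
 let ?P = "prodF F G"
 note K = prodF_cf[OF cF cG]
 obtain N x M r N' x' M' r' where p: "pres F N x M r" "pres G N' x' M' r'"
  using F G unfolding FC_Ob by (elim conjE exE) (rule that)
 have PO: "?P \<in> Ob FC" unfolding FC_Ob using K prod_pres[OF cF cG p] by simp
 let ?p = "\<lambda>X\<in>MO. \<lambda>v\<in>carrier (on_ob ?P X). p1 v" and ?q = "\<lambda>X\<in>MO. \<lambda>v\<in>carrier (on_ob ?P X). p2 v"
 have pq: "nt ?P F ?p" "nt ?P G ?q"
  by (rule ntI[OF cfD(1)[OF K] cf_lin(1)[OF K]]; auto)+
 have univ: "\<exists>h\<in>Hom FC W ?P. \<forall>X\<in>MO. \<forall>w\<in>carrier (on_ob W X). ?p X (h X w) = a X w \<and> ?q X (h X w) = b X w"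
  if W: "W \<in> Ob FC" and a: "a \<in> Hom FC W F" and b: "b \<in> Hom FC W G" for W a b
 proof -
  note cW = FC_cf[OF W] and a' = a[unfolded FC_Hom] and b' = b[unfolded FC_Hom]
  have "nt W ?P (\<lambda>X\<in>MO. \<lambda>w\<in>carrier (on_ob W X). pr (a X w) (b X w))"
   by (rule ntI[OF cfD(1)[OF cW] cf_lin(1)[OF cW]]) (simp_all add: ntD(3-6)[OF a'] ntD(3-6)[OF b'])
  then show ?thesis
   by (intro bexI[of _ "\<lambda>X\<in>MO. \<lambda>w\<in>carrier (on_ob W X). pr (a X w) (b X w)"])
    (simp_all add: FC_Hom ntD(3)[OF a'] ntD(3)[OF b'])
 qed
 show ?thesis
 proof (rule bexI[OF _ PO], rule bexI[of _ ?p], rule bexI[of _ ?q], intro conjI ballI impI)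
  fix X u v assume X: "X \<in> MO" and u: "u \<in> carrier (on_ob F X)" and v: "v \<in> carrier (on_ob G X)"
  show "\<exists>w\<in>carrier (on_ob ?P X). ?p X w = u \<and> ?q X w = v"
   by (rule bexI[of _ "pr u v"]) (use X u v in simp_all)
 next
  fix X w assume X: "X \<in> MO" and w: "w \<in> carrier (on_ob ?P X)" "?p X w = \<zero>[on_ob F X]" "?q X w = \<zero>[on_ob G X]"
  then have "pr (p1 w) (p2 w) = \<zero>[on_ob ?P X]" by (simp del: pr_simps(3))
  then show "w = \<zero>[on_ob ?P X]" by (simp only: pr_simps)
 next
  fix W a b assume "W \<in> Ob FC" "a \<in> Hom FC W F" "b \<in> Hom FC W G"
  then show "\<exists>h\<in>Hom FC W ?P. \<forall>X\<in>MO. \<forall>w\<in>carrier (on_ob W X). ?p X (h X w) = a X w \<and> ?q X (h X w) = b X w" by (rule univ)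
 qed (use pq in \<open>simp_all add: FC_Hom\<close>)
qed

text \<open>Preimages under \<open>i\<close> are unique, and uniqueness makes the pointwise choice
  linear and natural.\<close>

lemma FC_lift:
 assumes K: "K \<in> Ob FC" and F: "F \<in> Ob FC" and U: "U \<in> Ob FC" and i: "i \<in> Hom FC K F" and f: "f \<in> Hom FC U F"
  and inj: "\<And>X. X \<in> MO ==> inj_on (i X) (carrier (on_ob K X))"
  and im: "\<And>X u. X \<in> MO ==> u \<in> carrier (on_ob U X) ==> f X u \<in> i X ` carrier (on_ob K X)"
 shows "\<exists>h\<in>Hom FC U K. \<forall>X\<in>MO. \<forall>u\<in>carrier (on_ob U X). i X (h X u) = f X u"
proof -
 note cK = FC_cf[OF K] and cU = FC_cf[OF U] and i' = i[unfolded FC_Hom] and f' = f[unfolded FC_Hom]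
 define h where "h X u = inv_into (carrier (on_ob K X)) (i X) (f X u)" for X u
 have h: "h X u \<in> carrier (on_ob K X)" "i X (h X u) = f X u" if "X \<in> MO" "u \<in> carrier (on_ob U X)" for X u
  using im[OF that] inv_into_into f_inv_into_f unfolding h_def by metis+
 have eq: "h X u = v" if "X \<in> MO" "u \<in> carrier (on_ob U X)" "v \<in> carrier (on_ob K X)" "i X v = f X u" for X u v
  using inj_onD[OF inj[OF that(1)]] h[OF that(1,2)] that(3,4) by simp
 have "nt U K (\<lambda>X\<in>MO. \<lambda>u\<in>carrier (on_ob U X). h X u)"
 proof (rule ntI[OF cfD(1)[OF cU] cf_lin(1)[OF cU] h(1)])
  fix X u assume X: "X \<in> MO" and u: "u \<in> carrier (on_ob U X)"
  note VU = cfD(1)[OF cU X] and VK = cfD(1)[OF cK X]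
  show "h X (c \<odot>[on_ob U X] u) = c \<odot>[on_ob K X] h X u" for c
   by (rule eq[OF X]) (simp_all add: vs_smult[OF VU u] vs_smult[OF VK] h[OF X u] ntD(5)[OF i' X] ntD(5)[OF f' X] u)
  fix v assume v: "v \<in> carrier (on_ob U X)"
  show "h X (u \<oplus>[on_ob U X] v) = h X u \<oplus>[on_ob K X] h X v"
   by (rule eq[OF X]) (simp_all add: vs_add[OF VU] vs_add[OF VK] h[OF X] ntD(4)[OF i' X] ntD(4)[OF f' X] u v)
 next
  fix X Y g v assume X: "X \<in> MO" and Y: "Y \<in> MO" and g: "g \<in> MH X Y" and v: "v \<in> carrier (on_ob U Y)"
  show "on_mor K X Y g (h Y v) = h X (on_mor U X Y g v)"
   by (rule eq[OF X, symmetric]) (simp_all add: cf_lin(1)[OF cU X Y g] cf_lin(1)[OF cK X Y g] h[OF Y] v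
     ntD(6)[OF i' X Y g, symmetric] ntD(6)[OF f' X Y g, symmetric])
 qed
 then show ?thesis
  by (intro bexI[of _ "\<lambda>X\<in>MO. \<lambda>u\<in>carrier (on_ob U X). h X u"]) (use h in \<open>simp_all add: FC_Hom\<close>)
qed

text \<open>Two preimages under \<open>q\<close> differ by an element of its kernel, which
  \<open>f\<close> kills; the value is therefore independent of the choice.\<close>

lemma FC_desc:
 assumes F: "F \<in> Ob FC" and Q: "Q \<in> Ob FC" and G: "G \<in> Ob FC" and q: "q \<in> Hom FC F Q" and f: "f \<in> Hom FC F G"
  and surj: "\<And>X. X \<in> MO ==> q X ` carrier (on_ob F X) = carrier (on_ob Q X)"
  and ker: "\<And>X x. X \<in> MO ==> x \<in> carrier (on_ob F X) ==> q X x = \<zero>[on_ob Q X] ==> f X x = \<zero>[on_ob G X]"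
 shows "\<exists>h\<in>Hom FC Q G. \<forall>X\<in>MO. \<forall>x\<in>carrier (on_ob F X). h X (q X x) = f X x"
proof -
 note cF = FC_cf[OF F] and cQ = FC_cf[OF Q] and cG = FC_cf[OF G] and q' = q[unfolded FC_Hom] and f' = f[unfolded FC_Hom]
 define h where "h X y = f X (inv_into (carrier (on_ob F X)) (q X) y)" for X y
 have fq: "f X x = f X x'" if X: "X \<in> MO" and x: "x \<in> carrier (on_ob F X)" "x' \<in> carrier (on_ob F X)" and e: "q X x = q X x'" for X x x'
 proof -
  note VF = cfD(1)[OF cF X] and VQ = cfD(1)[OF cQ X] and VG = cfD(1)[OF cG X]
  have d: "q X (x \<ominus>\<^bsub>on_ob F X\<^esub> x') = q X x \<ominus>\<^bsub>on_ob Q X\<^esub> q X x'" "f X (x \<ominus>\<^bsub>on_ob F X\<^esub> x') = f X x \<ominus>\<^bsub>on_ob G X\<^esub> f X x'"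
   using x ntD(3-5)[OF q' X] ntD(3-5)[OF f' X] vs_smult[OF VF] by (simp_all add: vs_minus[OF VF] vs_minus[OF VQ] vs_minus[OF VG])
  have "q X (x \<ominus>\<^bsub>on_ob F X\<^esub> x') = \<zero>[on_ob Q X]"
   using d(1) e vs_minus_eq_zero[OF VQ ntD(3)[OF q' X x(1)] ntD(3)[OF q' X x(2)]] by simp
  then have "f X x \<ominus>\<^bsub>on_ob G X\<^esub> f X x' = \<zero>[on_ob G X]" using ker[OF X vs_minus_closed[OF VF x]] d(2) by simp
  then show ?thesis using vs_minus_eq_zero[OF VG ntD(3)[OF f' X x(1)] ntD(3)[OF f' X x(2)]] by blast
 qed
 have h: "h X (q X x) = f X x" if X: "X \<in> MO" and x: "x \<in> carrier (on_ob F X)" for X x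
 proof -
  have "q X x \<in> q X ` carrier (on_ob F X)" using x by blast
  then show ?thesis unfolding h_def using fq[OF X _ x] inv_into_into f_inv_into_f by metis
 qed
 have rep: "\<exists>x\<in>carrier (on_ob F X). y = q X x" if "X \<in> MO" "y \<in> carrier (on_ob Q X)" for X y
  using surj[OF that(1)] that(2) by blast
 have "nt Q G (\<lambda>X\<in>MO. \<lambda>y\<in>carrier (on_ob Q X). h X y)"
 proof (rule ntI[OF cfD(1)[OF cQ] cf_lin(1)[OF cQ]])
  fix X y assume X: "X \<in> MO" and y: "y \<in> carrier (on_ob Q X)"
  note VF = cfD(1)[OF cF X]
  obtain x where x: "x \<in> carrier (on_ob F X)" "y = q X x" using rep[OF X y] by blast
  show "h X y \<in> carrier (on_ob G X)" using h[OF X x(1)] x ntD(3)[OF f' X x(1)] by simp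
  show "h X (c \<odot>[on_ob Q X] y) = c \<odot>[on_ob G X] h X y" for c
   using h[OF X x(1)] h[OF X vs_smult[OF VF x(1), of c]] x ntD(5)[OF q' X x(1)] ntD(5)[OF f' X x(1)] by simp
  fix z assume z: "z \<in> carrier (on_ob Q X)"
  obtain w where w: "w \<in> carrier (on_ob F X)" "z = q X w" using rep[OF X z] by blast
  show "h X (y \<oplus>[on_ob Q X] z) = h X y \<oplus>[on_ob G X] h X z"
   using h[OF X x(1)] h[OF X w(1)] h[OF X vs_add[OF VF x(1) w(1)]] x w ntD(4)[OF q' X x(1) w(1)] ntD(4)[OF f' X x(1) w(1)] by simp
 next
  fix X Y g v assume X: "X \<in> MO" and Y: "Y \<in> MO" and g: "g \<in> MH X Y" and v: "v \<in> carrier (on_ob Q Y)"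
  obtain x where x: "x \<in> carrier (on_ob F Y)" "v = q Y x" using rep[OF Y v] by blast
  show "on_mor G X Y g (h Y v) = h X (on_mor Q X Y g v)"
   using h[OF Y x(1)] h[OF X cf_lin(1)[OF cF X Y g x(1)]] x ntD(6)[OF q' X Y g x(1)] ntD(6)[OF f' X Y g x(1)] by simp
 qed
 then show ?thesis
  by (intro bexI[of _ "\<lambda>X\<in>MO. \<lambda>y\<in>carrier (on_ob Q X). h X y"]) (use h ntD(3)[OF q'] in \<open>simp_all add: FC_Hom\<close>)
qed

lemma concrete_abelian_FC: "concrete_abelian FC MO on_ob"
proof (rule concrete_abelian.intro)
 fix F G :: "('k, nat => 'k, 'a, nat => 'k) mod_functor" and \<eta> \<theta> X x y
 assume F: "F \<in> Ob FC"
 note cF = FC_cf[OF F]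
 { assume X: "X \<in> MO"
  show "abelian_group (on_ob F X)" by (rule vs_abelian_group[OF cfD(1)[OF cF X]])
  show "x \<in> carrier (on_ob F X) ==> Id FC F X x = x" by (rule Id_FC[OF X]) }
 show "Id FC F \<in> Hom FC F F"
 proof -
  have "nt F F (\<lambda>X\<in>MO. \<lambda>v\<in>carrier (on_ob F X). v)" by (rule ntI[OF cfD(1)[OF cF] cf_lin(1)[OF cF]]) simp_all
  then show ?thesis by (simp add: fp_functor_category_def)
 qed
 assume G: "G \<in> Ob FC"
 note cG = FC_cf[OF G]
 show "\<exists>z\<in>Hom FC F G. \<forall>X\<in>MO. \<forall>x\<in>carrier (on_ob F X). z X x = \<zero>[on_ob G X]"
 proof -
  have "nt F G (\<lambda>X\<in>MO. \<lambda>v\<in>carrier (on_ob F X). \<zero>[on_ob G X])"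
   by (rule ntI[OF cfD(1)[OF cF] cf_lin(1)[OF cF]])
    (simp_all add: vs_zero[OF cfD(1)[OF cG]] vs_l_zero[OF cfD(1)[OF cG]] vs_smult_zero[OF cfD(1)[OF cG]] cf_lin(4)[OF cG])
  then show ?thesis by (intro bexI[of _ "\<lambda>X\<in>MO. \<lambda>v\<in>carrier (on_ob F X). \<zero>[on_ob G X]"]) (simp_all add: FC_Hom)
 qed
 { fix H assume H: "H \<in> Ob FC" and f: "\<eta> \<in> Hom FC F G" and g: "\<theta> \<in> Hom FC G H"
  note f' = f[unfolded FC_Hom] and g' = g[unfolded FC_Hom]
  have "nt F H (\<lambda>X\<in>MO. \<lambda>v\<in>carrier (on_ob F X). \<theta> X (\<eta> X v))"
   by (rule ntI[OF cfD(1)[OF cF] cf_lin(1)[OF cF]]) (simp_all add: ntD(3-6)[OF f'] ntD(3-6)[OF g'])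
  moreover have "Cmp FC F G H \<theta> \<eta> = (\<lambda>X\<in>MO. \<lambda>v\<in>carrier (on_ob F X). \<theta> X (\<eta> X v))"
   by (simp add: fp_functor_category_def compose_def)
  ultimately show "Cmp FC F G H \<theta> \<eta> \<in> Hom FC F H" by (simp add: FC_Hom)
  assume "X \<in> MO" "x \<in> carrier (on_ob F X)"
  then show "Cmp FC F G H \<theta> \<eta> X x = \<theta> X (\<eta> X x)" by (rule Cmp_FC) }
 assume \<eta>: "\<eta> \<in> Hom FC F G"
 note e = \<eta>[unfolded FC_Hom]
 { assume X: "X \<in> MO" and x: "x \<in> carrier (on_ob F X)"
  show "\<eta> X x \<in> carrier (on_ob G X)" by (rule ntD(3)[OF e X x])
  assume "y \<in> carrier (on_ob F X)"
  then show "\<eta> X (x \<oplus>[on_ob F X] y) = \<eta> X x \<oplus>[on_ob G X] \<eta> X y" by (rule ntD(4)[OF e X x]) }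
 assume \<theta>: "\<theta> \<in> Hom FC F G"
 note t = \<theta>[unfolded FC_Hom]
 show "(\<And>X x. X \<in> MO ==> x \<in> carrier (on_ob F X) ==> \<eta> X x = \<theta> X x) ==> \<eta> = \<theta>" by (rule nt_ext[OF e t])
 show "\<exists>h\<in>Hom FC F G. \<forall>X\<in>MO. \<forall>x\<in>carrier (on_ob F X). h X x = \<eta> X x \<ominus>\<^bsub>on_ob G X\<^esub> \<theta> X x"
 proof -
  have "nt F G (\<lambda>X\<in>MO. \<lambda>v\<in>carrier (on_ob F X). \<eta> X v \<ominus>\<^bsub>on_ob G X\<^esub> \<theta> X v)"
  proof (rule ntI[OF cfD(1)[OF cF] cf_lin(1)[OF cF]])
   fix X v assume X: "X \<in> MO" and v: "v \<in> carrier (on_ob F X)"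
   note VG = cfD(1)[OF cG X]
   interpret g: abelian_group "on_ob G X" by (rule vs_abelian_group[OF VG])
   note c = ntD(3)[OF e X] ntD(3)[OF t X]
   show "\<eta> X v \<ominus>\<^bsub>on_ob G X\<^esub> \<theta> X v \<in> carrier (on_ob G X)" using v c by simp
   show "\<eta> X (k \<odot>[on_ob F X] v) \<ominus>\<^bsub>on_ob G X\<^esub> \<theta> X (k \<odot>[on_ob F X] v) = k \<odot>[on_ob G X] (\<eta> X v \<ominus>\<^bsub>on_ob G X\<^esub> \<theta> X v)" for k
    using v c by (simp add: ntD(5)[OF e X] ntD(5)[OF t X] vs_minus[OF VG] vs_smult[OF VG] vs_r_distr[OF VG]
      vs_smult_assoc[OF VG, symmetric] mult.commute)
   fix w assume w: "w \<in> carrier (on_ob F X)"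
   show "\<eta> X (v \<oplus>[on_ob F X] w) \<ominus>\<^bsub>on_ob G X\<^esub> \<theta> X (v \<oplus>[on_ob F X] w) =
     (\<eta> X v \<ominus>\<^bsub>on_ob G X\<^esub> \<theta> X v) \<oplus>[on_ob G X] (\<eta> X w \<ominus>\<^bsub>on_ob G X\<^esub> \<theta> X w)"
    using v w c by (simp add: ntD(4)[OF e X] ntD(4)[OF t X] g.minus_eq g.minus_add g.a_ac)
  next
   fix X Y f v assume X: "X \<in> MO" and Y: "Y \<in> MO" and f: "f \<in> MH X Y" and v: "v \<in> carrier (on_ob F Y)"
   note VY = cfD(1)[OF cG Y] and VX = cfD(1)[OF cG X]
   show "on_mor G X Y f (\<eta> Y v \<ominus>\<^bsub>on_ob G Y\<^esub> \<theta> Y v) = \<eta> X (on_mor F X Y f v) \<ominus>\<^bsub>on_ob G X\<^esub> \<theta> X (on_mor F X Y f v)"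
    using ntD(3)[OF e Y v] ntD(3)[OF t Y v] cf_lin(1)[OF cF X Y f v] ntD(3)[OF e X] ntD(3)[OF t X]
     ntD(6)[OF e X Y f v] ntD(6)[OF t X Y f v] cf_lin(2,3)[OF cG X Y f] vs_smult[OF VY]
    by (simp add: vs_minus[OF VY] vs_minus[OF VX])
  qed
  then show ?thesis by (intro bexI[of _ "\<lambda>X\<in>MO. \<lambda>v\<in>carrier (on_ob F X). \<eta> X v \<ominus>\<^bsub>on_ob G X\<^esub> \<theta> X v"]) (simp_all add: FC_Hom)
 qed
qed (rule FC_lift FC_desc FC_ker FC_coker FC_prod; assumption)+

end

section \<open>Functors between module categories\<close>

text \<open>\<open>P\<close> sends B-modules to A-modules, so precomposition sends functors on
  A-modules to functors on B-modules. \<open>couniversal\<close> is a right adjoint of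
  \<open>P\<close>, stated object by object; it transports presentations. \<open>retract\<close>
  makes precomposition reflect zero.\<close>

locale module_functor = A: fd_algebra A + B: fd_algebra B
 for A :: "('k::field, 'a) module" and B :: "('k, 'b) module" +
 fixes P :: "('k, nat => 'k, 'b) right_module => ('k, nat => 'k, 'a) right_module"
  and Pm :: "('k, nat => 'k, 'b) right_module => ('k, nat => 'k, 'b) right_module =>
   ((nat => 'k) => nat => 'k) => (nat => 'k) => nat => 'k"
 assumes P_ob: "X \<in> B.MO ==> P X \<in> A.MO"
  and P_mor: "[| X \<in> B.MO; Y \<in> B.MO; f \<in> B.MH X Y |] ==> Pm X Y f \<in> A.MH (P X) (P Y)"
  and P_add: "[| X \<in> B.MO; Y \<in> B.MO; f \<in> B.MH X Y; g \<in> B.MH X Y; v \<in> carrier (P X) |] ==>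
   Pm X Y (\<lambda>v\<in>carrier X. f v \<oplus>[Y] g v) v = Pm X Y f v \<oplus>[P Y] Pm X Y g v"
  and P_smult: "[| X \<in> B.MO; Y \<in> B.MO; f \<in> B.MH X Y; v \<in> carrier (P X) |] ==>
   Pm X Y (\<lambda>v\<in>carrier X. c \<odot>[Y] f v) v = c \<odot>[P Y] Pm X Y f v"
  and P_id: "[| X \<in> B.MO; v \<in> carrier (P X) |] ==> Pm X X (\<lambda>v\<in>carrier X. v) v = v"
  and P_comp: "[| X \<in> B.MO; Y \<in> B.MO; Z \<in> B.MO; f \<in> B.MH X Y; g \<in> B.MH Y Z; v \<in> carrier (P X) |] ==>
   Pm X Z (compose (carrier X) g f) v = Pm Y Z g (Pm X Y f v)"
  and retract: "N \<in> A.MO ==> \<exists>M\<in>B.MO. \<exists>s\<in>A.MH N (P M). \<exists>p\<in>A.MH (P M) N. \<forall>v\<in>carrier N. p (s v) = v"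
  and couniversal: "N \<in> A.MO ==> \<exists>R\<in>B.MO. \<exists>\<epsilon>\<in>A.MH (P R) N. \<forall>X\<in>B.MO. \<forall>h\<in>A.MH (P X) N.
   \<exists>h'\<in>B.MH X R. (\<forall>v\<in>carrier (P X). \<epsilon> (Pm X R h' v) = h v) \<and>
    (\<forall>h''\<in>B.MH X R. (\<forall>v\<in>carrier (P X). \<epsilon> (Pm X R h'' v) = h v) --> h'' = h')"
begin

definition pull :: "('k, nat => 'k, 'a, nat => 'k) mod_functor => ('k, nat => 'k, 'b, nat => 'k) mod_functor" where
 "pull F = \<lparr>on_ob = (\<lambda>X. on_ob F (P X)), on_mor = (\<lambda>X Y f. on_mor F (P X) (P Y) (Pm X Y f))\<rparr>"

lemma pull_simps [simp]: "on_ob (pull F) X = on_ob F (P X)" "on_mor (pull F) X Y f = on_mor F (P X) (P Y) (Pm X Y f)"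
 by (simp_all add: pull_def)

lemma pull_cf: assumes F: "A.cf F" shows "B.cf (pull F)"
proof (rule B.cfI)
 fix X assume X: "X \<in> B.MO"
 note PX = P_ob[OF X]
 show "vs (on_ob (pull F) X)" "fd (on_ob (pull F) X)" using A.cfD(1,2)[OF F PX] by simp_all
 { fix v assume v: "v \<in> carrier (on_ob (pull F) X)"
  have e: "Pm X X (\<lambda>v\<in>carrier X. v) = (\<lambda>v\<in>carrier (P X). v)"
   by (rule mm_ext[OF P_mor[OF X X mm_id[OF B.MO_rm[OF X]]] mm_id[OF A.MO_rm[OF PX]]]) (simp add: P_id[OF X])
  show "on_mor (pull F) X X (\<lambda>v\<in>carrier X. v) v = v" using A.cfD(6)[OF F PX] v e by simp }
 fix Y f assume Y: "Y \<in> B.MO" and f: "f \<in> B.MH X Y"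
 note PY = P_ob[OF Y] and Pf = P_mor[OF X Y f]
 show "on_mor (pull F) X Y f \<in> linear_maps (on_ob (pull F) Y) (on_ob (pull F) X)" using A.cfD(3)[OF F PX PY Pf] by simp
 fix v
 { assume v: "v \<in> carrier (on_ob (pull F) Y)"
  { fix c
   have "Pm X Y (\<lambda>v\<in>carrier X. c \<odot>[Y] f v) = (\<lambda>v\<in>carrier (P X). c \<odot>[P Y] Pm X Y f v)"
    by (rule mm_ext[OF P_mor[OF X Y mm_smult[OF B.MO_rm[OF X] B.MO_rm[OF Y] f]] mm_smult[OF A.MO_rm[OF PX] A.MO_rm[OF PY] Pf]])
     (simp add: P_smult[OF X Y f])
   then show "on_mor (pull F) X Y (\<lambda>v\<in>carrier X. c \<odot>[Y] f v) v = c \<odot>[on_ob (pull F) X] on_mor (pull F) X Y f v"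
    using A.cfD(5)[OF F PX PY Pf] v by simp }
  fix g assume g: "g \<in> B.MH X Y"
  note Pg = P_mor[OF X Y g]
  have "Pm X Y (\<lambda>v\<in>carrier X. f v \<oplus>[Y] g v) = (\<lambda>v\<in>carrier (P X). Pm X Y f v \<oplus>[P Y] Pm X Y g v)"
   by (rule mm_ext[OF P_mor[OF X Y mm_plus[OF B.MO_rm[OF X] B.MO_rm[OF Y] f g]] mm_plus[OF A.MO_rm[OF PX] A.MO_rm[OF PY] Pf Pg]])
    (simp add: P_add[OF X Y f g])
  then show "on_mor (pull F) X Y (\<lambda>v\<in>carrier X. f v \<oplus>[Y] g v) v =
    on_mor (pull F) X Y f v \<oplus>[on_ob (pull F) X] on_mor (pull F) X Y g v"
   using A.cfD(4)[OF F PX PY Pf Pg] v by simp }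
 fix Z g assume Z: "Z \<in> B.MO" and g: "g \<in> B.MH Y Z" and v: "v \<in> carrier (on_ob (pull F) Z)"
 show "on_mor (pull F) X Z (compose (carrier X) g f) v = on_mor (pull F) X Y f (on_mor (pull F) Y Z g v)"
  using A.cf_comp[OF F PX PY P_ob[OF Z] Pf P_mor[OF Y Z g] P_mor[OF X Z mm_comp[OF B.MO_rm[OF X] f g]] P_comp[OF X Y Z f g]] v by simp
qed

text \<open>The right adjoint represents Hom(P X, N) by R through the counit
  \<open>\<epsilon>\<close>. A presentation by \<open>r\<close> from M to N thus becomes one by
  \<open>s\<close> from R' to R, where \<open>s\<close> is the transpose of \<open>r\<close> after
  \<open>\<epsilon>'\<close>.\<close>

lemma pull_pres: assumes F: "A.cf F" and p: "A.pres F N x M r" shows "\<exists>R y R' s. B.pres (pull F) R y R' s"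
proof -
 note D = A.presD[OF p]
 obtain R \<epsilon> where R: "R \<in> B.MO" and \<epsilon>: "\<epsilon> \<in> A.MH (P R) N" and U: "\<forall>X\<in>B.MO. \<forall>h\<in>A.MH (P X) N.
   \<exists>h'\<in>B.MH X R. (\<forall>v\<in>carrier (P X). \<epsilon> (Pm X R h' v) = h v) \<and>
    (\<forall>h''\<in>B.MH X R. (\<forall>v\<in>carrier (P X). \<epsilon> (Pm X R h'' v) = h v) --> h'' = h')"
  using couniversal[OF D(1)] by (elim bexE) (rule that)
 obtain R' \<epsilon>' where R': "R' \<in> B.MO" and \<epsilon>': "\<epsilon>' \<in> A.MH (P R') M" and U': "\<forall>X\<in>B.MO. \<forall>h\<in>A.MH (P X) M.
   \<exists>h'\<in>B.MH X R'. (\<forall>v\<in>carrier (P X). \<epsilon>' (Pm X R' h' v) = h v) \<and>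
    (\<forall>h''\<in>B.MH X R'. (\<forall>v\<in>carrier (P X). \<epsilon>' (Pm X R' h'' v) = h v) --> h'' = h')"
  using couniversal[OF D(2)] by (elim bexE) (rule that)
 note PR = P_ob[OF R] and PR' = P_ob[OF R']
 have "compose (carrier (P R')) r \<epsilon>' \<in> A.MH (P R') N" by (rule mm_comp[OF A.MO_rm[OF PR'] \<epsilon>' D(4)])
 then obtain s where s: "s \<in> B.MH R' R" and s': "\<forall>v\<in>carrier (P R'). \<epsilon> (Pm R' R s v) = compose (carrier (P R')) r \<epsilon>' v"
  using U R' by blast
 let ?y = "on_mor F (P R) N \<epsilon> x"
 have y: "?y \<in> carrier (on_ob F (P R))" by (rule A.cf_lin(1)[OF F PR D(1) \<epsilon> D(3)])
 have Fy: "on_mor (pull F) X R h' ?y = on_mor F (P X) N h x"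
  if X: "X \<in> B.MO" and h': "h' \<in> B.MH X R" and h: "h \<in> A.MH (P X) N" and e: "\<And>v. v \<in> carrier (P X) ==> h v = \<epsilon> (Pm X R h' v)" for X h' h
  using A.cf_comp[OF F P_ob[OF X] PR D(1) P_mor[OF X R h'] \<epsilon> h e D(3)] by simp
 have "B.pres (pull F) R ?y R' s"
 proof (rule B.presI[OF R R' _ s])
  show "?y \<in> carrier (on_ob (pull F) R)" using y by simp
  fix X assume X: "X \<in> B.MO"
  note PX = P_ob[OF X]
  { fix z assume "z \<in> carrier (on_ob (pull F) X)"
   then obtain h where h: "h \<in> A.MH (P X) N" "z = on_mor F (P X) N h x" using D(5)[OF PX] by auto
   obtain h' where h': "h' \<in> B.MH X R" "\<forall>v\<in>carrier (P X). \<epsilon> (Pm X R h' v) = h v" using U X h(1) by blast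
   have "z = on_mor (pull F) X R h' ?y" using Fy[OF X h'(1) h(1)] h'(2) h(2) by simp
   then show "\<exists>h\<in>B.MH X R. z = on_mor (pull F) X R h ?y" by (rule bexI[OF _ h'(1)]) }
  fix h' assume h': "h' \<in> B.MH X R"
  let ?h = "compose (carrier (P X)) \<epsilon> (Pm X R h')"
  note h = mm_comp[OF A.MO_rm[OF PX] P_mor[OF X R h'] \<epsilon>]
  have "on_mor (pull F) X R h' ?y = \<zero>[on_ob (pull F) X] \<longleftrightarrow> (\<exists>k\<in>A.MH (P X) M. \<forall>v\<in>carrier (P X). ?h v = r (k v))"
   using Fy[OF X h' h] D(6)[OF PX h] by (simp add: compose_eq)
  also have "\<dots> \<longleftrightarrow> (\<exists>k\<in>B.MH X R'. \<forall>v\<in>carrier X. h' v = s (k v))"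
  proof
   assume "\<exists>k\<in>A.MH (P X) M. \<forall>v\<in>carrier (P X). ?h v = r (k v)"
   then obtain k where k: "k \<in> A.MH (P X) M" "\<forall>v\<in>carrier (P X). ?h v = r (k v)" by blast
   obtain k' where k': "k' \<in> B.MH X R'" "\<forall>v\<in>carrier (P X). \<epsilon>' (Pm X R' k' v) = k v" using U' X k(1) by blast
   note sk = mm_comp[OF B.MO_rm[OF X] k'(1) s]
   have "\<epsilon> (Pm X R (compose (carrier X) s k') v) = ?h v" if v: "v \<in> carrier (P X)" for v
    using P_comp[OF X R' R k'(1) s v] s' mmD(1)[OF P_mor[OF X R' k'(1)] v] k'(2) k(2) v by (simp add: compose_eq)
   moreover have "\<epsilon> (Pm X R h' v) = ?h v" if v: "v \<in> carrier (P X)" for v using v by (simp add: compose_eq)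
   \<comment> \<open>Both maps give the same morphism to N under the counit, so uniqueness in the
     universal property identifies them.\<close>
   ultimately have "h' = compose (carrier X) s k'" using U X h h' sk by metis
   then have "\<forall>v\<in>carrier X. h' v = s (k' v)" by (simp add: compose_eq)
   then show "\<exists>k\<in>B.MH X R'. \<forall>v\<in>carrier X. h' v = s (k v)" by (rule bexI[OF _ k'(1)])
  next
   assume "\<exists>k\<in>B.MH X R'. \<forall>v\<in>carrier X. h' v = s (k v)"
   then obtain k' where k': "k' \<in> B.MH X R'" "\<forall>v\<in>carrier X. h' v = s (k' v)" by blast
   have e: "h' = compose (carrier X) s k'"
    by (rule mm_ext[OF h' mm_comp[OF B.MO_rm[OF X] k'(1) s]]) (use k' in \<open>simp add: compose_eq\<close>)
   have "?h v = r (compose (carrier (P X)) \<epsilon>' (Pm X R' k') v)" if v: "v \<in> carrier (P X)" for v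
    using P_comp[OF X R' R k'(1) s v] s' mmD(1)[OF P_mor[OF X R' k'(1)] v] v unfolding e by (simp add: compose_eq)
   then have "\<forall>v\<in>carrier (P X). ?h v = r (compose (carrier (P X)) \<epsilon>' (Pm X R' k') v)" by blast
   then show "\<exists>k\<in>A.MH (P X) M. \<forall>v\<in>carrier (P X). ?h v = r (k v)"
    by (rule bexI[OF _ mm_comp[OF A.MO_rm[OF PX] P_mor[OF X R' k'(1)] \<epsilon>']])
  qed
  finally show "on_mor (pull F) X R h' ?y = \<zero>[on_ob (pull F) X] \<longleftrightarrow> (\<exists>k\<in>B.MH X R'. \<forall>v\<in>carrier X. h' v = s (k v))" .
 qed
 then show ?thesis by blast
qed

lemma pull_ob: assumes F: "F \<in> Ob A.FC" shows "pull F \<in> Ob B.FC"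
proof -
 obtain N x M r where "A.pres F N x M r" using F unfolding A.FC_Ob by (elim conjE exE) (rule that)
 then show ?thesis unfolding B.FC_Ob using pull_cf[OF A.FC_cf[OF F]] pull_pres[OF A.FC_cf[OF F]] by blast
qed

lemma pull_nt: assumes F: "A.cf F" and \<eta>: "A.nt F G \<eta>" shows "B.nt (pull F) (pull G) (\<lambda>X\<in>B.MO. \<lambda>v\<in>carrier (on_ob (pull F) X). \<eta> (P X) v)"
 by (rule B.ntI[OF B.cfD(1)[OF pull_cf[OF F]] B.cf_lin(1)[OF pull_cf[OF F]]])
  (simp_all add: A.ntD(3-6)[OF \<eta>] P_ob P_mor)

text \<open>A module X is a summand of some P M, so F(X) is a summand of F(P M), the value of
  \<open>pull F\<close> at M, and vanishes with it. Exactness is preserved because it is tested at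
  each module separately.\<close>

sublocale ce: conservative_exact A.FC A.MO on_ob B.FC B.MO on_ob pull
proof -
 interpret CA: concrete_abelian A.FC A.MO on_ob by (rule A.concrete_abelian_FC)
 interpret CB: concrete_abelian B.FC B.MO on_ob by (rule B.concrete_abelian_FC)
 show "conservative_exact A.FC A.MO on_ob B.FC B.MO on_ob pull"
 proof unfold_locales
  fix F assume F: "F \<in> Ob A.FC"
  note cF = A.FC_cf[OF F]
  show "pull F \<in> Ob B.FC" by (rule pull_ob[OF F])
  assume z: "zero_object B.FC (pull F)"
  have "carrier (on_ob F X) = {\<zero>[on_ob F X]}" if X: "X \<in> A.MO" for X
  proof -
   obtain M s p where M: "M \<in> B.MO" and s: "s \<in> A.MH X (P M)" and p: "p \<in> A.MH (P M) X" and sp: "\<forall>v\<in>carrier X. p (s v) = v"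
    using retract[OF X] by (elim bexE) (rule that)
   note PM = P_ob[OF M]
   have zM: "carrier (on_ob F (P M)) = {\<zero>[on_ob F (P M)]}"
    using z CB.zero_object_iff[OF pull_ob[OF F]] M by simp
   have "v = \<zero>[on_ob F X]" if v: "v \<in> carrier (on_ob F X)" for v
   proof -
    have "v = on_mor F X X (\<lambda>v\<in>carrier X. v) v" using A.cfD(6)[OF cF X v] by simp
    also have "\<dots> = on_mor F X (P M) s (on_mor F (P M) X p v)"
     by (rule A.cf_comp[OF cF X PM X s p mm_id[OF A.MO_rm[OF X]] _ v]) (use sp in simp)
    also have "on_mor F (P M) X p v = \<zero>[on_ob F (P M)]" using A.cf_lin(1)[OF cF PM X p v] zM by blast
    finally show ?thesis using A.cf_lin(4)[OF cF X PM s] by simp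
   qed
   then show ?thesis using vs_zero[OF A.cfD(1)[OF cF X]] by blast
  qed
  then show "zero_object A.FC F" using CA.zero_object_iff[OF F] by blast
 next
  fix Y X Q i q assume s: "CA.ses Y X Q i q"
  note D = CA.sesD[OF s]
  note cY = A.FC_cf[OF D(1)] and cX = A.FC_cf[OF D(2)] and cQ = A.FC_cf[OF D(3)]
  let ?i = "\<lambda>Z\<in>B.MO. \<lambda>v\<in>carrier (on_ob (pull Y) Z). i (P Z) v" and ?q = "\<lambda>Z\<in>B.MO. \<lambda>v\<in>carrier (on_ob (pull X) Z). q (P Z) v"
  have i: "?i \<in> Hom B.FC (pull Y) (pull X)" using pull_nt[OF cY D(7)[unfolded A.FC_Hom]] by (simp add: B.FC_Hom)
  have q: "?q \<in> Hom B.FC (pull X) (pull Q)" using pull_nt[OF cX D(8)[unfolded A.FC_Hom]] by (simp add: B.FC_Hom)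
  have inj: "inj_on (i (P Z)) (carrier (on_ob Y (P Z)))" if "Z \<in> B.MO" for Z
   using D(4) P_ob[OF that] unfolding CA.mono_def by blast
  have sur: "q (P Z) ` carrier (on_ob X (P Z)) = carrier (on_ob Q (P Z))" if "Z \<in> B.MO" for Z
   using D(5) P_ob[OF that] unfolding CA.epi_def by blast
  have ik: "i (P Z) ` carrier (on_ob Y (P Z)) = {v \<in> carrier (on_ob X (P Z)). q (P Z) v = \<zero>[on_ob Q (P Z)]}" if "Z \<in> B.MO" for Z
   using D(6)[OF P_ob[OF that]] unfolding CA.im_def CA.ker_def .
  have "CB.ses (pull Y) (pull X) (pull Q) ?i ?q"
   unfolding CB.ses_def CB.mono_def CB.epi_def CB.im_def CB.ker_def
   using pull_ob[OF D(1)] pull_ob[OF D(2)] pull_ob[OF D(3)] i q inj sur ik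
   by (intro conjI ballI) (auto simp: inj_on_def cong: conj_cong)
  then show "\<exists>i' q'. CB.ses (pull Y) (pull X) (pull Q) i' q'" by blast
 qed
qed

end

section \<open>Functors and adjunctions given by two by two matrices\<close>

definition s2 :: "('k::field, 'v, 'x) module_scheme => (bool => 'v) => 'v" where
 "s2 V t = t False \<oplus>[V] t True"

lemma s2_cong: "(\<And>k. t k = u k) ==> s2 V t = s2 V u"
 by (simp add: s2_def)

lemma s2_closed: "vs V ==> (\<And>k. t k \<in> carrier V) ==> s2 V t \<in> carrier V"
 by (simp add: s2_def vs_add)

lemma s2_add:
 assumes V: "vs V" and t: "\<And>k. t k \<in> carrier V" and u: "\<And>k. u k \<in> carrier V"
 shows "s2 V (\<lambda>k. t k \<oplus>[V] u k) = s2 V t \<oplus>[V] s2 V u"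
proof -
 interpret abelian_group V by (rule vs_abelian_group[OF V])
 show ?thesis using t u by (simp add: s2_def a_ac)
qed

lemma s2_smult: "vs V ==> (\<And>k. t k \<in> carrier V) ==> s2 V (\<lambda>k. c \<odot>[V] t k) = c \<odot>[V] s2 V t"
 by (simp add: s2_def vs_r_distr)

lemma s2_swap:
 assumes V: "vs V" and t: "\<And>k l. t k l \<in> carrier V"
 shows "s2 V (\<lambda>k. s2 V (\<lambda>l. t k l)) = s2 V (\<lambda>l. s2 V (\<lambda>k. t k l))"
proof -
 interpret abelian_group V by (rule vs_abelian_group[OF V])
 show ?thesis using t by (simp add: s2_def a_ac)
qed

lemma s2_act1:
 "is_right_module A M ==> (\<And>k. t k \<in> carrier M) ==> a \<in> carrier A ==> act M (s2 M t) a = s2 M (\<lambda>k. act M (t k) a)"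
 by (simp add: s2_def rm_act(2))

lemma s2_act2:
 "is_right_module A M ==> v \<in> carrier M ==> (\<And>k. t k \<in> carrier A) ==> act M v (s2 A t) = s2 M (\<lambda>k. act M v (t k))"
 by (simp add: s2_def rm_act(3))

lemma s2_mm: "f \<in> module_maps A M N ==> (\<And>k. t k \<in> carrier M) ==> f (s2 M t) = s2 N (\<lambda>k. f (t k))"
 by (simp add: s2_def mmD)

text \<open>A \<open>bool\<close> index in place of two projections lets rows and columns of
  matrices be summed with \<open>s2\<close>.\<close>

definition cmp :: "bool => (nat => 'k) => nat => 'k" where "cmp k w = (if k then p2 w else p1 w)"
definition mk :: "(bool => nat => 'k) => nat => 'k" where "mk t = pr (t False) (t True)"

lemma cmp_mk [simp]: "cmp k (mk t) = t k"
 by (simp add: cmp_def mk_def)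

lemma cmp_ext: "(\<And>k. cmp k v = cmp k w) ==> v = w"
 unfolding cmp_def by (metis pr_simps(3))

lemma mk_eq_iff: "mk t = w \<longleftrightarrow> (\<forall>k. t k = cmp k w)"
 by (metis cmp_ext cmp_mk)

text \<open>\<open>\<Theta>\<close> is an algebra homomorphism from A to the two by two matrices
  over B that need not send 1 to the identity matrix; its value at 1 is an idempotent
  matrix.\<close>

locale matrix_functor = A: fd_algebra A + B: fd_algebra B
 for A :: "('k::field, 'a) module" and B :: "('k, 'b) module" +
 fixes \<Theta> :: "'a => bool => bool => 'b"
 assumes \<Theta>_closed: "a \<in> carrier A ==> \<Theta> a k l \<in> carrier B"
  and \<Theta>_add: "[| a \<in> carrier A; a' \<in> carrier A |] ==> \<Theta> (a \<oplus>[A] a') k l = \<Theta> a k l \<oplus>[B] \<Theta> a' k l"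
  and \<Theta>_smult: "a \<in> carrier A ==> \<Theta> (c \<odot>[A] a) k l = c \<odot>[B] \<Theta> a k l"
  and \<Theta>_mult: "[| a \<in> carrier A; a' \<in> carrier A |] ==>
   s2 B (\<lambda>m. \<Theta> a k m \<otimes>[B] \<Theta> a' m l) = \<Theta> (a \<otimes>[A] a') k l"
begin

definition P0 :: "('k, nat => 'k, 'b) right_module => ('k, nat => 'k, 'a) right_module" where
 "P0 M = \<lparr>carrier = {w. \<forall>k. cmp k w \<in> carrier M}, monoid.mult = undefined, one = undefined,
  zero = mk (\<lambda>_. \<zero>[M]), add = (\<lambda>x y. mk (\<lambda>k. cmp k x \<oplus>[M] cmp k y)),
  smult = (\<lambda>c x. mk (\<lambda>k. c \<odot>[M] cmp k x)), act = (\<lambda>x a. mk (\<lambda>l. s2 M (\<lambda>k. act M (cmp k x) (\<Theta> a k l))))\<rparr>"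

text \<open>Row vectors over M fixed by the idempotent matrix of 1. They form the summand of the
  space of pairs on which A acts unitally.\<close>

definition fixed :: "('k, nat => 'k, 'b) right_module => (nat => 'k) set" where
 "fixed M = {w. (\<forall>k. cmp k w \<in> carrier M) \<and> (\<forall>l. s2 M (\<lambda>k. act M (cmp k w) (\<Theta> \<one>[A] k l)) = cmp l w)}"

definition P :: "('k, nat => 'k, 'b) right_module => ('k, nat => 'k, 'a) right_module" where
 "P M = (P0 M)\<lparr>carrier := fixed M\<rparr>"

lemma P_simps [simp]:
 "carrier (P M) = fixed M" "\<zero>[P M] = mk (\<lambda>_. \<zero>[M])" "x \<oplus>[P M] y = mk (\<lambda>k. cmp k x \<oplus>[M] cmp k y)"
 "c \<odot>[P M] x = mk (\<lambda>k. c \<odot>[M] cmp k x)" "act (P M) x a = mk (\<lambda>l. s2 M (\<lambda>k. act M (cmp k x) (\<Theta> a k l)))"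
 by (simp_all add: P_def P0_def)

lemma fixedD: "w \<in> fixed M ==> cmp k w \<in> carrier M"
 "w \<in> fixed M ==> s2 M (\<lambda>k. act M (cmp k w) (\<Theta> \<one>[A] k l)) = cmp l w"
 by (simp_all add: fixed_def)

lemma fixedI: "(\<And>k. t k \<in> carrier M) ==> (\<And>l. s2 M (\<lambda>k. act M (t k) (\<Theta> \<one>[A] k l)) = t l) ==> mk t \<in> fixed M"
 by (simp add: fixed_def)

text \<open>Associativity of the action of matrices on rows: the two sums are exchanged, and
  multiplicativity of \<open>\<Theta>\<close> evaluates the inner one.\<close>

lemma act_act:
 assumes M: "is_right_module B M" and x: "\<And>k. x k \<in> carrier M" and a: "a \<in> carrier A" "b \<in> carrier A"
 shows "s2 M (\<lambda>m. act M (s2 M (\<lambda>k. act M (x k) (\<Theta> a k m))) (\<Theta> b m l)) = s2 M (\<lambda>k. act M (x k) (\<Theta> (a \<otimes>[A] b) k l))"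
proof -
 note V = rm_vs[OF M] and c = rm_act(1)[OF M] and t = \<Theta>_closed[OF a(1)] \<Theta>_closed[OF a(2)]
 have "s2 M (\<lambda>m. act M (s2 M (\<lambda>k. act M (x k) (\<Theta> a k m))) (\<Theta> b m l)) =
   s2 M (\<lambda>m. s2 M (\<lambda>k. act M (x k) (\<Theta> a k m \<otimes>[B] \<Theta> b m l)))"
  by (intro s2_cong) (simp add: s2_act1[OF M c[OF x t(1)] t(2)] rm_act(4)[OF M x t])
 also have "\<dots> = s2 M (\<lambda>k. s2 M (\<lambda>m. act M (x k) (\<Theta> a k m \<otimes>[B] \<Theta> b m l)))"
  by (intro s2_swap[OF V] c x ring.ring_simprules(5)[OF B.ring_A] t)
 also have "\<dots> = s2 M (\<lambda>k. act M (x k) (\<Theta> (a \<otimes>[A] b) k l))"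
  by (intro s2_cong) (simp add: s2_act2[OF M x, symmetric] ring.ring_simprules(5)[OF B.ring_A] t \<Theta>_mult[OF a])
 finally show ?thesis .
qed

lemma fixed_closed:
 assumes M: "is_right_module B M"
 shows "mk (\<lambda>_. \<zero>[M]) \<in> fixed M"
  and "x \<in> fixed M ==> y \<in> fixed M ==> mk (\<lambda>k. cmp k x \<oplus>[M] cmp k y) \<in> fixed M"
  and "x \<in> fixed M ==> mk (\<lambda>k. c \<odot>[M] cmp k x) \<in> fixed M"
  and "x \<in> fixed M ==> a \<in> carrier A ==> mk (\<lambda>l. s2 M (\<lambda>k. act M (cmp k x) (\<Theta> a k l))) \<in> fixed M"
proof -
 note V = rm_vs[OF M] and t = \<Theta>_closed[OF A.one_A] and c = rm_act(1)[OF M]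
 have z: "act M \<zero>[M] b = \<zero>[M]" if b: "b \<in> carrier B" for b
  using rm_act(6)[OF M vs_zero[OF V] b, of 0] vs_zero_smult[OF V vs_zero[OF V]] vs_zero_smult[OF V c[OF vs_zero[OF V] b]] by simp
 show "mk (\<lambda>_. \<zero>[M]) \<in> fixed M"
  by (rule fixedI) (simp_all add: z t s2_def vs_zero[OF V] vs_l_zero[OF V])
 { assume x: "x \<in> fixed M"
  { assume y: "y \<in> fixed M"
   show "mk (\<lambda>k. cmp k x \<oplus>[M] cmp k y) \<in> fixed M"
    using fixedD(2)[OF x] fixedD(2)[OF y]
    by (intro fixedI) (simp_all add: vs_add[OF V] fixedD(1)[OF x] fixedD(1)[OF y] rm_act(2)[OF M] t s2_add[OF V] c) }
  show "mk (\<lambda>k. c \<odot>[M] cmp k x) \<in> fixed M"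
   using fixedD(2)[OF x]
   by (intro fixedI) (simp_all add: vs_smult[OF V] fixedD(1)[OF x] rm_act(6)[OF M] t s2_smult[OF V] c)
  assume a: "a \<in> carrier A"
  show "mk (\<lambda>l. s2 M (\<lambda>k. act M (cmp k x) (\<Theta> a k l))) \<in> fixed M"
   by (rule fixedI)
    (simp_all add: s2_closed[OF V] c fixedD(1)[OF x] \<Theta>_closed a act_act[OF M fixedD(1)[OF x] a A.one_A]
     ring.ring_simprules(12)[OF A.ring_A] monoid.r_one[OF ring.is_monoid[OF A.ring_A]]) }
qed

lemma P_ob: assumes M: "M \<in> B.MO" shows "P M \<in> A.MO"
proof -
 note rM = B.MO_rm[OF M] and V = B.MO_vs[OF M]
 note t = \<Theta>_closed and c = rm_act(1)[OF rM] and f = fixed_closed[OF rM]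
 have P0: "carrier (P0 M) = {w. p1 w \<in> carrier M \<and> p2 w \<in> carrier M}" "\<zero>[P0 M] = pr \<zero>[M] \<zero>[M]"
   "\<And>x y. x \<oplus>[P0 M] y = pr (p1 x \<oplus>[M] p1 y) (p2 x \<oplus>[M] p2 y)"
   "\<And>c x. c \<odot>[P0 M] x = pr (c \<odot>[M] p1 x) (c \<odot>[M] p2 x)"
  by (auto simp: P0_def cmp_def mk_def)
 have sub: "fixed M \<subseteq> carrier (P0 M)" "\<zero>[P0 M] \<in> fixed M"
   "\<And>x y. x \<in> fixed M ==> y \<in> fixed M ==> x \<oplus>[P0 M] y \<in> fixed M" "\<And>x c. x \<in> fixed M ==> c \<odot>[P0 M] x \<in> fixed M"
  using f by (auto simp: P0_def fixed_def)
 note vP = vs_sub[OF vs_prod[OF V V P0] sub, folded P_def]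
 have "is_right_module A (P M)"
  by (rule rmI[OF vP])
   (simp_all add: f mk_eq_iff fixedD rm_act[OF rM] t s2_add[OF V] s2_smult[OF V] \<Theta>_add \<Theta>_smult c act_act[OF rM fixedD(1)])
 moreover have "fd (P M)"
  unfolding P_def by (rule fd_sub[OF vs_prod[OF V V P0] fd_prod[OF V B.MO_fd[OF M] V B.MO_fd[OF M] P0] sub])
 ultimately show ?thesis unfolding A.MO_iff by blast
qed

definition Pm :: "('k, nat => 'k, 'b) right_module => ('k, nat => 'k, 'b) right_module =>
  ((nat => 'k) => nat => 'k) => (nat => 'k) => nat => 'k" where
 "Pm X Y f = (\<lambda>w\<in>fixed X. mk (\<lambda>k. f (cmp k w)))"

lemma Pm_fixed:
 assumes X: "X \<in> B.MO" and f: "f \<in> B.MH X Y" and w: "w \<in> fixed X"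
 shows "mk (\<lambda>k. f (cmp k w)) \<in> fixed Y"
proof (rule fixedI)
 fix l
 have "s2 Y (\<lambda>k. act Y (f (cmp k w)) (\<Theta> \<one>[A] k l)) = f (s2 X (\<lambda>k. act X (cmp k w) (\<Theta> \<one>[A] k l)))"
  by (subst s2_mm[OF f]) (simp_all add: rm_act(1)[OF B.MO_rm[OF X]] fixedD(1)[OF w] \<Theta>_closed[OF A.one_A] mmD(5)[OF f])
 then show "s2 Y (\<lambda>k. act Y (f (cmp k w)) (\<Theta> \<one>[A] k l)) = f (cmp l w)" using fixedD(2)[OF w] by simp
qed (simp add: mmD(1)[OF f] fixedD(1)[OF w])

lemma P_mor: assumes X: "X \<in> B.MO" and Y: "Y \<in> B.MO" and f: "f \<in> B.MH X Y" shows "Pm X Y f \<in> A.MH (P X) (P Y)"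
proof -
 have "restrict (\<lambda>w. mk (\<lambda>k. f (cmp k w))) (carrier (P X)) \<in> A.MH (P X) (P Y)"
  by (rule mm_restrictI[OF A.MO_rm[OF P_ob[OF X]]])
   (simp_all add: Pm_fixed[OF X f] mmD[OF f] fixedD(1) s2_mm[OF f] rm_act(1)[OF B.MO_rm[OF X]] \<Theta>_closed)
 then show ?thesis by (simp add: Pm_def)
qed

end

text \<open>Matrix form of an adjunction with \<open>F.P\<close> left adjoint to \<open>G.P\<close>:
  \<open>c\<close> holds the coefficients of the counit, \<open>d\<close> those of the unit,
  \<open>counit\<close> and \<open>unit\<close> say that these are module maps, and
  \<open>triangle1\<close>, \<open>triangle2\<close> are the triangle identities. The coefficients
  \<open>d'\<close> define a map from N into its double transform, linear by \<open>unit'\<close>,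
  and by \<open>split\<close> it is a section of \<open>z\<close> times the counit.\<close>

locale matrix_adjunction = F: matrix_functor A B \<Theta> + G: matrix_functor B A \<Psi>
 for A :: "('k::field, 'a) module" and B :: "('k, 'b) module" and \<Theta> \<Psi> +
 fixes c d' :: "bool => bool => 'a" and d :: "bool => bool => 'b" and z :: 'k
 assumes c: "c k j \<in> carrier A" and d': "d' k j \<in> carrier A" and d: "d j k \<in> carrier B"
  and d_fix: "s2 B (\<lambda>l. d j l \<otimes>[B] \<Theta> \<one>[A] l k) = d j k"
  and d'_fix: "s2 A (\<lambda>l. d' k l \<otimes>[A] \<Psi> \<one>[B] l j) = d' k j"
  and triangle1: "s2 B (\<lambda>j. s2 B (\<lambda>l. d j l \<otimes>[B] \<Theta> (c k j) l i)) = \<Theta> \<one>[A] k i"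
  and triangle2: "s2 A (\<lambda>k. s2 A (\<lambda>j. \<Psi> (d i k) l j \<otimes>[A] c k j)) = \<Psi> \<one>[B] l i"
  and counit: "a \<in> carrier A ==> s2 A (\<lambda>k. s2 A (\<lambda>j. \<Psi> (\<Theta> a k' k) j' j \<otimes>[A] c k j)) = c k' j' \<otimes>[A] a"
  and unit: "b \<in> carrier B ==> s2 B (\<lambda>i. s2 B (\<lambda>l. d i l \<otimes>[B] \<Theta> (\<Psi> b i j) l k)) = b \<otimes>[B] d j k"
  and unit': "a \<in> carrier A ==> s2 A (\<lambda>k. s2 A (\<lambda>j. d' k j \<otimes>[A] \<Psi> (\<Theta> a k l) j i)) = a \<otimes>[A] d' l i"
  and split: "z \<odot>[A] s2 A (\<lambda>k. s2 A (\<lambda>j. d' k j \<otimes>[A] c k j)) = \<one>[A]"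
begin

lemma mult_A: "a \<in> carrier A ==> b \<in> carrier A ==> a \<otimes>[A] b \<in> carrier A"
 and mult_B: "a' \<in> carrier B ==> b' \<in> carrier B ==> a' \<otimes>[B] b' \<in> carrier B"
 by (rule ring.ring_simprules(5)[OF F.A.ring_A], assumption+) (rule ring.ring_simprules(5)[OF F.B.ring_A])

lemmas closed = c d' d F.\<Theta>_closed G.\<Theta>_closed F.A.one_A F.B.one_A mult_A mult_B

definition \<epsilon> :: "('k, nat => 'k, 'a) right_module => (nat => 'k) => nat => 'k" where
 "\<epsilon> N = (\<lambda>w\<in>carrier (F.P (G.P N)). s2 N (\<lambda>k. s2 N (\<lambda>j. act N (cmp j (cmp k w)) (c k j))))"

lemma s4_act:
 assumes N: "is_right_module A N" and x: "\<And>k j. x k j \<in> carrier N" and t: "\<And>k j k' j'. t k j k' j' \<in> carrier A"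
 shows "s2 N (\<lambda>k. s2 N (\<lambda>j. act N (s2 N (\<lambda>k'. s2 N (\<lambda>j'. act N (x k' j') (t k' j' k j)))) (c k j))) =
  s2 N (\<lambda>k'. s2 N (\<lambda>j'. act N (x k' j') (s2 A (\<lambda>k. s2 A (\<lambda>j. t k' j' k j \<otimes>[A] c k j)))))"
proof -
 interpret abelian_group N by (rule vs_abelian_group[OF rm_vs[OF N]])
 show ?thesis
  by (simp add: s2_def rm_act[OF N] x t c a_ac F.A.vs_A vs_add mult_A)
qed

lemma \<epsilon>_mm: assumes N: "N \<in> F.A.MO" shows "\<epsilon> N \<in> F.A.MH (F.P (G.P N)) N"
 unfolding \<epsilon>_def
proof (rule mm_restrictI[OF F.A.MO_rm[OF F.P_ob[OF G.P_ob[OF N]]]])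
 note rN = F.A.MO_rm[OF N] and V = F.A.MO_vs[OF N]
 fix v assume v: "v \<in> carrier (F.P (G.P N))"
 have vv: "cmp j (cmp k v) \<in> carrier N" for j k using v by (auto dest!: F.fixedD(1) intro: G.fixedD(1))
 show "s2 N (\<lambda>k. s2 N (\<lambda>j. act N (cmp j (cmp k v)) (c k j))) \<in> carrier N"
  by (intro s2_closed[OF V] rm_act(1)[OF rN] vv c)
 { fix w assume w: "w \<in> carrier (F.P (G.P N))"
  have ww: "cmp j (cmp k w) \<in> carrier N" for j k using w by (auto dest!: F.fixedD(1) intro: G.fixedD(1))
  show "s2 N (\<lambda>k. s2 N (\<lambda>j. act N (cmp j (cmp k (v \<oplus>[F.P (G.P N)] w))) (c k j))) =
   s2 N (\<lambda>k. s2 N (\<lambda>j. act N (cmp j (cmp k v)) (c k j))) \<oplus>[N] s2 N (\<lambda>k. s2 N (\<lambda>j. act N (cmp j (cmp k w)) (c k j)))"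
   by (simp add: rm_act[OF rN] vv ww c s2_add[OF V] s2_closed[OF V]) }
 { fix x
  show "s2 N (\<lambda>k. s2 N (\<lambda>j. act N (cmp j (cmp k (x \<odot>[F.P (G.P N)] v))) (c k j))) =
   x \<odot>[N] s2 N (\<lambda>k. s2 N (\<lambda>j. act N (cmp j (cmp k v)) (c k j)))"
   by (simp add: rm_act[OF rN] vv c s2_smult[OF V] s2_closed[OF V]) }
 fix a assume a: "a \<in> carrier A"
 have e: "cmp j (cmp k (act (F.P (G.P N)) v a)) =
   s2 N (\<lambda>k'. s2 N (\<lambda>j'. act N (cmp j' (cmp k' v)) (\<Psi> (\<Theta> a k' k) j' j)))" for j k
  by (simp add: s2_def)
 show "s2 N (\<lambda>k. s2 N (\<lambda>j. act N (cmp j (cmp k (act (F.P (G.P N)) v a))) (c k j))) =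
   act N (s2 N (\<lambda>k. s2 N (\<lambda>j. act N (cmp j (cmp k v)) (c k j)))) a"
  unfolding e
  by (subst s4_act[OF rN]) (simp_all add: vv a closed counit rm_act[OF rN] s2_act1[OF rN] s2_closed[OF V])
qed

text \<open>The adjoint transpose of \<open>h\<close>: the unit, with coefficients \<open>d\<close>,
  followed by \<open>h\<close> in each component.\<close>

definition \<eta> :: "('k, nat => 'k, 'b) right_module => ((nat => 'k) => nat => 'k) => (nat => 'k) => nat => 'k" where
 "\<eta> X h = (\<lambda>m\<in>carrier X. mk (\<lambda>j. h (mk (\<lambda>k. act X m (d j k)))))"

lemma d_fixed: assumes X: "is_right_module B X" and m: "m \<in> carrier X" shows "mk (\<lambda>k. act X m (d j k)) \<in> F.fixed X"
 by (rule F.fixedI)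
  (simp_all add: rm_act(1)[OF X m] rm_act(4)[OF X m, symmetric] s2_act2[OF X m, symmetric] closed d_fix)

text \<open>The equation \<open>unit\<close> moves the action of \<open>b\<close> past the
  coefficients \<open>d\<close>; this is the B-linearity of the transpose.\<close>

lemma h_unit:
 assumes X: "X \<in> F.B.MO" and h: "h \<in> F.A.MH (F.P X) N" and m: "m \<in> carrier X" and b: "b \<in> carrier B"
 shows "s2 N (\<lambda>j. act N (h (mk (\<lambda>k. act X m (d j k)))) (\<Psi> b j i)) = h (mk (\<lambda>k. act X (act X m b) (d i k)))"
proof -
 note rX = F.B.MO_rm[OF X] and V = F.B.MO_vs[OF X] and rP = F.A.MO_rm[OF F.P_ob[OF X]]
 have "s2 N (\<lambda>j. act N (h (mk (\<lambda>k. act X m (d j k)))) (\<Psi> b j i)) =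
   h (s2 (F.P X) (\<lambda>j. act (F.P X) (mk (\<lambda>k. act X m (d j k))) (\<Psi> b j i)))"
  by (subst s2_mm[OF h], rule rm_act(1)[OF rP])
   (simp_all del: F.P_simps(5) add: d_fixed[OF rX m] closed b mmD(5)[OF h])
 also have "s2 (F.P X) (\<lambda>j. act (F.P X) (mk (\<lambda>k. act X m (d j k))) (\<Psi> b j i)) =
   mk (\<lambda>k. s2 X (\<lambda>j. s2 X (\<lambda>l. act X (act X m (d j l)) (\<Theta> (\<Psi> b j i) l k))))"
  by (simp add: s2_def)
 also have "\<dots> = mk (\<lambda>k. act X m (s2 B (\<lambda>j. s2 B (\<lambda>l. d j l \<otimes>[B] \<Theta> (\<Psi> b j i) l k))))"
  by (simp add: s2_act2[OF rX m] rm_act(4)[OF rX m] closed b s2_closed[OF F.B.vs_A])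
 finally show ?thesis by (simp add: unit b rm_act(4)[OF rX m] closed)
qed

lemma \<eta>_mm: assumes X: "X \<in> F.B.MO" and N: "N \<in> F.A.MO" and h: "h \<in> F.A.MH (F.P X) N" shows "\<eta> X h \<in> F.B.MH X (G.P N)"
 unfolding \<eta>_def
proof (rule mm_restrictI[OF F.B.MO_rm[OF X]])
 note rX = F.B.MO_rm[OF X] and rP = F.A.MO_rm[OF F.P_ob[OF X]]
 fix v assume v: "v \<in> carrier X"
 show "mk (\<lambda>j. h (mk (\<lambda>k. act X v (d j k)))) \<in> carrier (G.P N)"
  unfolding G.P_simps
  by (rule G.fixedI) (simp_all add: mmD(1)[OF h] d_fixed[OF rX v] h_unit[OF X h v] closed rm_act(5)[OF rX v])
 { fix w assume w: "w \<in> carrier X"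
  have "mk (\<lambda>k. act X (v \<oplus>[X] w) (d j k)) = mk (\<lambda>k. act X v (d j k)) \<oplus>[F.P X] mk (\<lambda>k. act X w (d j k))" for j
   by (simp add: rm_act(2)[OF rX v w] d)
  then show "mk (\<lambda>j. h (mk (\<lambda>k. act X (v \<oplus>[X] w) (d j k)))) =
    mk (\<lambda>j. h (mk (\<lambda>k. act X v (d j k)))) \<oplus>[G.P N] mk (\<lambda>j. h (mk (\<lambda>k. act X w (d j k))))"
   by (simp del: F.P_simps(3) add: mmD(2)[OF h] d_fixed[OF rX] v w) }
 { fix x
  have "mk (\<lambda>k. act X (x \<odot>[X] v) (d j k)) = x \<odot>[F.P X] mk (\<lambda>k. act X v (d j k))" for j
   by (simp add: rm_act(6)[OF rX v] d)
  then show "mk (\<lambda>j. h (mk (\<lambda>k. act X (x \<odot>[X] v) (d j k)))) = x \<odot>[G.P N] mk (\<lambda>j. h (mk (\<lambda>k. act X v (d j k))))"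
   by (simp del: F.P_simps(4) add: mmD(3)[OF h] d_fixed[OF rX] v) }
 fix b assume "b \<in> carrier B"
 then show "mk (\<lambda>j. h (mk (\<lambda>k. act X (act X v b) (d j k)))) = act (G.P N) (mk (\<lambda>j. h (mk (\<lambda>k. act X v (d j k))))) b"
  by (simp add: h_unit[OF X h v])
qed

text \<open>Linearity of \<open>h\<close> collects the coefficients of unit and counit inside its
  argument, where \<open>triangle1\<close> reduces them to the matrix of 1, which fixes
  \<open>v\<close>.\<close>

lemma \<eta>_factors:
 assumes X: "X \<in> F.B.MO" and N: "N \<in> F.A.MO" and h: "h \<in> F.A.MH (F.P X) N" and v: "v \<in> carrier (F.P X)"
 shows "\<epsilon> N (F.Pm X (G.P N) (\<eta> X h) v) = h v"
proof -
 note rX = F.B.MO_rm[OF X] and V = F.B.MO_vs[OF X] and rP = F.A.MO_rm[OF F.P_ob[OF X]] and VP = F.A.MO_vs[OF F.P_ob[OF X]]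
 have vX: "cmp k v \<in> carrier X" for k using v by (simp add: F.fixedD)
 have "F.Pm X (G.P N) (\<eta> X h) v \<in> carrier (F.P (G.P N))"
  by (rule mmD(1)[OF F.P_mor[OF X G.P_ob[OF N] \<eta>_mm[OF X N h]] v])
 then have "\<epsilon> N (F.Pm X (G.P N) (\<eta> X h) v) =
   s2 N (\<lambda>k. s2 N (\<lambda>j. act N (h (mk (\<lambda>l. act X (cmp k v) (d j l)))) (c k j)))"
  using v vX by (simp add: \<epsilon>_def F.Pm_def \<eta>_def)
 also have "\<dots> = h (s2 (F.P X) (\<lambda>k. s2 (F.P X) (\<lambda>j. act (F.P X) (mk (\<lambda>l. act X (cmp k v) (d j l))) (c k j))))"
 proof -
  have cl: "act (F.P X) (mk (\<lambda>l. act X (cmp k v) (d j l))) (c k j) \<in> carrier (F.P X)" for k j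
   by (rule rm_act(1)[OF rP]) (simp_all add: d_fixed[OF rX vX] c)
  show ?thesis
   by (simp del: F.P_simps add: s2_mm[OF h] cl s2_closed[OF VP] mmD(5)[OF h] d_fixed[OF rX vX, folded F.P_simps(1)] c)
 qed
 also have "s2 (F.P X) (\<lambda>k. s2 (F.P X) (\<lambda>j. act (F.P X) (mk (\<lambda>l. act X (cmp k v) (d j l))) (c k j))) =
   mk (\<lambda>i. s2 X (\<lambda>k. s2 X (\<lambda>j. s2 X (\<lambda>l. act X (act X (cmp k v) (d j l)) (\<Theta> (c k j) l i)))))"
  by (simp add: s2_def)
 also have "\<dots> = mk (\<lambda>i. s2 X (\<lambda>k. act X (cmp k v) (s2 B (\<lambda>j. s2 B (\<lambda>l. d j l \<otimes>[B] \<Theta> (c k j) l i)))))"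
  by (simp add: s2_act2[OF rX vX] rm_act(4)[OF rX vX] closed s2_closed[OF F.B.vs_A])
 also have "\<dots> = v" using v by (simp add: triangle1 F.fixedD(2) mk_eq_iff)
 finally show ?thesis .
qed

text \<open>Evaluated on the vectors with entries \<open>act X m (d i k)\<close>, the counit formula
  collapses by \<open>triangle2\<close> to the components of \<open>h''\<close>; so \<open>h\<close>
  determines \<open>h''\<close>.\<close>

lemma \<eta>_unique:
 assumes X: "X \<in> F.B.MO" and N: "N \<in> F.A.MO" and h: "h \<in> F.A.MH (F.P X) N" and h'': "h'' \<in> F.B.MH X (G.P N)"
  and e: "\<forall>v\<in>carrier (F.P X). \<epsilon> N (F.Pm X (G.P N) h'' v) = h v"
 shows "h'' = \<eta> X h"
proof (rule mm_ext[OF h'' \<eta>_mm[OF X N h]])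
 note rX = F.B.MO_rm[OF X] and rN = F.A.MO_rm[OF N]
 fix m assume m: "m \<in> carrier X"
 note hm = mmD(1)[OF h'' m]
 have hN: "cmp l (h'' m) \<in> carrier N" for l using hm by (simp add: G.fixedD)
 have "cmp i (h'' m) = h (mk (\<lambda>k. act X m (d i k)))" for i
 proof -
  let ?v = "mk (\<lambda>k. act X m (d i k))"
  note v = d_fixed[OF rX m, of i]
  have "F.Pm X (G.P N) h'' ?v \<in> carrier (F.P (G.P N))"
   by (rule mmD(1)[OF F.P_mor[OF X G.P_ob[OF N] h'']]) (simp add: v)
  then have "h ?v = s2 N (\<lambda>k. s2 N (\<lambda>j. act N (cmp j (h'' (act X m (d i k)))) (c k j)))"
   using bspec[OF e, of ?v] v by (simp add: \<epsilon>_def F.Pm_def)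
  also have "\<dots> = s2 N (\<lambda>k. s2 N (\<lambda>j. s2 N (\<lambda>l. act N (cmp l (h'' m)) (\<Psi> (d i k) l j \<otimes>[A] c k j))))"
   by (simp add: mmD(5)[OF h'' m] d s2_act1[OF rN] rm_act(1)[OF rN hN] rm_act(4)[OF rN hN] closed)
  also have "\<dots> = s2 N (\<lambda>l. s2 N (\<lambda>k. s2 N (\<lambda>j. act N (cmp l (h'' m)) (\<Psi> (d i k) l j \<otimes>[A] c k j))))"
  proof -
   interpret abelian_group N by (rule vs_abelian_group[OF rm_vs[OF rN]])
   have "act N (cmp l (h'' m)) (\<Psi> (d i k) l j \<otimes>[A] c k j) \<in> carrier N" for l k j
    by (intro rm_act(1)[OF rN hN] closed)
   then show ?thesis by (simp add: s2_def a_ac)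
  qed
  also have "\<dots> = s2 N (\<lambda>l. act N (cmp l (h'' m)) (s2 A (\<lambda>k. s2 A (\<lambda>j. \<Psi> (d i k) l j \<otimes>[A] c k j))))"
   by (simp add: s2_act2[OF rN hN] closed s2_closed[OF F.A.vs_A])
  also have "\<dots> = cmp i (h'' m)" using hm by (simp add: triangle2 G.fixedD(2))
  finally show ?thesis by simp
 qed
 then show "h'' m = \<eta> X h m" using m by - (rule cmp_ext, simp add: \<eta>_def)
qed

text \<open>The section multiplies \<open>x\<close> by the coefficients \<open>d'\<close>, and by
  \<open>split\<close> the counit times \<open>z\<close> returns \<open>x\<close>.\<close>

lemma retract: assumes N: "N \<in> F.A.MO"
 shows "\<exists>M\<in>F.B.MO. \<exists>s\<in>F.A.MH N (F.P M). \<exists>p\<in>F.A.MH (F.P M) N. \<forall>v\<in>carrier N. p (s v) = v"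
proof -
 note rN = F.A.MO_rm[OF N] and V = F.A.MO_vs[OF N] and PG = F.P_ob[OF G.P_ob[OF N]]
 let ?s = "\<lambda>x. mk (\<lambda>k. mk (\<lambda>j. act N x (d' k j)))"
 let ?p = "\<lambda>v\<in>carrier (F.P (G.P N)). z \<odot>[N] \<epsilon> N v"
 have in1: "mk (\<lambda>j. act N x (d' k j)) \<in> G.fixed N" if x: "x \<in> carrier N" for x k
  by (rule G.fixedI)
   (simp_all add: rm_act(1)[OF rN x] rm_act(4)[OF rN x, symmetric] s2_act2[OF rN x, symmetric] closed d'_fix)
 have ac: "mk (\<lambda>l. s2 (G.P N) (\<lambda>k. act (G.P N) (mk (\<lambda>j. act N x (d' k j))) (\<Theta> a k l))) = ?s (act N x a)"
  if x: "x \<in> carrier N" and a: "a \<in> carrier A" for x a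
 proof -
  have "s2 (G.P N) (\<lambda>k. act (G.P N) (mk (\<lambda>j. act N x (d' k j))) (\<Theta> a k l)) =
    mk (\<lambda>i. s2 N (\<lambda>k. s2 N (\<lambda>j. act N (act N x (d' k j)) (\<Psi> (\<Theta> a k l) j i))))" for l
   by (simp add: s2_def)
  also have "\<dots> l = mk (\<lambda>i. act N x (s2 A (\<lambda>k. s2 A (\<lambda>j. d' k j \<otimes>[A] \<Psi> (\<Theta> a k l) j i))))" for l
   by (simp add: s2_act2[OF rN x] rm_act(4)[OF rN x] closed a s2_closed[OF F.A.vs_A])
  finally show ?thesis by (simp add: unit' a rm_act(4)[OF rN x] closed)
 qed
 have in2: "?s x \<in> F.fixed (G.P N)" if x: "x \<in> carrier N" for x
  using ac[OF x F.A.one_A] in1[OF x] by (intro F.fixedI) (simp_all add: rm_act(5)[OF rN x] mk_eq_iff)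
 have s: "restrict ?s (carrier N) \<in> F.A.MH N (F.P (G.P N))"
 proof (rule mm_restrictI[OF rN])
  fix v a assume v: "v \<in> carrier N" and a: "a \<in> carrier A"
  show "?s (act N v a) = act (F.P (G.P N)) (?s v) a" using ac[OF v a] by simp
 qed (simp_all add: in2 rm_act[OF rN] d')
 have p: "?p \<in> F.A.MH (F.P (G.P N)) N" by (rule mm_smult[OF F.A.MO_rm[OF PG] rN \<epsilon>_mm[OF N]])
 have "?p (restrict ?s (carrier N) x) = x" if x: "x \<in> carrier N" for x
 proof -
  have "?p (restrict ?s (carrier N) x) = z \<odot>[N] act N x (s2 A (\<lambda>k. s2 A (\<lambda>j. d' k j \<otimes>[A] c k j)))"
   using in2[OF x] x by (simp add: \<epsilon>_def s2_act2[OF rN x] rm_act(4)[OF rN x] closed s2_closed[OF F.A.vs_A])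
  also have "\<dots> = x" by (simp add: rm_act(7)[OF rN x, symmetric] s2_closed[OF F.A.vs_A] closed split rm_act(5)[OF rN x])
  finally show ?thesis .
 qed
 then show ?thesis using s p G.P_ob[OF N] by blast
qed

sublocale mf: module_functor A B F.P F.Pm
proof unfold_locales
 fix X Y Z f g v k
 show "X \<in> F.B.MO ==> F.P X \<in> F.A.MO" by (rule F.P_ob)
 assume X: "X \<in> F.B.MO"
 { assume "v \<in> carrier (F.P X)"
  then show "F.Pm X X (\<lambda>v\<in>carrier X. v) v = v" by (simp add: F.Pm_def F.fixedD(1) mk_eq_iff) }
 assume Y: "Y \<in> F.B.MO" and f: "f \<in> F.B.MH X Y"
 show "F.Pm X Y f \<in> F.A.MH (F.P X) (F.P Y)" by (rule F.P_mor[OF X Y f])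
 { assume "v \<in> carrier (F.P X)" "g \<in> F.B.MH X Y"
  then show "F.Pm X Y (\<lambda>v\<in>carrier X. f v \<oplus>[Y] g v) v = F.Pm X Y f v \<oplus>[F.P Y] F.Pm X Y g v"
   by (simp add: F.Pm_def F.fixedD(1)) }
 { assume "v \<in> carrier (F.P X)"
  then show "F.Pm X Y (\<lambda>v\<in>carrier X. k \<odot>[Y] f v) v = k \<odot>[F.P Y] F.Pm X Y f v"
   by (simp add: F.Pm_def F.fixedD(1)) }
 assume "v \<in> carrier (F.P X)"
 then show "F.Pm X Z (compose (carrier X) g f) v = F.Pm Y Z g (F.Pm X Y f v)"
  using F.Pm_fixed[OF X f] by (simp add: F.Pm_def F.fixedD(1) compose_eq)
next
 fix N assume N: "N \<in> F.A.MO"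
 show "\<exists>M\<in>F.B.MO. \<exists>s\<in>F.A.MH N (F.P M). \<exists>p\<in>F.A.MH (F.P M) N. \<forall>v\<in>carrier N. p (s v) = v" by (rule retract[OF N])
 show "\<exists>R\<in>F.B.MO. \<exists>\<epsilon>\<in>F.A.MH (F.P R) N. \<forall>X\<in>F.B.MO. \<forall>h\<in>F.A.MH (F.P X) N.
   \<exists>h'\<in>F.B.MH X R. (\<forall>v\<in>carrier (F.P X). \<epsilon> (F.Pm X R h' v) = h v) \<and>
    (\<forall>h''\<in>F.B.MH X R. (\<forall>v\<in>carrier (F.P X). \<epsilon> (F.Pm X R h'' v) = h v) --> h'' = h')"
 proof (rule bexI[OF _ G.P_ob[OF N]], rule bexI[OF _ \<epsilon>_mm[OF N]], intro ballI)
  fix X h assume X: "X \<in> F.B.MO" and h: "h \<in> F.A.MH (F.P X) N"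
  show "\<exists>h'\<in>F.B.MH X (G.P N). (\<forall>v\<in>carrier (F.P X). \<epsilon> N (F.Pm X (G.P N) h' v) = h v) \<and>
    (\<forall>h''\<in>F.B.MH X (G.P N). (\<forall>v\<in>carrier (F.P X). \<epsilon> N (F.Pm X (G.P N) h'' v) = h v) --> h'' = h')"
   using \<eta>_factors[OF X N h] \<eta>_unique[OF X N h] by (intro bexI[OF _ \<eta>_mm[OF X N h]]) blast
 qed
qed

end

section \<open>Passage between an algebra and a corner of its skew group algebra\<close>

lemma s2_mult:
 assumes "ring R" "\<And>k. t k \<in> carrier R" "x \<in> carrier R"
 shows "x \<otimes>[R] s2 R t = s2 R (\<lambda>k. x \<otimes>[R] t k)" "s2 R t \<otimes>[R] x = s2 R (\<lambda>k. t k \<otimes>[R] x)"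
 using assms by (simp_all add: s2_def ring.ring_simprules(13) ring.ring_simprules(23))

text \<open>S is the skew group algebra with A embedded by \<open>inc\<close>, \<open>\<pi>\<close>
  is the coefficient at the identity, \<open>g\<close> lists the two group elements, and
  \<open>\<phi>\<close> identifies B with the corner fSf. The equations for \<open>g\<close> expand
  an element in group elements, with coefficients on either side; \<open>vu\<close> says that the
  ideal generated by \<open>f\<close> is all of S. In this form every matrix identity is a
  computation in S.\<close>

locale corner_bridge = A: fd_algebra A + B: fd_algebra B
 for A :: "('k::field, 'a) module" and B :: "('k, 'b) module" +
 fixes S :: "('k, 's) module" (structure) and inc :: "'a => 's" and \<pi> :: "'s => 'a" and \<phi> :: "'b => 's"
  and f :: 's and g u v :: "bool => 's"
 assumes S: "K_algebra S"
  and inc: "a \<in> carrier A ==> inc a \<in> carrier S"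
   "a \<in> carrier A ==> a' \<in> carrier A ==> inc (a \<oplus>[A] a') = inc a \<oplus> inc a'"
   "a \<in> carrier A ==> inc (x \<odot>[A] a) = x \<odot> inc a"
   "a \<in> carrier A ==> a' \<in> carrier A ==> inc (a \<otimes>[A] a') = inc a \<otimes> inc a'" "inc \<one>[A] = \<one>"
  and \<pi>: "s \<in> carrier S ==> \<pi> s \<in> carrier A"
   "s \<in> carrier S ==> s' \<in> carrier S ==> \<pi> (s \<oplus> s') = \<pi> s \<oplus>[A] \<pi> s'"
   "s \<in> carrier S ==> \<pi> (x \<odot> s) = x \<odot>[A] \<pi> s"
   "a \<in> carrier A ==> s \<in> carrier S ==> \<pi> (inc a \<otimes> s) = a \<otimes>[A] \<pi> s"
   "a \<in> carrier A ==> s \<in> carrier S ==> \<pi> (s \<otimes> inc a) = \<pi> s \<otimes>[A] a" "\<pi> \<one> = \<one>[A]"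
  and g: "g j \<in> carrier S" "g j \<otimes> g j = \<one>"
   "s \<in> carrier S ==> s2 S (\<lambda>j. inc (\<pi> (s \<otimes> g j)) \<otimes> g j) = s"
   "s \<in> carrier S ==> s2 S (\<lambda>j. g j \<otimes> inc (\<pi> (g j \<otimes> s))) = s"
  and f: "f \<in> carrier S" "f \<otimes> f = f"
  and u: "u k \<in> carrier S" "f \<otimes> u k = u k" and v: "v k \<in> carrier S" "v k \<otimes> f = v k"
  and vu: "s2 S (\<lambda>k. v k \<otimes> u k) = \<one>"
  and \<phi>: "b \<in> carrier B ==> \<phi> b \<in> carrier S"
   "b \<in> carrier B ==> b' \<in> carrier B ==> \<phi> (b \<oplus>[B] b') = \<phi> b \<oplus> \<phi> b'"
   "b \<in> carrier B ==> \<phi> (x \<odot>[B] b) = x \<odot> \<phi> b"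
   "b \<in> carrier B ==> b' \<in> carrier B ==> \<phi> (b \<otimes>[B] b') = \<phi> b \<otimes> \<phi> b'" "\<phi> \<one>[B] = f"
   "inj_on \<phi> (carrier B)" "s \<in> carrier S ==> f \<otimes> s \<otimes> f \<in> \<phi> ` carrier B"
begin

lemma rS: "ring S" and vS: "vs S"
 using S unfolding K_algebra_def by auto

lemma m: "s \<in> carrier S ==> t \<in> carrier S ==> s \<otimes> t \<in> carrier S"
 and ma: "s \<in> carrier S ==> t \<in> carrier S ==> r \<in> carrier S ==> s \<otimes> t \<otimes> r = s \<otimes> (t \<otimes> r)"
 and m1: "s \<in> carrier S ==> \<one> \<otimes> s = s" "s \<in> carrier S ==> s \<otimes> \<one> = s"
 using ring.ring_simprules[OF rS] monoid.r_one[OF ring.is_monoid[OF rS]] by auto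

lemma mA: "a \<in> carrier A ==> b \<in> carrier A ==> a \<otimes>[A] b \<in> carrier A"
 and mB: "a' \<in> carrier B ==> b' \<in> carrier B ==> a' \<otimes>[B] b' \<in> carrier B"
 by (rule ring.ring_simprules(5)[OF A.ring_A], assumption+) (rule ring.ring_simprules(5)[OF B.ring_A])

lemma smS: "s \<in> carrier S ==> t \<in> carrier S ==> (x \<odot> s) \<otimes> t = x \<odot> (s \<otimes> t)"
 "s \<in> carrier S ==> t \<in> carrier S ==> s \<otimes> (x \<odot> t) = x \<odot> (s \<otimes> t)"
 using S unfolding K_algebra_def by simp_all

lemmas cl = inc(1) \<pi>(1) g(1) f(1) u(1) v(1) \<phi>(1) m mA mB A.one_A B.one_A

lemma fu: "s \<in> carrier S ==> f \<otimes> (u k \<otimes> s) = u k \<otimes> s"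
 and vf: "s \<in> carrier S ==> v k \<otimes> (f \<otimes> s) = v k \<otimes> s"
 and ff: "s \<in> carrier S ==> f \<otimes> (f \<otimes> s) = f \<otimes> s"
 by (simp_all add: ma[symmetric] u v f)

lemma \<phi>f: "b \<in> carrier B ==> f \<otimes> \<phi> b = \<phi> b" "b \<in> carrier B ==> \<phi> b \<otimes> f = \<phi> b"
 using \<phi>(4,5) B.one_A ring.ring_simprules(12)[OF B.ring_A] monoid.r_one[OF ring.is_monoid[OF B.ring_A]] by metis+

lemma \<phi>f': "b \<in> carrier B ==> s \<in> carrier S ==> f \<otimes> (\<phi> b \<otimes> s) = \<phi> b \<otimes> s"
 "b \<in> carrier B ==> s \<in> carrier S ==> \<phi> b \<otimes> (f \<otimes> s) = \<phi> b \<otimes> s"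
 by (simp_all add: ma[symmetric] cl \<phi>f)

definition \<psi> :: "'s => 'b" where "\<psi> = inv_into (carrier B) \<phi>"

lemma \<psi>: assumes "s \<in> carrier S" "f \<otimes> s = s" "s \<otimes> f = s"
 shows "\<psi> s \<in> carrier B" "\<phi> (\<psi> s) = s"
 using \<phi>(7)[OF assms(1)] assms(2,3) unfolding \<psi>_def by (simp_all add: inv_into_into f_inv_into_f)

lemma \<phi>_eqI: "b \<in> carrier B ==> b' \<in> carrier B ==> \<phi> b = \<phi> b' ==> b = b'"
 using \<phi>(6) by (simp add: inj_on_eq_iff)

lemma \<phi>_s2: "(\<And>k. t k \<in> carrier B) ==> \<phi> (s2 B t) = s2 S (\<lambda>k. \<phi> (t k))"
 and \<pi>_s2: "(\<And>k. t' k \<in> carrier S) ==> \<pi> (s2 S t') = s2 A (\<lambda>k. \<pi> (t' k))"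
 by (simp_all add: s2_def \<phi> \<pi>)

text \<open>The relation \<open>vu\<close> inserted between two factors; \<open>gl\<close> and
  \<open>gr\<close> below do the same with the expansions in group elements.\<close>

lemma uv: assumes "x \<in> carrier S" "y \<in> carrier S" shows "s2 S (\<lambda>l. x \<otimes> (v l \<otimes> (u l \<otimes> y))) = x \<otimes> y"
proof -
 have "s2 S (\<lambda>l. x \<otimes> (v l \<otimes> (u l \<otimes> y))) = x \<otimes> (s2 S (\<lambda>l. v l \<otimes> u l) \<otimes> y)"
  by (simp add: s2_mult[OF rS] cl assms ma)
 then show ?thesis by (simp add: vu m1 assms)
qed

lemma gl: assumes "x \<in> carrier S" "s \<in> carrier S" "y \<in> carrier S"
 shows "s2 S (\<lambda>j. x \<otimes> (g j \<otimes> (inc (\<pi> (g j \<otimes> s)) \<otimes> y))) = x \<otimes> (s \<otimes> y)"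
proof -
 have "s2 S (\<lambda>j. x \<otimes> (g j \<otimes> (inc (\<pi> (g j \<otimes> s)) \<otimes> y))) =
   x \<otimes> (s2 S (\<lambda>j. g j \<otimes> inc (\<pi> (g j \<otimes> s))) \<otimes> y)"
  by (simp add: s2_mult[OF rS] cl assms ma)
 then show ?thesis by (simp add: g assms)
qed

lemma gr: assumes "x \<in> carrier S" "s \<in> carrier S" "y \<in> carrier S"
 shows "s2 S (\<lambda>j. x \<otimes> (inc (\<pi> (s \<otimes> g j)) \<otimes> (g j \<otimes> y))) = x \<otimes> (s \<otimes> y)"
proof -
 have "s2 S (\<lambda>j. x \<otimes> (inc (\<pi> (s \<otimes> g j)) \<otimes> (g j \<otimes> y))) =
   x \<otimes> (s2 S (\<lambda>j. inc (\<pi> (s \<otimes> g j)) \<otimes> g j) \<otimes> y)"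
  by (simp add: s2_mult[OF rS] cl assms ma)
 then show ?thesis by (simp add: g assms)
qed

text \<open>Expanding \<open>s\<close> in group elements and moving the coefficients through
  \<open>\<pi>\<close> turns products in S into matrix products over A; this makes
  \<open>\<Psi>\<close> multiplicative.\<close>

lemma pp: assumes s: "s \<in> carrier S" and t: "t \<in> carrier S"
 shows "s2 A (\<lambda>j. \<pi> (s \<otimes> g j) \<otimes>[A] \<pi> (g j \<otimes> t)) = \<pi> (s \<otimes> t)"
proof -
 have "\<pi> (s \<otimes> t) = \<pi> (s2 S (\<lambda>j. inc (\<pi> (s \<otimes> g j)) \<otimes> g j) \<otimes> t)" by (simp add: g s)
 also have "\<dots> = s2 A (\<lambda>j. \<pi> (inc (\<pi> (s \<otimes> g j)) \<otimes> (g j \<otimes> t)))"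
  by (simp add: s2_mult[OF rS] \<pi>_s2 cl s t ma)
 finally show ?thesis by (simp add: \<pi> cl s t)
qed

text \<open>The functors are tensor products with fS over B and with Sf over A, in coordinates given
  by \<open>u\<close>, \<open>v\<close> and \<open>g\<close>. In these coordinates \<open>c\<close>
  is multiplication of Sf with fS followed by \<open>\<pi>\<close>, \<open>d\<close> is the sum of
  the tensors of f g_j with g_j f, \<open>c'\<close> is multiplication of fS with Sf into fSf, and
  \<open>d'\<close> is the decomposition of 1 into the tensors of v_k with u_k.\<close>

definition \<Theta> :: "'a => bool => bool => 'b" where "\<Theta> a k l = \<psi> (u k \<otimes> (inc a \<otimes> v l))"
definition \<Psi> :: "'b => bool => bool => 'a" where "\<Psi> b i j = \<pi> (g i \<otimes> (\<phi> b \<otimes> g j))"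
definition c :: "bool => bool => 'a" where "c k j = \<pi> (g j \<otimes> u k)"
definition d :: "bool => bool => 'b" where "d j k = \<psi> (f \<otimes> (g j \<otimes> v k))"
definition c' :: "bool => bool => 'b" where "c' j k = \<psi> (u k \<otimes> (g j \<otimes> f))"
definition d' :: "bool => bool => 'a" where "d' k j = \<pi> (v k \<otimes> g j)"

lemma \<Theta>: assumes "a \<in> carrier A" shows "\<Theta> a k l \<in> carrier B" "\<phi> (\<Theta> a k l) = u k \<otimes> (inc a \<otimes> v l)"
 unfolding \<Theta>_def by (rule \<psi>; simp add: cl assms fu ma v)+

lemma d: "d j k \<in> carrier B" "\<phi> (d j k) = f \<otimes> (g j \<otimes> v k)"
 unfolding d_def by (rule \<psi>; simp add: cl ff ma v)+

lemma c': "c' j k \<in> carrier B" "\<phi> (c' j k) = u k \<otimes> (g j \<otimes> f)"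
 unfolding c'_def by (rule \<psi>; simp add: cl fu ma f)+

lemma \<Psi>: "b \<in> carrier B ==> \<Psi> b i j \<in> carrier A" and c: "c k j \<in> carrier A" and d': "d' k j \<in> carrier A"
 by (simp_all add: \<Psi>_def c_def d'_def cl)

lemmas cl' = cl \<Theta>(1) d(1) c'(1) \<Psi> c d'

sublocale F: matrix_functor A B \<Theta>
proof unfold_locales
 fix a k l assume a: "a \<in> carrier A"
 show "\<Theta> a k l \<in> carrier B" by (rule \<Theta>(1)[OF a])
 show "\<Theta> (x \<odot>[A] a) k l = x \<odot>[B] \<Theta> a k l" for x
  by (rule \<phi>_eqI) (simp_all add: cl' a vs_smult[OF A.vs_A] vs_smult[OF B.vs_A] \<Theta> \<phi>(3) inc smS)
 fix a' assume a': "a' \<in> carrier A"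
 show "\<Theta> (a \<oplus>[A] a') k l = \<Theta> a k l \<oplus>[B] \<Theta> a' k l"
  by (rule \<phi>_eqI) (simp_all add: cl' a a' vs_add[OF A.vs_A] vs_add[OF B.vs_A] \<Theta> \<phi>(2) inc
   ring.ring_simprules(13)[OF rS] ring.ring_simprules(23)[OF rS])
 have "\<phi> (s2 B (\<lambda>m. \<Theta> a k m \<otimes>[B] \<Theta> a' m l)) = s2 S (\<lambda>m. (u k \<otimes> inc a) \<otimes> (v m \<otimes> (u m \<otimes> (inc a' \<otimes> v l))))"
  by (simp add: \<phi>_s2 \<phi>(4) cl' a a' \<Theta> ma)
 also have "\<dots> = \<phi> (\<Theta> (a \<otimes>[A] a') k l)" by (subst uv) (simp_all add: cl a a' \<Theta> inc ma)
 finally show "s2 B (\<lambda>m. \<Theta> a k m \<otimes>[B] \<Theta> a' m l) = \<Theta> (a \<otimes>[A] a') k l"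
  by (rule \<phi>_eqI[rotated 2]) (simp_all add: s2_closed[OF B.vs_A] cl' a a')
qed

sublocale G: matrix_functor B A \<Psi>
proof unfold_locales
 fix b k l assume b: "b \<in> carrier B"
 show "\<Psi> b k l \<in> carrier A" by (rule \<Psi>[OF b])
 show "\<Psi> (x \<odot>[B] b) k l = x \<odot>[A] \<Psi> b k l" for x
  by (simp add: \<Psi>_def cl b \<phi>(3) smS \<pi>(3))
 fix b' assume b': "b' \<in> carrier B"
 show "\<Psi> (b \<oplus>[B] b') k l = \<Psi> b k l \<oplus>[A] \<Psi> b' k l"
  by (simp add: \<Psi>_def cl b b' \<phi>(2) \<pi>(2) ring.ring_simprules(13)[OF rS] ring.ring_simprules(23)[OF rS])
 show "s2 A (\<lambda>m. \<Psi> b k m \<otimes>[A] \<Psi> b' m l) = \<Psi> (b \<otimes>[B] b') k l"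
  using pp[of "g k \<otimes> \<phi> b" "\<phi> b' \<otimes> g l"] by (simp add: \<Psi>_def cl b b' \<phi>(4) ma)
qed

lemma d_fix: "s2 B (\<lambda>l. d j l \<otimes>[B] \<Theta> \<one>[A] l k) = d j k"
proof (rule \<phi>_eqI)
 show "\<phi> (s2 B (\<lambda>l. d j l \<otimes>[B] \<Theta> \<one>[A] l k)) = \<phi> (d j k)"
  using uv[of "f \<otimes> g j" "v k"] by (simp add: \<phi>_s2 \<phi>(4) cl' d \<Theta> inc m1 ma)
qed (simp_all add: s2_closed[OF B.vs_A] cl')

lemma d'_fix: "s2 A (\<lambda>l. d' k l \<otimes>[A] \<Psi> \<one>[B] l j) = d' k j"
 using pp[of "v k" "f \<otimes> g j"] by (simp add: d'_def \<Psi>_def cl \<phi>(5) vf)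

lemma unit: assumes b: "b \<in> carrier B"
 shows "s2 B (\<lambda>i. s2 B (\<lambda>l. d i l \<otimes>[B] \<Theta> (\<Psi> b i j) l k)) = b \<otimes>[B] d j k"
proof (rule \<phi>_eqI)
 have "\<phi> (s2 B (\<lambda>i. s2 B (\<lambda>l. d i l \<otimes>[B] \<Theta> (\<Psi> b i j) l k))) =
   s2 S (\<lambda>i. s2 S (\<lambda>l. (f \<otimes> g i) \<otimes> (v l \<otimes> (u l \<otimes> (inc (\<Psi> b i j) \<otimes> v k)))))"
  by (simp add: \<phi>_s2 \<phi>(4) s2_closed[OF B.vs_A] cl' b d \<Theta> ma)
 also have "\<dots> = s2 S (\<lambda>i. f \<otimes> (g i \<otimes> (inc (\<pi> (g i \<otimes> (\<phi> b \<otimes> g j))) \<otimes> v k)))"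
  by (subst uv) (simp_all add: cl' b ma \<Psi>_def)
 also have "\<dots> = \<phi> (b \<otimes>[B] d j k)" by (subst gl) (simp_all add: cl' b ma \<phi>(4) d \<phi>f')
 finally show "\<phi> (s2 B (\<lambda>i. s2 B (\<lambda>l. d i l \<otimes>[B] \<Theta> (\<Psi> b i j) l k))) = \<phi> (b \<otimes>[B] d j k)" .
qed (simp_all add: s2_closed[OF B.vs_A] cl' b)

lemma unit': assumes a: "a \<in> carrier A"
 shows "s2 A (\<lambda>k. s2 A (\<lambda>j. d' k j \<otimes>[A] \<Psi> (\<Theta> a k l) j i)) = a \<otimes>[A] d' l i"
proof -
 have "s2 A (\<lambda>j. d' k j \<otimes>[A] \<Psi> (\<Theta> a k l) j i) = \<pi> (\<one> \<otimes> (v k \<otimes> (u k \<otimes> (inc a \<otimes> (v l \<otimes> g i)))))" for k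
  using pp[of "v k" "u k \<otimes> (inc a \<otimes> (v l \<otimes> g i))"] by (simp add: d'_def \<Psi>_def \<Theta> cl a ma m1)
 then show ?thesis
  using uv[of "\<one>" "inc a \<otimes> (v l \<otimes> g i)"] ring.ring_simprules(6)[OF rS]
  by (simp add: \<pi>_s2[symmetric] cl a m1 \<pi>(4) d'_def)
qed

text \<open>The constant is 1 here: the section followed by the counit is multiplication by
  \<open>\<pi>\<close> of the sum of the v_k u_k, which is 1.\<close>

sublocale F: matrix_adjunction A B \<Theta> \<Psi> c d' d 1
proof unfold_locales
 fix k j i l k' j'
 have "\<phi> (s2 B (\<lambda>j. s2 B (\<lambda>l. d j l \<otimes>[B] \<Theta> (c k j) l i))) =
   s2 S (\<lambda>j. s2 S (\<lambda>l. (f \<otimes> g j) \<otimes> (v l \<otimes> (u l \<otimes> (inc (c k j) \<otimes> v i)))))"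
  by (simp add: \<phi>_s2 \<phi>(4) s2_closed[OF B.vs_A] cl' d \<Theta> ma)
 also have "\<dots> = s2 S (\<lambda>j. f \<otimes> (g j \<otimes> (inc (\<pi> (g j \<otimes> u k)) \<otimes> v i)))"
  by (subst uv) (simp_all add: cl' ma c_def)
 also have "\<dots> = \<phi> (\<Theta> \<one>[A] k i)" by (subst gl) (simp_all add: cl' \<Theta> inc m1 fu)
 finally show "s2 B (\<lambda>j. s2 B (\<lambda>l. d j l \<otimes>[B] \<Theta> (c k j) l i)) = \<Theta> \<one>[A] k i"
  by (rule \<phi>_eqI[rotated 2]) (simp_all add: s2_closed[OF B.vs_A] cl')
 have "s2 A (\<lambda>j. \<Psi> (d i k) l j \<otimes>[A] c k j) = \<pi> ((g l \<otimes> (f \<otimes> g i)) \<otimes> (v k \<otimes> (u k \<otimes> \<one>)))" for k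
  using pp[of "g l \<otimes> (f \<otimes> (g i \<otimes> v k))" "u k"] by (simp add: c_def \<Psi>_def d cl ma m1)
 then show "s2 A (\<lambda>k. s2 A (\<lambda>j. \<Psi> (d i k) l j \<otimes>[A] c k j)) = \<Psi> \<one>[B] l i"
  using uv[of "g l \<otimes> (f \<otimes> g i)" "\<one>"] ring.ring_simprules(6)[OF rS]
  by (simp add: \<pi>_s2[symmetric] cl m1 \<Psi>_def \<phi>(5))
 { fix a assume a: "a \<in> carrier A"
  have "s2 A (\<lambda>j. \<Psi> (\<Theta> a k' k) j' j \<otimes>[A] c k j) = \<pi> ((g j' \<otimes> (u k' \<otimes> inc a)) \<otimes> (v k \<otimes> (u k \<otimes> \<one>)))" for k
   using pp[of "g j' \<otimes> (u k' \<otimes> (inc a \<otimes> v k))" "u k"] by (simp add: c_def \<Psi>_def \<Theta> cl a ma m1)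
  then show "s2 A (\<lambda>k. s2 A (\<lambda>j. \<Psi> (\<Theta> a k' k) j' j \<otimes>[A] c k j)) = c k' j' \<otimes>[A] a"
   using uv[of "g j' \<otimes> (u k' \<otimes> inc a)" "\<one>"] ring.ring_simprules(6)[OF rS]
   by (simp add: \<pi>_s2[symmetric] cl a m1 ma[symmetric] \<pi>(5) c_def) }
 have "s2 A (\<lambda>j. d' k j \<otimes>[A] c k j) = \<pi> (v k \<otimes> u k)" for k
  using pp[of "v k" "u k"] by (simp add: c_def d'_def cl)
 then show "1 \<odot>[A] s2 A (\<lambda>k. s2 A (\<lambda>j. d' k j \<otimes>[A] c k j)) = \<one>[A]"
  by (simp add: \<pi>_s2[symmetric] cl vu \<pi>(6) vs_one[OF A.vs_A])
qed (simp_all add: cl' d_fix d'_fix unit unit')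

text \<open>The two bimodules exchange their roles. The section followed by the counit is now the
  sum of f g_k g_k f over both group elements, that is f + f, so the factor \<open>z\<close> has to
  be one half.\<close>

lemma adjunction': assumes z: "z * 2 = (1::'k)" shows "matrix_adjunction B A \<Psi> \<Theta> c' d d' z"
proof unfold_locales
 fix k j i l k' j'
 have "s2 A (\<lambda>l. d' j l \<otimes>[A] \<Psi> (c' k j) l i) = \<pi> (\<one> \<otimes> (v j \<otimes> (u j \<otimes> (g k \<otimes> (f \<otimes> g i)))))" for j
  using pp[of "v j" "u j \<otimes> (g k \<otimes> (f \<otimes> g i))"] by (simp add: d'_def \<Psi>_def c' cl ma m1)
 then show "s2 A (\<lambda>j. s2 A (\<lambda>l. d' j l \<otimes>[A] \<Psi> (c' k j) l i)) = \<Psi> \<one>[B] k i"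
  using uv[of "\<one>" "g k \<otimes> (f \<otimes> g i)"] ring.ring_simprules(6)[OF rS]
  by (simp add: \<pi>_s2[symmetric] cl m1 \<Psi>_def \<phi>(5))
 have "\<phi> (s2 B (\<lambda>k. s2 B (\<lambda>j. \<Theta> (d' i k) l j \<otimes>[B] c' k j))) =
   s2 S (\<lambda>k. s2 S (\<lambda>j. (u l \<otimes> inc (d' i k)) \<otimes> (v j \<otimes> (u j \<otimes> (g k \<otimes> f)))))"
  by (simp add: \<phi>_s2 \<phi>(4) s2_closed[OF B.vs_A] cl' c' \<Theta> ma)
 also have "\<dots> = s2 S (\<lambda>k. u l \<otimes> (inc (\<pi> (v i \<otimes> g k)) \<otimes> (g k \<otimes> f)))"
  by (subst uv) (simp_all add: cl' ma d'_def)
 also have "\<dots> = \<phi> (\<Theta> \<one>[A] l i)" by (subst gr) (simp_all add: cl' \<Theta> inc m1 v)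
 finally show "s2 B (\<lambda>k. s2 B (\<lambda>j. \<Theta> (d' i k) l j \<otimes>[B] c' k j)) = \<Theta> \<one>[A] l i"
  by (rule \<phi>_eqI[rotated 2]) (simp_all add: s2_closed[OF B.vs_A] cl')
 { fix b assume b: "b \<in> carrier B"
  have "\<phi> (s2 B (\<lambda>k. s2 B (\<lambda>j. \<Theta> (\<Psi> b k' k) j' j \<otimes>[B] c' k j))) =
    s2 S (\<lambda>k. s2 S (\<lambda>j. (u j' \<otimes> inc (\<Psi> b k' k)) \<otimes> (v j \<otimes> (u j \<otimes> (g k \<otimes> f)))))"
   by (simp add: \<phi>_s2 \<phi>(4) s2_closed[OF B.vs_A] cl' b c' \<Theta> ma)
  also have "\<dots> = s2 S (\<lambda>k. u j' \<otimes> (inc (\<pi> ((g k' \<otimes> \<phi> b) \<otimes> g k)) \<otimes> (g k \<otimes> f)))"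
   by (subst uv) (simp_all add: cl' b ma \<Psi>_def)
  also have "\<dots> = \<phi> (c' k' j' \<otimes>[B] b)" by (subst gr) (simp_all add: cl' b ma \<phi>(4) c' \<phi>f)
  finally show "s2 B (\<lambda>k. s2 B (\<lambda>j. \<Theta> (\<Psi> b k' k) j' j \<otimes>[B] c' k j)) = c' k' j' \<otimes>[B] b"
   by (rule \<phi>_eqI[rotated 2]) (simp_all add: s2_closed[OF B.vs_A] cl' b) }
 have e: "z \<odot> (f \<oplus> f) = f"
  using vs_l_distr[OF vS f(1), of z z] vs_r_distr[OF vS f(1) f(1), of z] vs_one[OF vS f(1)] z
  unfolding mult_2_right by metis
 have "\<phi> (s2 B (\<lambda>k. s2 B (\<lambda>j. d k j \<otimes>[B] c' k j))) =
   s2 S (\<lambda>k. s2 S (\<lambda>j. (f \<otimes> g k) \<otimes> (v j \<otimes> (u j \<otimes> (g k \<otimes> f)))))"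
  by (simp add: \<phi>_s2 \<phi>(4) s2_closed[OF B.vs_A] cl' c' d ma)
 also have "\<dots> = s2 S (\<lambda>k. f \<otimes> ((g k \<otimes> g k) \<otimes> f))" by (subst uv) (simp_all add: cl' ma)
 also have "\<dots> = f \<oplus> f" by (simp add: g m1 f s2_def)
 finally show "z \<odot>[B] s2 B (\<lambda>k. s2 B (\<lambda>j. d k j \<otimes>[B] c' k j)) = \<one>[B]"
  using e by (intro \<phi>_eqI) (simp_all add: vs_smult[OF B.vs_A] s2_closed[OF B.vs_A] cl' \<phi>(3,5))
qed (simp_all add: cl' d_fix d'_fix unit unit')

text \<open>The two adjunctions give precomposition functors in opposite directions, and each
  reflects stages; so the same stages are exhaustive on both sides.\<close>

lemma KG_eq: assumes z: "z * 2 = (1::'k)" shows "(KG B :: 'i::wellorder option) = KG A"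
proof -
 interpret G: matrix_adjunction B A \<Psi> \<Theta> c' d d' z by (rule adjunction'[OF z])
 have "kg_stage B.FC (\<alpha>::'i) = Ob B.FC \<longleftrightarrow> kg_stage A.FC \<alpha> = Ob A.FC" for \<alpha>
  using F.mf.ce.kg_stage_full_reflect G.mf.ce.kg_stage_full_reflect by blast
 then show ?thesis unfolding KG_def kg_dimension_def by simp
qed

end

section \<open>Skew group algebras of involutions\<close>

lemma UNIV_bit: "(UNIV :: bit set) = {0, 1}"
 by (auto intro: bit.exhaust)

lemma Z2_simps [simp]: "carrier Z2_group = UNIV" "\<one>[Z2_group] = 0" "a \<otimes>[Z2_group] b = a + b"
 by (simp_all add: Z2_group_def)

lemma Z2_inv [simp]: "inv\<^bsub>Z2_group\<^esub> a = a"
proof -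
 have n: "- a = a" by (cases a) simp_all
 have b: "b = a" if "a + b = 0" for b using iffD1[OF add_eq_0_iff that] n by simp
 have a: "a + a = 0" using add.right_inverse[of a] unfolding n .
 show ?thesis unfolding m_inv_def Z2_simps by (rule the_equality) (simp add: a, erule conjE, rule b, blast)
qed

locale z2_action = fd_algebra A for A :: "('k::field, 'a) module" +
 fixes \<gamma> :: "bit => 'a => 'a"
 assumes \<gamma>0: "x \<in> carrier A ==> \<gamma> 0 x = x"
  and \<gamma>: "x \<in> carrier A ==> \<gamma> 1 x \<in> carrier A" "x \<in> carrier A ==> \<gamma> 1 (\<gamma> 1 x) = x"
   "x \<in> carrier A ==> y \<in> carrier A ==> \<gamma> 1 (x \<oplus>[A] y) = \<gamma> 1 x \<oplus>[A] \<gamma> 1 y"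
   "x \<in> carrier A ==> y \<in> carrier A ==> \<gamma> 1 (x \<otimes>[A] y) = \<gamma> 1 x \<otimes>[A] \<gamma> 1 y"
   "x \<in> carrier A ==> \<gamma> 1 (c \<odot>[A] x) = c \<odot>[A] \<gamma> 1 x"
begin

interpretation A: ring A by (rule ring_A)

abbreviation S :: "('k, bit => 'a) module" where "S \<equiv> skew_group_algebra A Z2_group \<gamma>"

text \<open>Coordinates of the element a tensor 1 plus b tensor g.\<close>

definition E :: "'a => 'a => bit => 'a" where "E a b = (\<lambda>c. if c = 0 then a else b)"

lemma E_simps [simp]: "E a b 0 = a" "E a b 1 = b" "E a b = E a' b' \<longleftrightarrow> a = a' \<and> b = b'"
 by (auto simp: E_def fun_eq_iff)

lemma E_cases: obtains a b where "x = E a b"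
proof
 show "x = E (x 0) (x 1)" unfolding E_def by (rule ext) (metis bit.exhaust)
qed

lemma S_simps [simp]:
 "E a b \<in> carrier S \<longleftrightarrow> a \<in> carrier A \<and> b \<in> carrier A"
 "\<one>[S] = E \<one>[A] \<zero>[A]" "\<zero>[S] = E \<zero>[A] \<zero>[A]"
 "E a b \<oplus>[S] E a' b' = E (a \<oplus>[A] a') (b \<oplus>[A] b')" "x \<odot>[S] E a b = E (x \<odot>[A] a) (x \<odot>[A] b)"
 "skew_tensor A Z2_group a 0 = E a \<zero>[A]"
 by (auto simp: skew_group_algebra_def skew_tensor_def E_def fun_eq_iff PiE_def extensional_def Pi_def)

lemma S_mult [simp]:
 assumes "a \<in> carrier A" "b \<in> carrier A" "a' \<in> carrier A" "b' \<in> carrier A"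
 shows "E a b \<otimes>[S] E a' b' = E (a \<otimes>[A] a' \<oplus>[A] b \<otimes>[A] \<gamma> 1 b') (a \<otimes>[A] b' \<oplus>[A] b \<otimes>[A] \<gamma> 1 a')"
proof
 fix c :: bit
 have "(E a b \<otimes>[S] E a' b') c = finsum A (\<lambda>i. E a b i \<otimes>[A] \<gamma> i (E a' b' (i + c))) {0, 1}"
  by (simp add: skew_group_algebra_def) (simp add: UNIV_bit)
 also have "\<dots> = a \<otimes>[A] \<gamma> 0 (E a' b' c) \<oplus>[A] b \<otimes>[A] \<gamma> 1 (E a' b' (1 + c))"
  using assms by (subst A.finsum_insert) (auto simp: E_def \<gamma>0 \<gamma>)
 also have "\<dots> = E (a \<otimes>[A] a' \<oplus>[A] b \<otimes>[A] \<gamma> 1 b') (a \<otimes>[A] b' \<oplus>[A] b \<otimes>[A] \<gamma> 1 a') c"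
  using assms by (cases c) (simp_all add: E_def \<gamma>0)
 finally show "(E a b \<otimes>[S] E a' b') c = \<dots>" .
qed

lemma carrier_S: "x \<in> carrier S ==> \<exists>a\<in>carrier A. \<exists>b\<in>carrier A. x = E a b"
 by (rule E_cases[of x]) simp

lemma \<gamma>_one: "\<gamma> 1 \<one>[A] = \<one>[A]"
proof -
 have "\<one>[A] = \<gamma> 1 (\<one>[A] \<otimes>[A] \<gamma> 1 \<one>[A])" by (simp add: \<gamma>)
 also have "\<dots> = \<gamma> 1 \<one>[A]" by (subst \<gamma>(4)) (simp_all add: \<gamma>)
 finally show ?thesis by simp
qed

lemma \<gamma>_zero: "\<gamma> 1 \<zero>[A] = \<zero>[A]"
 using \<gamma>(5)[OF zero_A, of 0] vs_zero_smult[OF vs_A zero_A] vs_zero_smult[OF vs_A \<gamma>(1)[OF zero_A]] by simp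

lemma A_smult: "a \<in> carrier A ==> b \<in> carrier A ==> (x \<odot>[A] a) \<otimes>[A] b = x \<odot>[A] (a \<otimes>[A] b)"
 "a \<in> carrier A ==> b \<in> carrier A ==> a \<otimes>[A] (x \<odot>[A] b) = x \<odot>[A] (a \<otimes>[A] b)"
 using alg unfolding K_algebra_def by simp_all

lemmas A_simps = \<gamma> \<gamma>_one \<gamma>_zero A_smult vs_smult[OF vs_A] vs_r_distr[OF vs_A] A.l_distr A.r_distr A.m_assoc

lemma vs_S: "vs S"
 by (rule vsI)
  (auto dest!: carrier_S simp: vs_smult[OF vs_A] vs_r_distr[OF vs_A] vs_l_distr[OF vs_A] vs_smult_assoc[OF vs_A] vs_one[OF vs_A]
   vs_zero_smult[OF vs_A] A.a_assoc intro: A.a_comm)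

lemma K_algebra_S: "K_algebra S"
 unfolding K_algebra_def
proof (intro conjI allI ballI vs_S)
 show "ring S"
 proof (rule ringI[OF vs_abelian_group[OF vs_S]])
  show "Group.monoid S" by (rule monoidI) (auto dest!: carrier_S simp: A_simps A.a_ac)
 qed (auto dest!: carrier_S simp: A_simps A.a_ac)
qed (auto dest!: carrier_S simp: A_simps)

text \<open>F1 is an idempotent below F0 whose translate complements F0. With g the generator, u_0 =
  v_0 = F0, u_1 = F1 g and v_1 = \<gamma>(F1) g satisfy v_0 u_0 + v_1 u_1 = F0 + \<gamma>(F1) =
  1.\<close>

lemma KG_corner:
 assumes B: "K_algebra B" and iso: "K_algebra_isomorphic B (corner_algebra S (E F0 \<zero>[A]))"
  and F: "F0 \<in> carrier A" "F1 \<in> carrier A" "F0 \<otimes>[A] F0 = F0" "F1 \<otimes>[A] F1 = F1"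
   "F0 \<otimes>[A] F1 = F1" "F1 \<otimes>[A] F0 = F1" "F0 \<oplus>[A] \<gamma> 1 F1 = \<one>[A]"
  and z: "z * 2 = (1 :: 'k)"
 shows "(KG B :: 'i::wellorder option) = KG A"
proof -
 let ?f = "E F0 \<zero>[A]" and ?g = "\<lambda>k. if k then E \<zero>[A] \<one>[A] else E \<one>[A] \<zero>[A]"
  and ?u = "\<lambda>k. if k then E \<zero>[A] F1 else E F0 \<zero>[A]" and ?v = "\<lambda>k. if k then E \<zero>[A] (\<gamma> 1 F1) else E F0 \<zero>[A]"
 have rS: "ring S" using K_algebra_S unfolding K_algebra_def by simp
 have sS: "(x \<odot>[S] s) \<otimes>[S] t = x \<odot>[S] (s \<otimes>[S] t)" "s \<otimes>[S] (x \<odot>[S] t) = x \<odot>[S] (s \<otimes>[S] t)"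
  if "s \<in> carrier S" "t \<in> carrier S" for s t x using K_algebra_S that unfolding K_algebra_def by simp_all
 obtain \<phi> where \<phi>: "\<phi> \<in> ring_iso B (corner_algebra S ?f)"
   and \<phi>s: "\<And>c x. x \<in> carrier B ==> \<phi> (c \<odot>[B] x) = c \<odot>[S] \<phi> x"
  using iso unfolding K_algebra_isomorphic_def corner_algebra_def by auto
 have ca: "a \<oplus>[corner_algebra S ?f] b = a \<oplus>[S] b" "a \<otimes>[corner_algebra S ?f] b = a \<otimes>[S] b" "\<one>[corner_algebra S ?f] = ?f"
  "carrier (corner_algebra S ?f) = {?f \<otimes>[S] x \<otimes>[S] ?f | x. x \<in> carrier S}" for a b
  by (simp_all add: corner_algebra_def)
 have f: "?f \<in> carrier S" using F by simp
 note mS = ring.ring_simprules(5)[OF rS]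
 have bij: "inj_on \<phi> (carrier B)" "\<phi> ` carrier B = {?f \<otimes>[S] x \<otimes>[S] ?f | x. x \<in> carrier S}"
  using ring_iso_memE(5)[OF \<phi>] unfolding bij_betw_def ca by auto
 have \<phi>S: "\<phi> b \<in> carrier S" if b: "b \<in> carrier B" for b
 proof -
  obtain x where "x \<in> carrier S" "\<phi> b = ?f \<otimes>[S] x \<otimes>[S] ?f" using imageI[OF b, of \<phi>] unfolding bij(2) by blast
  then show ?thesis using f mS by simp
 qed
 have \<phi>h: "\<phi> (a \<oplus>[B] b) = \<phi> a \<oplus>[S] \<phi> b" "\<phi> (a \<otimes>[B] b) = \<phi> a \<otimes>[S] \<phi> b" if "a \<in> carrier B" "b \<in> carrier B" for a b
  using ring_iso_memE(2,3)[OF \<phi> that] by (simp_all add: ca)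
 have vB: "vs B" and rB: "ring B" using B unfolding K_algebra_def by auto
 have fS: "?f \<otimes>[S] s \<otimes>[S] ?f \<in> \<phi> ` carrier B" if "s \<in> carrier S" for s using bij that by blast
 define \<psi> where "\<psi> s = inv_into (carrier B) \<phi> (?f \<otimes>[S] s \<otimes>[S] ?f)" for s
 have \<psi>: "\<psi> s \<in> carrier B" "\<phi> (\<psi> s) = ?f \<otimes>[S] s \<otimes>[S] ?f" if "s \<in> carrier S" for s
  using fS[OF that] unfolding \<psi>_def by (simp_all add: inv_into_into f_inv_into_f)
 have eq: "b = b'" if "b \<in> carrier B" "b' \<in> carrier B" "\<phi> b = \<phi> b'" for b b' using bij(1) that by (simp add: inj_on_eq_iff)
 have \<psi>a: "\<psi> (s \<oplus>[S] t) = \<psi> s \<oplus>[B] \<psi> t" if "s \<in> carrier S" "t \<in> carrier S" for s t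
  using that by (intro eq) (simp_all add: \<psi> vs_add[OF vB] vs_add[OF vs_S] \<phi>h ring.ring_simprules(13,23)[OF rS] F(1) mS)
 have \<psi>m: "\<psi> (x \<odot>[S] s) = x \<odot>[B] \<psi> s" if "s \<in> carrier S" for s x
  using that by (intro eq) (simp_all add: \<psi> vs_smult[OF vB] vs_smult[OF vs_S] \<phi>s sS F(1) mS)
 \<comment> \<open>Every element of the corner is the compression by \<open>?f\<close> of some a + b
   g, so two copies of A together map onto B.\<close>
 have "fd B"
 proof (rule fd_sum[OF vs_A fin vB, where f = "\<lambda>a. \<psi> (E a \<zero>[A])" and g = "\<lambda>a. \<psi> (E \<zero>[A] a)"])
  fix y assume y: "y \<in> carrier B"
  then obtain s where s: "s \<in> carrier S" "\<phi> y = ?f \<otimes>[S] s \<otimes>[S] ?f" using bij(2) by blast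
  then have "y = \<psi> s" by (intro eq) (simp_all add: \<psi> y)
  moreover obtain a b where "a \<in> carrier A" "b \<in> carrier A" "s = E a b" using carrier_S[OF s(1)] by blast
  ultimately show "\<exists>x\<in>carrier A. \<exists>x'\<in>carrier A. y = \<psi> (E x \<zero>[A]) \<oplus>[B] \<psi> (E \<zero>[A] x')"
   using \<psi>a[of "E a \<zero>[A]" "E \<zero>[A] b"] by auto
 qed (simp_all add: \<psi> \<psi>a[symmetric] \<psi>m[symmetric] vs_smult_zero[OF vs_A])
 then interpret B: fd_algebra B by unfold_locales (rule B)
 interpret corner_bridge A B S "\<lambda>a. E a \<zero>[A]" "\<lambda>s. s 0" \<phi> ?f ?g ?u ?v
 proof unfold_locales
  show "K_algebra S" by (rule K_algebra_S)
  show "\<phi> \<one>[B] = ?f" using ring_iso_memE(4)[OF \<phi>] by (simp add: ca)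
  show "s \<in> carrier S ==> ?f \<otimes>[S] s \<otimes>[S] ?f \<in> \<phi> ` carrier B" for s by (rule fS)
 qed (use F \<gamma>(4)[OF F(2,1)] \<gamma>(4)[OF F(2,2)] in \<open>auto dest!: carrier_S simp: A_simps vs_smult_zero[OF vs_A] s2_def \<phi>S \<phi>h \<phi>s bij(1)\<close>)
 show ?thesis by (rule KG_eq[OF z])
qed

end

section \<open>Path algebras and quotient algebras\<close>

locale ideal_quotient = ideal I A for I and A :: "('k::field, 'a) module" +
 assumes alg: "K_algebra A"
begin

abbreviation Q :: "('k, 'a set) module" where "Q \<equiv> quotient_algebra A I"
abbreviation q :: "'a => 'a set" where "q x \<equiv> I +>\<^bsub>A\<^esub> x"

lemma vA: "vs A"
 and smA: "x \<in> carrier A ==> y \<in> carrier A ==> (c \<odot>[A] x) \<otimes>[A] y = c \<odot>[A] (x \<otimes>[A] y)"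
  "x \<in> carrier A ==> y \<in> carrier A ==> x \<otimes>[A] (c \<odot>[A] y) = c \<odot>[A] (x \<otimes>[A] y)"
 using alg unfolding K_algebra_def by simp_all

lemma I_smult: assumes x: "x \<in> I" shows "c \<odot>[A] x \<in> I"
proof -
 have "c \<odot>[A] x = (c \<odot>[A] \<one>[A]) \<otimes>[A] x"
  using x a_subset by (simp add: smA subset_iff)
 then show ?thesis using I_l_closed[OF x] vs_smult[OF vA] by simp
qed

lemma q_eq: "x \<in> carrier A ==> y \<in> carrier A ==> q x = q y \<longleftrightarrow> x \<oplus>[A] (-1) \<odot>[A] y \<in> I"
 using quotient_eq_iff_same_a_r_cos[OF ideal_axioms] vs_minus[OF vA] by metis

lemma q_I: "x \<in> I ==> q x = q \<zero>[A]"
 using a_subset by (subst q_eq) (auto simp: vs_smult_zero[OF vA])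

lemma smult_q: assumes x: "x \<in> carrier A" shows "c \<odot>[Q] q x = q (c \<odot>[A] x)"
proof -
 have "q (c \<odot>[A] y) = q (c \<odot>[A] x)" if y: "y \<in> q x" for y
 proof -
  have yA: "y \<in> carrier A" using y x a_r_coset_subset_G[OF a_subset x] by blast
  have "q x = q y" by (rule a_repr_independence'[OF y x])
  then have "c \<odot>[A] (y \<oplus>[A] (-1) \<odot>[A] x) \<in> I" using q_eq[OF yA x] by (intro I_smult) simp
  then show ?thesis
   using x yA by (simp add: q_eq vs_smult[OF vA] vs_r_distr[OF vA] vs_smult_assoc[OF vA, symmetric])
 qed
 moreover have "x \<in> q x" by (rule a_rcos_self[OF x])
 ultimately have "(\<Union>y\<in>q x. q (c \<odot>[A] y)) = q (c \<odot>[A] x)" by blast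
 then show ?thesis by (simp add: quotient_algebra_def)
qed

lemma Q_simps:
 "carrier Q = q ` carrier A" "\<zero>[Q] = q \<zero>[A]" "\<one>[Q] = q \<one>[A]"
 "x \<in> carrier A ==> y \<in> carrier A ==> q x \<oplus>[Q] q y = q (x \<oplus>[A] y)"
 "x \<in> carrier A ==> y \<in> carrier A ==> q x \<otimes>[Q] q y = q (x \<otimes>[A] y)"
 using a_coset_join2[OF zero_closed is_additive_subgroup[THEN additive_subgroup.a_subgroup]] additive_subgroup.zero_closed[OF is_additive_subgroup]
 by (auto simp: quotient_algebra_def FactRing_def A_RCOSETS_def' a_rcos_sum rcoset_mult_add)

lemma vs_Q: "vs Q"
 by (rule vsI) (auto simp: Q_simps smult_q vs_smult[OF vA] vs_r_distr[OF vA] vs_l_distr[OF vA] vs_smult_assoc[OF vA]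
  vs_one[OF vA] vs_zero_smult[OF vA] a_ac)

lemma K_algebra_Q: "K_algebra Q"
 unfolding K_algebra_def
proof (intro conjI allI ballI vs_Q)
 show "ring Q"
 proof (rule ringI[OF vs_abelian_group[OF vs_Q]])
  show "Group.monoid Q" by (rule monoidI) (auto simp: Q_simps m_assoc)
 qed (auto simp: Q_simps l_distr r_distr)
qed (auto simp: Q_simps smult_q vs_smult[OF vA] smA)

text \<open>Generators inside the ideal vanish in the quotient; those that remain belong to the
  finite set \<open>L\<close>, which later consists of the short paths.\<close>

lemma fd_Q:
 assumes L: "finite L" "L \<subseteq> carrier A" and G: "G \<subseteq> L \<union> I" "\<And>x. x \<in> carrier A ==> x \<in> sp A G"
 shows "fd Q"
proof -
 have GA: "G \<subseteq> carrier A" using L G a_subset by blast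
 have "q x \<in> sp Q (q ` L)" if "x \<in> sp A G" for x
  using that
 proof induction
  case zero
  then show ?case using sp.zero[of Q "q ` L"] by (simp add: Q_simps)
 next
  case (step g v c)
  have g: "g \<in> carrier A" and v: "v \<in> carrier A" using step.hyps GA sp_closed[OF vA GA] by auto
  have e: "q (c \<odot>[A] g \<oplus>[A] v) = c \<odot>[Q] q g \<oplus>[Q] q v" using g v by (simp add: Q_simps smult_q vs_smult[OF vA])
  show ?case
  proof (cases "g \<in> L")
   case True
   then show ?thesis unfolding e using step by (intro sp.step) auto
  next
   case False
   then have "g \<in> I" using step.hyps G(1) by blast
   then have "q g = \<zero>[Q]" unfolding Q_simps(2) by (rule q_I)
   then show ?thesis unfolding e using step.IH vs_smult_zero[OF vs_Q] vs_l_zero[OF vs_Q, of "q v"] v by (simp add: Q_simps)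
  qed
 qed
 then show ?thesis using L G(2) by (intro fdI[OF vs_Q, of "q ` L"]) (auto simp: Q_simps)
qed

end

section \<open>Path algebras of finite quivers\<close>

context fin_digraph begin

abbreviation PA :: "('k::field, 'a \<times> 'b list => 'k) module" where "PA \<equiv> path_algebra G"

lemma PA_simps [simp]:
 "\<zero>[PA] = (\<lambda>p. 0)" "x \<oplus>[PA] y = (\<lambda>p. x p + y p)" "c \<odot>[PA] x = (\<lambda>p. c * x p)"
 by (simp_all add: path_algebra_def)

lemma PA_carrier: "x \<in> carrier PA \<longleftrightarrow> finite {p. x p \<noteq> 0} \<and> {p. x p \<noteq> 0} \<subseteq> quiver_paths G"
 by (simp add: path_algebra_def)

lemma PA_mult: "(x \<otimes>[PA] y) (u, p) = (\<Sum>i\<le>length p. x (u, take i p) * y (awlast u (take i p), drop i p))"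
 by (simp add: path_algebra_def)

lemma paths_iff: "(u, p) \<in> quiver_paths G \<longleftrightarrow> awalk u p (awlast u p)"
 by (auto simp: quiver_paths_def)

text \<open>The sum of the trivial paths at the vertices in X. The unit, the vertex idempotents and
  the corner idempotents all arise from it, with intersections for products and disjoint unions for
  sums.\<close>

definition idem :: "'a set => 'a \<times> 'b list => 'k::field" where
 "idem X = (\<lambda>(u, p). if u \<in> X \<and> p = [] then 1 else 0)"

lemma PA_one: "\<one>[PA] = idem (verts G)"
 by (simp add: path_algebra_def idem_def)

lemma idem_closed: assumes "X \<subseteq> verts G" shows "idem X \<in> carrier PA"
proof -
 have "{p. idem X p \<noteq> (0::'c)} = X \<times> {[]}" by (auto simp: idem_def split: if_splits)
 then show ?thesis using assms finite_subset[OF assms] by (auto simp: PA_carrier paths_iff awalk_Nil_iff)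
qed

lemma idem_Un: "X \<inter> Y = {} ==> (\<lambda>p. idem X p + idem Y p) = idem (X \<union> Y)"
 by (auto simp: idem_def fun_eq_iff)

lemma idem_single: "path_elem (e, []) = idem {e}"
 by (auto simp: idem_def path_elem_def fun_eq_iff)

lemma idem_mult: "idem X \<otimes>[PA] idem Y = idem (X \<inter> Y)"
proof
 fix r :: "'a \<times> 'b list"
 obtain u p where r: "r = (u, p)" by (cases r)
 show "(idem X \<otimes>[PA] idem Y) r = idem (X \<inter> Y) r"
  unfolding r PA_mult by (cases "p = []") (auto simp: idem_def intro!: sum.neutral)
qed

lemma PA_mult_closed: assumes x: "x \<in> carrier PA" and y: "y \<in> carrier PA" shows "x \<otimes>[PA] y \<in> carrier PA"
proof -
 have *: "\<exists>i. x (u, take i p) \<noteq> 0 \<and> y (awlast u (take i p), drop i p) \<noteq> 0" if "(x \<otimes>[PA] y) (u, p) \<noteq> 0" for u p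
  using that unfolding PA_mult by (rule sum.not_neutral_contains_not_neutral) auto
 have "{p. (x \<otimes>[PA] y) p \<noteq> 0} \<subseteq> (\<lambda>((u, p), (w, q)). (u, p @ q)) ` ({p. x p \<noteq> 0} \<times> {p. y p \<noteq> 0})"
 proof
  fix r assume r: "r \<in> {p. (x \<otimes>[PA] y) p \<noteq> 0}"
  obtain u p where [simp]: "r = (u, p)" by (cases r)
  obtain i where i: "x (u, take i p) \<noteq> 0" "y (awlast u (take i p), drop i p) \<noteq> 0" using * r by auto
  then show "r \<in> (\<lambda>((u, p), (w, q)). (u, p @ q)) ` ({p. x p \<noteq> 0} \<times> {p. y p \<noteq> 0})"
   by (intro image_eqI[of _ _ "((u, take i p), (awlast u (take i p), drop i p))"]) auto
 qed
 then have "finite {p. (x \<otimes>[PA] y) p \<noteq> 0}" using x y by (auto simp: PA_carrier intro: finite_subset)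
 moreover have "(u, p) \<in> quiver_paths G" if nz: "(x \<otimes>[PA] y) (u, p) \<noteq> 0" for u p
 proof -
  obtain i where "x (u, take i p) \<noteq> 0" "y (awlast u (take i p), drop i p) \<noteq> 0" using *[OF nz] by blast
  then have "(u, take i p) \<in> quiver_paths G" "(awlast u (take i p), drop i p) \<in> quiver_paths G"
   using x y by (auto simp: PA_carrier)
  then have "awalk u (take i p @ drop i p) (awlast (awlast u (take i p)) (drop i p))"
   unfolding paths_iff awalk_append_iff by simp
  then show ?thesis unfolding quiver_paths_def by auto
 qed
 ultimately show ?thesis by (auto simp: PA_carrier)
qed

text \<open>Both sides sum over all ways to cut a path into three pieces, indexed on the left by the
  two cut points and on the right by the lengths of the first two pieces.\<close>

lemma PA_assoc: "(x \<otimes>[PA] y) \<otimes>[PA] z = x \<otimes>[PA] (y \<otimes>[PA] z)" for x y z :: "'a \<times> 'b list => 'k::field"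
proof
 fix r :: "'a \<times> 'b list"
 obtain u p where r: "r = (u, p)" by (cases r)
 let ?n = "length p"
 define w where "w i = awlast u (take i p)" for i
 define g where "g a b = x (u, take a p) * y (w a, take b (drop a p)) * z (w (a + b), drop (a + b) p)" for a b
 have w: "awlast (w a) (take b (drop a p)) = w (a + b)" for a b
  unfolding w_def take_add by (simp add: awalk_verts_conv)
 have "((x \<otimes>[PA] y) \<otimes>[PA] z) r = (\<Sum>i\<le>?n. \<Sum>j\<le>i. g j (i - j))"
  unfolding r PA_mult g_def w_def[symmetric] sum_distrib_right
  by (intro sum.cong) (auto simp: min_def drop_take w_def)
 also have "\<dots> = (\<Sum>(i, j)\<in>{(i, j). i + j \<le> ?n}. g i j)" by (rule sum.triangle_reindex_eq[symmetric])
 also have "{(i, j). i + j \<le> ?n} = (SIGMA i:{..?n}. {..?n - i})" by auto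
 also have "(\<Sum>(i, j)\<in>\<dots>. g i j) = (\<Sum>i\<le>?n. \<Sum>j\<le>?n - i. g i j)" by (rule sum.Sigma[symmetric]) auto
 also have "\<dots> = (x \<otimes>[PA] (y \<otimes>[PA] z)) r"
  unfolding r PA_mult g_def sum_distrib_left w_def[symmetric]
  by (intro sum.cong) (auto simp: w mult.assoc add.commute)
 finally show "((x \<otimes>[PA] y) \<otimes>[PA] z) r = (x \<otimes>[PA] (y \<otimes>[PA] z)) r" .
qed

lemma PA_one_mult:
 assumes x: "x \<in> carrier PA"
 shows "\<one>[PA] \<otimes>[PA] x = x" "x \<otimes>[PA] \<one>[PA] = x"
proof -
 have v: "u \<in> verts G \<and> awlast u p \<in> verts G" if "x (u, p) \<noteq> 0" for u p
  using x that unfolding PA_carrier by (auto simp: quiver_paths_def)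
 have "(\<one>[PA] \<otimes>[PA] x) (u, p) = x (u, p)" for u p
 proof -
  have "(\<one>[PA] \<otimes>[PA] x) (u, p) = (\<Sum>i\<le>length p. if i = 0 then x (u, p) else 0)"
   unfolding PA_mult PA_one by (intro sum.cong) (use v in \<open>auto simp: idem_def\<close>)
  then show ?thesis by simp
 qed
 then show "\<one>[PA] \<otimes>[PA] x = x" by auto
 have "(x \<otimes>[PA] \<one>[PA]) (u, p) = x (u, p)" for u p
 proof -
  have "(x \<otimes>[PA] \<one>[PA]) (u, p) = (\<Sum>i\<le>length p. if i = length p then x (u, p) else 0)"
   unfolding PA_mult PA_one by (intro sum.cong) (use v in \<open>auto simp: idem_def\<close>)
  then show ?thesis by simp
 qed
 then show "x \<otimes>[PA] \<one>[PA] = x" by auto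
qed

lemma vs_PA: "vs PA"
proof (rule vsI)
 fix x y :: "'a \<times> 'b list => 'c" assume x: "x \<in> carrier PA" and y: "y \<in> carrier PA"
 have "{p. (x \<oplus>[PA] y) p \<noteq> 0} \<subseteq> {p. x p \<noteq> 0} \<union> {p. y p \<noteq> 0}" by auto
 then show "x \<oplus>[PA] y \<in> carrier PA" using x y finite_subset unfolding PA_carrier by blast
next
 fix x :: "'a \<times> 'b list => 'c" and c assume x: "x \<in> carrier PA"
 have "{p. (c \<odot>[PA] x) p \<noteq> 0} \<subseteq> {p. x p \<noteq> 0}" by auto
 then show "c \<odot>[PA] x \<in> carrier PA" using x finite_subset unfolding PA_carrier by blast
qed (auto simp: PA_carrier algebra_simps)

lemma K_algebra_PA: "K_algebra PA"
 unfolding K_algebra_def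
proof (intro conjI allI ballI vs_PA)
 show "ring PA"
 proof (rule ringI[OF vs_abelian_group[OF vs_PA]])
  show "Group.monoid PA"
   by (rule monoidI) (simp_all add: PA_mult_closed PA_assoc PA_one_mult idem_closed PA_one[symmetric], simp add: PA_one idem_closed)
 qed (auto simp: fun_eq_iff PA_mult algebra_simps sum.distrib)
qed (auto simp: fun_eq_iff PA_mult sum_distrib_left algebra_simps)

lemma path_elem_closed: "p \<in> quiver_paths G ==> path_elem p \<in> carrier PA"
 by (auto simp: PA_carrier path_elem_def)

lemma path_elem_mult: "path_elem (u, p) \<otimes>[PA] path_elem (w, q) = (if awlast u p = w then path_elem (u, p @ q) else \<zero>[PA])"
proof
 fix r :: "'a \<times> 'b list"
 obtain u' s where r: "r = (u', s)" by (cases r)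
 have "(path_elem (u, p) \<otimes>[PA] path_elem (w, q)) r =
   (\<Sum>i\<le>length s. if i = length p then (if u' = u \<and> s = p @ q \<and> awlast u p = w then 1 else 0) else 0)"
  unfolding r PA_mult
 proof (intro sum.cong refl)
  fix i assume i: "i \<in> {..length s}"
  show "path_elem (u, p) (u', take i s) * path_elem (w, q) (awlast u' (take i s), drop i s) =
    (if i = length p then (if u' = u \<and> s = p @ q \<and> awlast u p = w then 1 else 0) else 0)"
  proof (cases "take i s = p")
   case True
   then have "i = length p" "s = p @ drop i s" using i by auto
   then show ?thesis using True by (simp add: path_elem_def) (metis append_take_drop_id same_append_eq)
  next
   case False
   then show ?thesis by (auto simp: path_elem_def)
  qed
 qed
 also have "\<dots> = (if awlast u p = w then path_elem (u, p @ q) else \<zero>[PA]) r"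
  unfolding r by (auto simp: path_elem_def)
 finally show "(path_elem (u, p) \<otimes>[PA] path_elem (w, q)) r = \<dots>" .
qed

lemma PA_span: assumes x: "x \<in> carrier PA" shows "x \<in> sp PA (path_elem ` quiver_paths G)"
proof -
 have "{p. x p \<noteq> 0} \<subseteq> F ==> F \<subseteq> quiver_paths G ==> x \<in> sp PA (path_elem ` quiver_paths G)" if "finite F" for F
  using that
 proof (induction F arbitrary: x)
  case empty
  then have "x = \<zero>[PA]" by auto
  then show ?case using sp.zero by metis
 next
  case (insert p F)
  have "x(p := 0) \<in> sp PA (path_elem ` quiver_paths G)" using insert.prems by (intro insert.IH) auto
  then have "x p \<odot>[PA] path_elem p \<oplus>[PA] x(p := 0) \<in> sp PA (path_elem ` quiver_paths G)"
   using insert.prems by (intro sp.step) auto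
  moreover have "x p \<odot>[PA] path_elem p \<oplus>[PA] x(p := 0) = x" by (auto simp: path_elem_def)
  ultimately show ?case by metis
 qed
 then show ?thesis using x unfolding PA_carrier by blast
qed

end

section \<open>Brauer graph algebras\<close>

text \<open>The first n arrows along \<sigma> from h. Since n is arbitrary, powers of a cycle can be
  prolonged, or cut before their last arrow.\<close>

primrec orb :: "('h => 'h) => nat => 'h => 'h list" where
 "orb \<sigma> 0 h = []"
| "orb \<sigma> (Suc n) h = h # orb \<sigma> n (\<sigma> h)"

lemma orb_map: "map (\<lambda>i. (\<sigma> ^^ i) h) [0..<n] = orb \<sigma> n h"
proof (induction n arbitrary: h)
 case (Suc n)
 have "map (\<lambda>i. (\<sigma> ^^ i) h) [0..<Suc n] = h # map (\<lambda>i. (\<sigma> ^^ i) (\<sigma> h)) [0..<n]"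
  by (simp add: map_upt_Suc funpow_swap1 del: upt_Suc)
 then show ?case using Suc by simp
qed simp

lemma orb_add: "orb \<sigma> (a + b) h = orb \<sigma> a h @ orb \<sigma> b ((\<sigma> ^^ a) h)"
 by (induction a arbitrary: h) (simp_all add: funpow_swap1)

lemma concat_orb: "(\<sigma> ^^ l) h = h ==> concat (replicate m (orb \<sigma> l h)) = orb \<sigma> (m * l) h"
 by (induction m) (simp_all add: orb_add)

lemma length_orb [simp]: "length (orb \<sigma> n h) = n"
 by (induction n arbitrary: h) simp_all

locale brauer =
 fixes \<Gamma> :: "'h skew_brauer_graph"
 assumes \<Gamma>: "is_skew_brauer_graph \<Gamma>"
begin

abbreviation H where "H \<equiv> half_edges \<Gamma>"
abbreviation \<iota> where "\<iota> \<equiv> iota \<Gamma>"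
abbreviation \<sigma> where "\<sigma> \<equiv> sigma \<Gamma>"
abbreviation edge where "edge \<equiv> edge_of \<Gamma>"
abbreviation L where "L h \<equiv> mlt \<Gamma> h * card (Orbits.orbit \<sigma> h)"

lemma H: "finite H" "\<iota> permutes H" "\<sigma> permutes H" "h \<in> H ==> \<iota> (\<iota> h) = h" "h \<in> H ==> mlt \<Gamma> h > 0"
 using \<Gamma> unfolding is_skew_brauer_graph_def by auto

lemma in_H [simp]: "\<iota> h \<in> H \<longleftrightarrow> h \<in> H" "\<sigma> h \<in> H \<longleftrightarrow> h \<in> H"
 using permutes_in_image[OF H(2)] permutes_in_image[OF H(3)] by auto

lemma edge_iota: "h \<in> H ==> edge (\<iota> h) = edge h"
 by (auto simp: edge_of_def H(4))

lemma edge_eqD: "edge h = edge h' ==> h = h' \<or> h = \<iota> h'"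
 unfolding edge_of_def by (metis insertE insertI1 singletonD)

lemma quiver_simps [simp]:
 "verts (brauer_quiver \<Gamma>) = edge ` H" "arcs (brauer_quiver \<Gamma>) = H"
 "tail (brauer_quiver \<Gamma>) = edge" "head (brauer_quiver \<Gamma>) h = edge (\<sigma> h)"
 by (simp_all add: brauer_quiver_def)

sublocale Q: fin_digraph "brauer_quiver \<Gamma>"
 by unfold_locales (simp_all add: H(1))

lemma funpow_card: "(\<sigma> ^^ card (Orbits.orbit \<sigma> h)) h = h" "card (Orbits.orbit \<sigma> h) > 0"
proof -
 have h: "h \<in> Orbits.orbit \<sigma> h" by (rule permutation_self_in_orbit[OF permutes_imp_permutation[OF H(1,3)]])
 have "card (Orbits.orbit \<sigma> h) = funpow_dist1 \<sigma> h h"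
  by (subst orbit_conv_funpow_dist1[OF h]) (simp add: card_image[OF inj_on_funpow_dist1[OF h]])
 then show "(\<sigma> ^^ card (Orbits.orbit \<sigma> h)) h = h" "card (Orbits.orbit \<sigma> h) > 0"
  using funpow_dist1_prop[OF h] by simp_all
qed

lemma funpow_L: "(\<sigma> ^^ L h) h = h"
proof -
 have "(\<sigma> ^^ (n * card (Orbits.orbit \<sigma> h))) h = h" for n
  by (induction n) (simp_all add: funpow_add funpow_card)
 then show ?thesis .
qed

lemma cycle_power: "cycle_power \<Gamma> h = (edge h, orb \<sigma> (L h) h)"
 by (simp add: cycle_power_def orb_map concat_orb[OF funpow_card(1)])

lemma awalk_orb: "h \<in> H ==> Q.awalk (edge h) (orb \<sigma> n h) (edge ((\<sigma> ^^ n) h))"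
proof (induction n arbitrary: h)
 case (Suc n)
 then show ?case using Suc.IH[of "\<sigma> h"] by (simp add: Q.awalk_Cons_iff funpow_swap1)
qed (simp add: Q.awalk_Nil_iff)

abbreviation I :: "('h set \<times> 'h list => 'k::field) set" where "I \<equiv> brauer_ideal \<Gamma>"

lemma relations_closed: "(brauer_relations \<Gamma> :: ('h set \<times> 'h list => 'k::field) set) \<subseteq> carrier Q.PA"
proof -
 have 1: "(path_elem (cycle_power \<Gamma> h) :: _ => 'k) \<in> carrier Q.PA" if "h \<in> H" for h
  using awalk_orb[OF that] by (intro Q.path_elem_closed) (auto simp: cycle_power quiver_paths_def)
 have "(\<lambda>p. path_elem (cycle_power \<Gamma> h) p - path_elem (cycle_power \<Gamma> (\<iota> h)) p :: 'k) \<in> carrier Q.PA" if "h \<in> H" for h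
  using vs_add[OF Q.vs_PA 1[OF that] vs_smult[OF Q.vs_PA 1[of "\<iota> h"], of "-1"]] that by simp
 moreover have "(path_elem (edge h, [h, \<iota> (\<sigma> h)]) :: _ => 'k) \<in> carrier Q.PA" if "h \<in> H" for h
  using that by (intro Q.path_elem_closed) (simp add: Q.paths_iff Q.awalk_Cons_iff Q.awalk_Nil_iff edge_iota)
 ultimately show ?thesis unfolding brauer_relations_def by auto
qed

lemma ring_PA: "ring (Q.PA :: ('k::field, _) module)"
 using Q.K_algebra_PA unfolding K_algebra_def by blast

lemma ideal_quotient: "ideal_quotient (I :: (_ => 'k::field) set) Q.PA"
 unfolding ideal_quotient_def ideal_quotient_axioms_def brauer_ideal_def
 using ring.genideal_ideal[OF ring_PA relations_closed] Q.K_algebra_PA by blast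

lemma rel_in_I: "r \<in> brauer_relations \<Gamma> ==> r \<in> I"
 using ring.genideal_self[OF ring_PA relations_closed] unfolding brauer_ideal_def by blast

lemma path_in_I:
 assumes "Q.awalk u (p @ [h, \<iota> (\<sigma> h)] @ q) v"
 shows "path_elem (u, p @ [h, \<iota> (\<sigma> h)] @ q) \<in> (I :: (_ => 'k::field) set)"
proof -
 interpret iq: ideal_quotient "I :: (_ => 'k) set" Q.PA by (rule ideal_quotient)
 let ?r = "[h, \<iota> (\<sigma> h)]" and ?w = "edge (\<sigma> (\<iota> (\<sigma> h)))"
 have p: "Q.awalk u p (edge h)" and h: "h \<in> H" and q: "Q.awalk ?w q v" and e: "Q.awlast u p = edge h"
  using assms by (auto simp: Q.awalk_Cons_iff)
 have pq: "(path_elem (u, p) :: _ => 'k) \<in> carrier Q.PA" "(path_elem (?w, q) :: _ => 'k) \<in> carrier Q.PA"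
  using p q by (auto intro!: Q.path_elem_closed simp: quiver_paths_def)
 have "(path_elem (edge h, ?r) :: _ => 'k) \<in> I" using h by (intro rel_in_I) (auto simp: brauer_relations_def)
 moreover have "Q.awlast u (p @ ?r) = ?w" by (simp add: Q.awalk_verts_conv)
 ultimately show ?thesis using iq.I_r_closed[OF iq.I_l_closed[OF _ pq(1)] pq(2), of "path_elem (edge h, ?r)"]
  by (simp add: Q.path_elem_mult e)
qed

text \<open>The only arrows that start where \<open>e\<close> ends are \<open>\<sigma> e\<close> and
  \<open>\<iota> (\<sigma> e)\<close>, and the second forms a zero relation with \<open>e\<close>. A
  path without such a pair follows one \<sigma>-orbit.\<close>

lemma path_cases:
 assumes "Q.awalk u p v"
 obtains p1 h p2 where "p = p1 @ [h, \<iota> (\<sigma> h)] @ p2" | h where "p = orb \<sigma> (length p) h" "p \<noteq> [] --> h \<in> H \<and> u = edge h"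
proof -
 have "(\<exists>p1 h p2. p = p1 @ [h, \<iota> (\<sigma> h)] @ p2) \<or> (p \<noteq> [] --> p = orb \<sigma> (length p) (hd p) \<and> hd p \<in> H \<and> u = edge (hd p))"
  using assms
 proof (induction p arbitrary: u)
  case (Cons e p)
  then have e: "e \<in> H" "u = edge e" "Q.awalk (edge (\<sigma> e)) p v" by (auto simp: Q.awalk_Cons_iff)
  from Cons.IH[OF e(3)] show ?case
  proof
   assume "\<exists>p1 h p2. p = p1 @ [h, \<iota> (\<sigma> h)] @ p2"
   then show ?thesis by (metis append_Cons)
  next
   assume IH: "p \<noteq> [] --> p = orb \<sigma> (length p) (hd p) \<and> hd p \<in> H \<and> edge (\<sigma> e) = edge (hd p)"
   show ?thesis
   proof (cases p)
    case (Cons e' p')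
    then consider "e' = \<sigma> e" | "e' = \<iota> (\<sigma> e)" using IH edge_eqD[of e' "\<sigma> e"] by auto
    then show ?thesis
    proof cases
     case 1
     then have "p = orb \<sigma> (length p) (\<sigma> e)" using IH Cons by simp
     then show ?thesis using e by simp
    next
     case 2
     then have "e # p = [] @ [e, \<iota> (\<sigma> e)] @ p'" using Cons by simp
     then show ?thesis by blast
    qed
   qed (use e in simp)
  qed
 qed simp
 then show thesis by (elim disjE exE) (rule that(1), assumption, cases "p = []", auto intro: that(2))
qed

text \<open>Modulo the ideal, \<open>C\<^sub>h\<^sup>m\<close> followed by \<open>\<alpha>\<^sub>h\<close> is the power of \<open>C\<close> at \<open>\<iota>h\<close> followed by \<open>\<alpha>\<^sub>h\<close>, which contains a zero
 relation.\<close>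

lemma long_path_in_I:
 assumes h: "h \<in> H" and n: "n > L h"
 shows "path_elem (edge h, orb \<sigma> n h) \<in> (I :: (_ => 'k::field) set)"
proof -
 interpret iq: ideal_quotient "I :: (_ => 'k) set" Q.PA by (rule ideal_quotient)
 let ?r = "orb \<sigma> (n - L h) h" and ?x = "path_elem (cycle_power \<Gamma> h) :: _ => 'k" and ?y = "path_elem (cycle_power \<Gamma> (\<iota> h)) :: _ => 'k"
 have \<iota>h: "\<iota> h \<in> H" using h by simp
 have last: "Q.awlast (edge h') (orb \<sigma> (L h') h') = edge h'" if "h' \<in> H" for h'
  using awalk_orb[OF that, of "L h'"] funpow_L[of h'] by auto
 have r: "(path_elem (edge h, ?r) :: _ => 'k) \<in> carrier Q.PA"
  using awalk_orb[OF h] by (intro Q.path_elem_closed) (auto simp: quiver_paths_def)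
 have "(\<lambda>p. ?x p - ?y p) \<in> I" using h by (intro rel_in_I) (auto simp: brauer_relations_def)
 from iq.I_r_closed[OF this r] have A: "(\<lambda>p. (?x \<otimes>[Q.PA] path_elem (edge h, ?r)) p - (?y \<otimes>[Q.PA] path_elem (edge h, ?r)) p) \<in> I"
  by (rule back_subst[of "\<lambda>x. x \<in> I"]) (auto simp: fun_eq_iff Q.PA_mult algebra_simps sum_subtractf)
 have X: "?x \<otimes>[Q.PA] path_elem (edge h, ?r) = path_elem (edge h, orb \<sigma> n h)"
  using orb_add[of \<sigma> "L h" "n - L h" h] n by (simp add: cycle_power Q.path_elem_mult last[OF h] funpow_L)
 have B: "?y \<otimes>[Q.PA] path_elem (edge h, ?r) \<in> I"
 proof -
  obtain k where k: "L (\<iota> h) = Suc k" using H(5)[OF \<iota>h] funpow_card(2) gr0_implies_Suc by (metis nat_0_less_mult_iff)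
  \<comment> \<open>The last arrow of the cycle power at \<open>\<iota> h\<close>. As
    \<open>\<sigma> e\<close> is \<open>\<iota> h\<close>, the arrow \<open>h\<close> is the one
    that may not follow it.\<close>
  define e where "e = (\<sigma> ^^ k) (\<iota> h)"
  have "\<iota> (\<sigma> e) = h" using funpow_L[of "\<iota> h"] unfolding k e_def by (simp add: H(4)[OF h])
  moreover obtain r' where "?r = h # r'" using n by (cases "n - L h") auto
  ultimately have y: "orb \<sigma> (L (\<iota> h)) (\<iota> h) @ ?r = orb \<sigma> k (\<iota> h) @ [e, \<iota> (\<sigma> e)] @ r'"
   using orb_add[of \<sigma> k 1 "\<iota> h"] unfolding k e_def by simp
  have "Q.awalk (edge (\<iota> h)) (orb \<sigma> (L (\<iota> h)) (\<iota> h) @ ?r) (edge ((\<sigma> ^^ (n - L h)) h))"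
   using awalk_orb[OF \<iota>h, of "L (\<iota> h)"] awalk_orb[OF h] last[OF \<iota>h] funpow_L[of "\<iota> h"] by (simp add: edge_iota[OF h])
  then have "path_elem (edge (\<iota> h), orb \<sigma> k (\<iota> h) @ [e, \<iota> (\<sigma> e)] @ r') \<in> (I :: (_ => 'k) set)" unfolding y by (rule path_in_I)
  then show ?thesis unfolding y[symmetric] cycle_power Q.path_elem_mult last[OF \<iota>h] by (simp add: edge_iota[OF h])
 qed
 show ?thesis using additive_subgroup.a_closed[OF iq.is_additive_subgroup A B] unfolding X by simp
qed

text \<open>Every path longer than \<open>N\<close> vanishes in the quotient: it contains a zero
  relation or follows one orbit beyond the length of its cycle power. The finitely many paths of
  length at most \<open>N\<close> therefore span.\<close>

lemma fd_algebra: "fd_algebra (brauer_graph_algebra \<Gamma> :: ('k::field, _) module)"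
proof
 interpret iq: ideal_quotient "I :: (_ => 'k) set" Q.PA by (rule ideal_quotient)
 show "K_algebra (brauer_graph_algebra \<Gamma> :: ('k, _) module)" unfolding brauer_graph_algebra_def by (rule iq.K_algebra_Q)
 \<comment> \<open>The sum serves as a common upper bound for the lengths of all cycle
   powers.\<close>
 define N where "N = (\<Sum>h\<in>H. L h)"
 let ?P = "quiver_paths (brauer_quiver \<Gamma>) \<inter> {p. length (snd p) \<le> N}"
 have "?P \<subseteq> edge ` H \<times> {p. set p \<subseteq> H \<and> length p \<le> N}" by (auto simp: quiver_paths_def Q.awalk_def)
 then have fin: "finite ?P"
  by (rule finite_subset) (rule finite_cartesian_product[OF finite_imageI[OF H(1)] finite_lists_length_le[OF H(1)]])
 have short: "(path_elem p :: _ => 'k) \<in> path_elem ` ?P \<union> I" if p: "p \<in> quiver_paths (brauer_quiver \<Gamma>)" for p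
 proof (cases "length (snd p) \<le> N")
  case False
  obtain u l v where [simp]: "p = (u, l)" and w: "Q.awalk u l v" using p unfolding quiver_paths_def by auto
  from w show ?thesis
  proof (cases rule: path_cases)
   case (1 p1 h p2)
   then show ?thesis using path_in_I[of u p1 h p2 v, where ?'k = 'k] w by simp
  next
   case (2 h)
   then have h: "h \<in> H" "u = edge h" using False by auto
   have "L h \<le> N" unfolding N_def by (rule member_le_sum) (use h H(1) in auto)
   then have "(path_elem (edge h, orb \<sigma> (length l) h) :: _ => 'k) \<in> I" using False by (intro long_path_in_I h) simp
   then show ?thesis using 2(1) h(2) by simp
  qed
 qed (use p in auto)
 show "fd (brauer_graph_algebra \<Gamma> :: ('k, _) module)" unfolding brauer_graph_algebra_def
 proof (rule iq.fd_Q)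
  show "finite (path_elem ` ?P :: (_ => 'k) set)" using fin by blast
  show "(path_elem ` ?P :: (_ => 'k) set) \<subseteq> carrier Q.PA" using Q.path_elem_closed by blast
  show "(path_elem ` quiver_paths (brauer_quiver \<Gamma>) :: (_ => 'k) set) \<subseteq> path_elem ` ?P \<union> I" using short by blast
 qed (rule Q.PA_span)
qed

end

section \<open>The involution on the associated Brauer graph algebra\<close>

locale shifted_brauer =
 fixes \<Gamma>\<^sub>0 :: "'h skew_brauer_graph" and d :: "'h => bit"
 assumes \<Gamma>\<^sub>0: "is_skew_brauer_graph \<Gamma>\<^sub>0"
begin

abbreviation \<Gamma> where "\<Gamma> \<equiv> associated_brauer_graph \<Gamma>\<^sub>0 d"

sublocale brauer \<Gamma>
 using is_brauer_graph_associated[OF \<Gamma>\<^sub>0] unfolding is_brauer_graph_def by unfold_locales blast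

lemma half_edges [simp]: "(h, i) \<in> H \<longleftrightarrow> h \<in> half_edges \<Gamma>\<^sub>0"
 by (simp add: associated_brauer_graph_def)

context fixes a :: bit
begin

abbreviation s where "s \<equiv> shift_half_edge a"
abbreviation \<tau> where "\<tau> \<equiv> shift_elem a"

text \<open>The permutations of the associated graph change the second component by an amount that
  depends only on the first, so they commute with the shift.\<close>

lemma s_simps: "s h \<in> H \<longleftrightarrow> h \<in> H" "\<iota> (s h) = s (\<iota> h)" "\<sigma> (s h) = s (\<sigma> h)" "mlt \<Gamma> (s h) = mlt \<Gamma> h"
proof -
 obtain k i where h: "h = (k, i)" by (cases h)
 have c: "i + a + b = i + b + a" for b by (simp only: add.assoc add.commute[of a b])
 have s: "s (k, i) = (k, i + a)" for k i by (simp add: shift_half_edge_def)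
 have \<iota>: "\<iota> (k, i) = (if k \<in> half_edges \<Gamma>\<^sub>0 then if k \<in> H_cross \<Gamma>\<^sub>0 then (k, i + 1) else (iota \<Gamma>\<^sub>0 k, i) else (k, i))" for k i
  by (simp add: associated_brauer_graph_def)
 have \<sigma>: "\<sigma> (k, i) = (if k \<in> half_edges \<Gamma>\<^sub>0 then (sigma \<Gamma>\<^sub>0 k, i + d k) else (k, i))" for k i
  by (simp add: associated_brauer_graph_def)
 show "s h \<in> H \<longleftrightarrow> h \<in> H" unfolding h s half_edges ..
 show "\<iota> (s h) = s (\<iota> h)" unfolding h s \<iota> if_distrib[of s] s c ..
 show "\<sigma> (s h) = s (\<sigma> h)" unfolding h s \<sigma> if_distrib[of s] s c ..
 show "mlt \<Gamma> (s h) = mlt \<Gamma> h" unfolding h s by (simp add: associated_brauer_graph_def)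
qed

lemma edge_s: "edge (s h) = s ` edge h"
 by (simp add: edge_of_def s_simps)

lemma verts_s: "u \<in> edge ` H ==> s ` u \<in> edge ` H"
 by (elim imageE) (simp add: edge_s[symmetric] s_simps imageI)

lemma s_s: "s ` s ` u = u" "map (s \<circ> s) p = p"
 by (simp_all add: image_image shift_half_edge_involutive comp_def)

lemma s_image_iff: "s ` u \<in> X \<longleftrightarrow> u \<in> (`) s ` X"
 using imageI[of "s ` u" X "(`) s"] by (auto simp: s_s)

lemma verts_s_iff: "s ` u \<in> edge ` H \<longleftrightarrow> u \<in> edge ` H"
 using verts_s[of u] verts_s[of "s ` u"] by (auto simp: s_s)

lemma awalk_s: "Q.awalk u p v ==> Q.awalk (s ` u) (map s p) (s ` v)"
proof (induction p arbitrary: u)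
 case (Cons e p)
 then show ?case by (simp add: Q.awalk_Cons_iff s_simps edge_s)
qed (simp add: Q.awalk_Nil_iff verts_s)

lemma awlast_s: "Q.awlast (s ` u) (map s p) = s ` Q.awlast u p"
 by (simp add: Q.awalk_verts_conv last_map s_simps edge_s)

lemma \<tau>: "\<tau> x (u, p) = x (s ` u, map s p)"
proof -
 have "- a = a" by (cases a) simp_all
 then show ?thesis by (simp add: shift_elem_def shift_path_def)
qed

lemma \<tau>_\<tau>: "\<tau> (\<tau> x) = x"
 by (auto simp: fun_eq_iff \<tau> s_s)

lemma \<tau>_add: "\<tau> (\<lambda>p. x p + y p) = (\<lambda>p. \<tau> x p + \<tau> y p)" and \<tau>_smult: "\<tau> (\<lambda>p. c * x p) = (\<lambda>p. c * \<tau> x p)"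
 by (auto simp: fun_eq_iff \<tau>)

lemma \<tau>_closed: fixes x :: "_ => 'k::field" assumes x: "x \<in> carrier Q.PA" shows "\<tau> x \<in> carrier Q.PA"
proof -
 have e: "{p. \<tau> x p \<noteq> 0} = shift_path a ` {p. x p \<noteq> 0}"
 proof (intro Set.set_eqI iffI)
  fix p assume "p \<in> {p. \<tau> x p \<noteq> 0}"
  then have "shift_path a p \<in> {p. x p \<noteq> 0}" by (cases p) (simp add: \<tau> shift_path_def)
  from imageI[OF this, of "shift_path a"] show "p \<in> shift_path a ` {p. x p \<noteq> 0}" by (simp add: shift_path_involutive)
 next
  fix p assume "p \<in> shift_path a ` {p. x p \<noteq> 0}"
  then show "p \<in> {p. \<tau> x p \<noteq> 0}" by (auto simp: \<tau> shift_path_def s_s)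
 qed
 have "shift_path a p \<in> quiver_paths (brauer_quiver \<Gamma>)" if "p \<in> quiver_paths (brauer_quiver \<Gamma>)" for p
  using that awalk_s by (auto simp: quiver_paths_def shift_path_def)
 then show ?thesis using x unfolding Q.PA_carrier e by auto
qed

lemma \<tau>_mult: "\<tau> (x \<otimes>[Q.PA] y) = \<tau> x \<otimes>[Q.PA] \<tau> y" for x y :: "_ => 'k::field"
 by (auto simp: fun_eq_iff \<tau> Q.PA_mult take_map drop_map awlast_s)

lemma \<tau>_idem: "\<tau> (Q.idem X) = Q.idem ((`) s ` X)"
 by (auto simp: fun_eq_iff \<tau> Q.idem_def s_image_iff)

lemma \<tau>_hom: "ring_hom_ring Q.PA Q.PA (\<tau> :: (_ => 'k::field) => _)"
proof (rule ring_hom_ringI2[OF ring_PA ring_PA], rule ring_hom_memI)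
 have "(`) s ` edge ` H = edge ` H"
  by (intro Set.set_eqI) (simp only: s_image_iff[symmetric] verts_s_iff)
 then show "\<tau> \<one>[Q.PA] = (\<one>[Q.PA] :: _ => 'k)" by (simp add: Q.PA_one \<tau>_idem)
qed (simp_all add: \<tau>_closed \<tau>_mult \<tau>_add)

lemma cycle_power_s: "cycle_power \<Gamma> (s h) = shift_path a (cycle_power \<Gamma> h)"
proof -
 have f: "(\<sigma> ^^ n) (s h) = s ((\<sigma> ^^ n) h)" for n by (induction n) (simp_all add: s_simps)
 have "Orbits.orbit \<sigma> (s h) = s ` Orbits.orbit \<sigma> h"
  unfolding orbit_altdef by (auto simp: f)
 moreover have "inj s" using shift_half_edge_involutive by (rule inj_on_inverseI)
 ultimately have "card (Orbits.orbit \<sigma> (s h)) = card (Orbits.orbit \<sigma> h)"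
  by (metis card_image inj_on_subset subset_UNIV)
 then show ?thesis by (simp add: cycle_power_def shift_path_def edge_s s_simps f map_concat comp_def)
qed

lemma \<tau>_relations: "r \<in> brauer_relations \<Gamma> ==> \<tau> r \<in> brauer_relations \<Gamma>"
proof -
 assume "r \<in> brauer_relations \<Gamma>"
 then consider h where "h \<in> H" "r = (\<lambda>p. path_elem (cycle_power \<Gamma> h) p - path_elem (cycle_power \<Gamma> (\<iota> h)) p)"
  | h where "h \<in> H" "r = path_elem (edge h, [h, \<iota> (\<sigma> h)])" unfolding brauer_relations_def by blast
 then show ?thesis
 proof cases
  case 1
  have "\<tau> r = (\<lambda>p. \<tau> (path_elem (cycle_power \<Gamma> h)) p - \<tau> (path_elem (cycle_power \<Gamma> (\<iota> h))) p)"
   unfolding 1 by (auto simp: fun_eq_iff \<tau>)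
  also have "\<dots> = (\<lambda>p. path_elem (cycle_power \<Gamma> (s h)) p - path_elem (cycle_power \<Gamma> (\<iota> (s h))) p)"
   unfolding shift_elem_path_elem cycle_power_s[symmetric] s_simps ..
  finally show ?thesis using 1(1) s_simps(1) unfolding brauer_relations_def by blast
 next
  case 2
  have "\<tau> r = path_elem (edge (s h), [s h, \<iota> (\<sigma> (s h))])"
   unfolding 2 shift_elem_path_elem by (simp add: shift_path_def edge_s s_simps)
  then show ?thesis using 2(1) s_simps(1) unfolding brauer_relations_def by blast
 qed
qed

text \<open>The preimage of the ideal under \<open>\<tau>\<close> is an ideal that contains the
  relations, hence contains the ideal they generate; as \<open>\<tau>\<close> is an involution, the
  reverse inclusion follows.\<close>

lemma \<tau>_I: "\<tau> ` (I :: (_ => 'k::field) set) = I"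
proof -
 interpret iq: ideal_quotient "I :: (_ => 'k) set" Q.PA by (rule ideal_quotient)
 have "(I :: (_ => 'k) set) \<subseteq> {x \<in> carrier Q.PA. \<tau> x \<in> I}"
  unfolding brauer_ideal_def
  by (rule ring.genideal_minimal[OF ring_PA ring_hom_ring.ideal_vimage[OF \<tau>_hom iq.ideal_axioms[unfolded brauer_ideal_def]]])
   (use relations_closed \<tau>_relations rel_in_I in \<open>auto simp: brauer_ideal_def\<close>)
 then have 1: "\<tau> x \<in> I" if "x \<in> I" for x :: "_ => 'k" using that by blast
 show ?thesis
 proof (intro equalityI subsetI)
  fix x :: "_ => 'k" assume "x \<in> I"
  then show "x \<in> \<tau> ` I" using 1 \<tau>_\<tau>[of x] by (metis imageI)
 qed (use 1 in blast)
qed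

text \<open>The ideal is stable, so the elementwise image of a coset is the coset of the shifted
  representative; the action on cosets is thus the induced one.\<close>

lemma shift_class_q: "shift_class a ((I :: (_ => 'k::field) set) +>\<^bsub>Q.PA\<^esub> x) = I +>\<^bsub>Q.PA\<^esub> \<tau> x"
proof -
 have "shift_class a (I +>\<^bsub>Q.PA\<^esub> x) = (\<lambda>i. \<tau> i \<oplus>[Q.PA] \<tau> x) ` (I :: (_ => 'k) set)"
  unfolding shift_class_def a_r_coset_def' by (simp add: image_UN image_image \<tau>_add UNION_singleton_eq_range)
 also have "\<dots> = (\<lambda>i. i \<oplus>[Q.PA] \<tau> x) ` \<tau> ` I" by (simp only: image_image)
 also have "\<dots> = I +>\<^bsub>Q.PA\<^esub> \<tau> x" unfolding \<tau>_I a_r_coset_def' by auto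
 finally show ?thesis .
qed

end

abbreviation \<Lambda> :: "('k::field, _) module" where "\<Lambda> \<equiv> brauer_graph_algebra \<Gamma>"

lemma z2_action: "z2_action (\<Lambda> :: ('k::field, _) module) shift_class"
proof -
 interpret iq: ideal_quotient "I :: (_ => 'k) set" Q.PA by (rule ideal_quotient)
 interpret fd_algebra "\<Lambda> :: ('k, _) module" by (rule fd_algebra)
 have 0: "shift_elem 0 x = x" for x :: "('h \<times> bit) set \<times> ('h \<times> bit) list => 'k"
 proof -
  have s: "shift_half_edge 0 = (\<lambda>h :: 'h \<times> bit. h)"
   unfolding shift_half_edge_def by (simp only: add_0_right) auto
  show ?thesis by (rule ext) (simp add: split_paired_all \<tau> s)
 qed
 have lin: "\<tau> 1 (x \<oplus>[Q.PA] y) = \<tau> 1 x \<oplus>[Q.PA] \<tau> 1 y" "\<tau> 1 (c \<odot>[Q.PA] x) = c \<odot>[Q.PA] \<tau> 1 x" for x y :: "_ => 'k" and c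
  by (simp_all add: \<tau>_add \<tau>_smult)
 show ?thesis
  unfolding brauer_graph_algebra_def
  by (unfold_locales; unfold brauer_graph_algebra_def[symmetric]; (rule alg fin | unfold brauer_graph_algebra_def))
   (auto simp: iq.Q_simps iq.smult_q shift_class_q 0 \<tau>_\<tau> \<tau>_closed \<tau>_mult lin Q.PA_mult_closed
    vs_add[OF Q.vs_PA] vs_smult[OF Q.vs_PA] simp del: Q.PA_simps)
qed

text \<open>A half-edge fixed by \<iota> yields the single vertex [h_0] = [h_1], any other edge the
  two vertices [h_0] and [h_1]. With \<open>E0\<close> the set of all [h_0] and \<open>E1\<close>
  those from half-edges that are not fixed, the vertex set is the disjoint union of
  \<open>E0\<close> and the translate of \<open>E1\<close>. This is the decomposition of 1 that the
  corner requires.\<close>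

lemma KG_skew:
 fixes B :: "('k::field, 'b) module"
 assumes B: "is_skew_brauer_graph_algebra \<Gamma>\<^sub>0 d B" and z: "z * 2 = (1 :: 'k)"
 shows "(KG B :: 'i::wellorder option) = KG (\<Lambda> :: ('k, _) module)"
proof -
 interpret iq: ideal_quotient "I :: (_ => 'k) set" Q.PA by (rule ideal_quotient)
 interpret z: z2_action "\<Lambda> :: ('k, _) module" shift_class by (rule z2_action)
 note \<Lambda>_Q = brauer_graph_algebra_def[of \<Gamma>, where ?'k = 'k]
 define E0 E1 where "E0 = (\<lambda>h. edge (h, 0)) ` half_edges \<Gamma>\<^sub>0"
  and "E1 = (\<lambda>h. edge (h, 0)) ` (half_edges \<Gamma>\<^sub>0 - H_cross \<Gamma>\<^sub>0)"
 have E: "E1 \<subseteq> E0" "E0 \<subseteq> edge ` H" unfolding E0_def E1_def by auto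
 note E1 = order.trans[OF E]
 have edge_nc: "edge (h, i) = {(h, i), (iota \<Gamma>\<^sub>0 h, i)}" if "h \<in> half_edges \<Gamma>\<^sub>0 - H_cross \<Gamma>\<^sub>0" for h i
  using that by (simp add: edge_of_def associated_brauer_graph_def)
 have edge_c: "edge (h, i) = {(h, 0), (h, 1)}" if "h \<in> H_cross \<Gamma>\<^sub>0" for h i
  using that by (cases i) (auto simp: edge_of_def associated_brauer_graph_def H_cross_def)
 let ?s = "shift_half_edge 1"
 have sE1: "(`) ?s ` E1 = (\<lambda>h. edge (h, 1)) ` (half_edges \<Gamma>\<^sub>0 - H_cross \<Gamma>\<^sub>0)"
  unfolding E1_def image_image edge_s[symmetric] by (simp add: shift_half_edge_def)
 \<comment> \<open>A vertex in the translate of \<open>E1\<close> consists of half-edges with second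
   component 1.\<close>
 have disj: "E0 \<inter> (`) ?s ` E1 = {}"
 proof -
  have "(h, 0) \<in> edge (h, 0)" for h by (simp add: edge_of_def)
  moreover have "(h', 0) \<notin> edge (h, 1)" if "h \<in> half_edges \<Gamma>\<^sub>0 - H_cross \<Gamma>\<^sub>0" for h h' using edge_nc[OF that] by simp
  ultimately show ?thesis unfolding sE1 E0_def by blast
 qed
 have un: "E0 \<union> (`) ?s ` E1 = edge ` H"
 proof (intro equalityI subsetI)
  fix e assume "e \<in> edge ` H"
  then obtain h i where h: "e = edge (h, i)" "h \<in> half_edges \<Gamma>\<^sub>0" by (auto simp: associated_brauer_graph_def)
  show "e \<in> E0 \<union> (`) ?s ` E1"
  proof (cases "i = 0 \<or> h \<in> H_cross \<Gamma>\<^sub>0")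
   case True
   then have "e = edge (h, 0)" using edge_c[of h i] edge_c[of h 0] h(1) by auto
   then show ?thesis using h(2) unfolding E0_def by blast
  next
   case False
   then have "i = 1" by (cases i) auto
   then show ?thesis using h False unfolding sE1 by blast
  qed
 qed (use E verts_s in blast)
 have sub: "(`) ?s ` E1 \<subseteq> edge ` H" unfolding un[symmetric] by (rule Un_upper2)
 let ?q = "\<lambda>X. iq.q (Q.idem X) :: (_ => 'k) set"
 have cl: "(Q.idem X :: _ => 'k) \<in> carrier Q.PA" if "X \<subseteq> edge ` H" for X by (rule Q.idem_closed) (simp add: that)
 have q: "?q X \<in> carrier \<Lambda>" "?q X \<otimes>[\<Lambda>] ?q Y = ?q (X \<inter> Y)" "X \<inter> Y = {} ==> ?q X \<oplus>[\<Lambda>] ?q Y = ?q (X \<union> Y)"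
  if "X \<subseteq> edge ` H" "Y \<subseteq> edge ` H" for X Y
  unfolding \<Lambda>_Q using that cl by (simp_all add: iq.Q_simps Q.idem_mult Q.idem_Un)
 \<comment> \<open>All summands are supported at the identity of the group, so the sum in the skew
   group algebra is a sum of vertex idempotents in its first coordinate.\<close>
 have f: "finsum z.S (\<lambda>e. skew_tensor \<Lambda> Z2_group (vertex_idempotent \<Gamma> e) \<one>[Z2_group]) X = z.E (?q X) \<zero>[\<Lambda>]"
  if "finite X" "X \<subseteq> edge ` H" for X
  using that
 proof (induction X rule: finite_induct)
  case empty
  have "Q.idem {} = (\<zero>[Q.PA] :: _ => 'k)" by (auto simp: Q.idem_def)
  then have "?q {} = \<zero>[\<Lambda>]" by (simp add: \<Lambda>_Q iq.Q_simps)
  then show ?case using abelian_monoid.finsum_empty[OF vs_abelian_monoid[OF z.vs_S]] by simp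
 next
  case (insert e X)
  have e: "vertex_idempotent \<Gamma> e = ?q {e}" for e by (simp add: vertex_idempotent_def Q.idem_single)
  have "?q {e'} \<in> carrier \<Lambda>" if "e' \<in> insert e X" for e' using q(1)[of "{e'}" "{e'}"] that insert.prems by blast
  then have "finsum z.S (\<lambda>e. skew_tensor \<Lambda> Z2_group (vertex_idempotent \<Gamma> e) \<one>[Z2_group]) (insert e X) =
    z.E (?q {e}) \<zero>[\<Lambda>] \<oplus>[z.S] z.E (?q X) \<zero>[\<Lambda>]"
   using insert by (subst abelian_monoid.finsum_insert[OF vs_abelian_monoid[OF z.vs_S]]) (auto simp: e z.zero_A)
  also have "\<dots> = z.E (?q (insert e X)) \<zero>[\<Lambda>]"
   using insert q(3)[of "{e}" X] by (simp add: vs_l_zero[OF z.vs_A z.zero_A])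
  finally show ?case .
 qed
 have "finite E0" using E(2) H(1) finite_subset by blast
 then have ci: "corner_idempotent \<Gamma>\<^sub>0 d = z.E (?q E0) \<zero>[\<Lambda>]"
  using f[OF _ E(2)] unfolding corner_idempotent_def skew_group_brauer_algebra_def Let_def E0_def by blast
 show ?thesis
 proof (rule z.KG_corner[OF _ _ _ _ _ _ _ _ _ z, of B "?q E0" "?q E1"])
  show "K_algebra B" "K_algebra_isomorphic B (corner_algebra z.S (z.E (?q E0) \<zero>[\<Lambda>]))"
   using B unfolding is_skew_brauer_graph_algebra_def ci skew_group_brauer_algebra_def by blast+
  have "shift_class 1 (?q E1) = ?q ((`) ?s ` E1)" by (simp add: shift_class_q \<tau>_idem)
  moreover have "\<one>[\<Lambda>] = ?q (edge ` H)" unfolding \<Lambda>_Q by (simp add: iq.Q_simps Q.PA_one)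
  ultimately show "?q E0 \<oplus>[\<Lambda>] shift_class 1 (?q E1) = \<one>[\<Lambda>]" using q(3)[OF E(2) sub disj] unfolding un by simp
 qed (simp_all add: q(1)[OF E(2,2)] q(1)[OF E1 E1] q(2) E E1 Int_absorb1 Int_absorb2)
qed

end

theorem corollary5p12:
  fixes \<Gamma> :: "'h skew_brauer_graph"
    and d :: "'h \<Rightarrow> bit"
    and B :: "('k::alg_closed_field, 'b) module"
    and \<Lambda> :: "('k, (('h \<times> bit) set \<times> ('h \<times> bit) list \<Rightarrow> 'k) set) module"
  assumes "CHAR('k) \<noteq> 2"
    and "is_skew_brauer_graph \<Gamma>"
    and "zero_homogeneous \<Gamma> d"
    and "is_skew_brauer_graph_algebra \<Gamma> d B"
    and "\<Lambda> = brauer_graph_algebra (associated_brauer_graph \<Gamma> d)"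
  shows "(KG B :: 'i::wellorder option) = KG \<Lambda>"
proof -
 interpret shifted_brauer \<Gamma> d by unfold_locales (rule assms(2))
 have "(of_nat 2 :: 'k) \<noteq> 0"
 proof
  assume "(of_nat 2 :: 'k) = 0"
  then have c: "CHAR('k) dvd 2" by (simp only: of_nat_eq_0_iff_char_dvd)
  then have "CHAR('k) \<noteq> 0" by (intro notI) simp
  moreover have "CHAR('k) \<le> 2" by (rule dvd_imp_le[OF c]) simp
  \<comment> \<open>Among the divisors of 2 only 1 is left, and it is not the characteristic of a
    field.\<close>
  ultimately have "CHAR('k) = 1" using assms(1) by linarith
  then show False by simp
 qed
 then have "inverse 2 * 2 = (1 :: 'k)" by simp
 then show ?thesis unfolding assms(5) by (rule KG_skew[OF assms(4)])
qed

end
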